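(* Let $\Omega\subset\mathbb{R}^2$ be a domain, let $\vec F\in C^1(\Omega)$ be a vector field and $H\in C^0(\Omega)$ a function, and let $u\in C^1(\Omega)$ be a weak solution to $$\operatorname{div}\frac{\nabla u+\vec F}{|\nabla u+\vec F|}=H$$ such that $\Omega$ is nonsingular. Suppose further that $N^{\perp}(\operatorname{curl}\vec F)$ and $N(H)$ exist and are continuous. Then $D'$ and $D''$ exist and are continuous in $\Omega$. Moreover, $D$ satisfies the differential equation $$DD''=2\Big(D'-\frac{\operatorname{curl}\vec F}{2}\Big)\big(D'-\operatorname{curl}\vec F\big)+\big(N^{\perp}(\operatorname{curl}\vec F)\big)D+\big(H^2+N(H)\big)D^2 .$$
   Context: A domain is an open connected set. For $u\in C^1(\Omega)$ the singular set $S_{\vec F}(u)$ is the set of points (singular points) where $\nabla u+\vec F=0$; other points are nonsingular, and $\Omega$ is nonsingular if all its points are nonsingular. $u\in C^1(\Omega)$ is a weak solution to $\operatorname{div}\frac{\nabla u+\vec F}{|\nabla u+\vec F|}=H$ if for every $\varphi\in C_0^\infty(\Omega)$ $$\int_{S_{\vec F}(u)}|\nabla\varphi|+\int_{\Omega\setminus S_{\vec F}(u)}\frac{\nabla u+\vec F}{|\nabla u+\vec F|}\cdot\nabla\varphi+\int_\Omega H\varphi\ge 0 .$$ For $\vec F=(F_1,F_2)$, $\operatorname{curl}\vec F:=(F_2)_x-(F_1)_y$. At nonsingular points, $D:=|\nabla u+\vec F|$, $N:=\frac{\nabla u+\vec F}{|\nabla u+\vec F|}=(\cos\theta,\sin\theta)$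 (locally, for an angular function $\theta$), and $N^\perp:=(\sin\theta,-\cos\theta)$. For a function $f$, $N(f)$ and $N^\perp(f)$ (also $N^\perp f$) denote the derivatives of $f$ in the directions $N$ and $N^\perp$ (along integral curves of these fields). $D':=N^\perp D$ and $D'':=N^\perp(N^\perp D)$. *)

theory Defs
  imports "HOL-Analysis.Analysis"
begin

definition partial_deriv :: "'n::finite \<Rightarrow> (real^'n \<Rightarrow> real) \<Rightarrow> real^'n \<Rightarrow> real" where
  "partial_deriv i f x = frechet_derivative f (at x) (axis i 1)"

definition gradient :: "(real^'n::finite \<Rightarrow> real) \<Rightarrow> real^'n \<Rightarrow> real^'n" where
  "gradient f x = (\<chi> i. partial_deriv i f x)"

definition curl2 :: "(real^2 \<Rightarrow> real^2) \<Rightarrow> real^2 \<Rightarrow> real" where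
  "curl2 F x = partial_deriv 1 (\<lambda>y. F y $ 2) x - partial_deriv 2 (\<lambda>y. F y $ 1) x"

text \<open>The class \<open>C\<^sup>k(S)\<close>, meant for open \<open>S\<close> only: derivatives are taken with respect to
  the whole space, and values of \<open>f\<close> off \<open>S\<close> are irrelevant.\<close>

primrec C_k_on :: "nat \<Rightarrow> (real^'n::finite) set \<Rightarrow> (real^'n \<Rightarrow> real) \<Rightarrow> bool" where
  "C_k_on 0 S f \<longleftrightarrow> continuous_on S f"
| "C_k_on (Suc k) S f \<longleftrightarrow>
     (\<forall>x\<in>S. f differentiable (at x)) \<and> (\<forall>i. C_k_on k S (partial_deriv i f))"

definition test_function :: "(real^'n::finite) set \<Rightarrow> (real^'n \<Rightarrow> real) \<Rightarrow> bool" where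
  "test_function \<Omega> \<phi> \<longleftrightarrow> (\<forall>k. C_k_on k UNIV \<phi>) \<and>
     compact (closure {x. \<phi> x \<noteq> 0}) \<and> closure {x. \<phi> x \<noteq> 0} \<subseteq> \<Omega>"

definition singular_set ::
    "(real^'n::finite) set \<Rightarrow> (real^'n \<Rightarrow> real^'n) \<Rightarrow> (real^'n \<Rightarrow> real) \<Rightarrow> (real^'n) set" where
  "singular_set \<Omega> F u = {x \<in> \<Omega>. gradient u x + F x = 0}"

definition D_fun :: "(real^'n::finite \<Rightarrow> real^'n) \<Rightarrow> (real^'n \<Rightarrow> real) \<Rightarrow> real^'n \<Rightarrow> real" where
  "D_fun F u x = norm (gradient u x + F x)"

definition N_field ::
    "(real^'n::finite \<Rightarrow> real^'n) \<Rightarrow> (real^'n \<Rightarrow> real) \<Rightarrow> real^'n \<Rightarrow> real^'n" where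
  "N_field F u x = (gradient u x + F x) /\<^sub>R D_fun F u x"

text \<open>If \<open>N = (cos \<theta>, sin \<theta>)\<close> then \<open>N\<^sup>\<bottom> = (sin \<theta>, - cos \<theta>)\<close>.\<close>

definition Nperp_field ::
    "(real^2 \<Rightarrow> real^2) \<Rightarrow> (real^2 \<Rightarrow> real) \<Rightarrow> real^2 \<Rightarrow> real^2" where
  "Nperp_field F u x = vector [N_field F u x $ 2, - (N_field F u x $ 1)]"

definition weak_solution ::
    "(real^'n::finite) set \<Rightarrow> (real^'n \<Rightarrow> real^'n) \<Rightarrow> (real^'n \<Rightarrow> real) \<Rightarrow> (real^'n \<Rightarrow> real) \<Rightarrow> bool" where
  "weak_solution \<Omega> F H u \<longleftrightarrow> C_k_on 1 \<Omega> u \<and>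
     (\<forall>\<phi>. test_function \<Omega> \<phi> \<longrightarrow>
        (LINT x : singular_set \<Omega> F u | lborel. norm (gradient \<phi> x))
      + (LINT x : \<Omega> - singular_set \<Omega> F u | lborel. N_field F u x \<bullet> gradient \<phi> x)
      + (LINT x : \<Omega> | lborel. H x * \<phi> x) \<ge> 0)"

text \<open>An integral curve of \<open>V\<close> through \<open>p\<close>, defined near time \<open>0\<close>. If \<open>p\<close> lies in an open
  set, then so does \<open>\<gamma> t\<close> for small \<open>t\<close>, so only the values of \<open>V\<close> near \<open>p\<close> matter.\<close>

definition integral_curve_at ::
    "('a::real_normed_vector \<Rightarrow> 'a) \<Rightarrow> 'a \<Rightarrow> (real \<Rightarrow> 'a) \<Rightarrow> bool" where
  "integral_curve_at V p \<gamma> \<longleftrightarrow> \<gamma> 0 = p \<and>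
     (\<forall>\<^sub>F t in nhds 0. (\<gamma> has_vector_derivative V (\<gamma> t)) (at t))"

text \<open>The derivative \<open>V(f)\<close> at \<open>p\<close> along integral curves of \<open>V\<close>. The field \<open>V\<close> is in general
  only continuous, so integral curves are not unique a priori: the derivative is required to
  exist, with the same value, along every integral curve through \<open>p\<close>. The existence clause
  (automatic for continuous \<open>V\<close>, by Peano's theorem) keeps the definition from being vacuous
  and makes the value unique.\<close>

definition has_deriv_along ::
    "('a::real_normed_vector \<Rightarrow> 'a) \<Rightarrow> ('a \<Rightarrow> real) \<Rightarrow> 'a \<Rightarrow> real \<Rightarrow> bool" where
  "has_deriv_along V f p L \<longleftrightarrow> (\<exists>\<gamma>. integral_curve_at V p \<gamma>) \<and>
     (\<forall>\<gamma>. integral_curve_at V p \<gamma> \<longrightarrow> ((\<lambda>t. f (\<gamma> t)) has_real_derivative L) (at 0))"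

definition deriv_along ::
    "('a::real_normed_vector \<Rightarrow> 'a) \<Rightarrow> ('a \<Rightarrow> real) \<Rightarrow> 'a \<Rightarrow> real" where
  "deriv_along V f p = (THE L. has_deriv_along V f p L)"

definition C1_along ::
    "('a::real_normed_vector \<Rightarrow> 'a) \<Rightarrow> ('a \<Rightarrow> real) \<Rightarrow> 'a set \<Rightarrow> bool" where
  "C1_along V f S \<longleftrightarrow> (\<forall>p\<in>S. \<exists>L. has_deriv_along V f p L) \<and> continuous_on S (deriv_along V f)"

lemma deriv_along_eq: "has_deriv_along V f p L \<Longrightarrow> deriv_along V f p = L"
  unfolding deriv_along_def
  by (rule the_equality) (auto simp: has_deriv_along_def intro: DERIV_unique)

end

theory Submission
  imports Defs
begin

text \<open>
  Without singular points the weak equation says that the continuous form \<open>D N \<cdot> dr = du + F \<cdot> dr\<close>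
  has exterior derivative \<open>curl F\<close>, and that \<open>div N = H\<close>. In orthonormal coordinates along
  \<open>N\<^sup>\<bottom>(p)\<close>, \<open>N(p)\<close> the integral curves of \<open>N\<^sup>\<bottom>\<close> are the graphs of solutions of
  \<open>y' = tan t\<close>, where the angle \<open>t\<close> is only continuous. As \<open>D N \<cdot> dr\<close> vanishes along them, integrating
  the form turns this equation into a Lipschitz one. Hence the curves are unique and depend
  differentiably on their initial values, with a Jacobian \<open>J\<close> given by \<open>(D cos t J)' = curl F J\<close>.
  The form dual to \<open>div N = H\<close> is extremal on these curves, which gives \<open>N\<^sup>\<bottom>(\<theta>) = - H\<close>. The
  derivative of \<open>H\<close> along \<open>N\<close> turns this into an equation for the angle differences of neighbouring
  curves that is linear in \<open>J\<close>; so \<open>w = N(\<theta>)\<close> exists, and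
  \<open>D' = curl F - D w\<close>, \<open>w' = - (H\<^sup>2 + N(H) + w\<^sup>2)\<close>. Eliminating \<open>w\<close> gives the claim.
\<close>

section \<open>Curves transported by a closed form\<close>

text \<open>The obstacle is that \<open>t\<close> is only continuous, so no identity may be
  differentiated across the curves. Such identities are carried by potentials instead: each form is
  exact after adding a term \<open>k dx\<close>, where \<open>k\<close> is differentiable in
  \<open>y\<close> alone and its y-derivative plays the part of the exterior derivative. Up to sign,
  three forms of this kind occur: D N . dr with curl F, the dual form cos t dx + sin t dy with H,
  and H times the dual form with K = H^2 + N(H). The last one comes from the same transport argument
  applied to the curves of N, with the coordinates exchanged; there the derivative of H along N
  enters. Geometrically, T = cos t * J is the normal distance between neighbouring curves of N-perp.
  In arc length it satisfies the Jacobi equation T'' = - K T, the function w is the logarithmic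
  derivative T' / T, and the equation for w is the associated Riccati equation.\<close>

lemma gronwall_abs:
  fixes m m' :: "real \<Rightarrow> real"
  assumes st: "s \<le> t"
    and m: "\<And>x. x \<in> {s..t} \<Longrightarrow> (m has_real_derivative m' x) (at x)"
    and le: "\<And>x. x \<in> {s..t} \<Longrightarrow> \<bar>m' x\<bar> \<le> C * \<bar>m x\<bar>"
  shows "\<bar>m t\<bar> \<le> exp (C * (t - s)) * \<bar>m s\<bar>" "\<bar>m s\<bar> \<le> exp (C * (t - s)) * \<bar>m t\<bar>"
proof -
  have mm: "\<bar>m' x * m x\<bar> \<le> C * (m x)\<^sup>2" if "x \<in> {s..t}" for x
    using mult_right_mono[OF le[OF that] abs_ge_zero[of "m x"]]
    by (simp add: abs_mult power2_eq_square mult.assoc)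
  \<comment> \<open>The square needs no information on the sign of \<open>m\<close>. The weight exp
    (- 2 C x) makes it nonincreasing and exp (2 C x) makes it nondecreasing, so each end is bounded
    by the other.\<close>
  have mono: "(m t)\<^sup>2 * exp (c * t) \<le> (m s)\<^sup>2 * exp (c * s)" if "c = - 2 * C" for c
  proof -
    have "\<exists>y. ((\<lambda>x. (m x)\<^sup>2 * exp (c * x)) has_real_derivative y) (at x) \<and> y \<le> 0"
      if x: "s \<le> x" "x \<le> t" for x
    proof (intro exI conjI)
      show "((\<lambda>x. (m x)\<^sup>2 * exp (c * x)) has_real_derivative
          (2 * (m' x * m x) + c * (m x)\<^sup>2) * exp (c * x)) (at x)"
        by (rule derivative_eq_intros m refl | use x in force)+ (simp add: algebra_simps)
      show "(2 * (m' x * m x) + c * (m x)\<^sup>2) * exp (c * x) \<le> 0"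
        using mm[of x] x \<open>c = _\<close> by (intro mult_nonpos_nonneg) auto
    qed
    then show ?thesis
      using DERIV_nonpos_imp_nonincreasing[OF st, of "\<lambda>x. (m x)\<^sup>2 * exp (c * x)"] by blast
  qed
  have mono': "(m s)\<^sup>2 * exp (c * s) \<le> (m t)\<^sup>2 * exp (c * t)" if "c = 2 * C" for c
  proof -
    have "\<exists>y. ((\<lambda>x. (m x)\<^sup>2 * exp (c * x)) has_real_derivative y) (at x) \<and> y \<ge> 0"
      if x: "s \<le> x" "x \<le> t" for x
    proof (intro exI conjI)
      show "((\<lambda>x. (m x)\<^sup>2 * exp (c * x)) has_real_derivative
          (2 * (m' x * m x) + c * (m x)\<^sup>2) * exp (c * x)) (at x)"
        by (rule derivative_eq_intros m refl | use x in force)+ (simp add: algebra_simps)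
      show "0 \<le> (2 * (m' x * m x) + c * (m x)\<^sup>2) * exp (c * x)"
        using mm[of x] x \<open>c = _\<close> by (intro mult_nonneg_nonneg) auto
    qed
    then show ?thesis
      using DERIV_nonneg_imp_nondecreasing[OF st, of "\<lambda>x. (m x)\<^sup>2 * exp (c * x)"] by blast
  qed
  have sq: "\<bar>a\<bar> \<le> exp (C * (t - s)) * \<bar>b\<bar>" if "a\<^sup>2 * exp u \<le> b\<^sup>2 * exp w" "w - u = 2 * C * (t - s)" for a b u w :: real
  proof -
    have "a\<^sup>2 * exp u * exp (- u) \<le> b\<^sup>2 * exp w * exp (- u)"
      using that(1) by (intro mult_right_mono) auto
    then have "a\<^sup>2 \<le> b\<^sup>2 * exp (2 * (C * (t - s)))"
      using that(2) by (simp add: mult.assoc flip: exp_add)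
    also have "\<dots> = (exp (C * (t - s)) * \<bar>b\<bar>)\<^sup>2"
      by (simp add: power_mult_distrib exp_double)
    finally have "\<bar>a\<bar> \<le> \<bar>exp (C * (t - s)) * \<bar>b\<bar>\<bar>"
      by (simp only: abs_le_square_iff)
    then show ?thesis by simp
  qed
  show "\<bar>m t\<bar> \<le> exp (C * (t - s)) * \<bar>m s\<bar>"
    by (rule sq[OF mono[OF refl]]) (simp add: algebra_simps)
  show "\<bar>m s\<bar> \<le> exp (C * (t - s)) * \<bar>m t\<bar>"
    by (rule sq[OF mono'[OF refl]]) (simp add: algebra_simps)
qed

lemma has_real_derivative_along_curve:
  assumes "(f has_derivative (\<lambda>(p, q). A * p + B * q)) (at (x s, y s))"
    and "(x has_real_derivative x') (at s within S)" "(y has_real_derivative y') (at s within S)"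
  shows "((\<lambda>s. f (x s, y s)) has_real_derivative A * x' + B * y') (at s within S)"
proof -
  have "((\<lambda>s. (x s, y s)) has_derivative (\<lambda>t. (x' * t, y' * t))) (at s within S)"
    using assms(2,3) unfolding has_field_derivative_def by (intro has_derivative_Pair)
  from diff_chain_within[OF this, of f "\<lambda>(p, q). A * p + B * q"]
  have "((\<lambda>s. f (x s, y s)) has_derivative (\<lambda>t. A * (x' * t) + B * (y' * t))) (at s within S)"
    using has_derivative_at_withinI[OF assms(1)] by (simp add: o_def)
  then show ?thesis
    unfolding has_field_derivative_def by (rule has_derivative_eq_rhs) (auto simp: algebra_simps)
qed

lemma DERIV_sequence_quotient:
  fixes f :: "real \<Rightarrow> real"
  assumes "(f has_real_derivative D) (at y)" "yn \<longlonglongrightarrow> y" "\<And>n. yn n \<noteq> y"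
  shows "(\<lambda>n. (f (yn n) - f y) / (yn n - y)) \<longlonglongrightarrow> D"
proof -
  have "((\<lambda>z. (f z - f y) / (z - y)) \<longlongrightarrow> D) (at y)"
    using assms(1) by (simp add: has_field_derivative_iff)
  moreover have "filterlim yn (at y) sequentially"
    using assms(2,3) by (simp add: filterlim_at)
  ultimately show ?thesis
    by (rule filterlim_compose[where f = yn, simplified comp_def])
qed

lemma DERIV_sequenceI:
  fixes f :: "real \<Rightarrow> real"
  assumes "\<And>yn. (\<And>n. yn n \<noteq> y) \<Longrightarrow> yn \<longlonglongrightarrow> y \<Longrightarrow> (\<lambda>n. (f (yn n) - f y) / (yn n - y)) \<longlonglongrightarrow> D"
  shows "(f has_real_derivative D) (at y)"
  unfolding has_field_derivative_iff tendsto_at_iff_sequentially comp_def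
  using assms by auto

text \<open>The potential \<open>\<Phi>\<close> says that Q (dy - v dx) + k dx is exact. Thus the
  form Q (dy - v dx), which vanishes along y' = v, has exterior derivative h dx dy in an integrated
  sense, although \<open>Q\<close> and \<open>v\<close> are merely continuous. A single bound
  \<open>M\<close> for all data keeps the later constants simple.\<close>

locale transport =
  fixes a M q :: real and Q v h \<Phi> k :: "real \<times> real \<Rightarrow> real"
  assumes a: "a > 0" and q: "q > 0"
    and contQ: "continuous_on ({-a<..<a} \<times> {-a<..<a}) Q"
    and contv: "continuous_on ({-a<..<a} \<times> {-a<..<a}) v"
    and conth: "continuous_on ({-a<..<a} \<times> {-a<..<a}) h"
    and contk: "continuous_on ({-a<..<a} \<times> {-a<..<a}) k"
    and bounds: "\<And>x y. \<bar>x\<bar> < a \<Longrightarrow> \<bar>y\<bar> < a \<Longrightarrow>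
      q \<le> Q (x, y) \<and> Q (x, y) \<le> M \<and> \<bar>v (x, y)\<bar> \<le> M \<and> \<bar>h (x, y)\<bar> \<le> M \<and> \<bar>k (x, y)\<bar> \<le> M"
    and d\<Phi>: "\<And>x y. \<bar>x\<bar> < a \<Longrightarrow> \<bar>y\<bar> < a \<Longrightarrow>
      (\<Phi> has_derivative (\<lambda>(p, r). (k (x, y) - Q (x, y) * v (x, y)) * p + Q (x, y) * r)) (at (x, y))"
    and dk: "\<And>x y. \<bar>x\<bar> < a \<Longrightarrow> \<bar>y\<bar> < a \<Longrightarrow>
      ((\<lambda>y. k (x, y)) has_real_derivative h (x, y)) (at y)"
begin

text \<open>All solutions live on one interval around 0 and not around their own starting points, so
  any two of them can be compared at every level.\<close>

definition sol :: "real \<Rightarrow> (real \<Rightarrow> real) \<Rightarrow> bool" where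
  "sol r Y \<longleftrightarrow> (\<forall>x. \<bar>x\<bar> < r \<longrightarrow> \<bar>Y x\<bar> < a \<and> (Y has_real_derivative v (x, Y x)) (at x))"

lemma M: "M > 0"
  using bounds[of 0 0] a q by auto

lemma qM: "q \<le> M"
  using bounds[of 0 0] a q by auto

lemma d\<Phi>y: "\<bar>x\<bar> < a \<Longrightarrow> \<bar>y\<bar> < a \<Longrightarrow> ((\<lambda>y. \<Phi> (x, y)) has_real_derivative Q (x, y)) (at y)"
  using has_real_derivative_along_curve[OF d\<Phi>, of "\<lambda>_. x" y "\<lambda>y. y" 0 UNIV 1] by simp

lemma \<Phi>_mvt:
  assumes "\<bar>x\<bar> < a" "\<bar>y0\<bar> < a" "\<bar>y1\<bar> < a"
  obtains z where "z \<in> closed_segment y0 y1" "\<Phi> (x, y1) - \<Phi> (x, y0) = Q (x, z) * (y1 - y0)"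
proof -
  have *: "\<exists>z. y0 \<le> z \<and> z \<le> y1 \<and> \<Phi> (x, y1) - \<Phi> (x, y0) = Q (x, z) * (y1 - y0)"
    if "\<bar>y0\<bar> < a" "\<bar>y1\<bar> < a" "y0 < y1" for y0 y1
  proof -
    have "\<exists>z>y0. z < y1 \<and> \<Phi> (x, y1) - \<Phi> (x, y0) = (y1 - y0) * Q (x, z)"
      by (rule MVT2[OF that(3)]) (use d\<Phi>y that assms(1) in auto)
    then show ?thesis by (metis less_le mult.commute)
  qed
  consider "y0 < y1" | "y0 = y1" | "y1 < y0" by linarith
  then show ?thesis
  proof cases
    case 1
    then show ?thesis using *[of y0 y1] assms that by (auto simp: closed_segment_eq_real_ivl)
  next
    case 2
    then show ?thesis using that by auto
  next
    case 3
    then obtain z where "y1 \<le> z" "z \<le> y0" "\<Phi> (x, y0) - \<Phi> (x, y1) = Q (x, z) * (y0 - y1)"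
      using *[of y1 y0] assms by auto
    then show ?thesis using that[of z] 3 by (auto simp: closed_segment_eq_real_ivl algebra_simps)
  qed
qed

lemma k_lipschitz:
  assumes "\<bar>x\<bar> < a" "\<bar>y0\<bar> < a" "\<bar>y1\<bar> < a"
  shows "\<bar>k (x, y1) - k (x, y0)\<bar> \<le> M * \<bar>y1 - y0\<bar>"
proof -
  have *: "\<bar>k (x, y1) - k (x, y0)\<bar> \<le> M * \<bar>y1 - y0\<bar>"
    if "\<bar>y0\<bar> < a" "\<bar>y1\<bar> < a" "y0 < y1" for y0 y1
  proof -
    have "\<exists>z>y0. z < y1 \<and> k (x, y1) - k (x, y0) = (y1 - y0) * h (x, z)"
      by (rule MVT2[OF that(3)]) (use dk that assms(1) in auto)
    then obtain z where z: "z > y0" "z < y1" "k (x, y1) - k (x, y0) = (y1 - y0) * h (x, z)" by auto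
    then have "\<bar>h (x, z)\<bar> \<le> M" using bounds[of x z] that assms by auto
    then show ?thesis unfolding z(3) abs_mult by (subst mult.commute) (rule mult_right_mono, auto)
  qed
  show ?thesis
    using *[of y0 y1] *[of y1 y0] assms by (cases y0 y1 rule: linorder_cases) (auto simp: abs_minus_commute)
qed

text \<open>All three bounds come from the mean value \<open>Q (x, z)\<close> lying between
  \<open>q\<close> and \<open>M\<close>. The third is the contraction of a Newton step with the
  fixed slope 1 / M: the factor 1 - Q / M lies between 0 and 1 - q / M.\<close>

lemma \<Phi>_bilipschitz:
  assumes "\<bar>x\<bar> < a" "\<bar>y0\<bar> < a" "\<bar>y1\<bar> < a"
  shows "q * \<bar>y1 - y0\<bar> \<le> \<bar>\<Phi> (x, y1) - \<Phi> (x, y0)\<bar>" "\<bar>\<Phi> (x, y1) - \<Phi> (x, y0)\<bar> \<le> M * \<bar>y1 - y0\<bar>"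
    "\<bar>(y1 - y0) - (\<Phi> (x, y1) - \<Phi> (x, y0)) / M\<bar> \<le> (1 - q / M) * \<bar>y1 - y0\<bar>"
proof -
  obtain z where z: "z \<in> closed_segment y0 y1" "\<Phi> (x, y1) - \<Phi> (x, y0) = Q (x, z) * (y1 - y0)"
    using \<Phi>_mvt assms by blast
  then have "\<bar>z\<bar> < a" using assms by (auto simp: closed_segment_eq_real_ivl split: if_splits)
  then have b: "q \<le> Q (x, z)" "Q (x, z) \<le> M" using bounds assms by auto
  show "q * \<bar>y1 - y0\<bar> \<le> \<bar>\<Phi> (x, y1) - \<Phi> (x, y0)\<bar>" "\<bar>\<Phi> (x, y1) - \<Phi> (x, y0)\<bar> \<le> M * \<bar>y1 - y0\<bar>"
    unfolding z(2) abs_mult using b q by (auto intro: mult_right_mono)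
  have "(y1 - y0) - (\<Phi> (x, y1) - \<Phi> (x, y0)) / M = (1 - Q (x, z) / M) * (y1 - y0)"
    unfolding z(2) by (simp add: algebra_simps)
  moreover have "\<bar>1 - Q (x, z) / M\<bar> \<le> 1 - q / M"
    using b M by (auto simp: abs_if field_simps)
  ultimately show "\<bar>(y1 - y0) - (\<Phi> (x, y1) - \<Phi> (x, y0)) / M\<bar> \<le> (1 - q / M) * \<bar>y1 - y0\<bar>"
    by (simp add: abs_mult mult_right_mono)
qed

text \<open>The difference of \<open>\<Phi>\<close> along two curves has the derivative (k1 - k0)
  x', from which \<open>v\<close> has cancelled. It is comparable to the distance of the curves and
  \<open>k\<close> is Lipschitz in y, so Gronwall's inequality applies. The common parametrization
  \<open>x\<close> is arbitrary because plane integral curves are to be compared with graphs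
  later.\<close>

lemma curve_difference:
  assumes st: "s \<le> t"
    and x: "\<And>\<tau>. \<tau> \<in> {s..t} \<Longrightarrow> \<bar>x \<tau>\<bar> < a \<and> (x has_real_derivative x' \<tau>) (at \<tau>) \<and> \<bar>x' \<tau>\<bar> \<le> X"
    and y0: "\<And>\<tau>. \<tau> \<in> {s..t} \<Longrightarrow> \<bar>y0 \<tau>\<bar> < a \<and> (y0 has_real_derivative v (x \<tau>, y0 \<tau>) * x' \<tau>) (at \<tau>)"
    and y1: "\<And>\<tau>. \<tau> \<in> {s..t} \<Longrightarrow> \<bar>y1 \<tau>\<bar> < a \<and> (y1 has_real_derivative v (x \<tau>, y1 \<tau>) * x' \<tau>) (at \<tau>)"
  shows "\<bar>y1 t - y0 t\<bar> \<le> M / q * exp (M * X / q * (t - s)) * \<bar>y1 s - y0 s\<bar>"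
    "\<bar>y1 s - y0 s\<bar> \<le> M / q * exp (M * X / q * (t - s)) * \<bar>y1 t - y0 t\<bar>"
proof -
  define m where "m \<tau> = \<Phi> (x \<tau>, y1 \<tau>) - \<Phi> (x \<tau>, y0 \<tau>)" for \<tau>
  have d: "((\<lambda>\<tau>. \<Phi> (x \<tau>, y \<tau>)) has_real_derivative k (x \<tau>, y \<tau>) * x' \<tau>) (at \<tau>)"
    if "\<tau> \<in> {s..t}" "\<bar>y \<tau>\<bar> < a" "(y has_real_derivative v (x \<tau>, y \<tau>) * x' \<tau>) (at \<tau>)" for y \<tau>
  proof -
    have "((\<lambda>\<tau>. \<Phi> (x \<tau>, y \<tau>)) has_real_derivative
        (k (x \<tau>, y \<tau>) - Q (x \<tau>, y \<tau>) * v (x \<tau>, y \<tau>)) * x' \<tau> + Q (x \<tau>, y \<tau>) * (v (x \<tau>, y \<tau>) * x' \<tau>)) (at \<tau>)"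
      by (rule has_real_derivative_along_curve[OF d\<Phi>]) (use that x in auto)
    then show ?thesis by (rule DERIV_cong) (simp add: algebra_simps)
  qed
  have dm: "(m has_real_derivative (k (x \<tau>, y1 \<tau>) - k (x \<tau>, y0 \<tau>)) * x' \<tau>) (at \<tau>)"
    if "\<tau> \<in> {s..t}" for \<tau>
    unfolding m_def left_diff_distrib by (intro DERIV_diff d) (use that y0 y1 in auto)
  have mb: "q * \<bar>y1 \<tau> - y0 \<tau>\<bar> \<le> \<bar>m \<tau>\<bar>" "\<bar>m \<tau>\<bar> \<le> M * \<bar>y1 \<tau> - y0 \<tau>\<bar>" if "\<tau> \<in> {s..t}" for \<tau>
    using \<Phi>_bilipschitz(1,2)[of "x \<tau>" "y0 \<tau>" "y1 \<tau>"] that x y0 y1 unfolding m_def by auto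
  have le: "\<bar>(k (x \<tau>, y1 \<tau>) - k (x \<tau>, y0 \<tau>)) * x' \<tau>\<bar> \<le> M * X / q * \<bar>m \<tau>\<bar>" if "\<tau> \<in> {s..t}" for \<tau>
  proof -
    have "\<bar>(k (x \<tau>, y1 \<tau>) - k (x \<tau>, y0 \<tau>)) * x' \<tau>\<bar> \<le> (M * \<bar>y1 \<tau> - y0 \<tau>\<bar>) * X"
      unfolding abs_mult using k_lipschitz[of "x \<tau>" "y0 \<tau>" "y1 \<tau>"] that x[of \<tau>] y0[of \<tau>] y1[of \<tau>] M
      by (intro mult_mono) auto
    also have "\<dots> = M * X / q * (q * \<bar>y1 \<tau> - y0 \<tau>\<bar>)" using q by simp
    also have "\<dots> \<le> M * X / q * \<bar>m \<tau>\<bar>"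
      using mb[OF that] M q x[OF that] by (intro mult_left_mono divide_nonneg_pos mult_nonneg_nonneg) auto
    finally show ?thesis .
  qed
  have fin: "\<bar>d1\<bar> \<le> M / q * E * \<bar>d2\<bar>"
    if "q * \<bar>d1\<bar> \<le> \<bar>m1\<bar>" "\<bar>m1\<bar> \<le> E * \<bar>m2\<bar>" "\<bar>m2\<bar> \<le> M * \<bar>d2\<bar>" "E > 0" for d1 d2 m1 m2 E :: real
  proof -
    have "q * \<bar>d1\<bar> \<le> E * (M * \<bar>d2\<bar>)"
      using that by (meson mult_left_mono order_trans less_imp_le)
    then show ?thesis using q by (simp add: field_simps)
  qed
  note g = gronwall_abs[OF st dm le]
  show "\<bar>y1 t - y0 t\<bar> \<le> M / q * exp (M * X / q * (t - s)) * \<bar>y1 s - y0 s\<bar>"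
    by (rule fin[OF mb(1) g(1) mb(2)]) (use st in auto)
  show "\<bar>y1 s - y0 s\<bar> \<le> M / q * exp (M * X / q * (t - s)) * \<bar>y1 t - y0 t\<bar>"
    by (rule fin[OF mb(1) g(2) mb(2)]) (use st in auto)
qed

text \<open>2 a is the length of the whole interval of levels, so that one constant serves all pairs
  of levels.\<close>

definition Lip :: real where "Lip = M / q * exp (M / q * (2 * a))"

lemma Lip: "Lip > 0"
  using M q by (simp add: Lip_def)

lemma sol_difference:
  assumes "sol r Y0" "sol r Y1" "r \<le> a" "\<bar>s\<bar> < r" "\<bar>t\<bar> < r"
  shows "\<bar>Y1 t - Y0 t\<bar> \<le> Lip * \<bar>Y1 s - Y0 s\<bar>"
proof -
  have "\<bar>Y1 t - Y0 t\<bar> \<le> Lip * \<bar>Y1 s - Y0 s\<bar> \<and> \<bar>Y1 s - Y0 s\<bar> \<le> Lip * \<bar>Y1 t - Y0 t\<bar>"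
    if "s \<le> t" "\<bar>s\<bar> < r" "\<bar>t\<bar> < r" for s t
  proof -
    have "M / q * exp (M * 1 / q * (t - s)) \<le> Lip"
      unfolding Lip_def using that M q \<open>r \<le> a\<close> by (intro mult_left_mono) (auto simp: divide_right_mono)
    note L = mult_right_mono[OF this abs_ge_zero]
    note c = curve_difference[OF that(1), of "\<lambda>x. x" "\<lambda>_. 1" 1 Y0 Y1]
    show ?thesis
      by (intro conjI order_trans[OF _ L] c) (use assms that in \<open>auto simp: sol_def\<close>)
  qed
  from this[of s t] this[of t s] show ?thesis using assms by linarith
qed

lemma sol_unique:
  assumes "sol r Y0" "sol r Y1" "r \<le> a" "\<bar>s\<bar> < r" "\<bar>t\<bar> < r" "Y1 s = Y0 s"
  shows "Y1 t = Y0 t"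
  using sol_difference[OF assms(1-5)] assms(6) by simp

lemma sol_d\<Phi>:
  assumes "sol r Y" "\<bar>x\<bar> < r" "r \<le> a"
  shows "((\<lambda>x. \<Phi> (x, Y x)) has_real_derivative k (x, Y x)) (at x)"
proof -
  have "((\<lambda>x. \<Phi> (x, Y x)) has_real_derivative
      (k (x, Y x) - Q (x, Y x) * v (x, Y x)) * 1 + Q (x, Y x) * v (x, Y x)) (at x)"
    by (rule has_real_derivative_along_curve[OF d\<Phi>]) (use assms in \<open>auto simp: sol_def\<close>)
  then show ?thesis by simp
qed

lemma solD:
  assumes "sol r Y" "\<bar>x\<bar> < r"
  shows "\<bar>Y x\<bar> < a" "(Y has_real_derivative v (x, Y x)) (at x)"
  using assms by (auto simp: sol_def)

lemma sol_continuous: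
  assumes "sol r Y" "S \<subseteq> {-r<..<r}"
  shows "continuous_on S Y"
proof (rule continuous_at_imp_continuous_on, rule)
  fix x assume "x \<in> S"
  then have "x \<in> {-r<..<r}" using assms(2) by blast
  then have "\<bar>x\<bar> < r" by auto
  from DERIV_isCont[OF solD(2)[OF assms(1) this]] show "isCont Y x" .
qed

lemma sol_continuous_comp:
  assumes "sol r Y" "S \<subseteq> {-r<..<r}" "r \<le> a" "continuous_on ({-a<..<a} \<times> {-a<..<a}) g"
  shows "continuous_on S (\<lambda>x. g (x, Y x))"
proof (rule continuous_on_compose2[OF assms(4)])
  show "continuous_on S (\<lambda>x. (x, Y x))"
    by (intro continuous_intros sol_continuous[OF assms(1,2)])
  have "x \<in> {-a<..<a} \<and> Y x \<in> {-a<..<a}" if "x \<in> S" for x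
  proof -
    have "x \<in> {-r<..<r}" using assms(2) that by blast
    then show ?thesis using solD(1)[OF assms(1), of x] assms(3) by (auto simp: abs_less_iff)
  qed
  then show "(\<lambda>x. (x, Y x)) ` S \<subseteq> {-a<..<a} \<times> {-a<..<a}" by auto
qed

end

lemma tendsto_of_abs_le:
  fixes f :: "'a \<Rightarrow> real"
  assumes "\<And>n. \<bar>f n - l\<bar> \<le> b n" "(b \<longlongrightarrow> 0) F"
  shows "(f \<longlongrightarrow> l) F"
proof -
  have "((\<lambda>n. f n - l) \<longlongrightarrow> 0) F"
    by (rule Lim_null_comparison[OF _ assms(2)]) (use assms(1) in auto)
  then show ?thesis by (rule Lim_null[THEN iffD2])
qed

section \<open>Differentiability of the flow in the initial value\<close>

context transport
begin

text \<open>The solution of the linear equation (Q J)' = h J along \<open>Y\<close> with J = 1 at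
  \<open>s\<close>, written out. The formula is meant for s \<le> x, where the interval of
  integration is not empty.\<close>

definition flow_jacobian :: "(real \<Rightarrow> real) \<Rightarrow> real \<Rightarrow> real \<Rightarrow> real" where
  "flow_jacobian Y s x =
     Q (s, Y s) / Q (x, Y x) * exp (integral {s..x} (\<lambda>\<xi>. h (\<xi>, Y \<xi>) / Q (\<xi>, Y \<xi>)))"

text \<open>The logarithm of the potential difference \<open>m\<close> has the derivative
  \<open>R\<close>, a quotient of differences that is bounded by M / q and converges pointwise to h
  / Q. Dominated convergence therefore gives the limit of \<open>m n x / m n s\<close>, and the
  values of \<open>Q\<close> at both ends convert potential differences back into differences of
  heights.\<close>

lemma flow_quotient_tendsto:
  assumes Y: "sol r Y" and Yn: "\<And>n. sol r (Yn n)" and r: "r \<le> a"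
    and s: "\<bar>s\<bar> < r" and x: "\<bar>x\<bar> < r" and sx: "s \<le> x"
    and ne: "\<And>n. Yn n s \<noteq> Y s" and lim: "(\<lambda>n. Yn n s) \<longlonglongrightarrow> Y s"
  shows "(\<lambda>n. (Yn n x - Y x) / (Yn n s - Y s)) \<longlonglongrightarrow> flow_jacobian Y s x"
proof -
  define m where "m n \<xi> = \<Phi> (\<xi>, Yn n \<xi>) - \<Phi> (\<xi>, Y \<xi>)" for n \<xi>
  define R where "R n \<xi> = (k (\<xi>, Yn n \<xi>) - k (\<xi>, Y \<xi>)) / m n \<xi>" for n \<xi>
  have in_r: "\<bar>\<xi>\<bar> < r" if "\<xi> \<in> {s..x}" for \<xi> using that s x by auto
  have sub: "{s..x} \<subseteq> {-r<..<r}" using s x by auto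
  have ne': "Yn n \<xi> \<noteq> Y \<xi>" if "\<bar>\<xi>\<bar> < r" for n \<xi>
    using sol_unique[OF Y Yn r that s] ne by blast
  have lim': "(\<lambda>n. Yn n \<xi>) \<longlonglongrightarrow> Y \<xi>" if "\<bar>\<xi>\<bar> < r" for \<xi>
  proof -
    have "(\<lambda>n. Lip * \<bar>Yn n s - Y s\<bar>) \<longlonglongrightarrow> Lip * \<bar>Y s - Y s\<bar>"
      by (intro tendsto_intros lim)
    then have "(\<lambda>n. Lip * \<bar>Yn n s - Y s\<bar>) \<longlonglongrightarrow> 0" by simp
    from tendsto_of_abs_le[OF sol_difference[OF Y Yn r s that] this] show ?thesis .
  qed
  have bnd: "\<bar>\<xi>\<bar> < a" "\<bar>Y \<xi>\<bar> < a" "\<bar>Yn n \<xi>\<bar> < a" if "\<bar>\<xi>\<bar> < r" for \<xi> n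
    using solD(1)[OF Y that] solD(1)[OF Yn that] that r by auto
  have mb: "q * \<bar>Yn n \<xi> - Y \<xi>\<bar> \<le> \<bar>m n \<xi>\<bar>" if "\<bar>\<xi>\<bar> < r" for n \<xi>
    unfolding m_def by (rule \<Phi>_bilipschitz(1)[OF bnd[OF that]])
  have m0: "m n \<xi> \<noteq> 0" if "\<bar>\<xi>\<bar> < r" for n \<xi>
  proof
    assume "m n \<xi> = 0"
    then have "q * \<bar>Yn n \<xi> - Y \<xi>\<bar> \<le> 0" using mb[OF that, of n] by simp
    then show False using q ne'[OF that] by (simp add: mult_le_0_iff)
  qed
  have dm: "(m n has_real_derivative k (\<xi>, Yn n \<xi>) - k (\<xi>, Y \<xi>)) (at \<xi>)" if "\<bar>\<xi>\<bar> < r" for n \<xi>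
    unfolding m_def by (intro DERIV_diff sol_d\<Phi>[OF _ that r] Y Yn)
  have contm: "continuous_on {s..x} (m n)" for n
    by (rule continuous_at_imp_continuous_on) (use dm in_r DERIV_isCont in blast)
  \<comment> \<open>By uniqueness of solutions \<open>m\<close> has no zero, so by the intermediate
    value theorem it keeps the sign it has at \<open>s\<close>. This makes the logarithm below
    meaningful.\<close>
  have mq: "m n \<xi> / m n s > 0" if \<xi>: "\<xi> \<in> {s..x}" for n \<xi>
  proof (rule ccontr)
    assume "\<not> ?thesis"
    then have "m n \<xi> / m n s \<le> 0" by simp
    moreover have "m n s / m n s = 1" using m0[OF s] by simp
    moreover have "continuous_on {s..\<xi>} (\<lambda>\<xi>. m n \<xi> / m n s)"
      using \<xi> m0[OF s] by (intro continuous_intros continuous_on_subset[OF contm]) auto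
    ultimately obtain z where "s \<le> z" "z \<le> \<xi>" "m n z / m n s = 0"
      using IVT2'[of "\<lambda>\<xi>. m n \<xi> / m n s" \<xi> 0 s] \<xi> by force
    then show False using m0[of z n] m0[OF s, of n] in_r[of z] \<xi> by auto
  qed
  have int: "(R n has_integral ln (m n x / m n s)) {s..x}" for n
  proof -
    have "(R n has_integral ln (m n x / m n s) - ln (m n s / m n s)) {s..x}"
    proof (rule fundamental_theorem_of_calculus[OF sx])
      fix \<xi> assume \<xi>: "\<xi> \<in> {s..x}"
      have "((\<lambda>\<xi>. ln (m n \<xi> / m n s)) has_real_derivative R n \<xi>) (at \<xi>)"
        using mq[OF \<xi>] m0[OF in_r[OF \<xi>]] m0[OF s]
        by (auto intro!: derivative_eq_intros dm in_r[OF \<xi>] simp: R_def)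
      then show "((\<lambda>\<xi>. ln (m n \<xi> / m n s)) has_vector_derivative R n \<xi>) (at \<xi> within {s..x})"
        by (simp add: has_real_derivative_iff_has_vector_derivative has_vector_derivative_at_within)
    qed
    then show ?thesis using m0[OF s] by simp
  qed
  have RM: "norm (R n \<xi>) \<le> M / q" if "\<xi> \<in> {s..x}" for n \<xi>
  proof -
    note \<xi> = in_r[OF that]
    have "\<bar>k (\<xi>, Yn n \<xi>) - k (\<xi>, Y \<xi>)\<bar> \<le> M * \<bar>Yn n \<xi> - Y \<xi>\<bar>"
      by (rule k_lipschitz[OF bnd[OF \<xi>]])
    also have "\<dots> = M / q * (q * \<bar>Yn n \<xi> - Y \<xi>\<bar>)" using q by simp
    also have "\<dots> \<le> M / q * \<bar>m n \<xi>\<bar>" using mb[OF \<xi>] M q by (intro mult_left_mono) auto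
    finally show ?thesis using m0[OF \<xi>, of n] unfolding R_def by (simp add: abs_divide pos_divide_le_eq)
  qed
  have quot: "(\<lambda>n. m n \<xi> / (Yn n \<xi> - Y \<xi>)) \<longlonglongrightarrow> Q (\<xi>, Y \<xi>)" if "\<bar>\<xi>\<bar> < r" for \<xi>
    unfolding m_def
    by (rule DERIV_sequence_quotient[OF d\<Phi>y lim'[OF that] ne'[OF that]]) (use bnd[OF that] in auto)
  have Qpos: "Q (\<xi>, Y \<xi>) > 0" if "\<bar>\<xi>\<bar> < r" for \<xi>
    using bounds[OF bnd(1)[OF that] bnd(2)[OF that]] q by auto
  have Rlim: "(\<lambda>n. R n \<xi>) \<longlonglongrightarrow> h (\<xi>, Y \<xi>) / Q (\<xi>, Y \<xi>)" if "\<xi> \<in> {s..x}" for \<xi>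
  proof -
    note \<xi> = in_r[OF that]
    have "(\<lambda>n. (k (\<xi>, Yn n \<xi>) - k (\<xi>, Y \<xi>)) / (Yn n \<xi> - Y \<xi>)) \<longlonglongrightarrow> h (\<xi>, Y \<xi>)"
      by (rule DERIV_sequence_quotient[OF dk lim'[OF \<xi>] ne'[OF \<xi>]]) (use bnd[OF \<xi>] in auto)
    from tendsto_divide[OF this quot[OF \<xi>]] Qpos[OF \<xi>]
    have "(\<lambda>n. ((k (\<xi>, Yn n \<xi>) - k (\<xi>, Y \<xi>)) / (Yn n \<xi> - Y \<xi>)) / (m n \<xi> / (Yn n \<xi> - Y \<xi>)))
      \<longlonglongrightarrow> h (\<xi>, Y \<xi>) / Q (\<xi>, Y \<xi>)" by auto
    moreover have "((k (\<xi>, Yn n \<xi>) - k (\<xi>, Y \<xi>)) / (Yn n \<xi> - Y \<xi>)) / (m n \<xi> / (Yn n \<xi> - Y \<xi>)) = R n \<xi>" for n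
      using ne'[OF \<xi>, of n] unfolding R_def by simp
    ultimately show ?thesis by simp
  qed
  have "(\<lambda>n. integral {s..x} (R n)) \<longlonglongrightarrow> integral {s..x} (\<lambda>\<xi>. h (\<xi>, Y \<xi>) / Q (\<xi>, Y \<xi>))"
    by (rule dominated_convergence(2)[of _ _ "\<lambda>_. M / q"]) (use int RM Rlim in \<open>auto simp: has_integral_integrable\<close>)
  then have "(\<lambda>n. exp (ln (m n x / m n s))) \<longlonglongrightarrow> exp (integral {s..x} (\<lambda>\<xi>. h (\<xi>, Y \<xi>) / Q (\<xi>, Y \<xi>)))"
    unfolding integral_unique[OF int] by (rule tendsto_exp)
  then have e: "(\<lambda>n. m n x / m n s) \<longlonglongrightarrow> exp (integral {s..x} (\<lambda>\<xi>. h (\<xi>, Y \<xi>) / Q (\<xi>, Y \<xi>)))"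
    using mq[of x] sx by simp
  have "(\<lambda>n. (m n s / (Yn n s - Y s)) / (m n x / (Yn n x - Y x)) * (m n x / m n s)) \<longlonglongrightarrow> flow_jacobian Y s x"
    unfolding flow_jacobian_def using Qpos[OF x] by (intro tendsto_intros quot e s x) auto
  moreover have "(m n s / (Yn n s - Y s)) / (m n x / (Yn n x - Y x)) * (m n x / m n s)
      = (Yn n x - Y x) / (Yn n s - Y s)" for n
    using m0[OF s, of n] m0[OF x, of n] by simp
  ultimately show ?thesis by simp
qed

text \<open>Implicit differentiation starting from mere continuity of \<open>Y\<close>. The mean
  value theorem in y is applied at the level \<open>xn n\<close>, where it yields \<open>Q\<close>
  at an intermediate point, and joint continuity of \<open>Q\<close> gives the limit; the horizontal
  increment is taken at the fixed height \<open>Y x\<close>.\<close>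

lemma implicit_solution:
  assumes x: "\<bar>x\<bar> < a" "\<bar>Y x\<bar> < a" and cont: "isCont Y x"
    and d: "((\<lambda>x. \<Phi> (x, Y x)) has_real_derivative k (x, Y x)) (at x)"
  shows "(Y has_real_derivative v (x, Y x)) (at x)"
proof (rule DERIV_sequenceI)
  fix xn :: "nat \<Rightarrow> real" assume ne: "\<And>n. xn n \<noteq> x" and lim: "xn \<longlonglongrightarrow> x"
  have limY: "(\<lambda>n. Y (xn n)) \<longlonglongrightarrow> Y x"
    using isCont_tendsto_compose[OF cont lim] .
  \<comment> \<open>Putting the bounds into an implication inside the existential lets
    \<open>z\<close> be chosen for every index, including early ones whose points may lie outside
    the square.\<close>
  have "\<exists>z. z \<in> closed_segment (Y x) (Y (xn n)) \<and> (\<bar>xn n\<bar> < a \<and> \<bar>Y (xn n)\<bar> < a \<longrightarrow>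
      \<Phi> (xn n, Y (xn n)) - \<Phi> (xn n, Y x) = Q (xn n, z) * (Y (xn n) - Y x))" for n
    using \<Phi>_mvt[of "xn n" "Y x" "Y (xn n)"] x ends_in_segment by metis
  then obtain z where z: "\<And>n. z n \<in> closed_segment (Y x) (Y (xn n))"
    "\<And>n. \<bar>xn n\<bar> < a \<Longrightarrow> \<bar>Y (xn n)\<bar> < a \<Longrightarrow>
      \<Phi> (xn n, Y (xn n)) - \<Phi> (xn n, Y x) = Q (xn n, z n) * (Y (xn n) - Y x)"
    by metis
  have limz: "z \<longlonglongrightarrow> Y x"
  proof -
    have "\<bar>z n - Y x\<bar> \<le> \<bar>Y (xn n) - Y x\<bar>" for n
      using z(1)[of n] by (auto simp: closed_segment_eq_real_ivl split: if_splits)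
    moreover have "(\<lambda>n. \<bar>Y (xn n) - Y x\<bar>) \<longlonglongrightarrow> \<bar>Y x - Y x\<bar>"
      by (intro tendsto_intros limY)
    ultimately show ?thesis using tendsto_of_abs_le[of z "Y x" "\<lambda>n. \<bar>Y (xn n) - Y x\<bar>" sequentially] by simp
  qed
  have "isCont Q (x, Y x)"
    using contQ x by (subst (asm) continuous_on_eq_continuous_at) (auto simp: open_Times abs_less_iff)
  then have limQ: "(\<lambda>n. Q (xn n, z n)) \<longlonglongrightarrow> Q (x, Y x)"
    by (rule isCont_tendsto_compose) (intro tendsto_Pair lim limz)
  have Qx: "Q (x, Y x) > 0" using bounds[OF x] q by auto
  have d0: "((\<lambda>\<xi>. \<Phi> (\<xi>, Y x)) has_real_derivative k (x, Y x) - Q (x, Y x) * v (x, Y x)) (at x)"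
    using has_real_derivative_along_curve[OF d\<Phi>, of "\<lambda>x. x" x "\<lambda>_. Y x" 1 UNIV 0] x by simp
  have "(\<lambda>n. ((\<Phi> (xn n, Y (xn n)) - \<Phi> (x, Y x)) / (xn n - x) -
      (\<Phi> (xn n, Y x) - \<Phi> (x, Y x)) / (xn n - x)) / Q (xn n, z n)) \<longlonglongrightarrow>
      (k (x, Y x) - (k (x, Y x) - Q (x, Y x) * v (x, Y x))) / Q (x, Y x)"
    using Qx by (intro tendsto_divide tendsto_diff limQ DERIV_sequence_quotient[OF d lim ne]
      DERIV_sequence_quotient[OF d0 lim ne]) auto
  then have l: "(\<lambda>n. ((\<Phi> (xn n, Y (xn n)) - \<Phi> (x, Y x)) / (xn n - x) -
      (\<Phi> (xn n, Y x) - \<Phi> (x, Y x)) / (xn n - x)) / Q (xn n, z n)) \<longlonglongrightarrow> v (x, Y x)"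
    using Qx by simp
  have "eventually (\<lambda>n. \<bar>xn n\<bar> < a) sequentially" "eventually (\<lambda>n. \<bar>Y (xn n)\<bar> < a) sequentially"
    using order_tendstoD(2)[OF tendsto_rabs[OF lim] x(1)] order_tendstoD(2)[OF tendsto_rabs[OF limY] x(2)] by auto
  moreover have "eventually (\<lambda>n. Q (xn n, z n) > 0) sequentially"
    using order_tendstoD(1)[OF limQ Qx] .
  ultimately have "eventually (\<lambda>n. ((\<Phi> (xn n, Y (xn n)) - \<Phi> (x, Y x)) / (xn n - x) -
      (\<Phi> (xn n, Y x) - \<Phi> (x, Y x)) / (xn n - x)) / Q (xn n, z n) = (Y (xn n) - Y x) / (xn n - x)) sequentially"
  proof eventually_elim
    case (elim n)
    have "(\<Phi> (xn n, Y (xn n)) - \<Phi> (x, Y x)) / (xn n - x) - (\<Phi> (xn n, Y x) - \<Phi> (x, Y x)) / (xn n - x)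
      = Q (xn n, z n) * (Y (xn n) - Y x) / (xn n - x)"
      using z(2)[of n] elim by (simp flip: diff_divide_distrib)
    then show ?case using elim by simp
  qed
  then show "(\<lambda>n. (Y (xn n) - Y x) / (xn n - x)) \<longlonglongrightarrow> v (x, Y x)"
    by (rule Lim_transform_eventually[OF l])
qed

section \<open>Existence of solutions by contraction\<close>

lemma continuous_\<Phi>: "continuous_on ({-a<..<a} \<times> {-a<..<a}) \<Phi>"
proof (rule continuous_at_imp_continuous_on, clarify)
  fix x y assume "x \<in> {-a<..<a}" "y \<in> {-a<..<a}"
  then show "isCont \<Phi> (x, y)" by (intro has_derivative_continuous[OF d\<Phi>]) auto
qed

lemma \<Phi>_horizontal:
  assumes "\<bar>x0\<bar> < a" "\<bar>x1\<bar> < a" "\<bar>y\<bar> < a"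
  shows "\<bar>\<Phi> (x1, y) - \<Phi> (x0, y)\<bar> \<le> (M + M\<^sup>2) * \<bar>x1 - x0\<bar>"
proof -
  have *: "\<bar>\<Phi> (x1, y) - \<Phi> (x0, y)\<bar> \<le> (M + M\<^sup>2) * \<bar>x1 - x0\<bar>" if "\<bar>x0\<bar> < a" "\<bar>x1\<bar> < a" "x0 < x1" for x0 x1
  proof -
    have "((\<lambda>\<xi>. \<Phi> (\<xi>, y)) has_real_derivative k (x, y) - Q (x, y) * v (x, y)) (at x)" if "\<bar>x\<bar> < a" for x
      using has_real_derivative_along_curve[OF d\<Phi>, of "\<lambda>x. x" x "\<lambda>_. y" 1 UNIV 0] assms that by simp
    then have "\<exists>z>x0. z < x1 \<and> \<Phi> (x1, y) - \<Phi> (x0, y) = (x1 - x0) * (k (z, y) - Q (z, y) * v (z, y))"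
      by (intro MVT2[OF that(3)]) (use that in auto)
    then obtain z where z: "z > x0" "z < x1" "\<Phi> (x1, y) - \<Phi> (x0, y) = (x1 - x0) * (k (z, y) - Q (z, y) * v (z, y))" by auto
    have b: "\<bar>k (z, y)\<bar> \<le> M" "\<bar>Q (z, y)\<bar> \<le> M" "\<bar>v (z, y)\<bar> \<le> M"
    proof -
      have "\<bar>z\<bar> < a" using z that by linarith
      from bounds[OF this assms(3)] q show "\<bar>k (z, y)\<bar> \<le> M" "\<bar>Q (z, y)\<bar> \<le> M" "\<bar>v (z, y)\<bar> \<le> M" by auto
    qed
    have "\<bar>k (z, y) - Q (z, y) * v (z, y)\<bar> \<le> M + M * M"
      using b(1) mult_mono[OF b(2,3)] M abs_triangle_ineq4[of "k (z, y)" "Q (z, y) * v (z, y)"]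
      by (auto simp: abs_mult)
    then show ?thesis unfolding z(3) abs_mult power2_eq_square
      by (subst mult.commute) (rule mult_right_mono, auto)
  qed
  show ?thesis
    using *[of x0 x1] *[of x1 x0] assms by (cases x0 x1 rule: linorder_cases) (auto simp: abs_minus_commute)
qed

text \<open>The integrated equation \<open>\<Phi>(x, Y x) = \<Phi>(x\<^sub>0, y\<^sub>0) + \<integral> k(\<xi>, Y \<xi>) d\<xi>\<close> is Lipschitz in \<open>Y\<close>
  although \<open>v\<close> is merely continuous; a Newton-type step of length \<open>1 / M\<close> makes it contracting.\<close>

lemma sol_exists: "\<exists>r>0. r \<le> a \<and> (\<forall>x0 y0. \<bar>x0\<bar> < r \<longrightarrow> \<bar>y0\<bar> < r \<longrightarrow> (\<exists>Y. sol r Y \<and> Y x0 = y0))"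
proof -
  define R where "R = a / 2"
  \<comment> \<open>The bound q / (8 M) keeps the Lipschitz contribution 4 \<open>\<rho>\<close> of
    the integrals at or below half of the gain q / M of the Newton step. The last bound keeps the
    values within [- R, R]: the number 7 + 2 M collects 2 (1 + M) from moving to the level
    \<open>x\<close>, 1 from the initial height and 4 from the integrals.\<close>
  define \<rho> where "\<rho> = min (a / 2) (min (q / (8 * M)) (q * R / (M * (7 + 2 * M))))"
  have R: "0 < R" "R < a" using a by (auto simp: R_def)
  have \<rho>: "0 < \<rho>" "\<rho> \<le> R" "\<rho> < a" "\<rho> \<le> q / (8 * M)" "\<rho> \<le> q * R / (M * (7 + 2 * M))"
  proof -
    have "0 < q / (8 * M)" "0 < q * R / (M * (7 + 2 * M))" using a M q R by (auto intro!: divide_pos_pos)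
    then show "0 < \<rho>" using a by (simp add: \<rho>_def)
    show "\<rho> \<le> R" unfolding \<rho>_def R_def by (rule min.cobounded1)
    then show "\<rho> < a" using R by linarith
    show "\<rho> \<le> q / (8 * M)" "\<rho> \<le> q * R / (M * (7 + 2 * M))" by (auto simp: \<rho>_def)
  qed
  have \<rho>R: "\<rho> * (7 + 2 * M) \<le> q / M * R"
  proof -
    have "\<rho> * (7 + 2 * M) \<le> q * R / (M * (7 + 2 * M)) * (7 + 2 * M)"
      using \<rho>(5) M by (intro mult_right_mono) auto
    also have "\<dots> = q / M * R" using M by (simp add: add_pos_pos less_imp_neq[symmetric])
    finally show ?thesis .
  qed
  show ?thesis
  proof (intro exI[of _ \<rho>] conjI allI impI)
    show "0 < \<rho>" "\<rho> \<le> a" using \<rho> by auto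
    fix x0 y0 :: real assume x0: "\<bar>x0\<bar> < \<rho>" and y0: "\<bar>y0\<bar> < \<rho>"
    \<comment> \<open>Starting at the left end for every \<open>x\<close> avoids oriented integrals;
      subtracting the value at \<open>x0\<close> imposes the initial condition.\<close>
    define I where "I Y x = integral {-\<rho>..x} (\<lambda>\<xi>. k (\<xi>, Y \<xi>))" for Y :: "real \<Rightarrow> real" and x
    define G where "G Y x = Y x - (\<Phi> (x, Y x) - \<Phi> (x0, y0) - (I Y x - I Y x0)) / M" for Y :: "real \<Rightarrow> real" and x
    \<comment> \<open>Clamping to [- \<open>\<rho>\<close>, \<open>\<rho>\<close>] extends the
      iterates to the whole line, so that they are elements of the complete space of bounded
      continuous functions.\<close>
    define cl where "cl x = max (- \<rho>) (min \<rho> x)" for x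
    have cl: "cl x \<in> {-\<rho>..\<rho>}" for x using \<rho> by (auto simp: cl_def)
    have clx: "x \<in> {-\<rho>..\<rho>} \<Longrightarrow> cl x = x" for x by (auto simp: cl_def)
    have contcl: "continuous_on UNIV cl" unfolding cl_def by (intro continuous_intros)
    define T where "T Y = Bcontfun (\<lambda>x. G (apply_bcontfun Y) (cl x))" for Y :: "real \<Rightarrow>\<^sub>C real"
    define S where "S = (cball 0 R :: (real \<Rightarrow>\<^sub>C real) set)"
    have SR: "\<bar>apply_bcontfun Y x\<bar> \<le> R" if "Y \<in> S" for Y x
      using norm_bounded[of Y x] that by (auto simp: S_def dist_norm)
    have SA: "\<bar>apply_bcontfun Y x\<bar> < a" if "Y \<in> S" for Y x
      using SR[OF that, of x] R by auto
    have contk': "continuous_on {-\<rho>..\<rho>} (\<lambda>x. k (x, apply_bcontfun Y x))"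
      and cont\<Phi>: "continuous_on {-\<rho>..\<rho>} (\<lambda>x. \<Phi> (x, apply_bcontfun Y x))" if "Y \<in> S" for Y
    proof -
      have *: "(\<lambda>x. (x, apply_bcontfun Y x)) ` {-\<rho>..\<rho>} \<subseteq> {-a<..<a} \<times> {-a<..<a}"
        using SA[OF that] \<rho> by (auto simp: abs_less_iff) (smt (verit))+
      show "continuous_on {-\<rho>..\<rho>} (\<lambda>x. k (x, apply_bcontfun Y x))"
        by (rule continuous_on_compose2[OF contk _ *]) (intro continuous_intros continuous_on_apply_bcontfun)
      show "continuous_on {-\<rho>..\<rho>} (\<lambda>x. \<Phi> (x, apply_bcontfun Y x))"
        by (rule continuous_on_compose2[OF continuous_\<Phi> _ *]) (intro continuous_intros continuous_on_apply_bcontfun)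
    qed
    have dI: "(I (apply_bcontfun Y) has_real_derivative k (x, apply_bcontfun Y x)) (at x within {-\<rho>..\<rho>})"
      if "Y \<in> S" "x \<in> {-\<rho>..\<rho>}" for Y x
      unfolding I_def by (rule integral_has_real_derivative[OF contk'[OF that(1)] that(2)])
    have contI: "continuous_on {-\<rho>..\<rho>} (I (apply_bcontfun Y))" if "Y \<in> S" for Y
      using dI[OF that] has_field_derivative_imp_has_derivative has_derivative_continuous
      unfolding continuous_on_eq_continuous_within by blast
    have contG: "continuous_on {-\<rho>..\<rho>} (G (apply_bcontfun Y))" if "Y \<in> S" for Y
      unfolding G_def using M by (intro continuous_intros continuous_on_apply_bcontfun cont\<Phi>[OF that] contI[OF that]) auto
    have len: "x - (- \<rho>) \<le> 2 * \<rho>" if "x \<in> {-\<rho>..\<rho>}" for x using that by auto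
    have IM: "\<bar>I (apply_bcontfun Y) x\<bar> \<le> 2 * \<rho> * M" if "Y \<in> S" "x \<in> {-\<rho>..\<rho>}" for Y x
    proof -
      have "norm (I (apply_bcontfun Y) x) \<le> M * (x - (-\<rho>))" unfolding I_def
      proof (rule integral_bound)
        show "continuous_on {-\<rho>..x} (\<lambda>\<xi>. k (\<xi>, apply_bcontfun Y \<xi>))"
          using that by (intro continuous_on_subset[OF contk']) auto
        show "norm (k (t, apply_bcontfun Y t)) \<le> M" if "t \<in> {-\<rho>..x}" for t
          using bounds[OF _ SA[OF \<open>Y \<in> S\<close>], of t] that \<open>x \<in> _\<close> \<rho> by auto
      qed (use that in auto)
      also have "\<dots> \<le> M * (2 * \<rho>)" using len[OF that(2)] M by (intro mult_left_mono) auto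
      finally show ?thesis by (simp add: mult_ac)
    qed
    have ID: "\<bar>I (apply_bcontfun Y) x - I (apply_bcontfun Z) x\<bar> \<le> 2 * \<rho> * M * dist Y Z"
      if "Y \<in> S" "Z \<in> S" "x \<in> {-\<rho>..\<rho>}" for Y Z x
    proof -
      have sub: "{-\<rho>..x} \<subseteq> {-\<rho>..\<rho>}" using that by auto
      note c = continuous_on_subset[OF contk' sub]
      have "I (apply_bcontfun Y) x - I (apply_bcontfun Z) x =
        integral {-\<rho>..x} (\<lambda>\<xi>. k (\<xi>, apply_bcontfun Y \<xi>) - k (\<xi>, apply_bcontfun Z \<xi>))"
        unfolding I_def by (intro integral_diff[symmetric] integrable_continuous_real c that)
      also have "norm \<dots> \<le> (M * dist Y Z) * (x - (-\<rho>))"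
      proof (rule integral_bound)
        show "continuous_on {-\<rho>..x} (\<lambda>\<xi>. k (\<xi>, apply_bcontfun Y \<xi>) - k (\<xi>, apply_bcontfun Z \<xi>))"
          by (intro continuous_intros c that)
        fix t assume "t \<in> {-\<rho>..x}"
        then have "\<bar>k (t, apply_bcontfun Y t) - k (t, apply_bcontfun Z t)\<bar> \<le> M * \<bar>apply_bcontfun Y t - apply_bcontfun Z t\<bar>"
          by (intro k_lipschitz SA that) (use \<rho> \<open>x \<in> _\<close> in auto)
        also have "\<dots> \<le> M * dist Y Z"
          using dist_bounded[of Y t Z] M by (intro mult_left_mono) (auto simp: dist_real_def)
        finally show "norm (k (t, apply_bcontfun Y t) - k (t, apply_bcontfun Z t)) \<le> M * dist Y Z" by simp
      qed (use that in auto)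
      also have "\<dots> \<le> (M * dist Y Z) * (2 * \<rho>)" using len[OF that(3)] M by (intro mult_left_mono) auto
      finally show ?thesis by (simp add: mult_ac)
    qed
    have x0': "x0 \<in> {-\<rho>..\<rho>}" using x0 by auto
    have GR: "\<bar>G (apply_bcontfun Y) x\<bar> \<le> R" if "Y \<in> S" "x \<in> {-\<rho>..\<rho>}" for Y x
    proof -
      define y where "y = apply_bcontfun Y x"
      have y: "\<bar>y\<bar> \<le> R" "\<bar>y\<bar> < a" using SR SA that by (auto simp: y_def)
      have xa: "\<bar>x\<bar> < a" "\<bar>x0\<bar> < a" "\<bar>0::real\<bar> < a" "\<bar>y0\<bar> < a" using that \<rho> x0 y0 a by auto
      \<comment> \<open>The three groups are the Newton step at the fixed level \<open>x\<close>
        based at height 0, the cost of moving the base point from (x, 0) to (x0, y0), and the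
        integral.\<close>
      have "G (apply_bcontfun Y) x = ((y - 0) - (\<Phi> (x, y) - \<Phi> (x, 0)) / M)
          - ((\<Phi> (x, 0) - \<Phi> (x0, 0)) / M + (\<Phi> (x0, 0) - \<Phi> (x0, y0)) / M)
          + (I (apply_bcontfun Y) x - I (apply_bcontfun Y) x0) / M"
        unfolding G_def y_def[symmetric] by (simp add: diff_divide_distrib)
      moreover have "\<bar>(y - 0) - (\<Phi> (x, y) - \<Phi> (x, 0)) / M\<bar> \<le> (1 - q / M) * R"
        using \<Phi>_bilipschitz(3)[OF xa(1,3) y(2)] y qM M
          mult_left_mono[OF y(1), of "1 - q / M"] by auto
      moreover have "\<bar>(\<Phi> (x, 0) - \<Phi> (x0, 0)) / M\<bar> \<le> (1 + M) * (2 * \<rho>)"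
      proof -
        have "\<bar>\<Phi> (x, 0) - \<Phi> (x0, 0)\<bar> \<le> (M + M\<^sup>2) * \<bar>x - x0\<bar>" by (rule \<Phi>_horizontal[OF xa(2,1,3)])
        also have "\<dots> \<le> (M + M\<^sup>2) * (2 * \<rho>)" using that x0 M by (intro mult_left_mono) auto
        finally show ?thesis using M by (simp add: abs_divide pos_divide_le_eq power2_eq_square algebra_simps)
      qed
      moreover have "\<bar>(\<Phi> (x0, 0) - \<Phi> (x0, y0)) / M\<bar> \<le> \<rho>"
      proof -
        have "\<bar>\<Phi> (x0, 0) - \<Phi> (x0, y0)\<bar> \<le> M * \<bar>0 - y0\<bar>" by (rule \<Phi>_bilipschitz(2)[OF xa(2,4,3)])
        also have "\<dots> \<le> M * \<rho>" using y0 M by (intro mult_left_mono) auto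
        finally show ?thesis using M by (simp add: abs_divide pos_divide_le_eq mult.commute)
      qed
      moreover have "\<bar>(I (apply_bcontfun Y) x - I (apply_bcontfun Y) x0) / M\<bar> \<le> 4 * \<rho>"
      proof -
        have "\<bar>I (apply_bcontfun Y) x - I (apply_bcontfun Y) x0\<bar> \<le> 4 * \<rho> * M"
          using IM[OF that] IM[OF that(1) x0'] by linarith
        then show ?thesis using M by (simp add: abs_divide pos_divide_le_eq)
      qed
      moreover have "(1 - q / M) * R + (1 + M) * (2 * \<rho>) + \<rho> + 4 * \<rho> \<le> R"
        using \<rho>R by (simp add: algebra_simps)
      ultimately show ?thesis by linarith
    qed
    have T_app: "apply_bcontfun (T Y) x = G (apply_bcontfun Y) (cl x)" if "Y \<in> S" for Y x
    proof -
      have "(\<lambda>x. G (apply_bcontfun Y) (cl x)) \<in> bcontfun"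
      proof (rule bcontfun_normI)
        show "continuous_on UNIV (\<lambda>x. G (apply_bcontfun Y) (cl x))"
          by (rule continuous_on_compose2[OF contG[OF that] contcl]) (use cl in auto)
        show "norm (G (apply_bcontfun Y) (cl x)) \<le> R" for x using GR[OF that cl] by simp
      qed
      then show ?thesis unfolding T_def by (simp add: Bcontfun_inverse)
    qed
    have "\<exists>!Y\<in>S. T Y = Y"
    proof (rule Banach_fix)
      show "complete S" unfolding S_def by (simp add: complete_eq_closed)
      show "S \<noteq> {}" unfolding S_def using R by auto
      have "q / M \<le> 1" using qM M by simp
      then show "0 \<le> 1 - q / M + 4 * \<rho>" using \<rho>(1) by linarith
      have "\<rho> * (8 * M) \<le> q" using \<rho>(4) M by (simp only: pos_le_divide_eq mult_pos_pos zero_less_numeral)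
      then have "8 * \<rho> \<le> q / M" using M by (simp add: pos_le_divide_eq mult_ac)
      then show "1 - q / M + 4 * \<rho> < 1" using \<rho>(1) by linarith
      show "T ` S \<subseteq> S"
      proof (clarify)
        fix Y assume "Y \<in> S"
        then have "norm (T Y) \<le> R" by (intro norm_bound) (use GR cl T_app in auto)
        then show "T Y \<in> S" by (auto simp: S_def dist_norm)
      qed
      show "dist (T Y) (T Z) \<le> (1 - q / M + 4 * \<rho>) * dist Y Z" if "Y \<in> S" "Z \<in> S" for Y Z
      proof (rule dist_bound)
        fix t :: real
        define x where "x = cl t"
        have x: "x \<in> {-\<rho>..\<rho>}" unfolding x_def by (rule cl)
        have YZ: "Y \<in> S" "Z \<in> S" using that by auto
        define y z where "y = apply_bcontfun Y x" and "z = apply_bcontfun Z x"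
        have yz: "\<bar>z - y\<bar> \<le> dist Y Z"
          using dist_bounded[of Y x Z] unfolding y_def z_def by (auto simp: dist_real_def)
        have "\<bar>(z - y) - (\<Phi> (x, z) - \<Phi> (x, y)) / M\<bar> \<le> (1 - q / M) * \<bar>z - y\<bar>"
          by (rule \<Phi>_bilipschitz(3)) (use x \<rho> SA YZ in \<open>auto simp: y_def z_def\<close>)
        also have "\<dots> \<le> (1 - q / M) * dist Y Z" using yz qM M by (intro mult_left_mono) auto
        finally have 1: "\<bar>(z - y) - (\<Phi> (x, z) - \<Phi> (x, y)) / M\<bar> \<le> (1 - q / M) * dist Y Z" .
        have "\<bar>(I Z x - I Z x0) - (I Y x - I Y x0)\<bar> \<le> 4 * \<rho> * dist Y Z * M"
          using ID[OF YZ x] ID[OF YZ x0'] by (simp add: algebra_simps)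
        then have 2: "\<bar>((I Z x - I Z x0) - (I Y x - I Y x0)) / M\<bar> \<le> 4 * \<rho> * dist Y Z"
          using M by (simp add: abs_divide pos_divide_le_eq)
        have "G Z x - G Y x = ((z - y) - (\<Phi> (x, z) - \<Phi> (x, y)) / M) +
          ((I Z x - I Z x0) - (I Y x - I Y x0)) / M"
          unfolding G_def y_def[symmetric] z_def[symmetric] by (simp add: diff_divide_distrib)
        then have "\<bar>G Z x - G Y x\<bar> \<le> (1 - q / M) * dist Y Z + 4 * \<rho> * dist Y Z"
          using 1 2 by linarith
        then show "dist (apply_bcontfun (T Y) t) (apply_bcontfun (T Z) t) \<le> (1 - q / M + 4 * \<rho>) * dist Y Z"
          unfolding T_app[OF YZ(1)] T_app[OF YZ(2)] x_def[symmetric] dist_real_def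
          by (simp add: abs_minus_commute algebra_simps)
      qed
    qed
    then obtain Y where Y: "Y \<in> S" "T Y = Y" by blast
    define y where "y = apply_bcontfun Y"
    have eq: "\<Phi> (x, y x) = \<Phi> (x0, y0) + (I y x - I y x0)" if "x \<in> {-\<rho>..\<rho>}" for x
    proof -
      have "y x = G y x" using T_app[OF Y(1), of x] Y(2) clx[OF that] by (simp add: y_def)
      then show ?thesis using M by (simp add: G_def)
    qed
    have "sol \<rho> y"
      unfolding sol_def
    proof (intro allI impI conjI)
      fix x assume x: "\<bar>x\<bar> < \<rho>"
      show ya: "\<bar>y x\<bar> < a" using SA[OF Y(1)] by (simp add: y_def)
      have "(I y has_real_derivative k (x, y x)) (at x within {-\<rho>..\<rho>})"
        unfolding y_def by (rule dI[OF Y(1)]) (use x in auto)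
      then have "(I y has_real_derivative k (x, y x)) (at x within {-\<rho><..<\<rho>})"
        by (rule DERIV_subset) auto
      then have "(I y has_real_derivative k (x, y x)) (at x)"
        using x by (subst (asm) at_within_open) auto
      then have "((\<lambda>x. \<Phi> (x0, y0) + (I y x - I y x0)) has_real_derivative k (x, y x)) (at x)"
        by (auto intro!: derivative_eq_intros)
      then have "((\<lambda>x. \<Phi> (x, y x)) has_real_derivative k (x, y x)) (at x)"
        by (rule has_field_derivative_transform_within_open[where S = "{-\<rho><..<\<rho>}"])
           (use eq x in auto)
      then show "(y has_real_derivative v (x, y x)) (at x)"
        by (intro implicit_solution)
           (use x ya \<rho> in \<open>auto simp: y_def intro: continuous_on_interior[OF continuous_on_apply_bcontfun[of UNIV]]\<close>)
    qed
    moreover have "y x0 = y0"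
    proof -
      have "q * \<bar>y x0 - y0\<bar> \<le> \<bar>\<Phi> (x0, y x0) - \<Phi> (x0, y0)\<bar>"
        by (rule \<Phi>_bilipschitz(1)) (use x0 y0 \<rho> SA[OF Y(1)] in \<open>auto simp: y_def\<close>)
      also have "\<dots> = 0" using eq[OF x0'] by simp
      finally show ?thesis using q by (simp add: mult_le_0_iff)
    qed
    ultimately show "\<exists>Y. sol \<rho> Y \<and> Y x0 = y0" by blast
  qed
qed

lemma flow_has_derivative:
  assumes F: "\<And>\<zeta>. \<zeta> \<in> U \<Longrightarrow> sol r (F \<zeta>)" "\<And>\<zeta>. \<zeta> \<in> U \<Longrightarrow> F \<zeta> s = \<zeta>"
    and U: "open U" "\<zeta> \<in> U" and r: "r \<le> a" "\<bar>s\<bar> < r" "\<bar>x\<bar> < r" "s \<le> x"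
  shows "((\<lambda>\<zeta>. F \<zeta> x) has_real_derivative flow_jacobian (F \<zeta>) s x) (at \<zeta>)"
proof -
  have "((\<lambda>\<zeta>. F \<zeta> x) has_real_derivative flow_jacobian (F \<zeta>) s x) (at \<zeta> within U)"
    unfolding has_field_derivative_iff tendsto_at_iff_sequentially comp_def
  proof (intro allI impI)
    fix z :: "nat \<Rightarrow> real" assume z: "\<forall>i. z i \<in> U - {\<zeta>}" "z \<longlonglongrightarrow> \<zeta>"
    have zU: "z n \<in> U" and z\<zeta>: "z n \<noteq> \<zeta>" for n using z(1) by auto
    have ne: "F (z n) s \<noteq> F \<zeta> s" for n
      unfolding F(2)[OF zU] F(2)[OF U(2)] by (rule z\<zeta>)
    have lim: "(\<lambda>n. F (z n) s) \<longlonglongrightarrow> F \<zeta> s"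
      unfolding F(2)[OF zU] F(2)[OF U(2)] by (rule z(2))
    have "(\<lambda>n. (F (z n) x - F \<zeta> x) / (F (z n) s - F \<zeta> s)) \<longlonglongrightarrow> flow_jacobian (F \<zeta>) s x"
      by (rule flow_quotient_tendsto[OF F(1)[OF U(2)] F(1)[OF zU] r ne lim])
    then show "(\<lambda>n. (F (z n) x - F \<zeta> x) / (z n - \<zeta>)) \<longlonglongrightarrow> flow_jacobian (F \<zeta>) s x"
      unfolding F(2)[OF zU] F(2)[OF U(2)] .
  qed
  then show ?thesis unfolding at_within_open[OF U(2,1)] .
qed

lemma sol_lipschitz:
  assumes Y: "sol r Y" and "r \<le> a" "\<bar>s\<bar> < r" "\<bar>t\<bar> < r"
  shows "\<bar>Y t - Y s\<bar> \<le> M * \<bar>t - s\<bar>"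
proof -
  have "norm (Y t - Y s) \<le> M * norm (t - s)"
  proof (rule field_differentiable_bound[where S = "{-r<..<r}"])
    fix z assume "z \<in> {-r<..<r}"
    then have z: "\<bar>z\<bar> < r" by auto
    show "(Y has_real_derivative v (z, Y z)) (at z within {-r<..<r})"
      using solD(2)[OF Y z] by (rule has_field_derivative_at_within)
    show "norm (v (z, Y z)) \<le> M" using bounds[of z "Y z"] solD(1)[OF Y z] z \<open>r \<le> a\<close> by auto
  qed (use assms in auto)
  then show ?thesis by simp
qed

text \<open>Potentials constructed later exist on smaller squares only; the constants
  \<open>M\<close> and \<open>q\<close> can be kept there.\<close>

lemma restrict:
  assumes "0 < b" "b \<le> a"
  shows "transport b M q Q v h \<Phi> k"
proof
  have *: "{-b<..<b} \<times> {-b<..<b} \<subseteq> {-a<..<a} \<times> {-a<..<a}" using assms by auto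
  show "continuous_on ({-b<..<b} \<times> {-b<..<b}) Q" "continuous_on ({-b<..<b} \<times> {-b<..<b}) v"
    "continuous_on ({-b<..<b} \<times> {-b<..<b}) h" "continuous_on ({-b<..<b} \<times> {-b<..<b}) k"
    by (rule continuous_on_subset[OF contQ *] continuous_on_subset[OF contv *]
      continuous_on_subset[OF conth *] continuous_on_subset[OF contk *])+
  show "b > 0" "q > 0" by (fact assms q)+
  fix x y :: real assume "\<bar>x\<bar> < b" "\<bar>y\<bar> < b"
  then have xy: "\<bar>x\<bar> < a" "\<bar>y\<bar> < a" using assms by auto
  show "q \<le> Q (x, y) \<and> Q (x, y) \<le> M \<and> \<bar>v (x, y)\<bar> \<le> M \<and> \<bar>h (x, y)\<bar> \<le> M \<and> \<bar>k (x, y)\<bar> \<le> M"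
    by (rule bounds[OF xy])
  show "(\<Phi> has_derivative (\<lambda>(p, r). (k (x, y) - Q (x, y) * v (x, y)) * p + Q (x, y) * r)) (at (x, y))"
    by (rule d\<Phi>[OF xy])
  show "((\<lambda>y. k (x, y)) has_real_derivative h (x, y)) (at y)"
    by (rule dk[OF xy])
qed

end

section \<open>The angle along a characteristic curve\<close>

text \<open>The substitution c + s (y - c) moves the variable end point into the integrand, so that
  continuity of parameter integrals over the fixed interval [0, 1] applies.\<close>

lemma continuous_on_primitive_param:
  fixes f :: "real \<times> 'b::metric_space \<Rightarrow> real"
  assumes f: "continuous_on ({c..d} \<times> T) f"
  shows "continuous_on ({c..d} \<times> T) (\<lambda>(y, z). integral {c..y} (\<lambda>\<eta>. f (\<eta>, z)))"
proof -
  have "continuous_on ({c..d} \<times> T) (\<lambda>p. integral (cbox 0 1) (\<lambda>s. (fst p - c) * f (c + s * (fst p - c), snd p)))"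
  proof (rule integral_continuous_on_param)
    have *: "c + s * (y - c) \<in> {c..d}" if "s \<in> {0..1}" "y \<in> {c..d}" for s y :: real
    proof -
      have "s * (y - c) \<le> 1 * (y - c)" using that by (intro mult_right_mono) auto
      moreover have "0 \<le> s * (y - c)" using that by auto
      ultimately show ?thesis using that by auto
    qed
    have "continuous_on (({c..d} \<times> T) \<times> {0..1}) (\<lambda>x. f (c + snd x * (fst (fst x) - c), snd (fst x)))"
      by (rule continuous_on_compose2[OF f]) (use * in \<open>auto intro!: continuous_intros\<close>)
    then show "continuous_on (({c..d} \<times> T) \<times> cbox 0 1) (\<lambda>(p, s). (fst p - c) * f (c + s * (fst p - c), snd p))"
      unfolding case_prod_unfold by (auto intro!: continuous_intros)
  qed
  moreover have "integral (cbox 0 1) (\<lambda>s. (y - c) * f (c + s * (y - c), z)) = integral {c..y} (\<lambda>\<eta>. f (\<eta>, z))"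
    if "y \<in> {c..d}" "z \<in> T" for y z
  proof -
    have cont: "continuous_on {c..y} (\<lambda>\<eta>. f (\<eta>, z))"
      by (rule continuous_on_compose2[OF f]) (use that in \<open>auto intro!: continuous_intros\<close>)
    have "((\<lambda>s. (y - c) *\<^sub>R f (c + s * (y - c), z)) has_integral integral {c + 0 * (y - c)..c + 1 * (y - c)} (\<lambda>\<eta>. f (\<eta>, z))) {0..1}"
    proof (rule has_integral_substitution[where c = c and d = y and g = "\<lambda>s. c + s * (y - c)"])
      show "(\<lambda>s. c + s * (y - c)) ` {0..1} \<subseteq> {c..y}"
      proof (clarify)
        fix s :: real assume s: "s \<in> {0..1}"
        then have "s * (y - c) \<le> 1 * (y - c)" using that by (intro mult_right_mono) auto
        moreover have "0 \<le> s * (y - c)" using that s by auto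
        ultimately show "c + s * (y - c) \<in> {c..y}" by auto
      qed
      show "((\<lambda>s. c + s * (y - c)) has_field_derivative y - c) (at x within {0..1})" for x
        by (auto intro!: derivative_eq_intros)
    qed (use that cont in auto)
    from integral_unique[OF this] show ?thesis by simp
  qed
  ultimately show ?thesis by (elim continuous_on_eq) auto
qed

text \<open>Continuity of one partial derivative is enough; the other is asked for at a single
  point. The criterion that is applied wants continuity in the second variable, hence the exchange
  of coordinates inside the proof.\<close>

lemma has_derivative_from_partials:
  fixes f :: "real \<times> real \<Rightarrow> real"
  assumes S: "open S" "(x0, y0) \<in> S"
    and fx: "\<And>x y. (x, y) \<in> S \<Longrightarrow> ((\<lambda>x. f (x, y)) has_real_derivative A (x, y)) (at x)"
    and A: "continuous_on S A"
    and fy: "((\<lambda>y. f (x0, y)) has_real_derivative B) (at y0)"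
  shows "(f has_derivative (\<lambda>(p, r). A (x0, y0) * p + B * r)) (at (x0, y0))"
proof -
  obtain U V where UV': "open U" "open V" "(x0, y0) \<in> U \<times> V" "U \<times> V \<subseteq> S"
    by (rule open_prod_elim[OF S])
  then have UV: "open U" "open V" "x0 \<in> U" "y0 \<in> V" "U \<times> V \<subseteq> S" by auto
  obtain e where e: "e > 0" "ball x0 e \<subseteq> U" using openE[OF UV(1,3)] by blast
  define X where "X = ball x0 e"
  have XV: "X \<times> V \<subseteq> S" using e UV unfolding X_def by blast
  have X: "open X" "x0 \<in> X" "convex X" unfolding X_def using e by auto
  have cA: "continuous (at (y0, x0) within V \<times> X) (\<lambda>(y, x). blinfun_mult_right (A (x, y)))"
  proof -
    have "continuous_on (V \<times> X) (\<lambda>p. A (snd p, fst p))"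
      by (rule continuous_on_compose2[OF A]) (use XV in \<open>auto intro!: continuous_intros\<close>)
    then have "continuous (at (y0, x0) within V \<times> X) (\<lambda>p. A (snd p, fst p))"
      using X UV unfolding continuous_on_eq_continuous_within by blast
    then show ?thesis unfolding case_prod_unfold
      by (rule bounded_linear.continuous[OF bounded_linear_blinfun_mult_right])
  qed
  have "((\<lambda>(y, x). f (x, y)) has_derivative (\<lambda>(ty, tx). B * ty + blinfun_mult_right (A (x0, y0)) tx)) (at (y0, x0) within V \<times> X)"
  proof (rule has_derivative_partialsI[OF _ _ cA])
    show "((\<lambda>y. f (x0, y)) has_derivative (*) B) (at y0 within V)"
      using fy unfolding has_field_derivative_def by (rule has_derivative_at_withinI)
    show "((\<lambda>x. f (x, y)) has_derivative blinfun_apply (blinfun_mult_right (A (x, y)))) (at x within X)"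
      if "y \<in> V" "x \<in> X" for x y
    proof -
      have "(x, y) \<in> S" using that XV by auto
      from fx[OF this] show ?thesis
        unfolding has_field_derivative_def blinfun_mult_right.rep_eq by (rule has_derivative_at_withinI)
    qed
  qed (use X in auto)
  moreover have "at (y0, x0) within V \<times> X = at (y0, x0)"
    by (rule at_within_open) (use X UV in \<open>auto simp: open_Times\<close>)
  ultimately have d: "((\<lambda>(y, x). f (x, y)) has_derivative (\<lambda>(ty, tx). B * ty + A (x0, y0) * tx)) (at (y0, x0))"
    by simp
  have sw: "((\<lambda>p::real \<times> real. (snd p, fst p)) has_derivative (\<lambda>p. (snd p, fst p))) (at (x0, y0))"
    by (auto intro!: derivative_eq_intros)
  have "((\<lambda>p. f (fst p, snd p)) has_derivative (\<lambda>p. B * snd p + A (x0, y0) * fst p)) (at (x0, y0))"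
    using diff_chain_at[OF sw, of "\<lambda>(y, x). f (x, y)" "\<lambda>(ty, tx). B * ty + A (x0, y0) * tx"] d
    by (simp add: o_def case_prod_unfold)
  then show ?thesis by (simp add: case_prod_unfold add.commute)
qed

text \<open>A form \<open>f\<^sub>x dx + (f\<^sub>y + \<kappa>) dy\<close> with \<open>\<kappa>\<^sub>x = h\<close> has exterior derivative \<open>h dx dy\<close>; the
  correction can be moved from the \<open>dy\<close> part to the \<open>dx\<close> part.\<close>

lemma change_gauge:
  fixes f \<kappa> P Q h :: "real \<times> real \<Rightarrow> real"
  assumes \<rho>: "0 < \<rho>" "\<rho> < \<beta>"
    and fx: "\<And>x y. \<bar>x\<bar> < \<beta> \<Longrightarrow> \<bar>y\<bar> < \<beta> \<Longrightarrow> ((\<lambda>x. f (x, y)) has_real_derivative P (x, y)) (at x)"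
    and fy: "\<And>x y. \<bar>x\<bar> < \<beta> \<Longrightarrow> \<bar>y\<bar> < \<beta> \<Longrightarrow> ((\<lambda>y. f (x, y)) has_real_derivative Q (x, y) - \<kappa> (x, y)) (at y)"
    and \<kappa>x: "\<And>x y. \<bar>x\<bar> < \<beta> \<Longrightarrow> \<bar>y\<bar> < \<beta> \<Longrightarrow> ((\<lambda>x. \<kappa> (x, y)) has_real_derivative h (x, y)) (at x)"
    and P: "continuous_on ({-\<beta><..<\<beta>} \<times> {-\<beta><..<\<beta>}) P"
    and h: "continuous_on ({-\<beta><..<\<beta>} \<times> {-\<beta><..<\<beta>}) h"
    and \<kappa>: "continuous_on ({-\<beta><..<\<beta>} \<times> {-\<beta><..<\<beta>}) \<kappa>"
  shows "\<exists>\<Phi> k. continuous_on ({-\<rho><..<\<rho>} \<times> {-\<rho><..<\<rho>}) k \<and> (\<forall>x y. \<bar>x\<bar> < \<rho> \<longrightarrow> \<bar>y\<bar> < \<rho> \<longrightarrow>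
     (\<Phi> has_derivative (\<lambda>(p, r). (k (x, y) + P (x, y)) * p + Q (x, y) * r)) (at (x, y)) \<and>
     ((\<lambda>y. k (x, y)) has_real_derivative h (x, y)) (at y))"
proof -
  \<comment> \<open>Adding the y-primitive \<open>W\<close> of \<open>\<kappa>\<close> to
    \<open>f\<close> cancels - \<open>\<kappa>\<close> in the y-derivative. Differentiation under
    the integral sign shows that it adds \<open>k\<close>, the y-primitive of \<open>h\<close>, to
    the x-derivative.\<close>
  define k where "k = (\<lambda>(x, y). integral {-\<rho>..y} (\<lambda>\<eta>. h (x, \<eta>)))"
  define W where "W = (\<lambda>(x, y). integral {-\<rho>..y} (\<lambda>\<eta>. \<kappa> (x, \<eta>)))"
  have contk: "continuous_on ({-\<rho><..<\<rho>} \<times> {-\<rho><..<\<rho>}) k"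
  proof -
    have "continuous_on ({-\<rho>..\<rho>} \<times> {-\<rho><..<\<rho>}) (\<lambda>p. h (snd p, fst p))"
      by (rule continuous_on_compose2[OF h]) (use \<rho> in \<open>auto intro!: continuous_intros\<close>)
    from continuous_on_primitive_param[OF this]
    have c: "continuous_on ({-\<rho>..\<rho>} \<times> {-\<rho><..<\<rho>}) (\<lambda>(y, x). k (x, y))"
      by (simp add: k_def case_prod_unfold)
    have "continuous_on ({-\<rho><..<\<rho>} \<times> {-\<rho><..<\<rho>}) (\<lambda>p. (\<lambda>(y, x). k (x, y)) (snd p, fst p))"
      by (rule continuous_on_compose2[OF c]) (auto intro!: continuous_intros)
    then show ?thesis by simp
  qed
  have prim: "((\<lambda>y. integral {-\<rho>..y} (\<lambda>\<eta>. g (x, \<eta>))) has_real_derivative g (x, y)) (at y)"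
    if "continuous_on ({-\<beta><..<\<beta>} \<times> {-\<beta><..<\<beta>}) g" "\<bar>x\<bar> < \<rho>" "\<bar>y\<bar> < \<rho>" for g :: "real \<times> real \<Rightarrow> real" and x y
  proof -
    have "continuous_on {-\<rho>..\<rho>} (\<lambda>\<eta>. g (x, \<eta>))"
      by (rule continuous_on_compose2[OF that(1)]) (use \<rho> that in \<open>auto intro!: continuous_intros\<close>)
    from integral_has_real_derivative[OF this, of y]
    have "((\<lambda>y. integral {-\<rho>..y} (\<lambda>\<eta>. g (x, \<eta>))) has_real_derivative g (x, y)) (at y within {-\<rho>..\<rho>})"
      using that by (simp add: abs_less_iff)
    then have "((\<lambda>y. integral {-\<rho>..y} (\<lambda>\<eta>. g (x, \<eta>))) has_real_derivative g (x, y)) (at y within {-\<rho><..<\<rho>})"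
      by (rule DERIV_subset) auto
    then show ?thesis using that by (subst (asm) at_within_open) auto
  qed
  have Wx: "((\<lambda>x. W (x, y)) has_real_derivative k (x, y)) (at x)" if xy: "\<bar>x\<bar> < \<rho>" "\<bar>y\<bar> < \<rho>" for x y
  proof -
    have "((\<lambda>x. integral (cbox (-\<rho>) y) (\<lambda>\<eta>. \<kappa> (x, \<eta>))) has_real_derivative
        integral (cbox (-\<rho>) y) (\<lambda>\<eta>. h (x, \<eta>))) (at x within {-\<rho><..<\<rho>})"
    proof (rule leibniz_rule_field_derivative)
      show "((\<lambda>x. \<kappa> (x, t)) has_real_derivative h (x, t)) (at x within {-\<rho><..<\<rho>})"
        if "x \<in> {-\<rho><..<\<rho>}" "t \<in> cbox (-\<rho>) y" for x t
        by (rule has_field_derivative_at_within[OF \<kappa>x]) (use that \<rho> xy in auto)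
      show "(\<lambda>\<eta>. \<kappa> (x, \<eta>)) integrable_on cbox (-\<rho>) y" if "x \<in> {-\<rho><..<\<rho>}" for x
      proof (rule integrable_continuous)
        show "continuous_on (cbox (-\<rho>) y) (\<lambda>\<eta>. \<kappa> (x, \<eta>))"
          by (rule continuous_on_compose2[OF \<kappa>]) (use that xy \<rho> in \<open>auto intro!: continuous_intros\<close>)
      qed
      show "continuous_on ({-\<rho><..<\<rho>} \<times> cbox (-\<rho>) y) (\<lambda>(x, t). h (x, t))"
        using xy \<rho> by (auto intro!: continuous_on_subset[OF h])
    qed (use xy in auto)
    then show ?thesis using xy by (subst (asm) at_within_open) (auto simp: W_def k_def)
  qed
  have Wy: "((\<lambda>y. W (x, y)) has_real_derivative \<kappa> (x, y)) (at y)" if "\<bar>x\<bar> < \<rho>" "\<bar>y\<bar> < \<rho>" for x y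
    using prim[OF \<kappa> that] by (simp add: W_def)
  show ?thesis
  proof (intro exI conjI allI impI)
    show "continuous_on ({-\<rho><..<\<rho>} \<times> {-\<rho><..<\<rho>}) k" by (rule contk)
    fix x y assume xy: "\<bar>x\<bar> < \<rho>" "\<bar>y\<bar> < \<rho>"
    show "((\<lambda>y. k (x, y)) has_real_derivative h (x, y)) (at y)"
      using prim[OF h xy] by (simp add: k_def)
    have "((\<lambda>z. f z + W z) has_derivative (\<lambda>(p, r). (\<lambda>z. k z + P z) (x, y) * p + Q (x, y) * r)) (at (x, y))"
    proof (rule has_derivative_from_partials[where S = "{-\<rho><..<\<rho>} \<times> {-\<rho><..<\<rho>}"])
      show "((\<lambda>x. f (x, y) + W (x, y)) has_real_derivative k (x, y) + P (x, y)) (at x)"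
        if "(x, y) \<in> {-\<rho><..<\<rho>} \<times> {-\<rho><..<\<rho>}" for x y
        using DERIV_add[OF fx[of x y] Wx[of x y]] that \<rho> by (auto simp: add.commute)
      show "((\<lambda>y. f (x, y) + W (x, y)) has_real_derivative Q (x, y)) (at y)"
        using DERIV_add[OF fy[of x y] Wy[of x y]] xy \<rho> by auto
      show "continuous_on ({-\<rho><..<\<rho>} \<times> {-\<rho><..<\<rho>}) (\<lambda>z. k z + P z)"
        using \<rho> by (intro continuous_intros contk continuous_on_subset[OF P]) auto
    qed (use xy in \<open>auto simp: open_Times\<close>)
    then show "((\<lambda>z. f z + W z) has_derivative (\<lambda>(p, r). (k (x, y) + P (x, y)) * p + Q (x, y) * r)) (at (x, y))"
      by simp
  qed
qed

text \<open>Along a curve \<open>y' = tan t\<close> the form \<open>cos t dx + sin t dy\<close> has the largest possible value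
  among all its translates in the \<open>y\<close>-direction. So the integral of the form over translates of
  the curve is stationary at the curve itself, which yields the derivative of \<open>sin t\<close>
  although \<open>t\<close> is only continuous.\<close>

lemma sin_angle_deriv:
  fixes t H \<Psi> l :: "real \<times> real \<Rightarrow> real"
  assumes contt: "continuous_on ({-a<..<a} \<times> {-a<..<a}) t"
    and contH: "continuous_on ({-a<..<a} \<times> {-a<..<a}) H"
    and cpos: "\<And>x y. \<bar>x\<bar> < a \<Longrightarrow> \<bar>y\<bar> < a \<Longrightarrow> cos (t (x, y)) > 0"
    and d\<Psi>: "\<And>x y. \<bar>x\<bar> < a \<Longrightarrow> \<bar>y\<bar> < a \<Longrightarrow>
      (\<Psi> has_derivative (\<lambda>(p, r). (l (x, y) - cos (t (x, y))) * p - sin (t (x, y)) * r)) (at (x, y))"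
    and dl: "\<And>x y. \<bar>x\<bar> < a \<Longrightarrow> \<bar>y\<bar> < a \<Longrightarrow> ((\<lambda>y. l (x, y)) has_real_derivative H (x, y)) (at y)"
    and Y: "\<And>x. \<bar>x\<bar> < r \<Longrightarrow> \<bar>Y x\<bar> < a \<and> (Y has_real_derivative tan (t (x, Y x))) (at x)"
    and r: "r \<le> a" and x0: "\<bar>x0\<bar> < r"
  shows "((\<lambda>x. sin (t (x, Y x))) has_real_derivative - H (x0, Y x0)) (at x0)"
proof -
  define B where "B = {-a<..<a} \<times> {-a<..<a}"
  define s where "s x = sin (t (x, Y x))" for x
  have Ya: "\<bar>Y x\<bar> < a" if "\<bar>x\<bar> < r" for x using Y[OF that] by simp
  \<comment> \<open>The curve translated by \<open>\<tau>\<close> is compared with the curve itself.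
    On the direction (1, tan t) the form has at most the value 1 / cos t, and the last summand is
    the loss against this maximum; it is never negative.\<close>
  have dm: "((\<lambda>x. \<Psi> (x, Y x + \<tau>) - \<Psi> (x, Y x)) has_real_derivative
      l (x, Y x + \<tau>) - l (x, Y x) + (1 - cos (t (x, Y x + \<tau>) - t (x, Y x))) / cos (t (x, Y x))) (at x)"
    if x: "\<bar>x\<bar> < r" and \<tau>: "\<bar>Y x + \<tau>\<bar> < a" for x \<tau>
  proof -
    have d: "((\<lambda>x. \<Psi> (x, Y x + \<tau>)) has_real_derivative
      (l (x, Y x + \<tau>) - cos (t (x, Y x + \<tau>))) * 1 + (- sin (t (x, Y x + \<tau>))) * tan (t (x, Y x))) (at x)"
      if "\<bar>Y x + \<tau>\<bar> < a" for \<tau>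
    proof (rule has_real_derivative_along_curve)
      show "(\<Psi> has_derivative (\<lambda>(p, q). (l (x, Y x + \<tau>) - cos (t (x, Y x + \<tau>))) * p + (- sin (t (x, Y x + \<tau>))) * q)) (at (x, Y x + \<tau>))"
        using d\<Psi>[of x "Y x + \<tau>"] that x r by (simp add: case_prod_unfold)
      show "((\<lambda>x. Y x + \<tau>) has_real_derivative tan (t (x, Y x))) (at x)"
        using Y[OF x] by (auto intro!: derivative_eq_intros)
    qed simp
    have c: "cos (t (x, Y x)) > 0" using cpos[of x "Y x"] Ya[OF x] x r by auto
    have trig: "- cos \<alpha> - sin \<alpha> * tan \<beta> + cos \<beta> + sin \<beta> * tan \<beta> = (1 - cos (\<alpha> - \<beta>)) / cos \<beta>"
      if "cos \<beta> > 0" for \<alpha> \<beta> :: real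
    proof -
      have "cos \<beta> * cos \<beta> + sin \<beta> * sin \<beta> = 1" by (simp flip: power2_eq_square)
      then show ?thesis using that by (simp add: tan_def cos_diff field_simps)
    qed
    have d0: "((\<lambda>x. \<Psi> (x, Y x)) has_real_derivative
      (l (x, Y x) - cos (t (x, Y x))) * 1 + (- sin (t (x, Y x))) * tan (t (x, Y x))) (at x)"
      using d[of 0] Ya[OF x] by simp
    show ?thesis
      by (rule DERIV_cong[OF DERIV_diff[OF d[OF \<tau>] d0]]) (simp add: trig[OF c, symmetric])
  qed
  have ds: "((\<lambda>\<tau>. (\<Psi> (x, Y x + \<tau>) - \<Psi> (x, Y x)) / \<tau>) \<longlongrightarrow> - s x) (at 0)" if x: "\<bar>x\<bar> < r" for x
  proof -
    have "((\<lambda>y. \<Psi> (x, y)) has_real_derivative (l (x, Y x) - cos (t (x, Y x))) * 0 + (- s x) * 1) (at (Y x))"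
    proof (rule has_real_derivative_along_curve[of _ _ _ "\<lambda>_. x" "Y x" "\<lambda>y. y"])
      show "(\<Psi> has_derivative (\<lambda>(p, q). (l (x, Y x) - cos (t (x, Y x))) * p + (- s x) * q)) (at (x, Y x))"
        using d\<Psi>[of x "Y x"] Ya[OF x] x r by (simp add: case_prod_unfold s_def)
    qed auto
    then show ?thesis by (simp add: DERIV_def)
  qed
  \<comment> \<open>The loss \<open>\<epsilon>\<close> is nonnegative for either sign of
    \<open>\<tau>\<close>. Hence \<open>\<epsilon> / \<tau>\<close> is nonnegative for positive and
    nonpositive for negative \<open>\<tau>\<close>: the limit from the right gives the lower bound
    and the limit from the left the upper bound, although the size of
    \<open>\<epsilon> / \<tau>\<close> is unknown.\<close>
  have est: "lo * (x2 - x1) \<le> s x1 - s x2 \<and> s x1 - s x2 \<le> hi * (x2 - x1)"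
    if x12: "x1 < x2" "\<bar>x1\<bar> < r" "\<bar>x2\<bar> < r" and \<delta>: "\<delta> > 0"
      and H: "\<And>x \<tau>. x \<in> {x1..x2} \<Longrightarrow> \<bar>\<tau>\<bar> < \<delta> \<Longrightarrow> \<bar>Y x + \<tau>\<bar> < a \<and> lo \<le> H (x, Y x + \<tau>) \<and> H (x, Y x + \<tau>) \<le> hi"
    for x1 x2 \<delta> lo hi
  proof -
    define q where "q \<tau> = (\<Psi> (x2, Y x2 + \<tau>) - \<Psi> (x2, Y x2)) / \<tau> - (\<Psi> (x1, Y x1 + \<tau>) - \<Psi> (x1, Y x1)) / \<tau>" for \<tau>
    have xr: "\<bar>x\<bar> < r" if "x1 \<le> x" "x \<le> x2" for x using that x12 by auto
    have lim: "(q \<longlongrightarrow> s x1 - s x2) (at 0)"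
      unfolding q_def using tendsto_diff[OF ds[OF x12(3)] ds[OF x12(2)]] by simp
    have qe: "\<exists>x \<zeta> \<epsilon>. x \<in> {x1..x2} \<and> \<bar>\<zeta>\<bar> < \<delta> \<and> \<epsilon> \<ge> 0 \<and> q \<tau> = (x2 - x1) * (H (x, Y x + \<zeta>) + \<epsilon> / \<tau>)"
      if \<tau>: "\<tau> \<noteq> 0" "\<bar>\<tau>\<bar> < \<delta>" for \<tau>
    proof -
      have "\<exists>x>x1. x < x2 \<and> (\<Psi> (x2, Y x2 + \<tau>) - \<Psi> (x2, Y x2)) - (\<Psi> (x1, Y x1 + \<tau>) - \<Psi> (x1, Y x1)) =
        (x2 - x1) * (l (x, Y x + \<tau>) - l (x, Y x) + (1 - cos (t (x, Y x + \<tau>) - t (x, Y x))) / cos (t (x, Y x)))"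
        by (rule MVT2[OF x12(1)]) (use H \<tau> xr in \<open>auto intro!: dm\<close>)
      then obtain x where x: "x > x1" "x < x2" and eq: "(\<Psi> (x2, Y x2 + \<tau>) - \<Psi> (x2, Y x2)) - (\<Psi> (x1, Y x1 + \<tau>) - \<Psi> (x1, Y x1)) =
        (x2 - x1) * (l (x, Y x + \<tau>) - l (x, Y x) + (1 - cos (t (x, Y x + \<tau>) - t (x, Y x))) / cos (t (x, Y x)))"
        by blast
      have xx: "\<bar>x\<bar> < r" "x \<in> {x1..x2}" using xr x by auto
      have dl': "((\<lambda>\<sigma>. l (x, Y x + \<sigma>)) has_real_derivative H (x, Y x + \<sigma>)) (at \<sigma>)" if "\<bar>\<sigma>\<bar> < \<delta>" for \<sigma>
      proof -
        have "((\<lambda>y. l (x, y)) has_real_derivative H (x, Y x + \<sigma>)) (at (Y x + \<sigma>))"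
          by (rule dl) (use H[OF xx(2) that] xx r in auto)
        from DERIV_chain2[of "\<lambda>y. l (x, y)" _ "\<lambda>\<sigma>. Y x + \<sigma>" \<sigma> 1 UNIV, OF this] show ?thesis
          using DERIV_add[OF DERIV_const DERIV_ident, of "Y x" \<sigma> UNIV] by simp
      qed
      obtain \<zeta> where \<zeta>: "\<bar>\<zeta>\<bar> < \<delta>" "l (x, Y x + \<tau>) - l (x, Y x) = \<tau> * H (x, Y x + \<zeta>)"
      proof (cases "\<tau> > 0")
        case True
        have "\<exists>z>0. z < \<tau> \<and> l (x, Y x + \<tau>) - l (x, Y x + 0) = (\<tau> - 0) * H (x, Y x + z)"
          by (rule MVT2[OF True dl']) (use \<tau> in auto)
        then obtain z where "z > 0" "z < \<tau>" "l (x, Y x + \<tau>) - l (x, Y x) = \<tau> * H (x, Y x + z)" by auto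
        then show ?thesis using that[of z] \<tau> by auto
      next
        case False
        then have neg: "\<tau> < 0" using \<tau> by auto
        have "\<exists>z>\<tau>. z < 0 \<and> l (x, Y x + 0) - l (x, Y x + \<tau>) = (0 - \<tau>) * H (x, Y x + z)"
          by (rule MVT2[OF neg dl']) (use \<tau> neg in auto)
        then obtain z where "z > \<tau>" "z < 0" "l (x, Y x + \<tau>) - l (x, Y x) = \<tau> * H (x, Y x + z)" by auto
        then show ?thesis using that[of z] \<tau> by auto
      qed
      define \<epsilon> where "\<epsilon> = (1 - cos (t (x, Y x + \<tau>) - t (x, Y x))) / cos (t (x, Y x))"
      have "cos (t (x, Y x)) > 0" using cpos[of x "Y x"] Ya[OF xx(1)] xx r by auto
      then have \<epsilon>: "\<epsilon> \<ge> 0" unfolding \<epsilon>_def by (intro divide_nonneg_pos) auto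
      have "q \<tau> = ((\<Psi> (x2, Y x2 + \<tau>) - \<Psi> (x2, Y x2)) - (\<Psi> (x1, Y x1 + \<tau>) - \<Psi> (x1, Y x1))) / \<tau>"
        unfolding q_def by (simp add: diff_divide_distrib)
      also have "\<dots> = (x2 - x1) * (H (x, Y x + \<zeta>) + \<epsilon> / \<tau>)"
        unfolding eq \<zeta>(2) \<epsilon>_def[symmetric] using \<tau> by (simp add: field_simps)
      finally show ?thesis using xx(2) \<zeta>(1) \<epsilon> by blast
    qed
    have up: "\<forall>\<^sub>F \<tau> in at_right 0. q \<tau> \<ge> lo * (x2 - x1)"
      unfolding eventually_at_right_field
    proof (intro exI[of _ \<delta>] conjI allI impI \<delta>)
      fix \<tau> assume \<tau>: "\<tau> > 0" "\<tau> < \<delta>"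
      then obtain x \<zeta> \<epsilon> where *: "x \<in> {x1..x2}" "\<bar>\<zeta>\<bar> < \<delta>" "\<epsilon> \<ge> 0" "q \<tau> = (x2 - x1) * (H (x, Y x + \<zeta>) + \<epsilon> / \<tau>)"
        using qe[of \<tau>] by auto
      have "lo \<le> H (x, Y x + \<zeta>) + \<epsilon> / \<tau>" using H[OF *(1,2)] \<tau> * by (simp add: add_increasing2)
      then show "lo * (x2 - x1) \<le> q \<tau>" unfolding *(4) using x12 by (subst mult.commute) (simp add: mult_left_mono)
    qed
    have down: "\<forall>\<^sub>F \<tau> in at_left 0. q \<tau> \<le> hi * (x2 - x1)"
      unfolding eventually_at_left_field
    proof (intro exI[of _ "-\<delta>"] conjI allI impI)
      show "- \<delta> < 0" using \<delta> by simp
      fix \<tau> assume \<tau>: "\<tau> > -\<delta>" "\<tau> < 0"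
      then obtain x \<zeta> \<epsilon> where *: "x \<in> {x1..x2}" "\<bar>\<zeta>\<bar> < \<delta>" "\<epsilon> \<ge> 0" "q \<tau> = (x2 - x1) * (H (x, Y x + \<zeta>) + \<epsilon> / \<tau>)"
        using qe[of \<tau>] by auto
      have "\<epsilon> / \<tau> \<le> 0" using *(3) \<tau> by (simp add: divide_nonneg_neg)
      then have "H (x, Y x + \<zeta>) + \<epsilon> / \<tau> \<le> hi" using H[OF *(1,2)] by linarith
      then show "q \<tau> \<le> hi * (x2 - x1)" unfolding *(4) using x12 by (subst mult.commute) (simp add: mult_right_mono)
    qed
    have r: "(q \<longlongrightarrow> s x1 - s x2) (at_right 0)" and l: "(q \<longlongrightarrow> s x1 - s x2) (at_left 0)"
      using lim by (auto simp: filterlim_at_split)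
    show ?thesis
      using tendsto_lowerbound[OF r up] tendsto_upperbound[OF l down] by simp
  qed
  have near: "\<exists>d>0. \<forall>x1 x2. x1 < x2 \<longrightarrow> \<bar>x1 - x0\<bar> < d \<longrightarrow> \<bar>x2 - x0\<bar> < d \<longrightarrow>
      \<bar>(s x1 - s x2) - H (x0, Y x0) * (x2 - x1)\<bar> \<le> e * (x2 - x1)" if e: "e > 0" for e
  proof -
    have opB: "open B" by (auto simp: B_def open_Times)
    have z0: "(x0, Y x0) \<in> B" using Ya[OF x0] x0 r by (auto simp: B_def)
    have "isCont H (x0, Y x0)"
      using contH opB z0 unfolding B_def by (simp add: continuous_on_eq_continuous_at)
    then have "\<forall>\<^sub>F z in nhds (x0, Y x0). dist (H z) (H (x0, Y x0)) < e"
      using e by (simp add: isCont_def tendsto_iff eventually_at_filter eventually_nhds_metric)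
        (metis dist_self)
    moreover have "\<forall>\<^sub>F z in nhds (x0, Y x0). z \<in> B" using eventually_nhds_in_open[OF opB z0] .
    ultimately have "\<forall>\<^sub>F z in nhds (x0, Y x0). dist (H z) (H (x0, Y x0)) < e \<and> z \<in> B"
      by (rule eventually_conj)
    then obtain d where d: "d > 0" "\<And>z. dist z (x0, Y x0) < d \<Longrightarrow> dist (H z) (H (x0, Y x0)) < e \<and> z \<in> B"
      unfolding eventually_nhds_metric by blast
    have "isCont Y x0" using Y[OF x0] DERIV_isCont by blast
    then obtain d1 where d1: "d1 > 0" "\<And>x. dist x x0 < d1 \<Longrightarrow> dist (Y x) (Y x0) < d / 3"
      using d(1) unfolding continuous_at_eps_delta by (metis zero_less_divide_iff zero_less_numeral)
    \<comment> \<open>A third of \<open>d\<close> each is spent on the level, on the variation of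
      \<open>Y\<close> and on the translation \<open>\<tau>\<close>. The last entry keeps the levels
      inside the domain of \<open>Y\<close>.\<close>
    define d2 where "d2 = min (min d1 (d / 3)) (r - \<bar>x0\<bar>)"
    have d2: "d2 > 0" using d1 d x0 by (auto simp: d2_def)
    show ?thesis
    proof (intro exI[of _ d2] conjI allI impI d2)
      fix x1 x2 assume x: "x1 < x2" "\<bar>x1 - x0\<bar> < d2" "\<bar>x2 - x0\<bar> < d2"
      have "(H (x0, Y x0) - e) * (x2 - x1) \<le> s x1 - s x2 \<and> s x1 - s x2 \<le> (H (x0, Y x0) + e) * (x2 - x1)"
      proof (rule est[OF x(1)])
        show "\<bar>x1\<bar> < r" "\<bar>x2\<bar> < r" using x by (auto simp: d2_def)
        show "d / 3 > 0" using d by simp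
        fix x' \<tau> assume x': "x' \<in> {x1..x2}" "\<bar>\<tau>\<bar> < d / 3"
        have x'0: "\<bar>x' - x0\<bar> < d1" "\<bar>x' - x0\<bar> < d / 3"
        proof -
          have "d2 \<le> d1" "d2 \<le> d / 3" unfolding d2_def by linarith+
          moreover have "x1 \<le> x'" "x' \<le> x2" using x'(1) by auto
          ultimately show "\<bar>x' - x0\<bar> < d1" "\<bar>x' - x0\<bar> < d / 3" using x by linarith+
        qed
        have "dist (x', Y x' + \<tau>) (x0, Y x0) \<le> \<bar>x' - x0\<bar> + \<bar>Y x' + \<tau> - Y x0\<bar>"
          unfolding dist_Pair_Pair dist_real_def by (rule sqrt_sum_squares_le_sum_abs[THEN order_trans]) auto
        also have "\<dots> < d"
        proof -
          have "\<bar>Y x' - Y x0\<bar> < d / 3" using d1(2)[of x'] x'0(1) by (simp add: dist_real_def)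
          moreover have "\<bar>Y x' + \<tau> - Y x0\<bar> \<le> \<bar>Y x' - Y x0\<bar> + \<bar>\<tau>\<bar>" by linarith
          ultimately show ?thesis using x'0(2) x'(2) by linarith
        qed
        finally have "dist (H (x', Y x' + \<tau>)) (H (x0, Y x0)) < e \<and> (x', Y x' + \<tau>) \<in> B" by (rule d(2))
        then show "\<bar>Y x' + \<tau>\<bar> < a \<and> H (x0, Y x0) - e \<le> H (x', Y x' + \<tau>) \<and> H (x', Y x' + \<tau>) \<le> H (x0, Y x0) + e"
          by (auto simp: B_def dist_real_def)
      qed
      then show "\<bar>(s x1 - s x2) - H (x0, Y x0) * (x2 - x1)\<bar> \<le> e * (x2 - x1)"
        by (auto simp: algebra_simps)
    qed
  qed
  have "(s has_real_derivative - H (x0, Y x0)) (at x0)"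
    unfolding has_field_derivative_iff
  proof (rule LIM_I)
    fix e :: real assume "e > 0"
    then obtain d where d: "d > 0" "\<And>x1 x2. x1 < x2 \<Longrightarrow> \<bar>x1 - x0\<bar> < d \<Longrightarrow> \<bar>x2 - x0\<bar> < d \<Longrightarrow>
      \<bar>(s x1 - s x2) - H (x0, Y x0) * (x2 - x1)\<bar> \<le> e / 2 * (x2 - x1)"
      using near[of "e / 2"] by auto
    show "\<exists>d>0. \<forall>x. x \<noteq> x0 \<and> norm (x - x0) < d \<longrightarrow>
        norm ((s x - s x0) / (x - x0) - - H (x0, Y x0)) < e"
    proof (intro exI[of _ d] conjI allI impI d(1))
      fix x assume x: "x \<noteq> x0 \<and> norm (x - x0) < d"
      have "\<bar>(s x0 - s x) - H (x0, Y x0) * (x - x0)\<bar> \<le> e / 2 * \<bar>x - x0\<bar>"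
        using d(2)[of x0 x] d(2)[of x x0] x d(1)
        by (cases "x0 < x") (auto simp: algebra_simps abs_if split: if_splits)
      moreover have "(s x - s x0) / (x - x0) - - H (x0, Y x0) = - ((s x0 - s x) - H (x0, Y x0) * (x - x0)) / (x - x0)"
        using x by (simp add: field_simps)
      ultimately have "norm ((s x - s x0) / (x - x0) - - H (x0, Y x0)) \<le> e / 2"
        using x by (simp add: abs_divide pos_divide_le_eq abs_minus_commute)
      then show "norm ((s x - s x0) / (x - x0) - - H (x0, Y x0)) < e" using \<open>e > 0\<close> by linarith
    qed
  qed
  then show ?thesis by (simp add: s_def[abs_def])
qed

section \<open>The Jacobi equation\<close>

lemma integral_has_real_derivative_interior:
  fixes f :: "real \<Rightarrow> real"
  assumes "continuous_on {s..e} f" "s < x" "x < e"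
  shows "((\<lambda>x. integral {s..x} f) has_real_derivative f x) (at x)"
proof -
  have "((\<lambda>x. integral {s..x} f) has_real_derivative f x) (at x within {s..e})"
    by (rule integral_has_real_derivative[OF assms(1)]) (use assms in auto)
  then have "((\<lambda>x. integral {s..x} f) has_real_derivative f x) (at x within {s<..<e})"
    by (rule DERIV_subset) auto
  then show ?thesis using assms by (subst (asm) at_within_open) auto
qed

text \<open>The denominators \<open>kn\<close> are independent of \<open>yn n - y\<close>, which may
  vanish for some indices. Caratheodory's form of the derivative covers this case, as its quotient
  \<open>g\<close> is defined at \<open>y\<close> too.\<close>

lemma DERIV_sequence_scaled:
  fixes f :: "real \<Rightarrow> real"
  assumes f: "(f has_real_derivative D) (at y)" and k: "\<And>n. kn n \<noteq> 0" "kn \<longlonglongrightarrow> 0"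
    and L: "(\<lambda>n. (yn n - y) / kn n) \<longlonglongrightarrow> L"
  shows "(\<lambda>n. (f (yn n) - f y) / kn n) \<longlonglongrightarrow> D * L"
proof -
  obtain g where g: "\<And>z. f z - f y = g z * (z - y)" "isCont g y" "g y = D"
    using f unfolding CARAT_DERIV by auto
  have "(\<lambda>n. (yn n - y) / kn n * kn n) \<longlonglongrightarrow> L * 0" by (intro tendsto_mult L k)
  then have "(\<lambda>n. yn n - y) \<longlonglongrightarrow> 0" using k(1) by simp
  then have "yn \<longlonglongrightarrow> y" by (rule Lim_null[THEN iffD2])
  then have "(\<lambda>n. g (yn n)) \<longlonglongrightarrow> D" using isCont_tendsto_compose[OF g(2)] g(3) by auto
  from tendsto_mult[OF this L] show ?thesis by (simp add: g(1))
qed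

text \<open>On the segment between the two angles the derivative 1 + tan^2 of tan lies between 1 and
  1 + M^2, because tan is monotone there and bounded by \<open>M\<close> at both ends.\<close>

lemma tan_difference:
  assumes "\<bar>\<alpha>\<bar> < pi / 2" "\<bar>\<beta>\<bar> < pi / 2" "\<bar>tan \<alpha>\<bar> \<le> M" "\<bar>tan \<beta>\<bar> \<le> M"
  shows "\<bar>\<alpha> - \<beta>\<bar> \<le> \<bar>tan \<alpha> - tan \<beta>\<bar>" "\<bar>tan \<alpha> - tan \<beta>\<bar> \<le> (1 + M\<^sup>2) * \<bar>\<alpha> - \<beta>\<bar>"
proof -
  have *: "\<bar>\<alpha> - \<beta>\<bar> \<le> \<bar>tan \<alpha> - tan \<beta>\<bar> \<and> \<bar>tan \<alpha> - tan \<beta>\<bar> \<le> (1 + M\<^sup>2) * \<bar>\<alpha> - \<beta>\<bar>"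
    if a: "\<bar>\<alpha>\<bar> < pi / 2" "\<bar>\<beta>\<bar> < pi / 2" "\<bar>tan \<alpha>\<bar> \<le> M" "\<bar>tan \<beta>\<bar> \<le> M" "\<beta> < \<alpha>" for \<alpha> \<beta>
  proof -
    have c: "cos z > 0" if "\<beta> \<le> z" "z \<le> \<alpha>" for z using that a by (intro cos_gt_zero_pi) auto
    have "\<exists>z>\<beta>. z < \<alpha> \<and> tan \<alpha> - tan \<beta> = (\<alpha> - \<beta>) * inverse ((cos z)\<^sup>2)"
      by (rule MVT2[OF a(5)]) (use c in \<open>force intro!: DERIV_tan\<close>)
    then obtain z where z: "z > \<beta>" "z < \<alpha>" "tan \<alpha> - tan \<beta> = (\<alpha> - \<beta>) * inverse ((cos z)\<^sup>2)" by auto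
    have "tan \<beta> \<le> tan z" "tan z \<le> tan \<alpha>"
    proof -
      have "- (pi / 2) < \<beta>" "\<alpha> < pi / 2" using a by linarith+
      then show "tan \<beta> \<le> tan z" "tan z \<le> tan \<alpha>"
        using tan_monotone[of \<beta> z] tan_monotone[of z \<alpha>] z by auto
    qed
    then have "\<bar>tan z\<bar> \<le> M" using a by auto
    then have "(tan z)\<^sup>2 \<le> M\<^sup>2" by (metis abs_ge_zero power2_abs power_mono)
    moreover have "inverse ((cos z)\<^sup>2) = 1 + (tan z)\<^sup>2"
      using tan_sec[of z] c[of z] z by (simp add: power_inverse)
    ultimately have "1 \<le> inverse ((cos z)\<^sup>2)" "inverse ((cos z)\<^sup>2) \<le> 1 + M\<^sup>2" by auto
    then show ?thesis unfolding z(3) abs_mult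
      using a(5) mult_left_mono[of 1 "inverse ((cos z)\<^sup>2)" "\<alpha> - \<beta>"]
        mult_left_mono[of "inverse ((cos z)\<^sup>2)" "1 + M\<^sup>2" "\<alpha> - \<beta>"] by (auto simp: mult.commute)
  qed
  have "\<bar>\<alpha> - \<beta>\<bar> \<le> \<bar>tan \<alpha> - tan \<beta>\<bar> \<and> \<bar>tan \<alpha> - tan \<beta>\<bar> \<le> (1 + M\<^sup>2) * \<bar>\<alpha> - \<beta>\<bar>"
    using *[of \<alpha> \<beta>] *[of \<beta> \<alpha>] assms by (cases \<alpha> \<beta> rule: linorder_cases) (auto simp: abs_minus_commute)
  then show "\<bar>\<alpha> - \<beta>\<bar> \<le> \<bar>tan \<alpha> - tan \<beta>\<bar>" "\<bar>tan \<alpha> - tan \<beta>\<bar> \<le> (1 + M\<^sup>2) * \<bar>\<alpha> - \<beta>\<bar>" by auto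
qed

lemma continuous_on_lipschitz2:
  fixes g :: "real \<times> real \<Rightarrow> real"
  assumes "A \<ge> 0" "B \<ge> 0"
    and "\<And>x y x' y'. (x, y) \<in> S \<Longrightarrow> (x', y') \<in> S \<Longrightarrow> \<bar>g (x, y) - g (x', y')\<bar> \<le> A * \<bar>x - x'\<bar> + B * \<bar>y - y'\<bar>"
  shows "continuous_on S g"
proof -
  have "(A + B)-lipschitz_on S g"
  proof (rule lipschitz_onI)
    fix p p' assume "p \<in> S" "p' \<in> S"
    then have "\<bar>g p - g p'\<bar> \<le> A * \<bar>fst p - fst p'\<bar> + B * \<bar>snd p - snd p'\<bar>"
      using assms(3)[of "fst p" "snd p" "fst p'" "snd p'"] by simp
    also have "\<dots> \<le> A * dist p p' + B * dist p p'"
      using dist_fst_le[of p p'] dist_snd_le[of p p'] assms(1,2)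
      by (intro add_mono mult_left_mono) (auto simp: dist_real_def)
    finally show "dist (g p) (g p') \<le> (A + B) * dist p p'" by (simp add: dist_real_def distrib_right)
  qed (use assms in auto)
  then show ?thesis by (rule lipschitz_on_continuous_on)
qed

text \<open>\<open>\<Theta>\<close> is a potential of l dx - H (cos t dx + sin t dy), so
  \<open>K\<close> is the exterior derivative of the dual form weighted by \<open>H\<close>, up to
  sign. The property \<open>sin_along\<close> is an assumption because it stems from the unweighted
  dual form, whose potential is not among the data of this locale.\<close>

locale riccati = transport a M q "\<lambda>z. D z * cos (t z)" "\<lambda>z. tan (t z)" c \<Phi> k
  for a M q :: real and D t c \<Phi> k :: "real \<times> real \<Rightarrow> real" +
  fixes H K \<Theta> l :: "real \<times> real \<Rightarrow> real"
  assumes contt: "continuous_on ({-a<..<a} \<times> {-a<..<a}) t"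
    and contH: "continuous_on ({-a<..<a} \<times> {-a<..<a}) H"
    and contK: "continuous_on ({-a<..<a} \<times> {-a<..<a}) K"
    and contl: "continuous_on ({-a<..<a} \<times> {-a<..<a}) l"
    and tH: "\<And>x y. \<bar>x\<bar> < a \<Longrightarrow> \<bar>y\<bar> < a \<Longrightarrow>
      \<bar>t (x, y)\<bar> < pi / 2 \<and> \<bar>H (x, y)\<bar> \<le> M \<and> \<bar>K (x, y)\<bar> \<le> M"
    and d\<Theta>: "\<And>x y. \<bar>x\<bar> < a \<Longrightarrow> \<bar>y\<bar> < a \<Longrightarrow> (\<Theta> has_derivative
      (\<lambda>(p, r). (l (x, y) - H (x, y) * cos (t (x, y))) * p + (- H (x, y) * sin (t (x, y))) * r)) (at (x, y))"
    and dl: "\<And>x y. \<bar>x\<bar> < a \<Longrightarrow> \<bar>y\<bar> < a \<Longrightarrow> ((\<lambda>y. l (x, y)) has_real_derivative K (x, y)) (at y)"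
    and sin_along: "\<And>r Y x. sol r Y \<Longrightarrow> r \<le> a \<Longrightarrow> \<bar>x\<bar> < r \<Longrightarrow>
      ((\<lambda>x. sin (t (x, Y x))) has_real_derivative - H (x, Y x)) (at x)"
begin

lemma cpos: "\<bar>x\<bar> < a \<Longrightarrow> \<bar>y\<bar> < a \<Longrightarrow> cos (t (x, y)) > 0"
  using tH[of x y] by (intro cos_gt_zero_pi) auto

lemma sol_in: "sol r Y \<Longrightarrow> r \<le> a \<Longrightarrow> \<bar>x\<bar> < r \<Longrightarrow> \<bar>x\<bar> < a \<and> \<bar>Y x\<bar> < a"
  using solD(1) by fastforce

lemma t_along:
  assumes Y: "sol r Y" "r \<le> a" "\<bar>x\<bar> < r"
  shows "((\<lambda>x. t (x, Y x)) has_real_derivative - H (x, Y x) / cos (t (x, Y x))) (at x)"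
proof -
  have c: "cos (t (x, Y x)) > 0" using cpos sol_in[OF Y] by auto
  \<comment> \<open>Since t lies strictly between - pi / 2 and pi / 2, arcsin undoes sin, and cos t
    > 0 keeps sin t away from the end points where arcsin is not differentiable.\<close>
  have "((\<lambda>x. arcsin (sin (t (x, Y x)))) has_real_derivative
      inverse (sqrt (1 - (sin (t (x, Y x)))\<^sup>2)) * (- H (x, Y x))) (at x)"
  proof (rule DERIV_chain2[OF DERIV_arcsin sin_along[OF Y]])
    have "(sin (t (x, Y x)))\<^sup>2 < 1\<^sup>2" using c by (simp add: sin_squared_eq)
    then have "\<bar>sin (t (x, Y x))\<bar> < 1" by (metis abs_1 abs_square_less_1 one_power2)
    then show "- 1 < sin (t (x, Y x))" "sin (t (x, Y x)) < 1" by auto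
  qed
  moreover have "sqrt (1 - (sin (t (x, Y x)))\<^sup>2) = cos (t (x, Y x))"
    using c by (simp flip: cos_squared_eq)
  ultimately have d: "((\<lambda>x. arcsin (sin (t (x, Y x)))) has_real_derivative - H (x, Y x) / cos (t (x, Y x))) (at x)"
    by (simp add: divide_inverse mult.commute)
  show ?thesis
  proof (rule has_field_derivative_transform_within_open[OF d, of "{-r<..<r}"])
    fix x assume "x \<in> {-r<..<r}"
    then have "\<bar>t (x, Y x)\<bar> < pi / 2" using tH[of x "Y x"] sol_in[OF Y(1,2), of x] by auto
    then show "arcsin (sin (t (x, Y x))) = t (x, Y x)" by (intro arcsin_sin) auto
  qed (use Y in auto)
qed

lemma cos_along:
  assumes Y: "sol r Y" "r \<le> a" "\<bar>x\<bar> < r"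
  shows "((\<lambda>x. cos (t (x, Y x))) has_real_derivative H (x, Y x) * tan (t (x, Y x))) (at x)"
  by (rule DERIV_cong[OF DERIV_chain2[OF DERIV_cos t_along[OF Y]]]) (simp add: tan_def)

text \<open>On the curves the weighted form equals H cos t + H sin t tan t = H / cos t, which is
  minus the derivative of t. The term with \<open>H\<close> therefore cancels in t -
  \<open>\<Theta>\<close>, and what is left, \<open>l\<close>, is differentiable in y. So angle
  differences between neighbouring curves become accessible.\<close>

lemma gauge_along:
  assumes Y: "sol r Y" "r \<le> a" "\<bar>x\<bar> < r"
  shows "((\<lambda>x. t (x, Y x) - \<Theta> (x, Y x)) has_real_derivative - l (x, Y x)) (at x)"
proof -
  have c: "cos (t (x, Y x)) > 0" using cpos sol_in[OF Y] by auto
  have "((\<lambda>x. \<Theta> (x, Y x)) has_real_derivative (l (x, Y x) - H (x, Y x) * cos (t (x, Y x))) * 1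
      + (- H (x, Y x) * sin (t (x, Y x))) * tan (t (x, Y x))) (at x)"
    by (rule has_real_derivative_along_curve[OF d\<Theta>]) (use sol_in[OF Y] solD(2)[OF Y(1,3)] in auto)
  from DERIV_diff[OF t_along[OF Y] this] show ?thesis
  proof (rule DERIV_cong)
    have "H (x, Y x) * cos (t (x, Y x)) + H (x, Y x) * sin (t (x, Y x)) * tan (t (x, Y x)) = H (x, Y x) / cos (t (x, Y x))"
      using c by (simp add: tan_def field_simps) (simp flip: distrib_left)
    then show "- H (x, Y x) / cos (t (x, Y x)) - ((l (x, Y x) - H (x, Y x) * cos (t (x, Y x))) * 1
      + - H (x, Y x) * sin (t (x, Y x)) * tan (t (x, Y x))) = - l (x, Y x)"
      by simp
  qed
qed

lemma d\<Theta>y: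
  assumes "\<bar>x\<bar> < a" "\<bar>y\<bar> < a"
  shows "((\<lambda>y. \<Theta> (x, y)) has_real_derivative - H (x, y) * sin (t (x, y))) (at y)"
proof -
  have "((\<lambda>y. \<Theta> (x, y)) has_real_derivative (l (x, y) - H (x, y) * cos (t (x, y))) * 0
      + (- H (x, y) * sin (t (x, y))) * 1) (at y)"
    by (rule has_real_derivative_along_curve[of \<Theta> _ _ "\<lambda>_. x" y "\<lambda>y. y"]) (use d\<Theta>[OF assms] in auto)
  then show ?thesis by simp
qed

lemma \<Theta>_lipschitz:
  assumes "\<bar>x\<bar> < a" "\<bar>y0\<bar> < a" "\<bar>y1\<bar> < a"
  shows "\<bar>\<Theta> (x, y1) - \<Theta> (x, y0)\<bar> \<le> M * \<bar>y1 - y0\<bar>" "\<bar>l (x, y1) - l (x, y0)\<bar> \<le> M * \<bar>y1 - y0\<bar>"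
proof -
  have *: "norm (f y1 - f y0) \<le> M * norm (y1 - y0)"
    if "\<And>y. \<bar>y\<bar> < a \<Longrightarrow> (f has_real_derivative f' y) (at y)" "\<And>y. \<bar>y\<bar> < a \<Longrightarrow> \<bar>f' y\<bar> \<le> M" for f f'
  proof (rule field_differentiable_bound[where S = "{-a<..<a}"])
    show "(f has_real_derivative f' z) (at z within {-a<..<a})" if "z \<in> {-a<..<a}" for z
      by (rule has_field_derivative_at_within) (use that \<open>\<And>y. \<bar>y\<bar> < a \<Longrightarrow> (f has_real_derivative f' y) (at y)\<close>[of z] in auto)
    show "norm (f' z) \<le> M" if "z \<in> {-a<..<a}" for z
      using that \<open>\<And>y. \<bar>y\<bar> < a \<Longrightarrow> \<bar>f' y\<bar> \<le> M\<close>[of z] by auto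
  qed (use assms in auto)
  show "\<bar>l (x, y1) - l (x, y0)\<bar> \<le> M * \<bar>y1 - y0\<bar>"
    using *[of "\<lambda>y. l (x, y)" "\<lambda>y. K (x, y)"] dl tH assms by auto
  have "\<bar>H (x, y) * sin (t (x, y))\<bar> \<le> M * 1" if "\<bar>y\<bar> < a" for y
    unfolding abs_mult using tH[OF assms(1) that] M by (intro mult_mono) auto
  then show "\<bar>\<Theta> (x, y1) - \<Theta> (x, y0)\<bar> \<le> M * \<bar>y1 - y0\<bar>"
    using *[of "\<lambda>y. \<Theta> (x, y)" "\<lambda>y. - H (x, y) * sin (t (x, y))"] d\<Theta>y[OF assms(1)] by auto
qed

lemma Qpos: "\<bar>x\<bar> < a \<Longrightarrow> \<bar>y\<bar> < a \<Longrightarrow> D (x, y) * cos (t (x, y)) > 0"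
  using bounds[of x y] q by auto

text \<open>The derivative \<open>J\<close> of the flow with respect to the initial value exists by transport alone.
  Since the angle differences satisfy a linear relation with unknown initial slope, comparing
  with \<open>J\<close> shows that the difference quotients of the initial angle have a limit.\<close>

lemma jacobi_equation:
  assumes ex: "\<And>x0 y0. \<bar>x0\<bar> < r \<Longrightarrow> \<bar>y0\<bar> < r \<Longrightarrow> \<exists>Y. sol r Y \<and> Y x0 = y0"
    and r: "r \<le> a" and s: "\<bar>s\<bar> < r" and e: "\<bar>e\<bar> < r" "s < e"
    and Y: "sol r Y" "\<bar>Y s\<bar> < r"
  defines "J \<equiv> flow_jacobian Y s"
  shows "\<exists>w. \<forall>x\<in>{s..e}. J x - 1 = integral {s..x} (\<lambda>\<xi>. (w - H (\<xi>, Y \<xi>) * sin (t (\<xi>, Y \<xi>)) * J \<xi>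
     - integral {s..\<xi>} (\<lambda>\<eta>. K (\<eta>, Y \<eta>) * J \<eta>)) / (cos (t (\<xi>, Y \<xi>)))\<^sup>2)"
proof -
  \<comment> \<open>Half the distance of \<open>Y s\<close> from the end of the admissible range
    leaves room for all the initial values \<open>Y s + kn n\<close>.\<close>
  define \<delta> where "\<delta> = (r - \<bar>Y s\<bar>) / 2"
  have \<delta>: "\<delta> > 0" using Y by (simp add: \<delta>_def)
  define kn where "kn n = \<delta> / real (Suc n)" for n
  have kn: "kn n > 0" "kn n \<le> \<delta>" for n
  proof -
    show "kn n > 0" using \<delta> by (simp add: kn_def)
    have "\<delta> / real (Suc n) \<le> \<delta> / 1" using \<delta> by (intro divide_left_mono) auto
    then show "kn n \<le> \<delta>" by (simp add: kn_def)
  qed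
  have kn0: "kn \<longlonglongrightarrow> 0"
    unfolding kn_def using LIMSEQ_Suc[OF lim_const_over_n[of \<delta>]] by simp
  have "\<exists>Z. sol r Z \<and> Z s = Y s + kn n" for n
  proof (rule ex[OF s])
    have "\<bar>Y s\<bar> + \<delta> < r" using Y(2) by (simp add: \<delta>_def field_simps)
    then show "\<bar>Y s + kn n\<bar> < r" using kn[of n] by linarith
  qed
  then obtain Z where Z: "\<And>n. sol r (Z n)" "\<And>n. Z n s = Y s + kn n" by metis
  have xr: "\<bar>x\<bar> < r" if "x \<in> {s..e}" for x using that s e by auto
  have xa: "\<bar>x\<bar> < a" "\<bar>Y x\<bar> < a" "\<bar>Z n x\<bar> < a" if "x \<in> {s..e}" for x n
    using sol_in[OF Y(1) r xr[OF that]] sol_in[OF Z(1) r xr[OF that]] by auto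
  have sin': "s \<in> {s..e}" and ein: "e \<in> {s..e}" using e by auto
  define d where "d n x = Z n x - Y x" for n x
  define dt where "dt n x = t (x, Z n x) - t (x, Y x)" for n x
  define d\<theta> where "d\<theta> n x = \<Theta> (x, Z n x) - \<Theta> (x, Y x)" for n x
  have dL: "\<bar>d n x\<bar> \<le> Lip * kn n" if "x \<in> {s..e}" for n x
    using sol_difference[OF Y(1) Z(1) r s xr[OF that], of n] Z(2)[of n] kn(1)[of n] by (simp add: d_def)
  have J: "(\<lambda>n. d n x / kn n) \<longlonglongrightarrow> J x" if "x \<in> {s..e}" for x
  proof -
    have "(\<lambda>n. (Z n x - Y x) / (Z n s - Y s)) \<longlonglongrightarrow> J x" unfolding J_def
    proof (rule flow_quotient_tendsto[OF Y(1) Z(1) r s xr[OF that]])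
      show "s \<le> x" using that by simp
      show "Z n s \<noteq> Y s" for n using Z(2)[of n] kn(1)[of n] by simp
      show "(\<lambda>n. Z n s) \<longlonglongrightarrow> Y s" unfolding Z(2) using tendsto_add[OF tendsto_const kn0, of "Y s"] by simp
    qed
    then show ?thesis by (simp add: Z(2) d_def)
  qed
  have d\<theta>L: "\<bar>d\<theta> n x\<bar> \<le> M * Lip * kn n" if "x \<in> {s..e}" for n x
  proof -
    have "\<bar>d\<theta> n x\<bar> \<le> M * \<bar>d n x\<bar>" unfolding d\<theta>_def d_def by (rule \<Theta>_lipschitz(1)[OF xa[OF that]])
    also have "\<dots> \<le> M * (Lip * kn n)" using dL[OF that] M by (intro mult_left_mono) auto
    finally show ?thesis by simp
  qed
  have lL: "\<bar>(l (x, Z n x) - l (x, Y x)) / kn n\<bar> \<le> M * Lip" if "x \<in> {s..e}" for n x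
  proof -
    have "\<bar>l (x, Z n x) - l (x, Y x)\<bar> \<le> M * \<bar>d n x\<bar>" unfolding d_def by (rule \<Theta>_lipschitz(2)[OF xa[OF that]])
    also have "\<dots> \<le> M * (Lip * kn n)" using dL[OF that] M by (intro mult_left_mono) auto
    finally show ?thesis using kn(1)[of n] by (simp add: abs_divide pos_divide_le_eq)
  qed
  \<comment> \<open>The scaled initial value of the gauged angle difference: the unknown initial
    slope, not yet known to converge.\<close>
  define \<alpha> where "\<alpha> n = (dt n s - d\<theta> n s) / kn n" for n
  define N where "N n x = integral {s..x} (\<lambda>\<xi>. (l (\<xi>, Z n \<xi>) - l (\<xi>, Y \<xi>)) / kn n)" for n x
  have sub: "{s..e} \<subseteq> {-r<..<r}" using s e by auto
  have contY: "continuous_on {s..e} (\<lambda>x. g (x, Y x))" and contZ: "continuous_on {s..e} (\<lambda>x. g (x, Z n x))"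
    if "continuous_on ({-a<..<a} \<times> {-a<..<a}) g" for g :: "real \<times> real \<Rightarrow> real" and n
    using sol_continuous_comp[OF Y(1) sub r that] sol_continuous_comp[OF Z(1) sub r that] by auto
  have N: "((\<lambda>\<xi>. (l (\<xi>, Z n \<xi>) - l (\<xi>, Y \<xi>)) / kn n) has_integral \<alpha> n - (dt n x - d\<theta> n x) / kn n) {s..x}"
    if x: "x \<in> {s..e}" for n x
  proof -
    have "((\<lambda>\<xi>. (l (\<xi>, Z n \<xi>) - l (\<xi>, Y \<xi>)) / kn n) has_integral
      - ((dt n x - d\<theta> n x) / kn n) - - ((dt n s - d\<theta> n s) / kn n)) {s..x}"
    proof (rule fundamental_theorem_of_calculus)
      show "s \<le> x" using x by simp
      fix \<xi> assume "\<xi> \<in> {s..x}"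
      then have \<xi>: "\<bar>\<xi>\<bar> < r" using x xr[of \<xi>] by auto
      have "((\<lambda>x. - (((t (x, Z n x) - \<Theta> (x, Z n x)) - (t (x, Y x) - \<Theta> (x, Y x))) / kn n))
        has_real_derivative - ((- l (\<xi>, Z n \<xi>) - - l (\<xi>, Y \<xi>)) / kn n)) (at \<xi>)"
        by (intro DERIV_minus DERIV_cdivide DERIV_diff gauge_along[OF Y(1) r \<xi>] gauge_along[OF Z(1) r \<xi>])
      moreover have "(\<lambda>x. - (((t (x, Z n x) - \<Theta> (x, Z n x)) - (t (x, Y x) - \<Theta> (x, Y x))) / kn n)) =
        (\<lambda>x. - ((dt n x - d\<theta> n x) / kn n))" by (simp add: fun_eq_iff dt_def d\<theta>_def)
      moreover have "- ((- l (\<xi>, Z n \<xi>) - - l (\<xi>, Y \<xi>)) / kn n) = (l (\<xi>, Z n \<xi>) - l (\<xi>, Y \<xi>)) / kn n"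
        by (simp add: minus_divide_left)
      ultimately have "((\<lambda>x. - ((dt n x - d\<theta> n x) / kn n)) has_real_derivative (l (\<xi>, Z n \<xi>) - l (\<xi>, Y \<xi>)) / kn n) (at \<xi>)"
        by simp
      then show "((\<lambda>x. - ((dt n x - d\<theta> n x) / kn n)) has_vector_derivative (l (\<xi>, Z n \<xi>) - l (\<xi>, Y \<xi>)) / kn n) (at \<xi> within {s..x})"
        by (simp add: has_real_derivative_iff_has_vector_derivative has_vector_derivative_at_within)
    qed
    then show ?thesis by (simp add: \<alpha>_def)
  qed
  have dtN: "dt n x / kn n = \<alpha> n + d\<theta> n x / kn n - N n x" if "x \<in> {s..e}" for n x
    using integral_unique[OF N[OF that, of n]] by (simp add: N_def diff_divide_distrib)
  have NL: "\<bar>N n x\<bar> \<le> M * Lip * (e - s)" if "x \<in> {s..e}" for n x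
  proof -
    have "norm (N n x) \<le> (M * Lip) * (x - s)" unfolding N_def
    proof (rule integral_bound)
      show "continuous_on {s..x} (\<lambda>\<xi>. (l (\<xi>, Z n \<xi>) - l (\<xi>, Y \<xi>)) / kn n)"
        using that kn(1)[of n]
        by (intro continuous_intros continuous_on_subset[OF contY[OF contl]] continuous_on_subset[OF contZ[OF contl]]) auto
      show "norm ((l (\<xi>, Z n \<xi>) - l (\<xi>, Y \<xi>)) / kn n) \<le> M * Lip" if "\<xi> \<in> {s..x}" for \<xi>
        using lL[of \<xi> n] that \<open>x \<in> _\<close> by auto
    qed (use that in auto)
    also have "\<dots> \<le> (M * Lip) * (e - s)" using that M Lip by (intro mult_left_mono) auto
    finally show ?thesis by simp
  qed
  have Tdiff: "\<bar>dt n x\<bar> \<le> \<bar>tan (t (x, Z n x)) - tan (t (x, Y x))\<bar>"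
    "\<bar>tan (t (x, Z n x)) - tan (t (x, Y x))\<bar> \<le> (1 + M\<^sup>2) * \<bar>dt n x\<bar>" if "x \<in> {s..e}" for n x
  proof -
    have "\<bar>t (x, Z n x)\<bar> < pi / 2" "\<bar>t (x, Y x)\<bar> < pi / 2" "\<bar>tan (t (x, Z n x))\<bar> \<le> M" "\<bar>tan (t (x, Y x))\<bar> \<le> M"
      using tH[OF xa(1)[OF that] xa(3)[OF that]] tH[OF xa(1)[OF that] xa(2)[OF that]]
        bounds[OF xa(1)[OF that] xa(3)[OF that]] bounds[OF xa(1)[OF that] xa(2)[OF that]] by auto
    from tan_difference[OF this] show "\<bar>dt n x\<bar> \<le> \<bar>tan (t (x, Z n x)) - tan (t (x, Y x))\<bar>"
      "\<bar>tan (t (x, Z n x)) - tan (t (x, Y x))\<bar> \<le> (1 + M\<^sup>2) * \<bar>dt n x\<bar>" unfolding dt_def by auto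
  qed
  have dd: "((\<lambda>x. d n x) has_real_derivative tan (t (x, Z n x)) - tan (t (x, Y x))) (at x)" if "x \<in> {s..e}" for n x
    unfolding d_def by (intro DERIV_diff solD(2)[OF Y(1) xr[OF that]] solD(2)[OF Z(1) xr[OF that]])
  define C where "C = (Lip + 1) / (e - s) + M * Lip + M * Lip * (e - s)"
  \<comment> \<open>The two curves stay within \<open>Lip * kn n\<close> of each other, so by the
    mean value theorem their slopes, and hence their angles, differ by at most a constant multiple
    of \<open>kn n\<close> at some level \<open>z\<close>. The gauged difference changes by a
    controlled amount between \<open>s\<close> and \<open>z\<close>, which bounds it at
    \<open>s\<close>.\<close>
  have \<alpha>C: "\<bar>\<alpha> n\<bar> \<le> C" for n
  proof -
    have "\<exists>z>s. z < e \<and> d n e - d n s = (e - s) * (tan (t (z, Z n z)) - tan (t (z, Y z)))"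
      by (rule MVT2[OF e(2) dd]) auto
    then obtain z where "s < z" "z < e" and z2: "d n e - d n s = (e - s) * (tan (t (z, Z n z)) - tan (t (z, Y z)))"
      by blast
    then have z: "z \<in> {s..e}" "d n e - d n s = (e - s) * (tan (t (z, Z n z)) - tan (t (z, Y z)))" by auto
    have "(e - s) * \<bar>dt n z\<bar> \<le> (e - s) * \<bar>tan (t (z, Z n z)) - tan (t (z, Y z))\<bar>"
      using Tdiff(1)[OF z(1), of n] e by (intro mult_left_mono) auto
    also have "\<dots> = \<bar>d n e - d n s\<bar>" unfolding z(2) abs_mult using e by simp
    also have "\<dots> \<le> Lip * kn n + kn n" using dL[OF ein, of n] Z(2)[of n] kn(1)[of n] by (simp add: d_def)
    finally have "(e - s) * (\<bar>dt n z\<bar> / kn n) \<le> Lip + 1"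
      using kn(1)[of n] by (simp add: pos_divide_le_eq algebra_simps)
    then have 1: "\<bar>dt n z / kn n\<bar> \<le> (Lip + 1) / (e - s)"
      using e kn(1)[of n] by (simp add: pos_le_divide_eq abs_divide mult.commute)
    have 2: "\<bar>d\<theta> n z / kn n\<bar> \<le> M * Lip"
      using d\<theta>L[OF z(1), of n] kn(1)[of n] by (simp add: abs_divide pos_divide_le_eq)
    show ?thesis using dtN[OF z(1), of n] NL[OF z(1), of n] 1 2 unfolding C_def by linarith
  qed
  have "bounded (range \<alpha>)" unfolding bounded_iff using \<alpha>C by auto
  \<comment> \<open>A subsequence suffices: the equation derived from it contains \<open>J\<close>,
    the limit of the whole sequence, and is affine in \<open>w\<close>.\<close>
  then obtain w \<phi> where \<phi>: "strict_mono \<phi>" "(\<alpha> \<circ> \<phi>) \<longlonglongrightarrow> w"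
    using bounded_imp_convergent_subsequence by blast
  have sublim: "(\<lambda>n. f (\<phi> n)) \<longlonglongrightarrow> L" if "f \<longlonglongrightarrow> L" for f :: "nat \<Rightarrow> real" and L
    using LIMSEQ_subseq_LIMSEQ[OF that \<phi>(1)] by (simp add: comp_def)
  have kn00: "kn n \<noteq> 0" for n using kn(1)[of n] by simp
  have scale: "(\<lambda>n. (f (Z n x) - f (Y x)) / kn n) \<longlonglongrightarrow> f' * J x"
    if "x \<in> {s..e}" "(f has_real_derivative f') (at (Y x))" for f f' x
    by (rule DERIV_sequence_scaled[OF that(2) kn00 kn0]) (use J[OF that(1)] in \<open>simp add: d_def\<close>)
  have Nlim: "(\<lambda>n. N n x) \<longlonglongrightarrow> integral {s..x} (\<lambda>\<eta>. K (\<eta>, Y \<eta>) * J \<eta>)" if x: "x \<in> {s..e}" for x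
    unfolding N_def
  proof (rule dominated_convergence(2)[of _ _ "\<lambda>_. M * Lip"])
    show "(\<lambda>\<xi>. (l (\<xi>, Z n \<xi>) - l (\<xi>, Y \<xi>)) / kn n) integrable_on {s..x}" for n
      using N[OF x] by blast
    have sub: "\<xi> \<in> {s..e}" if "\<xi> \<in> {s..x}" for \<xi> using that x by auto
    show "norm ((l (\<xi>, Z n \<xi>) - l (\<xi>, Y \<xi>)) / kn n) \<le> M * Lip" if "\<xi> \<in> {s..x}" for n \<xi>
      using lL[OF sub[OF that]] by simp
    show "(\<lambda>n. (l (\<xi>, Z n \<xi>) - l (\<xi>, Y \<xi>)) / kn n) \<longlonglongrightarrow> K (\<xi>, Y \<xi>) * J \<xi>" if "\<xi> \<in> {s..x}" for \<xi>
      by (rule scale[OF sub[OF that] dl]) (use xa[OF sub[OF that]] in auto)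
  qed auto
  define B where "B x = w - H (x, Y x) * sin (t (x, Y x)) * J x - integral {s..x} (\<lambda>\<eta>. K (\<eta>, Y \<eta>) * J \<eta>)" for x
  have dtlim: "(\<lambda>n. dt (\<phi> n) x / kn (\<phi> n)) \<longlonglongrightarrow> B x" if x: "x \<in> {s..e}" for x
  proof -
    have "(\<lambda>n. d\<theta> n x / kn n) \<longlonglongrightarrow> (- H (x, Y x) * sin (t (x, Y x))) * J x"
      unfolding d\<theta>_def by (rule scale[OF x d\<Theta>y]) (use xa[OF x] in auto)
    from tendsto_diff[OF tendsto_add[OF \<phi>(2) sublim[OF this]] sublim[OF Nlim[OF x]]]
    show ?thesis unfolding dtN[OF x] B_def by (simp add: comp_def algebra_simps)
  qed
  have dtB: "\<bar>dt n x / kn n\<bar> \<le> C + M * Lip + M * Lip * (e - s)" if x: "x \<in> {s..e}" for n x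
  proof -
    have "\<bar>d\<theta> n x / kn n\<bar> \<le> M * Lip"
      using d\<theta>L[OF x, of n] kn(1)[of n] by (simp add: abs_divide pos_divide_le_eq)
    then show ?thesis using dtN[OF x, of n] NL[OF x, of n] \<alpha>C[of n] by linarith
  qed
  have "J x - 1 = integral {s..x} (\<lambda>\<xi>. B \<xi> / (cos (t (\<xi>, Y \<xi>)))\<^sup>2)" if x: "x \<in> {s..e}" for x
  proof -
    define T where "T n \<xi> = (tan (t (\<xi>, Z n \<xi>)) - tan (t (\<xi>, Y \<xi>))) / kn n" for n \<xi>
    have sub: "\<xi> \<in> {s..e}" if "\<xi> \<in> {s..x}" for \<xi> using that x by auto
    have T: "(T n has_integral d n x / kn n - d n s / kn n) {s..x}" for n
    proof (rule fundamental_theorem_of_calculus)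
      show "s \<le> x" using x by simp
      fix \<xi> assume "\<xi> \<in> {s..x}"
      then have "((\<lambda>x. d n x / kn n) has_real_derivative T n \<xi>) (at \<xi>)"
        unfolding T_def by (intro DERIV_cdivide dd sub)
      then show "((\<lambda>x. d n x / kn n) has_vector_derivative T n \<xi>) (at \<xi> within {s..x})"
        by (simp add: has_real_derivative_iff_has_vector_derivative has_vector_derivative_at_within)
    qed
    have "(\<lambda>n. integral {s..x} (T (\<phi> n))) \<longlonglongrightarrow> integral {s..x} (\<lambda>\<xi>. B \<xi> / (cos (t (\<xi>, Y \<xi>)))\<^sup>2)"
    proof (rule dominated_convergence(2)[of _ _ "\<lambda>_. (1 + M\<^sup>2) * (C + M * Lip + M * Lip * (e - s))"])
      show "T (\<phi> n) integrable_on {s..x}" for n using T by blast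
      fix \<xi> assume "\<xi> \<in> {s..x}"
      then have \<xi>: "\<xi> \<in> {s..e}" by (rule sub)
      show "norm (T (\<phi> n) \<xi>) \<le> (1 + M\<^sup>2) * (C + M * Lip + M * Lip * (e - s))" for n
      proof -
        have "norm (T (\<phi> n) \<xi>) \<le> (1 + M\<^sup>2) * \<bar>dt (\<phi> n) \<xi> / kn (\<phi> n)\<bar>"
          using divide_right_mono[OF Tdiff(2)[OF \<xi>, of "\<phi> n"], of "kn (\<phi> n)"] kn(1)[of "\<phi> n"] unfolding T_def
          by (simp add: abs_divide)
        also have "\<dots> \<le> (1 + M\<^sup>2) * (C + M * Lip + M * Lip * (e - s))"
          using dtB[OF \<xi>] by (intro mult_left_mono) auto
        finally show ?thesis .
      qed
      have c: "cos (t (\<xi>, Y \<xi>)) > 0" using cpos xa[OF \<xi>] by blast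
      have "(\<lambda>n. (tan (t (\<xi>, Z (\<phi> n) \<xi>)) - tan (t (\<xi>, Y \<xi>))) / kn (\<phi> n)) \<longlonglongrightarrow> inverse ((cos (t (\<xi>, Y \<xi>)))\<^sup>2) * B \<xi>"
      proof (rule DERIV_sequence_scaled[where f = tan and y = "t (\<xi>, Y \<xi>)" and
            yn = "\<lambda>n. t (\<xi>, Z (\<phi> n) \<xi>)" and kn = "\<lambda>n. kn (\<phi> n)"])
        show "(tan has_real_derivative inverse ((cos (t (\<xi>, Y \<xi>)))\<^sup>2)) (at (t (\<xi>, Y \<xi>)))" using c by (intro DERIV_tan) auto
        show "(\<lambda>n. (t (\<xi>, Z (\<phi> n) \<xi>) - t (\<xi>, Y \<xi>)) / kn (\<phi> n)) \<longlonglongrightarrow> B \<xi>"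
          using dtlim[OF \<xi>] by (simp add: dt_def)
      qed (use kn00 sublim[OF kn0] in auto)
      then show "(\<lambda>n. T (\<phi> n) \<xi>) \<longlonglongrightarrow> B \<xi> / (cos (t (\<xi>, Y \<xi>)))\<^sup>2"
        unfolding T_def by (simp add: divide_inverse mult.commute)
    qed auto
    moreover have "(\<lambda>n. integral {s..x} (T (\<phi> n))) \<longlonglongrightarrow> J x - 1"
    proof -
      have "integral {s..x} (T n) = d n x / kn n - 1" for n
        using integral_unique[OF T[of n]] Z(2)[of n] kn00[of n] by (simp add: d_def)
      then show ?thesis using tendsto_diff[OF sublim[OF J[OF x]] tendsto_const[of 1]] by simp
    qed
    ultimately show ?thesis using LIMSEQ_unique by blast
  qed
  then show ?thesis unfolding B_def by blast
qed

text \<open>In terms of the normal distance T = cos t * J the equation for \<open>J\<close> becomes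
  T' = (w - N) / cos t with N' = K J. This is the Jacobi equation as a first-order system, and W =
  (w - N) / T is its logarithmic derivative. The factors 1 / cos t appear because the derivatives
  are taken in x and not in arc length.\<close>

lemma riccati_along_sol:
  assumes r: "r \<le> a" and s: "\<bar>s\<bar> < r" and e: "\<bar>e\<bar> < r" and Y: "sol r Y"
  defines "J \<equiv> flow_jacobian Y s"
  defines "N \<equiv> \<lambda>x. integral {s..x} (\<lambda>\<eta>. K (\<eta>, Y \<eta>) * J \<eta>)"
  assumes eq: "\<And>x. x \<in> {s..e} \<Longrightarrow> J x - 1 = integral {s..x} (\<lambda>\<xi>. (w - H (\<xi>, Y \<xi>) * sin (t (\<xi>, Y \<xi>)) * J \<xi>
     - N \<xi>) / (cos (t (\<xi>, Y \<xi>)))\<^sup>2)"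
    and x: "s < x" "x < e"
    and W: "\<And>x. s < x \<Longrightarrow> x < e \<Longrightarrow> W x = (w - N x) / (cos (t (x, Y x)) * J x)"
  shows "((\<lambda>x. D (x, Y x)) has_real_derivative (c (x, Y x) - D (x, Y x) * W x) / cos (t (x, Y x))) (at x)"
    and "(W has_real_derivative - (K (x, Y x) + (W x)\<^sup>2) / cos (t (x, Y x))) (at x)"
proof -
  have xr: "\<bar>x\<bar> < r" using x s e by auto
  have sub: "{s..e} \<subseteq> {-r<..<r}" using s e by auto
  note cY = sol_continuous_comp[OF Y sub r]
  have inr: "\<bar>\<xi>\<bar> < r" if "\<xi> \<in> {s..e}" for \<xi> using that s e by auto
  have c0: "cos (t (\<xi>, Y \<xi>)) > 0" if "\<xi> \<in> {s..e}" for \<xi> using cpos sol_in[OF Y r inr[OF that]] by blast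
  have Q0: "D (\<xi>, Y \<xi>) * cos (t (\<xi>, Y \<xi>)) > 0" if "\<xi> \<in> {s..e}" for \<xi> using Qpos sol_in[OF Y r inr[OF that]] by blast
  define I where "I x = integral {s..x} (\<lambda>\<xi>. c (\<xi>, Y \<xi>) / (D (\<xi>, Y \<xi>) * cos (t (\<xi>, Y \<xi>))))" for x
  define Q0' where "Q0' = D (s, Y s) * cos (t (s, Y s))"
  have J: "J x = Q0' / (D (x, Y x) * cos (t (x, Y x))) * exp (I x)" for x
    unfolding J_def flow_jacobian_def Q0'_def I_def ..
  have Q0'0: "Q0' > 0" using Q0[of s] x by (simp add: Q0'_def)
  have J0: "J \<xi> > 0" if "\<xi> \<in> {s..e}" for \<xi> using Q0[OF that] Q0'0 by (simp add: J)
  have contq: "continuous_on {s..e} (\<lambda>\<xi>. c (\<xi>, Y \<xi>) / (D (\<xi>, Y \<xi>) * cos (t (\<xi>, Y \<xi>))))"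
    by (intro continuous_on_divide cY conth cY[OF contQ]) (use Q0 in fastforce)
  have contI: "continuous_on {s..e} I"
    unfolding I_def by (rule indefinite_integral_continuous_1[OF integrable_continuous_real[OF contq]])
  have contJ: "continuous_on {s..e} J"
    unfolding J by (intro continuous_intros cY[OF contQ] contI) (use Q0 in fastforce)
  have contKJ: "continuous_on {s..e} (\<lambda>\<eta>. K (\<eta>, Y \<eta>) * J \<eta>)"
    by (intro continuous_intros cY[OF contK] contJ)
  have contN: "continuous_on {s..e} N"
    unfolding N_def by (rule indefinite_integral_continuous_1[OF integrable_continuous_real[OF contKJ]])
  define R where "R \<xi> = (w - H (\<xi>, Y \<xi>) * sin (t (\<xi>, Y \<xi>)) * J \<xi> - N \<xi>) / (cos (t (\<xi>, Y \<xi>)))\<^sup>2" for \<xi>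
  have contR: "continuous_on {s..e} R"
    unfolding R_def by (intro continuous_intros cY[OF contH] cY[OF contt] contJ contN) (use c0 in fastforce)
  have dI: "(I has_real_derivative c (x, Y x) / (D (x, Y x) * cos (t (x, Y x)))) (at x)"
    unfolding I_def by (rule integral_has_real_derivative_interior[OF contq x])
  have dN: "(N has_real_derivative K (x, Y x) * J x) (at x)"
    unfolding N_def by (rule integral_has_real_derivative_interior[OF contKJ x])
  have dJ: "(J has_real_derivative R x) (at x)"
  proof -
    have "((\<lambda>x. 1 + integral {s..x} R) has_real_derivative 0 + R x) (at x)"
      by (intro DERIV_add DERIV_const integral_has_real_derivative_interior[OF contR x])
    then have "((\<lambda>x. 1 + integral {s..x} R) has_real_derivative R x) (at x)" by simp
    then show ?thesis
      by (rule has_field_derivative_transform_within_open[where S = "{s<..<e}"])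
         (use eq x in \<open>auto simp: R_def[abs_def] algebra_simps\<close>)
  qed
  define T where "T x = cos (t (x, Y x)) * J x" for x
  have xe: "x \<in> {s..e}" using x by simp
  have cx: "cos (t (x, Y x)) > 0" and Tx: "T x > 0" using c0[OF xe] J0[OF xe] by (auto simp: T_def)
  have dT: "(T has_real_derivative (w - N x) / cos (t (x, Y x))) (at x)"
  proof -
    have "(T has_real_derivative H (x, Y x) * tan (t (x, Y x)) * J x + R x * cos (t (x, Y x))) (at x)"
      unfolding T_def by (rule DERIV_mult[OF cos_along[OF Y r xr] dJ])
    moreover have "H (x, Y x) * tan (t (x, Y x)) * J x + R x * cos (t (x, Y x)) = (w - N x) / cos (t (x, Y x))"
      using cx unfolding R_def tan_def by (simp add: field_simps power2_eq_square)
    ultimately show ?thesis by simp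
  qed
  have Wx: "W x = (w - N x) / T x" using W[OF x] by (simp add: T_def)
  \<comment> \<open>Transport gives D cos t J = Q0' exp I. Solved for \<open>D\<close>, this makes
    \<open>D\<close> differentiable along the curve, although it was only continuous.\<close>
  have DT: "D (\<xi>, Y \<xi>) = Q0' * exp (I \<xi>) / T \<xi>" if "\<xi> \<in> {s..e}" for \<xi>
    using c0[OF that] Q0[OF that] Q0'0 unfolding T_def J by simp
  have "((\<lambda>x. Q0' * exp (I x) / T x) has_real_derivative
      (Q0' * (exp (I x) * (c (x, Y x) / (D (x, Y x) * cos (t (x, Y x))))) * T x
        - Q0' * exp (I x) * ((w - N x) / cos (t (x, Y x)))) / (T x * T x)) (at x)"
    using Tx by (intro DERIV_divide DERIV_cmult DERIV_chain2[OF DERIV_exp] dI dT) auto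
  moreover have "(Q0' * (exp (I x) * (c (x, Y x) / (D (x, Y x) * cos (t (x, Y x))))) * T x
        - Q0' * exp (I x) * ((w - N x) / cos (t (x, Y x)))) / (T x * T x)
      = (c (x, Y x) - D (x, Y x) * W x) / cos (t (x, Y x))"
  proof -
    have QI: "Q0' * exp (I x) = D (x, Y x) * T x" using DT[OF xe] Tx by simp
    have "D (x, Y x) \<noteq> 0" using Q0[OF xe] by auto
    moreover have "(Q0' * (exp (I x) * (c (x, Y x) / (D (x, Y x) * cos (t (x, Y x))))) * T x
        - Q0' * exp (I x) * ((w - N x) / cos (t (x, Y x)))) =
      (Q0' * exp (I x)) * (c (x, Y x) / (D (x, Y x) * cos (t (x, Y x))) * T x - (w - N x) / cos (t (x, Y x)))"
      by (simp add: algebra_simps)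
    ultimately show ?thesis unfolding QI Wx using Tx cx by (simp add: field_simps)
  qed
  ultimately have "((\<lambda>x. Q0' * exp (I x) / T x) has_real_derivative (c (x, Y x) - D (x, Y x) * W x) / cos (t (x, Y x))) (at x)"
    by simp
  then show "((\<lambda>x. D (x, Y x)) has_real_derivative (c (x, Y x) - D (x, Y x) * W x) / cos (t (x, Y x))) (at x)"
    by (rule has_field_derivative_transform_within_open[where S = "{s<..<e}"]) (use DT x in auto)
  have "((\<lambda>x. (w - N x) / T x) has_real_derivative
      ((0 - K (x, Y x) * J x) * T x - (w - N x) * ((w - N x) / cos (t (x, Y x)))) / (T x * T x)) (at x)"
    using Tx by (intro DERIV_divide DERIV_diff DERIV_const dN dT) auto
  moreover have "((0 - K (x, Y x) * J x) * T x - (w - N x) * ((w - N x) / cos (t (x, Y x)))) / (T x * T x)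
      = - (K (x, Y x) + (W x)\<^sup>2) / cos (t (x, Y x))"
  proof -
    have "J x = T x / cos (t (x, Y x))" using cx by (simp add: T_def)
    then show ?thesis unfolding Wx using Tx cx by (simp add: field_simps power2_eq_square)
  qed
  ultimately have "((\<lambda>x. (w - N x) / T x) has_real_derivative - (K (x, Y x) + (W x)\<^sup>2) / cos (t (x, Y x))) (at x)"
    by simp
  then show "(W has_real_derivative - (K (x, Y x) + (W x)\<^sup>2) / cos (t (x, Y x))) (at x)"
    by (rule has_field_derivative_transform_within_open[where S = "{s<..<e}"]) (use W x in \<open>auto simp: T_def\<close>)
qed

end

section \<open>Flow windows and weighted forms\<close>

context transport
begin

text \<open>A window of curves around the origin: all curves through the inner box are labelled by their
  values at the level \<open>- \<rho>\<close>.\<close>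

lemma flow_window:
  obtains \<rho> r F where "0 < \<rho>" "4 * \<rho> \<le> r" "r \<le> a" "2 * M * \<rho> \<le> r / 4"
    "\<And>x y. \<bar>x\<bar> < r \<Longrightarrow> \<bar>y\<bar> < r \<Longrightarrow> \<exists>Y. sol r Y \<and> Y x = y"
    "\<And>\<zeta>. \<bar>\<zeta>\<bar> < r \<Longrightarrow> sol r (F \<zeta>) \<and> F \<zeta> (-\<rho>) = \<zeta>"
    "continuous_on ({-\<rho>..\<rho>} \<times> {-r<..<r}) (\<lambda>(x, \<zeta>). F \<zeta> x)"
proof -
  obtain r where r: "r > 0" "r \<le> a" and ex: "\<And>x y. \<bar>x\<bar> < r \<Longrightarrow> \<bar>y\<bar> < r \<Longrightarrow> \<exists>Y. sol r Y \<and> Y x = y"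
    using sol_exists by blast
  \<comment> \<open>The slope is at most \<open>M\<close> and the window has width 2
    \<open>\<rho>\<close>, so the bound r / (8 M) limits the vertical movement of a curve across the
    window to r / 4.\<close>
  define \<rho> where "\<rho> = min (r / 4) (r / (8 * M))"
  have \<rho>: "0 < \<rho>" "4 * \<rho> \<le> r" "2 * M * \<rho> \<le> r / 4"
  proof -
    show "0 < \<rho>" using r M by (simp add: \<rho>_def)
    have "\<rho> \<le> r / 4" unfolding \<rho>_def by simp
    then show "4 * \<rho> \<le> r" by simp
    have "\<rho> \<le> r / (8 * M)" unfolding \<rho>_def by simp
    then have "\<rho> * (8 * M) \<le> r" using M by (simp only: pos_le_divide_eq mult_pos_pos zero_less_numeral)
    then show "2 * M * \<rho> \<le> r / 4" by (simp add: algebra_simps)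
  qed
  have "\<exists>Y. \<bar>\<zeta>\<bar> < r \<longrightarrow> sol r Y \<and> Y (-\<rho>) = \<zeta>" for \<zeta>
    using ex[of "-\<rho>" \<zeta>] \<rho> r by auto
  then obtain F where F: "\<And>\<zeta>. \<bar>\<zeta>\<bar> < r \<Longrightarrow> sol r (F \<zeta>) \<and> F \<zeta> (-\<rho>) = \<zeta>" by metis
  have "continuous_on ({-\<rho>..\<rho>} \<times> {-r<..<r}) (\<lambda>(x, \<zeta>). F \<zeta> x)"
  proof (rule continuous_on_lipschitz2)
    fix x \<zeta> x' \<zeta>' assume "(x, \<zeta>) \<in> {-\<rho>..\<rho>} \<times> {-r<..<r}" "(x', \<zeta>') \<in> {-\<rho>..\<rho>} \<times> {-r<..<r}"
    then have b: "\<bar>x\<bar> < r" "\<bar>x'\<bar> < r" "\<bar>\<zeta>\<bar> < r" "\<bar>\<zeta>'\<bar> < r" using \<rho> r by auto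
    have s: "\<bar>-\<rho>\<bar> < r" using \<rho> r by auto
    have "\<bar>F \<zeta> x - F \<zeta> x'\<bar> \<le> M * \<bar>x - x'\<bar>"
      by (rule sol_lipschitz[of r]) (use F b r in auto)
    moreover have "\<bar>F \<zeta> x' - F \<zeta>' x'\<bar> \<le> Lip * \<bar>F \<zeta> (-\<rho>) - F \<zeta>' (-\<rho>)\<bar>"
      by (rule sol_difference[of r]) (use F b r s in auto)
    ultimately show "\<bar>(case (x, \<zeta>) of (x, \<zeta>) \<Rightarrow> F \<zeta> x) - (case (x', \<zeta>') of (x, \<zeta>) \<Rightarrow> F \<zeta> x)\<bar>
        \<le> M * \<bar>x - x'\<bar> + Lip * \<bar>\<zeta> - \<zeta>'\<bar>"
      using F[OF b(3)] F[OF b(4)] by auto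
  qed (use M Lip in auto)
  with \<rho> r ex F that show thesis by blast
qed

lemma window_bound:
  assumes "sol r Y" "r \<le> a" "0 < \<rho>" "4 * \<rho> \<le> r" "2 * M * \<rho> \<le> r / 4" "\<bar>x\<bar> \<le> \<rho>" "\<bar>x'\<bar> \<le> \<rho>"
  shows "\<bar>Y x - Y x'\<bar> \<le> r / 4"
proof -
  have "\<bar>Y x - Y x'\<bar> \<le> M * \<bar>x - x'\<bar>" by (rule sol_lipschitz[of r]) (use assms in auto)
  also have "\<dots> \<le> M * (2 * \<rho>)" using assms M by (intro mult_left_mono) auto
  finally show ?thesis using assms(5) by simp
qed

text \<open>Continuity is joint in the level and the label; this is what differentiation under the
  integral over labels and the continuity of w both rest on.\<close>

lemma jacobian_continuous:
  assumes "r \<le> a" "\<bar>s\<bar> < r" "\<bar>e\<bar> < r"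
    and F: "\<And>\<zeta>. \<bar>\<zeta>\<bar> < r \<Longrightarrow> sol r (F \<zeta>) \<and> F \<zeta> s = \<zeta>"
    and cF: "continuous_on ({s..e} \<times> {-r<..<r}) (\<lambda>(x, \<zeta>). F \<zeta> x)"
  shows "continuous_on ({s..e} \<times> {-r<..<r}) (\<lambda>(x, \<zeta>). flow_jacobian (F \<zeta>) s x)"
    and "\<And>g. continuous_on ({-a<..<a} \<times> {-a<..<a}) g \<Longrightarrow>
      continuous_on ({s..e} \<times> {-r<..<r}) (\<lambda>(x, \<zeta>). g (x, F \<zeta> x))"
proof -
  have in_a: "\<bar>x\<bar> < a \<and> \<bar>F \<zeta> x\<bar> < a" if "x \<in> {s..e}" "\<zeta> \<in> {-r<..<r}" for x \<zeta>
  proof -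
    have "\<bar>x\<bar> < r" "\<bar>\<zeta>\<bar> < r" using that assms(2,3) by auto
    then show ?thesis using solD(1)[of r "F \<zeta>" x] F[of \<zeta>] assms(1) by auto
  qed
  have in_a': "(x, F \<zeta> x) \<in> {-a<..<a} \<times> {-a<..<a}" if "x \<in> {s..e}" "\<zeta> \<in> {-r<..<r}" for x \<zeta>
    using in_a[OF that] by (auto simp: abs_less_iff)
  show comp: "continuous_on ({s..e} \<times> {-r<..<r}) (\<lambda>(x, \<zeta>). g (x, F \<zeta> x))"
    if "continuous_on ({-a<..<a} \<times> {-a<..<a}) g" for g
    unfolding case_prod_unfold
  proof (rule continuous_on_compose2[OF that])
    show "continuous_on ({s..e} \<times> {-r<..<r}) (\<lambda>p. (fst p, F (snd p) (fst p)))"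
      using cF unfolding case_prod_unfold by (intro continuous_intros)
    show "(\<lambda>p. (fst p, F (snd p) (fst p))) ` ({s..e} \<times> {-r<..<r}) \<subseteq> {-a<..<a} \<times> {-a<..<a}"
    proof (rule image_subsetI)
      fix p assume "p \<in> {s..e} \<times> {-r<..<r}"
      then show "(fst p, F (snd p) (fst p)) \<in> {-a<..<a} \<times> {-a<..<a}" using in_a'[of "fst p" "snd p"] by auto
    qed
  qed
  have Q0: "Q (x, F \<zeta> x) > 0" if "x \<in> {s..e}" "\<zeta> \<in> {-r<..<r}" for x \<zeta>
    using bounds[of x "F \<zeta> x"] in_a[OF that] q by auto
  have "continuous_on ({s..e} \<times> {-r<..<r}) (\<lambda>(x, \<zeta>). h (x, F \<zeta> x) / Q (x, F \<zeta> x))"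
    using comp[OF conth] comp[OF contQ] Q0 unfolding case_prod_unfold
    by (intro continuous_on_divide) (auto simp: less_imp_neq[symmetric])
  from continuous_on_primitive_param[OF this]
  have I: "continuous_on ({s..e} \<times> {-r<..<r}) (\<lambda>(x, \<zeta>). integral {s..x} (\<lambda>\<xi>. h (\<xi>, F \<zeta> \<xi>) / Q (\<xi>, F \<zeta> \<xi>)))"
    by simp
  have "continuous_on ({s..e} \<times> {-r<..<r}) (\<lambda>p. Q (s, snd p))"
    by (rule continuous_on_compose2[OF contQ]) (use assms(1,2) in \<open>auto intro!: continuous_intros\<close>)
  then have "continuous_on ({s..e} \<times> {-r<..<r}) (\<lambda>(x, \<zeta>). Q (s, F \<zeta> s))"
    by (rule continuous_on_eq) (use F in \<open>auto simp: abs_less_iff\<close>)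
  then show "continuous_on ({s..e} \<times> {-r<..<r}) (\<lambda>(x, \<zeta>). flow_jacobian (F \<zeta>) s x)"
    using I comp[OF contQ] Q0 unfolding flow_jacobian_def case_prod_unfold
    by (intro continuous_on_mult continuous_on_divide continuous_on_exp) (auto simp: less_imp_neq[symmetric])
qed

end

section \<open>The function w on a square\<close>

context riccati
begin

text \<open>At x = \<open>\<rho>\<close> the equation of \<open>jacobi_equation\<close> reads J - 1
  = w G0 + G1 with G0 > 0. So the slope has the explicit value \<open>wL\<close>, built from
  quantities that depend continuously on the label, which settles uniqueness and continuity
  together. The label map \<open>\<pi>\<close> then turns a function of level and label into a
  function on the square.\<close>

lemma riccati_local:
  obtains \<rho> r w where "0 < \<rho>" "\<rho> \<le> r" "r \<le> a"
    "continuous_on ({-\<rho><..<\<rho>} \<times> {-\<rho><..<\<rho>}) w"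
    "\<And>x y. \<bar>x\<bar> < \<rho> \<Longrightarrow> \<bar>y\<bar> < \<rho> \<Longrightarrow> \<exists>Y. sol r Y \<and> Y x = y"
    "\<And>Y x. sol r Y \<Longrightarrow> \<bar>x\<bar> < \<rho> \<Longrightarrow> \<bar>Y x\<bar> < \<rho> \<Longrightarrow>
      ((\<lambda>x. D (x, Y x)) has_real_derivative (c (x, Y x) - D (x, Y x) * w (x, Y x)) / cos (t (x, Y x))) (at x) \<and>
      ((\<lambda>x. w (x, Y x)) has_real_derivative - (K (x, Y x) + (w (x, Y x))\<^sup>2) / cos (t (x, Y x))) (at x)"
proof (rule flow_window)
  fix r \<rho> F assume \<rho>: "0 < \<rho>" "4 * \<rho> \<le> r" and r: "r \<le> a" and M\<rho>: "2 * M * \<rho> \<le> r / 4"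
    and ex: "\<And>x y. \<bar>x\<bar> < r \<Longrightarrow> \<bar>y\<bar> < r \<Longrightarrow> \<exists>Y. sol r Y \<and> Y x = y"
    and F: "\<And>\<zeta>. \<bar>\<zeta>\<bar> < r \<Longrightarrow> sol r (F \<zeta>) \<and> F \<zeta> (-\<rho>) = \<zeta>"
    and cF: "continuous_on ({-\<rho>..\<rho>} \<times> {-r<..<r}) (\<lambda>(x, \<zeta>). F \<zeta> x)"
  have s: "\<bar>-\<rho>\<bar> < r" and e: "\<bar>\<rho>\<bar> < r" "-\<rho> < \<rho>" using \<rho> by auto
  have wb: "\<bar>Y x - Y x'\<bar> \<le> r / 4" if "sol r Y" "\<bar>x\<bar> \<le> \<rho>" "\<bar>x'\<bar> \<le> \<rho>" for Y x x'
    by (rule window_bound[OF that(1) r \<rho> M\<rho> that(2,3)])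
  define S where "S = {-\<rho>..\<rho>} \<times> {-r<..<r}"
  have gF: "continuous_on S (\<lambda>(x, \<zeta>). g (x, F \<zeta> x))" if "continuous_on ({-a<..<a} \<times> {-a<..<a}) g" for g
    unfolding S_def by (rule jacobian_continuous(2)[OF r s e(1) _ cF that]) (rule F)
  have cJ: "continuous_on S (\<lambda>(x, \<zeta>). flow_jacobian (F \<zeta>) (-\<rho>) x)"
    unfolding S_def by (rule jacobian_continuous(1)[OF r s e(1) _ cF]) (rule F)
  have cpos': "cos (t (x, F \<zeta> x)) > 0" if "(x, \<zeta>) \<in> S" for x \<zeta>
  proof -
    have "\<bar>x\<bar> < r" "\<bar>\<zeta>\<bar> < r" using that e by (auto simp: S_def)
    then show ?thesis using F[of \<zeta>] sol_in[of r "F \<zeta>" x] r by (intro cpos) auto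
  qed
  have prim: "continuous_on S (\<lambda>(x, \<zeta>). integral {-\<rho>..x} (\<lambda>\<xi>. f \<xi> \<zeta>))"
    if "continuous_on S (\<lambda>(x, \<zeta>). f x \<zeta>)" for f :: "real \<Rightarrow> real \<Rightarrow> real"
    using continuous_on_primitive_param[OF that[unfolded S_def]] by (simp add: S_def)
  define J where "J x \<zeta> = flow_jacobian (F \<zeta>) (-\<rho>) x" for x \<zeta>
  define N where "N x \<zeta> = integral {-\<rho>..x} (\<lambda>\<eta>. K (\<eta>, F \<zeta> \<eta>) * J \<eta> \<zeta>)" for x \<zeta>
  define g0 where "g0 x \<zeta> = 1 / (cos (t (x, F \<zeta> x)))\<^sup>2" for x \<zeta>
  define g1 where "g1 x \<zeta> = (- H (x, F \<zeta> x) * sin (t (x, F \<zeta> x)) * J x \<zeta> - N x \<zeta>) / (cos (t (x, F \<zeta> x)))\<^sup>2" for x \<zeta>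
  define G0 where "G0 x \<zeta> = integral {-\<rho>..x} (\<lambda>\<xi>. g0 \<xi> \<zeta>)" for x \<zeta>
  define G1 where "G1 x \<zeta> = integral {-\<rho>..x} (\<lambda>\<xi>. g1 \<xi> \<zeta>)" for x \<zeta>
  define wL where "wL \<zeta> = (J \<rho> \<zeta> - 1 - G1 \<rho> \<zeta>) / G0 \<rho> \<zeta>" for \<zeta>
  define W where "W x \<zeta> = (wL \<zeta> - N x \<zeta>) / (cos (t (x, F \<zeta> x)) * J x \<zeta>)" for x \<zeta>
  have cJ': "continuous_on S (\<lambda>(x, \<zeta>). J x \<zeta>)" using cJ by (simp add: J_def)
  have cN: "continuous_on S (\<lambda>(x, \<zeta>). N x \<zeta>)"
    unfolding N_def using gF[OF contK] cJ' by (intro prim) (auto simp: case_prod_unfold intro!: continuous_intros)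
  have ct: "continuous_on S (\<lambda>p. t (fst p, F (snd p) (fst p)))" and cH: "continuous_on S (\<lambda>p. H (fst p, F (snd p) (fst p)))"
    using gF[OF contt] gF[OF contH] by (auto simp: case_prod_unfold)
  have cne: "(cos (t (fst p, F (snd p) (fst p)))) \<noteq> 0" if "p \<in> S" for p
    using cpos'[of "fst p" "snd p"] that by auto
  have cg0: "continuous_on S (\<lambda>(x, \<zeta>). g0 x \<zeta>)"
    unfolding g0_def case_prod_unfold using cne by (intro continuous_intros ct) auto
  have cg1: "continuous_on S (\<lambda>(x, \<zeta>). g1 x \<zeta>)"
    unfolding g1_def case_prod_unfold using cne cJ' cN
    by (intro continuous_intros ct cH) (auto simp: case_prod_unfold)
  have cG: "continuous_on S (\<lambda>(x, \<zeta>). G0 x \<zeta>)" "continuous_on S (\<lambda>(x, \<zeta>). G1 x \<zeta>)"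
    unfolding G0_def G1_def by (rule prim[OF cg0] prim[OF cg1])+
  have ate: "continuous_on S (\<lambda>(x, \<zeta>). f \<rho> \<zeta>)" if "continuous_on S (\<lambda>(x, \<zeta>). f x \<zeta>)" for f :: "real \<Rightarrow> real \<Rightarrow> real"
  proof -
    have "continuous_on S (\<lambda>p. (\<lambda>(x, \<zeta>). f x \<zeta>) (\<rho>, snd p))"
      by (rule continuous_on_compose2[OF that]) (use \<rho> in \<open>auto simp: S_def intro!: continuous_intros\<close>)
    then show ?thesis by (simp add: case_prod_unfold)
  qed
  have slice: "continuous_on {-\<rho>..\<rho>} (\<lambda>x. f x \<zeta>)" if "continuous_on S (\<lambda>(x, \<zeta>). f x \<zeta>)" "\<bar>\<zeta>\<bar> < r" for f :: "real \<Rightarrow> real \<Rightarrow> real" and \<zeta>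
  proof -
    have "continuous_on {-\<rho>..\<rho>} (\<lambda>x. (\<lambda>(x, \<zeta>). f x \<zeta>) (x, \<zeta>))"
      by (rule continuous_on_compose2[OF that(1)]) (use that in \<open>auto simp: S_def intro!: continuous_intros\<close>)
    then show ?thesis by simp
  qed
  have G0pos: "G0 \<rho> \<zeta> > 0" if "\<bar>\<zeta>\<bar> < r" for \<zeta>
  proof -
    \<comment> \<open>The integrand 1 / cos^2 is at least 1, so \<open>G0\<close> is at least the
      width of the window.\<close>
    have "integral {-\<rho>..\<rho>} (\<lambda>_. 1) \<le> G0 \<rho> \<zeta>"
      unfolding G0_def
    proof (rule integral_le)
      show "(\<lambda>\<xi>. g0 \<xi> \<zeta>) integrable_on {-\<rho>..\<rho>}" by (rule integrable_continuous_real[OF slice[OF cg0 that]])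
      fix x assume "x \<in> {-\<rho>..\<rho>}"
      then have c: "cos (t (x, F \<zeta> x)) > 0" using that by (intro cpos') (auto simp: S_def)
      have "(cos (t (x, F \<zeta> x)))\<^sup>2 \<le> 1\<^sup>2" using c by (intro power_mono) auto
      then show "1 \<le> g0 x \<zeta>" using c by (simp add: g0_def)
    qed (rule integrable_continuous_real, rule continuous_on_const)
    then show ?thesis using \<rho> by simp
  qed
  have Jpos: "J x \<zeta> > 0" if "(x, \<zeta>) \<in> S" for x \<zeta>
  proof -
    have "\<bar>x\<bar> < r" "\<bar>\<zeta>\<bar> < r" using that e by (auto simp: S_def)
    then have "D (x, F \<zeta> x) * cos (t (x, F \<zeta> x)) > 0" "D (-\<rho>, F \<zeta> (-\<rho>)) * cos (t (-\<rho>, F \<zeta> (-\<rho>))) > 0"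
      using F[of \<zeta>] sol_in[of r "F \<zeta>" x] sol_in[of r "F \<zeta>" "-\<rho>"] r s by (auto intro!: Qpos)
    then show ?thesis unfolding J_def flow_jacobian_def by simp
  qed
  have cW: "continuous_on S (\<lambda>(x, \<zeta>). W x \<zeta>)"
  proof -
    have "continuous_on S (\<lambda>(x, \<zeta>). wL \<zeta>)"
      unfolding wL_def case_prod_unfold
      using ate[OF cJ'] ate[OF cG(1)] ate[OF cG(2)] G0pos unfolding case_prod_unfold
      by (intro continuous_intros) (auto simp: S_def less_imp_neq[symmetric] abs_less_iff)
    then show ?thesis
      unfolding W_def using cN cJ' cne Jpos
      by (auto simp: case_prod_unfold less_imp_neq[symmetric] intro!: continuous_intros ct)
  qed
  have jac: "J x \<zeta> - 1 = integral {-\<rho>..x} (\<lambda>\<xi>. (wL \<zeta> - H (\<xi>, F \<zeta> \<xi>) * sin (t (\<xi>, F \<zeta> \<xi>)) * J \<xi> \<zeta> - N \<xi> \<zeta>) / (cos (t (\<xi>, F \<zeta> \<xi>)))\<^sup>2)"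
    if x: "x \<in> {-\<rho>..\<rho>}" and \<zeta>: "\<bar>\<zeta>\<bar> < r" for x \<zeta>
  proof -
    have F\<zeta>: "sol r (F \<zeta>)" "\<bar>F \<zeta> (-\<rho>)\<bar> < r" using F[OF \<zeta>] \<zeta> by auto
    have "\<exists>w. \<forall>x\<in>{-\<rho>..\<rho>}. J x \<zeta> - 1 = integral {-\<rho>..x}
        (\<lambda>\<xi>. (w - H (\<xi>, F \<zeta> \<xi>) * sin (t (\<xi>, F \<zeta> \<xi>)) * J \<xi> \<zeta> - N \<xi> \<zeta>) / (cos (t (\<xi>, F \<zeta> \<xi>)))\<^sup>2)"
      unfolding J_def N_def by (rule jacobi_equation[OF _ r s e F\<zeta>]) (rule ex)
    then obtain w where w: "\<And>x. x \<in> {-\<rho>..\<rho>} \<Longrightarrow> J x \<zeta> - 1 = integral {-\<rho>..x}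
        (\<lambda>\<xi>. (w - H (\<xi>, F \<zeta> \<xi>) * sin (t (\<xi>, F \<zeta> \<xi>)) * J \<xi> \<zeta> - N \<xi> \<zeta>) / (cos (t (\<xi>, F \<zeta> \<xi>)))\<^sup>2)"
      by blast
    have "J \<rho> \<zeta> - 1 = integral {-\<rho>..\<rho>} (\<lambda>\<xi>. w * g0 \<xi> \<zeta> + g1 \<xi> \<zeta>)"
      using w[of \<rho>] \<rho> unfolding g0_def g1_def by (simp add: add_divide_distrib[symmetric] algebra_simps)
    also have "\<dots> = w * G0 \<rho> \<zeta> + G1 \<rho> \<zeta>"
      unfolding G0_def G1_def
      using integrable_on_cmult_left[OF integrable_continuous_real[OF slice[OF cg0 \<zeta>]], of w]
        integrable_continuous_real[OF slice[OF cg1 \<zeta>]]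
      by (subst integral_add) simp_all
    finally have "w = wL \<zeta>" using G0pos[OF \<zeta>] by (simp add: wL_def)
    then show ?thesis using w[OF x] by simp
  qed
  \<comment> \<open>The choice is harmless: by uniqueness all solutions through (x, y) have the same
    value at - \<open>\<rho>\<close>.\<close>
  define \<pi> where "\<pi> = (\<lambda>(x, y). (SOME Y. sol r Y \<and> Y x = y) (-\<rho>))"
  have \<pi>: "\<pi> (x, Y x) = Y (-\<rho>)" if "sol r Y" "\<bar>x\<bar> < r" for Y x
  proof -
    have "sol r (SOME Z. sol r Z \<and> Z x = Y x) \<and> (SOME Z. sol r Z \<and> Z x = Y x) x = Y x"
      by (rule someI[of _ Y]) (use that in auto)
    then show ?thesis unfolding \<pi>_def using sol_unique[OF that(1) _ r that(2) s] by auto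
  qed
  have \<pi>S: "(x, \<pi> (x, y)) \<in> S" if xy: "\<bar>x\<bar> < \<rho>" "\<bar>y\<bar> < 2 * \<rho>" for x y
  proof -
    have "\<bar>x\<bar> < r" "\<bar>y\<bar> < r" using xy \<rho> by linarith+
    then obtain Y where Y: "sol r Y" "Y x = y" using ex by blast
    then have "\<pi> (x, y) = Y (-\<rho>)" using \<pi>[of Y x] xy \<rho> by auto
    moreover have "\<bar>Y (-\<rho>) - Y x\<bar> \<le> r / 4" by (rule wb) (use Y xy \<rho> in auto)
    ultimately have "\<bar>\<pi> (x, y)\<bar> < r" using Y(2) xy \<rho> by linarith
    then show ?thesis using xy by (auto simp: S_def)
  qed
  have c\<pi>: "continuous_on ({-\<rho><..<\<rho>} \<times> {-\<rho><..<\<rho>}) \<pi>"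
  proof (rule continuous_on_lipschitz2)
    fix x y x' y' assume "(x, y) \<in> {-\<rho><..<\<rho>} \<times> {-\<rho><..<\<rho>}" "(x', y') \<in> {-\<rho><..<\<rho>} \<times> {-\<rho><..<\<rho>}"
    then have b: "\<bar>x\<bar> < r" "\<bar>y\<bar> < r" "\<bar>x'\<bar> < r" "\<bar>y'\<bar> < r" using \<rho> by auto
    obtain Y Y' where Y: "sol r Y" "Y x = y" and Y': "sol r Y'" "Y' x' = y'" using ex b by metis
    have "\<bar>Y (-\<rho>) - Y' (-\<rho>)\<bar> \<le> Lip * \<bar>Y x - Y' x\<bar>" by (rule sol_difference[OF Y'(1) Y(1) r b(1) s])
    also have "\<dots> \<le> Lip * (\<bar>y - y'\<bar> + M * \<bar>x - x'\<bar>)"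
      using sol_lipschitz[OF Y'(1) r b(3) b(1)] Y(2) Y'(2) Lip by (intro mult_left_mono) auto
    finally show "\<bar>\<pi> (x, y) - \<pi> (x', y')\<bar> \<le> (Lip * M) * \<bar>x - x'\<bar> + Lip * \<bar>y - y'\<bar>"
      using \<pi>[OF Y(1) b(1)] \<pi>[OF Y'(1) b(3)] Y(2) Y'(2) by (simp add: algebra_simps)
  qed (use M Lip in auto)
  define w where "w = (\<lambda>(x, y). W x (\<pi> (x, y)))"
  have cw: "continuous_on ({-\<rho><..<\<rho>} \<times> {-\<rho><..<\<rho>}) w"
  proof -
    have "continuous_on ({-\<rho><..<\<rho>} \<times> {-\<rho><..<\<rho>}) (\<lambda>p. (\<lambda>(x, \<zeta>). W x \<zeta>) (fst p, \<pi> p))"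
    proof (rule continuous_on_compose2[OF cW])
      show "continuous_on ({-\<rho><..<\<rho>} \<times> {-\<rho><..<\<rho>}) (\<lambda>p. (fst p, \<pi> p))"
        by (intro continuous_intros c\<pi>)
      show "(\<lambda>p. (fst p, \<pi> p)) ` ({-\<rho><..<\<rho>} \<times> {-\<rho><..<\<rho>}) \<subseteq> S"
      proof (rule image_subsetI)
        fix p assume "p \<in> {-\<rho><..<\<rho>} \<times> {-\<rho><..<\<rho>}"
        then show "(fst p, \<pi> p) \<in> S" using \<pi>S[of "fst p" "snd p"] \<rho> by (auto simp: abs_less_iff)
      qed
    qed
    then show ?thesis by (simp add: w_def case_prod_unfold)
  qed
  show thesis
  proof (rule that[OF \<rho>(1) _ r cw])
    show "\<rho> \<le> r" using \<rho> by linarith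
    show "\<exists>Y. sol r Y \<and> Y x = y" if "\<bar>x\<bar> < \<rho>" "\<bar>y\<bar> < \<rho>" for x y
      using ex[of x y] that \<rho> by auto
    fix Y x assume Y: "sol r Y" and x: "\<bar>x\<bar> < \<rho>" and Yx: "\<bar>Y x\<bar> < \<rho>"
    have \<zeta>: "\<bar>Y (-\<rho>)\<bar> < r"
    proof -
      have "\<bar>Y (-\<rho>) - Y x\<bar> \<le> r / 4" by (rule wb) (use Y x \<rho> in auto)
      then show ?thesis using Yx \<rho> by linarith
    qed
    define \<zeta> where "\<zeta> = Y (-\<rho>)"
    have FY: "F \<zeta> x' = Y x'" if "\<bar>x'\<bar> < r" for x'
      using sol_unique[OF Y _ r s that, of "F \<zeta>"] F[OF \<zeta>] by (simp add: \<zeta>_def)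
    have xx: "-\<rho> < x" "x < \<rho>" using x by auto
    have Ww: "w (x', F \<zeta> x') = (wL \<zeta> - N x' \<zeta>) / (cos (t (x', F \<zeta> x')) * J x' \<zeta>)" if "-\<rho> < x'" "x' < \<rho>" for x'
    proof -
      have x': "\<bar>x'\<bar> < r" using that \<rho> by auto
      show ?thesis unfolding FY[OF x'] w_def using \<pi>[OF Y x'] by (simp add: W_def \<zeta>_def[symmetric] FY[OF x'])
    qed
    have sF: "sol r (F \<zeta>)" using F[OF \<zeta>] by (simp add: \<zeta>_def)
    note j = jac[OF _ \<zeta>[folded \<zeta>_def], unfolded J_def N_def]
    note Ww' = Ww[unfolded J_def N_def]
    have d: "((\<lambda>x. D (x, F \<zeta> x)) has_real_derivative (c (x, F \<zeta> x) - D (x, F \<zeta> x) * w (x, F \<zeta> x)) / cos (t (x, F \<zeta> x))) (at x)"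
      by (rule riccati_along_sol(1)[OF r s e(1) sF _ xx, of "wL \<zeta>" "\<lambda>x. w (x, F \<zeta> x)"]) (rule j Ww', assumption+)+
    have d2: "((\<lambda>x. w (x, F \<zeta> x)) has_real_derivative - (K (x, F \<zeta> x) + (w (x, F \<zeta> x))\<^sup>2) / cos (t (x, F \<zeta> x))) (at x)"
      by (rule riccati_along_sol(2)[OF r s e(1) sF _ xx, of "wL \<zeta>" "\<lambda>x. w (x, F \<zeta> x)"]) (rule j Ww', assumption+)+
    have xr: "\<bar>x\<bar> < r" using x \<rho> by auto
    have "((\<lambda>x. D (x, Y x)) has_real_derivative (c (x, Y x) - D (x, Y x) * w (x, Y x)) / cos (t (x, Y x))) (at x)"
      using d unfolding FY[OF xr]
      by (rule has_field_derivative_transform_within_open[where S = "{-r<..<r}"]) (use xr FY in auto)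
    moreover have "((\<lambda>x. w (x, Y x)) has_real_derivative - (K (x, Y x) + (w (x, Y x))\<^sup>2) / cos (t (x, Y x))) (at x)"
      using d2 unfolding FY[OF xr]
      by (rule has_field_derivative_transform_within_open[where S = "{-r<..<r}"]) (use xr FY in auto)
    ultimately show "((\<lambda>x. D (x, Y x)) has_real_derivative (c (x, Y x) - D (x, Y x) * w (x, Y x)) / cos (t (x, Y x))) (at x) \<and>
      ((\<lambda>x. w (x, Y x)) has_real_derivative - (K (x, Y x) + (w (x, Y x))\<^sup>2) / cos (t (x, Y x))) (at x)"
      by blast
  qed
qed

end

text \<open>Between the two values that are subtracted only the second argument changes, so the mean
  value theorem in y and continuity of \<open>p\<close> suffice. Subtracted from a derivative along
  the curve, the result isolates the partial derivative in x, which is otherwise out of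
  reach.\<close>

lemma moving_endpoint:
  fixes f p :: "real \<times> real \<Rightarrow> real"
  assumes fy: "\<And>x y. x \<in> U \<Longrightarrow> \<bar>y\<bar> < b \<Longrightarrow> ((\<lambda>y. f (x, y)) has_real_derivative p (x, y)) (at y)"
    and p: "continuous_on (U \<times> {-b<..<b}) p"
    and U: "open U" "x0 \<in> U" and Yb: "\<And>x. x \<in> U \<Longrightarrow> \<bar>Y x\<bar> < b"
    and Y: "(Y has_real_derivative Y') (at x0)"
  shows "((\<lambda>x. f (x, Y x) - f (x, Y x0)) has_real_derivative p (x0, Y x0) * Y') (at x0)"
proof -
  have "((\<lambda>x. f (x, Y x) - f (x, Y x0)) has_real_derivative p (x0, Y x0) * Y') (at x0 within U)"
    unfolding has_field_derivative_iff tendsto_at_iff_sequentially comp_def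
  proof (intro allI impI)
    fix xn :: "nat \<Rightarrow> real" assume xn: "\<forall>i. xn i \<in> U - {x0}" "xn \<longlonglongrightarrow> x0"
    have xU: "xn n \<in> U" "xn n \<noteq> x0" for n using xn(1) by auto
    have limY: "(\<lambda>n. Y (xn n)) \<longlonglongrightarrow> Y x0"
      using isCont_tendsto_compose[OF DERIV_isCont[OF Y] xn(2)] .
    have "\<exists>z. \<bar>z\<bar> < b \<and> \<bar>z - Y x0\<bar> \<le> \<bar>Y (xn n) - Y x0\<bar> \<and>
        f (xn n, Y (xn n)) - f (xn n, Y x0) = p (xn n, z) * (Y (xn n) - Y x0)" for n
    proof -
      have Yn: "\<bar>Y (xn n)\<bar> < b" "\<bar>Y x0\<bar> < b" using Yb xU U by auto
      consider "Y x0 < Y (xn n)" | "Y x0 = Y (xn n)" | "Y (xn n) < Y x0" by linarith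
      then show ?thesis
      proof cases
        case 1
        have "\<exists>z>Y x0. z < Y (xn n) \<and> f (xn n, Y (xn n)) - f (xn n, Y x0) = (Y (xn n) - Y x0) * p (xn n, z)"
          by (rule MVT2[OF 1 fy[OF xU(1)]]) (use Yn in auto)
        then obtain z where "z > Y x0" "z < Y (xn n)" "f (xn n, Y (xn n)) - f (xn n, Y x0) = (Y (xn n) - Y x0) * p (xn n, z)"
          by blast
        then show ?thesis using Yn by (intro exI[of _ z]) (auto simp: mult.commute)
      next
        case 2
        then show ?thesis using Yn by (intro exI[of _ "Y x0"]) auto
      next
        case 3
        have "\<exists>z>Y (xn n). z < Y x0 \<and> f (xn n, Y x0) - f (xn n, Y (xn n)) = (Y x0 - Y (xn n)) * p (xn n, z)"
          by (rule MVT2[OF 3 fy[OF xU(1)]]) (use Yn in auto)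
        then obtain z where "z > Y (xn n)" "z < Y x0" "f (xn n, Y x0) - f (xn n, Y (xn n)) = (Y x0 - Y (xn n)) * p (xn n, z)"
          by blast
        then show ?thesis using Yn by (intro exI[of _ z]) (auto simp: algebra_simps)
      qed
    qed
    then obtain z where z: "\<And>n. \<bar>z n\<bar> < b" "\<And>n. \<bar>z n - Y x0\<bar> \<le> \<bar>Y (xn n) - Y x0\<bar>"
      "\<And>n. f (xn n, Y (xn n)) - f (xn n, Y x0) = p (xn n, z n) * (Y (xn n) - Y x0)" by metis
    have "(\<lambda>n. \<bar>Y (xn n) - Y x0\<bar>) \<longlonglongrightarrow> \<bar>Y x0 - Y x0\<bar>" by (intro tendsto_intros limY)
    then have "(\<lambda>n. \<bar>Y (xn n) - Y x0\<bar>) \<longlonglongrightarrow> 0" by simp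
    from tendsto_of_abs_le[OF z(2) this] have limz: "z \<longlonglongrightarrow> Y x0" .
    have "isCont p (x0, Y x0)"
    proof -
      have "open (U \<times> {-b<..<b})" using U by (auto simp: open_Times)
      moreover have "(x0, Y x0) \<in> U \<times> {-b<..<b}" using U Yb[of x0] by (auto simp: abs_less_iff)
      ultimately show ?thesis using p by (simp add: continuous_on_eq_continuous_at)
    qed
    then have "(\<lambda>n. p (xn n, z n)) \<longlonglongrightarrow> p (x0, Y x0)"
      by (rule isCont_tendsto_compose) (intro tendsto_Pair xn limz)
    from tendsto_mult[OF this DERIV_sequence_quotient[OF Y xn(2) xU(2)]]
    show "(\<lambda>n. ((f (xn n, Y (xn n)) - f (xn n, Y x0)) - (f (x0, Y x0) - f (x0, Y x0))) / (xn n - x0))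
        \<longlonglongrightarrow> p (x0, Y x0) * Y'" by (simp add: z(3))
  qed
  then show ?thesis unfolding at_within_open[OF U(2,1)] .
qed

section \<open>Potentials of weighted forms\<close>

context transport
begin

text \<open>The product of the transported form \<open>Q (dy - v dx)\<close> with a function \<open>g\<close> that is differentiable
  along the flow only has the exterior derivative \<open>(Q g' + g h) dx dy\<close> expected from the
  smooth case.\<close>

lemma weighted_form_potential:
  fixes g g' :: "real \<times> real \<Rightarrow> real"
  assumes g: "continuous_on ({-a<..<a} \<times> {-a<..<a}) g" and g': "continuous_on ({-a<..<a} \<times> {-a<..<a}) g'"
    and dg: "\<And>r Y x. sol r Y \<Longrightarrow> r \<le> a \<Longrightarrow> \<bar>x\<bar> < r \<Longrightarrow>
      ((\<lambda>x. g (x, Y x)) has_real_derivative g' (x, Y x)) (at x)"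
  shows "\<exists>\<rho> f \<kappa>. 0 < \<rho> \<and> \<rho> \<le> a \<and> continuous_on ({-\<rho><..<\<rho>} \<times> {-\<rho><..<\<rho>}) \<kappa> \<and>
    (\<forall>x y. \<bar>x\<bar> < \<rho> \<longrightarrow> \<bar>y\<bar> < \<rho> \<longrightarrow>
      ((\<lambda>y. f (x, y)) has_real_derivative g (x, y) * Q (x, y)) (at y) \<and>
      ((\<lambda>x. f (x, y)) has_real_derivative \<kappa> (x, y) - g (x, y) * Q (x, y) * v (x, y)) (at x) \<and>
      ((\<lambda>y. \<kappa> (x, y)) has_real_derivative Q (x, y) * g' (x, y) + g (x, y) * h (x, y)) (at y))"
proof (rule flow_window)
  fix r \<rho> F assume \<rho>: "0 < \<rho>" "4 * \<rho> \<le> r" and r: "r \<le> a" and M\<rho>: "2 * M * \<rho> \<le> r / 4"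
    and ex: "\<And>x y. \<bar>x\<bar> < r \<Longrightarrow> \<bar>y\<bar> < r \<Longrightarrow> \<exists>Y. sol r Y \<and> Y x = y"
    and F: "\<And>\<zeta>. \<bar>\<zeta>\<bar> < r \<Longrightarrow> sol r (F \<zeta>) \<and> F \<zeta> (-\<rho>) = \<zeta>"
    and cF: "continuous_on ({-\<rho>..\<rho>} \<times> {-r<..<r}) (\<lambda>(x, \<zeta>). F \<zeta> x)"
  have s: "\<bar>-\<rho>\<bar> < r" and e: "\<bar>\<rho>\<bar> < r" using \<rho> by auto
  have r0: "r > 0" using \<rho> by linarith
  have wb: "\<bar>Y x - Y x'\<bar> \<le> r / 4" if "sol r Y" "\<bar>x\<bar> \<le> \<rho>" "\<bar>x'\<bar> \<le> \<rho>" for Y x x'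
    by (rule window_bound[OF that(1) r \<rho> M\<rho> that(2,3)])
  \<comment> \<open>Curves with labels up to r / 2 move by at most r / 4 across the window. They
    stay within 3 r / 4, hence strictly inside [- b, b], which in turn lies strictly inside the
    square.\<close>
  define b where "b = 7 / 8 * r"
  have b: "b < a" "b < r" "0 < b" "\<rho> < b" using \<rho> r r0 by (auto simp: b_def)
  have Fb: "\<bar>F \<zeta> x\<bar> < b" if "\<bar>\<zeta>\<bar> \<le> r / 2" "\<bar>x\<bar> \<le> \<rho>" for \<zeta> x
  proof -
    have "\<bar>\<zeta>\<bar> < r" using that(1) r0 by linarith
    from F[OF this] have "sol r (F \<zeta>)" "F \<zeta> (-\<rho>) = \<zeta>" by auto
    moreover have "\<bar>-\<rho>\<bar> \<le> \<rho>" using \<rho> by simp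
    ultimately have "\<bar>F \<zeta> x - \<zeta>\<bar> \<le> r / 4" using wb[of "F \<zeta>" x "-\<rho>"] that(2) by simp
    then show ?thesis using that(1) r0 unfolding b_def by linarith
  qed
  \<comment> \<open>The integrals below start at this curve of the family and not at a constant
    height. After the substitution by labels both limits of integration are then independent of
    x.\<close>
  define Y1 where "Y1 = F (- (r / 2))"
  have Y1: "sol r Y1" "\<And>x. \<bar>x\<bar> \<le> \<rho> \<Longrightarrow> \<bar>Y1 x\<bar> < b"
    using F[of "- (r / 2)"] Fb[of "- (r / 2)"] r0 by (auto simp: Y1_def)
  define J where "J x \<zeta> = flow_jacobian (F \<zeta>) (-\<rho>) x" for x \<zeta>
  have cJ: "continuous_on ({-\<rho>..\<rho>} \<times> {-r<..<r}) (\<lambda>(x, \<zeta>). J x \<zeta>)"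
    unfolding J_def by (rule jacobian_continuous(1)[OF r s e _ cF]) (rule F)
  have gF: "continuous_on ({-\<rho>..\<rho>} \<times> {-r<..<r}) (\<lambda>(x, \<zeta>). G (x, F \<zeta> x))"
    if "continuous_on ({-a<..<a} \<times> {-a<..<a}) G" for G
    by (rule jacobian_continuous(2)[OF r s e _ cF that]) (rule F)
  have prim: "((\<lambda>y. integral {-b..y} (\<lambda>\<eta>. G (x, \<eta>))) has_real_derivative G (x, y)) (at y)"
    if "continuous_on ({-a<..<a} \<times> {-a<..<a}) G" "\<bar>x\<bar> < a" "\<bar>y\<bar> < b" for G :: "real \<times> real \<Rightarrow> real" and x y
  proof (rule integral_has_real_derivative_interior)
    show "continuous_on {-b..b} (\<lambda>\<eta>. G (x, \<eta>))"
      by (rule continuous_on_compose2[OF that(1)]) (use b that in \<open>auto intro!: continuous_intros simp: abs_less_iff\<close>)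
  qed (use that in auto)
  \<comment> \<open>Substitution of heights by labels, with the flow derivative \<open>J\<close> as
    Jacobian.\<close>
  have subst: "integral {-b..F \<zeta> x} (\<lambda>\<eta>. G (x, \<eta>)) - integral {-b..Y1 x} (\<lambda>\<eta>. G (x, \<eta>))
      = integral {- (r / 2)..\<zeta>} (\<lambda>z. G (x, F z x) * J x z)"
    if G: "continuous_on ({-a<..<a} \<times> {-a<..<a}) G" and x: "\<bar>x\<bar> \<le> \<rho>" and \<zeta>: "\<bar>\<zeta>\<bar> \<le> r / 2" for G x \<zeta>
  proof -
    have "((\<lambda>z. G (x, F z x) * J x z) has_integral
        integral {-b..F \<zeta> x} (\<lambda>\<eta>. G (x, \<eta>)) - integral {-b..F (- (r / 2)) x} (\<lambda>\<eta>. G (x, \<eta>))) {- (r / 2)..\<zeta>}"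
    proof (rule fundamental_theorem_of_calculus)
      show "- (r / 2) \<le> \<zeta>" using \<zeta> by linarith
      fix z assume "z \<in> {- (r / 2)..\<zeta>}"
      then have z: "\<bar>z\<bar> \<le> r / 2" "z \<in> {-r<..<r}" using \<zeta> r0 by auto
      have xa: "\<bar>x\<bar> < a" "\<bar>x\<bar> < r" "-\<rho> \<le> x" using x \<rho> r by auto
      have dF: "((\<lambda>z. F z x) has_real_derivative flow_jacobian (F z) (-\<rho>) x) (at z)"
        by (rule flow_has_derivative[where U = "{-r<..<r}" and r = r]) (use F z r s xa in auto)
      have "((\<lambda>z. integral {-b..F z x} (\<lambda>\<eta>. G (x, \<eta>))) has_real_derivative G (x, F z x) * J x z) (at z)"
        unfolding J_def by (rule DERIV_chain2[OF prim[OF G xa(1) Fb[OF z(1) x]] dF])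
      then show "((\<lambda>z. integral {-b..F z x} (\<lambda>\<eta>. G (x, \<eta>))) has_vector_derivative G (x, F z x) * J x z) (at z within {- (r / 2)..\<zeta>})"
        by (simp add: has_real_derivative_iff_has_vector_derivative has_vector_derivative_at_within)
    qed
    then show ?thesis by (simp add: integral_unique Y1_def)
  qed
  define p where "p z = g z * Q z" for z
  define K where "K z = Q z * g' z + g z * h z" for z
  have cp: "continuous_on ({-a<..<a} \<times> {-a<..<a}) p" and cK: "continuous_on ({-a<..<a} \<times> {-a<..<a}) K"
    unfolding p_def K_def by (intro continuous_intros g g' contQ conth)+
  define f where "f = (\<lambda>(x, y). integral {-b..y} (\<lambda>\<eta>. p (x, \<eta>)) - integral {-b..Y1 x} (\<lambda>\<eta>. p (x, \<eta>)))"
  define \<kappa> where "\<kappa> = (\<lambda>(x, y). integral {-b..y} (\<lambda>\<eta>. K (x, \<eta>)) - integral {-b..Y1 x} (\<lambda>\<eta>. K (x, \<eta>)))"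
  have fy: "((\<lambda>y. f (x, y)) has_real_derivative p (x, y)) (at y)"
    and \<kappa>y: "((\<lambda>y. \<kappa> (x, y)) has_real_derivative K (x, y)) (at y)" if "\<bar>x\<bar> < a" "\<bar>y\<bar> < b" for x y
    using DERIV_diff[OF prim[OF cp that] DERIV_const] DERIV_diff[OF prim[OF cK that] DERIV_const]
    by (simp_all add: f_def \<kappa>_def)
  have along: "((\<lambda>x. f (x, F \<zeta> x)) has_real_derivative \<kappa> (x, F \<zeta> x)) (at x)"
    if \<zeta>: "\<bar>\<zeta>\<bar> \<le> r / 2" and x: "\<bar>x\<bar> < \<rho>" for \<zeta> x
  proof -
    have zr: "\<bar>z\<bar> < r" if "z \<in> {- (r / 2)..\<zeta>}" for z using that \<zeta> r0 by auto
    have sub: "{- (r / 2)..\<zeta>} \<subseteq> {-r<..<r}"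
    proof
      fix z assume "z \<in> {- (r / 2)..\<zeta>}"
      from zr[OF this] show "z \<in> {-r<..<r}" by auto
    qed
    have "((\<lambda>x. integral (cbox (- (r / 2)) \<zeta>) (\<lambda>z. p (x, F z x) * J x z)) has_real_derivative
        integral (cbox (- (r / 2)) \<zeta>) (\<lambda>z. K (x, F z x) * J x z)) (at x within {-\<rho><..<\<rho>})"
    proof (rule leibniz_rule_field_derivative)
      show "continuous_on ({-\<rho><..<\<rho>} \<times> cbox (- (r / 2)) \<zeta>) (\<lambda>(x, z). K (x, F z x) * J x z)"
      proof -
        have "continuous_on ({-\<rho>..\<rho>} \<times> {-r<..<r}) (\<lambda>(x, z). K (x, F z x) * J x z)"
          using gF[OF cK] cJ by (auto simp: case_prod_unfold intro!: continuous_intros)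
        then show ?thesis by (rule continuous_on_subset) (use sub in auto)
      qed
      show "(\<lambda>z. p (x, F z x) * J x z) integrable_on cbox (- (r / 2)) \<zeta>" if x: "x \<in> {-\<rho><..<\<rho>}" for x
      proof (rule integrable_continuous)
        have c: "continuous_on ({-\<rho>..\<rho>} \<times> {-r<..<r}) (\<lambda>(x, z). p (x, F z x) * J x z)"
          using gF[OF cp] cJ by (auto simp: case_prod_unfold intro!: continuous_intros)
        have "continuous_on (cbox (- (r / 2)) \<zeta>) (\<lambda>z. (\<lambda>(x, z). p (x, F z x) * J x z) (x, z))"
          by (rule continuous_on_compose2[OF c]) (use sub x in \<open>auto intro!: continuous_intros\<close>)
        then show "continuous_on (cbox (- (r / 2)) \<zeta>) (\<lambda>z. p (x, F z x) * J x z)" by simp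
      qed
      fix x z assume "x \<in> {-\<rho><..<\<rho>}" and "z \<in> cbox (- (r / 2)) \<zeta>"
      then have x: "\<bar>x\<bar> < \<rho>" "-\<rho> < x" "x < \<rho>" and z: "\<bar>z\<bar> < r" using zr by auto
      have Fz: "sol r (F z)" using F[OF z] by simp
      have xr: "\<bar>x\<bar> < r" using x \<rho> by auto
      have in_a: "\<bar>\<xi>\<bar> < a \<and> \<bar>F z \<xi>\<bar> < a" if "\<bar>\<xi>\<bar> < r" for \<xi> using solD(1)[OF Fz that] that r by auto
      have Q0: "Q (\<xi>, F z \<xi>) > 0" if "\<bar>\<xi>\<bar> < r" for \<xi> using bounds[of \<xi> "F z \<xi>"] in_a[OF that] q by auto
      have cI: "continuous_on {-\<rho>..\<rho>} (\<lambda>\<xi>. h (\<xi>, F z \<xi>) / Q (\<xi>, F z \<xi>))"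
      proof (intro continuous_on_divide sol_continuous_comp[OF Fz _ r] conth contQ ballI)
        show "{-\<rho>..\<rho>} \<subseteq> {-r<..<r}" "{-\<rho>..\<rho>} \<subseteq> {-r<..<r}" using \<rho> by auto
        show "Q (\<xi>, F z \<xi>) \<noteq> 0" if "\<xi> \<in> {-\<rho>..\<rho>}" for \<xi>
        proof -
          have "\<bar>\<xi>\<bar> < r" using that \<rho> by auto
          from Q0[OF this] show ?thesis by simp
        qed
      qed
      \<comment> \<open>In p J = g (Q J) the factor Q J is an explicit exponential and thus
        differentiable in x, whereas \<open>Q\<close> and \<open>J\<close> separately need not be.
        The other factor \<open>g\<close> is differentiable along curves by assumption.\<close>
      have pJ: "p (x, F z x) * J x z = g (x, F z x) * (Q (-\<rho>, F z (-\<rho>)) * exp (integral {-\<rho>..x} (\<lambda>\<xi>. h (\<xi>, F z \<xi>) / Q (\<xi>, F z \<xi>))))"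
        if "\<bar>x\<bar> < r" for x
        using Q0[OF that] unfolding p_def J_def flow_jacobian_def by simp
      have "((\<lambda>x. g (x, F z x) * (Q (-\<rho>, F z (-\<rho>)) * exp (integral {-\<rho>..x} (\<lambda>\<xi>. h (\<xi>, F z \<xi>) / Q (\<xi>, F z \<xi>)))))
          has_real_derivative g' (x, F z x) * (Q (-\<rho>, F z (-\<rho>)) * exp (integral {-\<rho>..x} (\<lambda>\<xi>. h (\<xi>, F z \<xi>) / Q (\<xi>, F z \<xi>))))
            + Q (-\<rho>, F z (-\<rho>)) * (exp (integral {-\<rho>..x} (\<lambda>\<xi>. h (\<xi>, F z \<xi>) / Q (\<xi>, F z \<xi>))) * (h (x, F z x) / Q (x, F z x))) * g (x, F z x)) (at x)"
        by (rule DERIV_mult[OF dg[OF Fz r xr] DERIV_cmult[OF DERIV_chain2[OF DERIV_exp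
              integral_has_real_derivative_interior[OF cI x(2,3)]]]])
      moreover have "g' (x, F z x) * (Q (-\<rho>, F z (-\<rho>)) * exp (integral {-\<rho>..x} (\<lambda>\<xi>. h (\<xi>, F z \<xi>) / Q (\<xi>, F z \<xi>))))
            + Q (-\<rho>, F z (-\<rho>)) * (exp (integral {-\<rho>..x} (\<lambda>\<xi>. h (\<xi>, F z \<xi>) / Q (\<xi>, F z \<xi>))) * (h (x, F z x) / Q (x, F z x))) * g (x, F z x)
          = K (x, F z x) * J x z"
        using Q0[OF xr] unfolding K_def J_def flow_jacobian_def by (simp add: field_simps)
      ultimately have "((\<lambda>x. g (x, F z x) * (Q (-\<rho>, F z (-\<rho>)) * exp (integral {-\<rho>..x} (\<lambda>\<xi>. h (\<xi>, F z \<xi>) / Q (\<xi>, F z \<xi>)))))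
          has_real_derivative K (x, F z x) * J x z) (at x)" by simp
      then have "((\<lambda>x. p (x, F z x) * J x z) has_real_derivative K (x, F z x) * J x z) (at x)"
        by (rule has_field_derivative_transform_within_open[where S = "{-r<..<r}"]) (use pJ xr in auto)
      then show "((\<lambda>x. p (x, F z x) * J x z) has_real_derivative K (x, F z x) * J x z) (at x within {-\<rho><..<\<rho>})"
        by (rule has_field_derivative_at_within)
    qed (use x in auto)
    moreover have "at x within {-\<rho><..<\<rho>} = at x" by (rule at_within_open) (use x in auto)
    ultimately have d: "((\<lambda>x. integral {- (r / 2)..\<zeta>} (\<lambda>z. p (x, F z x) * J x z)) has_real_derivative
        integral {- (r / 2)..\<zeta>} (\<lambda>z. K (x, F z x) * J x z)) (at x)" by simp
    have k: "\<kappa> (x, F \<zeta> x) = integral {- (r / 2)..\<zeta>} (\<lambda>z. K (x, F z x) * J x z)"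
      using subst[OF cK _ \<zeta>, of x] x by (simp add: \<kappa>_def)
    have ff: "f (x, F \<zeta> x) = integral {- (r / 2)..\<zeta>} (\<lambda>z. p (x, F z x) * J x z)" if "x \<in> {-\<rho><..<\<rho>}" for x
    proof -
      have "\<bar>x\<bar> \<le> \<rho>" using that by auto
      from subst[OF cp this \<zeta>] show ?thesis by (simp add: f_def)
    qed
    show ?thesis unfolding k
      by (rule has_field_derivative_transform_within_open[OF d, where S = "{-\<rho><..<\<rho>}"]) (use x ff in auto)
  qed
  have fx: "((\<lambda>x. f (x, y0)) has_real_derivative \<kappa> (x0, y0) - p (x0, y0) * v (x0, y0)) (at x0)"
    if x0: "\<bar>x0\<bar> < \<rho>" and y0: "\<bar>y0\<bar> < \<rho>" for x0 y0
  proof -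
    have "\<bar>x0\<bar> < r" "\<bar>y0\<bar> < r" using x0 y0 \<rho> by auto
    then obtain Y where Y: "sol r Y" "Y x0 = y0" using ex by blast
    define \<zeta> where "\<zeta> = Y (-\<rho>)"
    have \<zeta>: "\<bar>\<zeta>\<bar> \<le> r / 2" "\<bar>\<zeta>\<bar> < r"
    proof -
      have "\<bar>Y (-\<rho>) - Y x0\<bar> \<le> r / 4" by (rule wb) (use Y x0 \<rho> in auto)
      then show "\<bar>\<zeta>\<bar> \<le> r / 2" using Y(2) y0 \<rho> unfolding \<zeta>_def by linarith
      then show "\<bar>\<zeta>\<bar> < r" using r0 by linarith
    qed
    have sF: "sol r (F \<zeta>)" and F\<zeta>: "F \<zeta> (-\<rho>) = Y (-\<rho>)" using F[OF \<zeta>(2)] by (auto simp: \<zeta>_def)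
    have Fx0: "F \<zeta> x0 = y0" using sol_unique[OF Y(1) sF r s \<open>\<bar>x0\<bar> < r\<close> F\<zeta>] Y(2) by simp
    have dF: "(F \<zeta> has_real_derivative v (x0, F \<zeta> x0)) (at x0)" by (rule solD(2)[OF sF \<open>\<bar>x0\<bar> < r\<close>])
    have "((\<lambda>x. f (x, F \<zeta> x) - f (x, F \<zeta> x0)) has_real_derivative p (x0, F \<zeta> x0) * v (x0, F \<zeta> x0)) (at x0)"
    proof (rule moving_endpoint[where U = "{-\<rho><..<\<rho>}" and b = b])
      show "((\<lambda>y. f (x, y)) has_real_derivative p (x, y)) (at y)" if "x \<in> {-\<rho><..<\<rho>}" "\<bar>y\<bar> < b" for x y
        by (rule fy) (use that \<rho> b in auto)
      show "continuous_on ({-\<rho><..<\<rho>} \<times> {-b<..<b}) p"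
        by (rule continuous_on_subset[OF cp]) (use b in auto)
      show "\<bar>F \<zeta> x\<bar> < b" if "x \<in> {-\<rho><..<\<rho>}" for x using Fb[OF \<zeta>(1), of x] that by auto
    qed (use x0 dF in auto)
    from DERIV_diff[OF along[OF \<zeta>(1) x0] this] show ?thesis by (simp add: Fx0)
  qed
  have c\<kappa>: "continuous_on ({-\<rho><..<\<rho>} \<times> {-\<rho><..<\<rho>}) \<kappa>"
  proof -
    have "continuous_on ({-b..b} \<times> {-\<rho><..<\<rho>}) (\<lambda>p. K (snd p, fst p))"
      by (rule continuous_on_compose2[OF cK]) (use b \<rho> in \<open>auto intro!: continuous_intros\<close>)
    from continuous_on_primitive_param[OF this]
    have R: "continuous_on ({-b..b} \<times> {-\<rho><..<\<rho>}) (\<lambda>p. integral {-b..fst p} (\<lambda>\<eta>. K (snd p, \<eta>)))"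
      by (simp add: case_prod_unfold)
    have "continuous_on {-\<rho><..<\<rho>} Y1" by (rule sol_continuous[OF Y1(1)]) (use \<rho> in auto)
    then have cY1: "continuous_on ({-\<rho><..<\<rho>} \<times> {-\<rho><..<\<rho>}) (\<lambda>p. Y1 (fst p))"
      by (rule continuous_on_compose2) (auto intro!: continuous_intros)
    have "continuous_on ({-\<rho><..<\<rho>} \<times> {-\<rho><..<\<rho>}) (\<lambda>p. integral {-b..fst (snd p, fst p)} (\<lambda>\<eta>. K (snd (snd p, fst p), \<eta>)))"
      by (rule continuous_on_compose2[OF R]) (use b in \<open>auto intro!: continuous_intros\<close>)
    moreover have "continuous_on ({-\<rho><..<\<rho>} \<times> {-\<rho><..<\<rho>}) (\<lambda>p. integral {-b..fst (Y1 (fst p), fst p)} (\<lambda>\<eta>. K (snd (Y1 (fst p), fst p), \<eta>)))"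
    proof (rule continuous_on_compose2[OF R])
      show "(\<lambda>p. (Y1 (fst p), fst p)) ` ({-\<rho><..<\<rho>} \<times> {-\<rho><..<\<rho>}) \<subseteq> {-b..b} \<times> {-\<rho><..<\<rho>}"
      proof (rule image_subsetI)
        fix p :: "real \<times> real" assume "p \<in> {-\<rho><..<\<rho>} \<times> {-\<rho><..<\<rho>}"
        then have *: "fst p \<in> {-\<rho><..<\<rho>}" by auto
        then have "\<bar>fst p\<bar> \<le> \<rho>" by auto
        from Y1(2)[OF this] * show "(Y1 (fst p), fst p) \<in> {-b..b} \<times> {-\<rho><..<\<rho>}" by auto
      qed
    qed (intro continuous_intros cY1)
    ultimately show ?thesis
      unfolding \<kappa>_def case_prod_unfold by (intro continuous_on_diff) simp_all
  qed
  show ?thesis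
  proof (rule exI[of _ \<rho>], rule exI[of _ f], rule exI[of _ \<kappa>], intro conjI allI impI \<rho>(1) c\<kappa>)
    show "\<rho> \<le> a" using \<rho> r by linarith
    fix x y assume xy: "\<bar>x\<bar> < \<rho>" "\<bar>y\<bar> < \<rho>"
    have xa: "\<bar>x\<bar> < a" "\<bar>y\<bar> < b" using xy b by auto
    show "((\<lambda>y. f (x, y)) has_real_derivative g (x, y) * Q (x, y)) (at y)"
      using fy[OF xa] by (simp add: p_def)
    show "((\<lambda>y. \<kappa> (x, y)) has_real_derivative Q (x, y) * g' (x, y) + g (x, y) * h (x, y)) (at y)"
      using \<kappa>y[OF xa] by (simp add: K_def)
    show "((\<lambda>x. f (x, y)) has_real_derivative \<kappa> (x, y) - g (x, y) * Q (x, y) * v (x, y)) (at x)"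
      using fx[OF xy] by (simp add: p_def)
  qed
qed

end

section \<open>The planar Riccati equation\<close>

lemma bounded_on_smaller_box:
  fixes f :: "real \<times> real \<Rightarrow> real"
  assumes "continuous_on ({-a<..<a} \<times> {-a<..<a}) f" "b < a"
  shows "\<exists>M. \<forall>x y. \<bar>x\<bar> \<le> b \<longrightarrow> \<bar>y\<bar> \<le> b \<longrightarrow> \<bar>f (x, y)\<bar> \<le> M"
proof -
  have "continuous_on ({-b..b} \<times> {-b..b}) f"
    by (rule continuous_on_subset[OF assms(1)]) (use assms(2) in auto)
  then have "bounded (f ` ({-b..b} \<times> {-b..b}))"
    by (intro compact_imp_bounded compact_continuous_image compact_Times compact_Icc)
  then obtain M where M: "\<forall>z\<in>f ` ({-b..b} \<times> {-b..b}). norm z \<le> M" unfolding bounded_iff by blast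
  have "\<bar>f (x, y)\<bar> \<le> M" if "\<bar>x\<bar> \<le> b" "\<bar>y\<bar> \<le> b" for x y
    using M that by (auto simp: abs_le_iff)
  then show ?thesis by blast
qed

text \<open>A plane integral curve runs on the graph of a solution with horizontal speed
  \<open>\<xi>'\<close>. Both sides satisfy the same equation in \<open>\<tau>\<close>, so
  \<open>curve_difference\<close> with coinciding values at time 0 applies, forwards and backwards
  in time.\<close>

lemma (in transport) curve_on_sol:
  assumes Y: "sol r Y" "r \<le> a"
    and \<epsilon>: "\<bar>\<tau>\<bar> < \<epsilon>"
    and \<xi>: "\<And>\<tau>. \<bar>\<tau>\<bar> < \<epsilon> \<Longrightarrow> \<bar>\<xi> \<tau>\<bar> < r \<and> (\<xi> has_real_derivative \<xi>' \<tau>) (at \<tau>) \<and> \<bar>\<xi>' \<tau>\<bar> \<le> 1"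
    and \<eta>: "\<And>\<tau>. \<bar>\<tau>\<bar> < \<epsilon> \<Longrightarrow> \<bar>\<eta> \<tau>\<bar> < a \<and> (\<eta> has_real_derivative v (\<xi> \<tau>, \<eta> \<tau>) * \<xi>' \<tau>) (at \<tau>)"
    and 0: "\<eta> 0 = Y (\<xi> 0)"
  shows "\<eta> \<tau> = Y (\<xi> \<tau>)"
proof -
  have Y\<xi>: "\<bar>Y (\<xi> \<tau>)\<bar> < a \<and> ((\<lambda>\<tau>. Y (\<xi> \<tau>)) has_real_derivative v (\<xi> \<tau>, Y (\<xi> \<tau>)) * \<xi>' \<tau>) (at \<tau>)"
    if "\<bar>\<tau>\<bar> < \<epsilon>" for \<tau>
    using solD[OF Y(1), of "\<xi> \<tau>"] \<xi>[OF that] DERIV_chain2[of Y _ \<xi> \<tau> "\<xi>' \<tau>" UNIV] by auto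
  have \<xi>a: "\<bar>\<xi> \<tau>\<bar> < a \<and> (\<xi> has_real_derivative \<xi>' \<tau>) (at \<tau>) \<and> \<bar>\<xi>' \<tau>\<bar> \<le> 1" if "\<bar>\<tau>\<bar> < \<epsilon>" for \<tau>
    using \<xi>[OF that] Y(2) by auto
  show ?thesis
  proof (cases "0 \<le> \<tau>")
    case True
    have in\<epsilon>: "\<bar>\<sigma>\<bar> < \<epsilon>" if "\<sigma> \<in> {0..\<tau>}" for \<sigma> using that \<epsilon> by auto
    have "\<bar>\<eta> \<tau> - Y (\<xi> \<tau>)\<bar> \<le> M / q * exp (M * 1 / q * (\<tau> - 0)) * \<bar>\<eta> 0 - Y (\<xi> 0)\<bar>"
      by (rule curve_difference(1)[OF True \<xi>a[OF in\<epsilon>] Y\<xi>[OF in\<epsilon>] \<eta>[OF in\<epsilon>]])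
    then show ?thesis using 0 by simp
  next
    case False
    then have \<tau>: "\<tau> \<le> 0" by simp
    have in\<epsilon>: "\<bar>\<sigma>\<bar> < \<epsilon>" if "\<sigma> \<in> {\<tau>..0}" for \<sigma> using that \<epsilon> by auto
    have "\<bar>\<eta> \<tau> - Y (\<xi> \<tau>)\<bar> \<le> M / q * exp (M * 1 / q * (0 - \<tau>)) * \<bar>\<eta> 0 - Y (\<xi> 0)\<bar>"
      by (rule curve_difference(2)[OF \<tau> \<xi>a[OF in\<epsilon>] Y\<xi>[OF in\<epsilon>] \<eta>[OF in\<epsilon>]])
    then show ?thesis using 0 by simp
  qed
qed

lemma continuous_on_swap:
  fixes f :: "real \<times> real \<Rightarrow> real"
  assumes "continuous_on (A \<times> A) f"
  shows "continuous_on (A \<times> A) (\<lambda>(y, x). f (x, y))"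
proof -
  have "continuous_on (A \<times> A) (\<lambda>p. f (snd p, fst p))"
    by (rule continuous_on_compose2[OF assms]) (auto intro!: continuous_intros)
  then show ?thesis by (simp add: case_prod_unfold)
qed

text \<open>In coordinates N-perp is (cos t, sin t) and N is (- sin t, cos t). The hypotheses
  provide potentials for D N . dr (\<open>\<Phi>\<close> and \<open>k\<close>) and for the dual form
  (\<open>f\<close> and \<open>\<kappa>\<close>). What has to be constructed is a potential for
  \<open>H\<close> times the dual form; \<open>dH\<close> supplies the derivative along the curves
  of N that this needs.\<close>

theorem planar_riccati:
  fixes t D c H NH \<Phi> k f \<kappa> :: "real \<times> real \<Rightarrow> real"
  assumes a: "a > 0"
    and cont: "continuous_on ({-a<..<a} \<times> {-a<..<a}) t" "continuous_on ({-a<..<a} \<times> {-a<..<a}) D"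
      "continuous_on ({-a<..<a} \<times> {-a<..<a}) c" "continuous_on ({-a<..<a} \<times> {-a<..<a}) H"
      "continuous_on ({-a<..<a} \<times> {-a<..<a}) NH" "continuous_on ({-a<..<a} \<times> {-a<..<a}) k"
      "continuous_on ({-a<..<a} \<times> {-a<..<a}) \<kappa>"
    and tD: "\<And>x y. \<bar>x\<bar> < a \<Longrightarrow> \<bar>y\<bar> < a \<Longrightarrow> \<bar>t (x, y)\<bar> < pi / 2 \<and> D (x, y) > 0"
    and d\<Phi>: "\<And>x y. \<bar>x\<bar> < a \<Longrightarrow> \<bar>y\<bar> < a \<Longrightarrow> (\<Phi> has_derivative
      (\<lambda>(p, r). (k (x, y) - D (x, y) * sin (t (x, y))) * p + D (x, y) * cos (t (x, y)) * r)) (at (x, y))"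
    and dk: "\<And>x y. \<bar>x\<bar> < a \<Longrightarrow> \<bar>y\<bar> < a \<Longrightarrow> ((\<lambda>y. k (x, y)) has_real_derivative c (x, y)) (at y)"
    and fx: "\<And>x y. \<bar>x\<bar> < a \<Longrightarrow> \<bar>y\<bar> < a \<Longrightarrow> ((\<lambda>x. f (x, y)) has_real_derivative - cos (t (x, y))) (at x)"
    and fy: "\<And>x y. \<bar>x\<bar> < a \<Longrightarrow> \<bar>y\<bar> < a \<Longrightarrow> ((\<lambda>y. f (x, y)) has_real_derivative - sin (t (x, y)) - \<kappa> (x, y)) (at y)"
    and \<kappa>x: "\<And>x y. \<bar>x\<bar> < a \<Longrightarrow> \<bar>y\<bar> < a \<Longrightarrow> ((\<lambda>x. \<kappa> (x, y)) has_real_derivative H (x, y)) (at x)"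
    and dH: "\<And>r X y. (\<And>y. \<bar>y\<bar> < r \<Longrightarrow> \<bar>X y\<bar> < a \<and> (X has_real_derivative - tan (t (X y, y))) (at y)) \<Longrightarrow>
      r \<le> a \<Longrightarrow> \<bar>y\<bar> < r \<Longrightarrow> ((\<lambda>y. H (X y, y)) has_real_derivative NH (X y, y) / cos (t (X y, y))) (at y)"
  obtains \<rho> w where "0 < \<rho>" "\<rho> \<le> a" "continuous_on ({-\<rho><..<\<rho>} \<times> {-\<rho><..<\<rho>}) w"
    "\<And>\<xi> \<eta>. \<bar>\<xi> 0\<bar> < \<rho> \<Longrightarrow> \<bar>\<eta> 0\<bar> < \<rho> \<Longrightarrow>
      (\<forall>\<^sub>F \<tau> in nhds 0. (\<xi> has_real_derivative cos (t (\<xi> \<tau>, \<eta> \<tau>))) (at \<tau>) \<and>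
        (\<eta> has_real_derivative sin (t (\<xi> \<tau>, \<eta> \<tau>))) (at \<tau>)) \<Longrightarrow>
      ((\<lambda>\<tau>. D (\<xi> \<tau>, \<eta> \<tau>)) has_real_derivative c (\<xi> 0, \<eta> 0) - D (\<xi> 0, \<eta> 0) * w (\<xi> 0, \<eta> 0)) (at 0) \<and>
      ((\<lambda>\<tau>. w (\<xi> \<tau>, \<eta> \<tau>)) has_real_derivative
        - ((H (\<xi> 0, \<eta> 0))\<^sup>2 + NH (\<xi> 0, \<eta> 0) + (w (\<xi> 0, \<eta> 0))\<^sup>2)) (at 0)"
proof -
  define B where "B = {-a<..<a} \<times> {-a<..<a}"
  define K where "K z = (H z)\<^sup>2 + NH z" for z
  note cont = cont[folded B_def]
  have cp: "cos (t (x, y)) > 0" if "\<bar>x\<bar> < a" "\<bar>y\<bar> < a" for x y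
    using tD[OF that] by (intro cos_gt_zero_pi) auto
  have cB: "cos (t z) > 0" "D z > 0" if "z \<in> B" for z
    using cp[of "fst z" "snd z"] tD[of "fst z" "snd z"] that by (auto simp: B_def abs_less_iff)
  have cc: "continuous_on B (\<lambda>z. cos (t z))" "continuous_on B (\<lambda>z. D z * cos (t z))" "continuous_on B K"
    "continuous_on B (\<lambda>z. tan (t z))" "continuous_on B (\<lambda>z. 1 / cos (t z))" "continuous_on B (\<lambda>z. 1 / (D z * cos (t z)))"
    "continuous_on B (\<lambda>z. NH z / cos (t z))"
  proof -
    have ne: "\<forall>z\<in>B. cos (t z) \<noteq> 0" "\<forall>z\<in>B. D z * cos (t z) \<noteq> 0" using cB by fastforce+
    show "continuous_on B (\<lambda>z. cos (t z))" "continuous_on B (\<lambda>z. D z * cos (t z))" "continuous_on B K"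
      unfolding K_def by (intro continuous_intros cont)+
    show "continuous_on B (\<lambda>z. tan (t z))" unfolding tan_def by (intro continuous_intros cont ne)
    show "continuous_on B (\<lambda>z. 1 / cos (t z))" "continuous_on B (\<lambda>z. 1 / (D z * cos (t z)))"
      "continuous_on B (\<lambda>z. NH z / cos (t z))"
      by (intro continuous_intros cont ne)+
  qed
  define b where "b = a / 2"
  have b: "0 < b" "b < a" using a by (auto simp: b_def)
  \<comment> \<open>A bound on the closed half-size square. The choice is justified for continuous
    \<open>g\<close>, the only functions to which \<open>bd\<close> is applied in the
    estimates.\<close>
  define bd where "bd g = (SOME M. \<forall>x y. \<bar>x\<bar> \<le> b \<longrightarrow> \<bar>y\<bar> \<le> b \<longrightarrow> \<bar>g (x, y)\<bar> \<le> M)"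
    for g :: "real \<times> real \<Rightarrow> real"
  have bd: "\<bar>g (x, y)\<bar> \<le> bd g" if g: "continuous_on B g" and xy: "\<bar>x\<bar> \<le> b" "\<bar>y\<bar> \<le> b" for g x y
  proof -
    have "\<forall>x y. \<bar>x\<bar> \<le> b \<longrightarrow> \<bar>y\<bar> \<le> b \<longrightarrow> \<bar>g (x, y)\<bar> \<le> bd g"
      unfolding bd_def by (rule someI_ex[OF bounded_on_smaller_box[OF g[unfolded B_def] b(2)]])
    then show ?thesis using xy by blast
  qed
  \<comment> \<open>The reciprocals of cos t and D cos t are in the list so that 1 / M is a positive
    lower bound \<open>q\<close> for both transports below.\<close>
  define G where "G = {\<lambda>z. cos (t z), \<lambda>z. D z * cos (t z), K, \<lambda>z. tan (t z), \<lambda>z. 1 / cos (t z),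
    \<lambda>z. 1 / (D z * cos (t z)), c, H, k, \<kappa>}"
  define M where "M = Max (insert 1 (bd ` G))"
  have "1 \<le> M" unfolding M_def G_def by (intro Max_ge) auto
  then have M: "M > 0" by simp
  have bdG: "bd g \<le> M" if "g \<in> G" for g
    unfolding M_def by (intro Max_ge) (use that in \<open>auto simp: G_def\<close>)
  have bM: "\<bar>cos (t (x, y))\<bar> \<le> M" "\<bar>D (x, y) * cos (t (x, y))\<bar> \<le> M" "\<bar>K (x, y)\<bar> \<le> M" "\<bar>tan (t (x, y))\<bar> \<le> M"
    "\<bar>1 / cos (t (x, y))\<bar> \<le> M" "\<bar>1 / (D (x, y) * cos (t (x, y)))\<bar> \<le> M" "\<bar>c (x, y)\<bar> \<le> M" "\<bar>H (x, y)\<bar> \<le> M"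
    "\<bar>k (x, y)\<bar> \<le> M" "\<bar>\<kappa> (x, y)\<bar> \<le> M" if "\<bar>x\<bar> < b" "\<bar>y\<bar> < b" for x y
  proof -
    have xy: "\<bar>x\<bar> \<le> b" "\<bar>y\<bar> \<le> b" using that by auto
    have B: "\<bar>g (x, y)\<bar> \<le> M" if "continuous_on B g" "g \<in> G" for g
      using bd[OF that(1) xy] bdG[OF that(2)] by linarith
    show "\<bar>cos (t (x, y))\<bar> \<le> M" by (rule B[OF cc(1)]) (simp add: G_def)
    show "\<bar>D (x, y) * cos (t (x, y))\<bar> \<le> M" by (rule B[OF cc(2)]) (simp add: G_def)
    show "\<bar>K (x, y)\<bar> \<le> M" by (rule B[OF cc(3)]) (simp add: G_def)
    show "\<bar>tan (t (x, y))\<bar> \<le> M" by (rule B[OF cc(4)]) (simp add: G_def)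
    show "\<bar>1 / cos (t (x, y))\<bar> \<le> M" by (rule B[OF cc(5)]) (simp add: G_def)
    show "\<bar>1 / (D (x, y) * cos (t (x, y)))\<bar> \<le> M" by (rule B[OF cc(6)]) (simp add: G_def)
    show "\<bar>c (x, y)\<bar> \<le> M" by (rule B[OF cont(3)]) (simp add: G_def)
    show "\<bar>H (x, y)\<bar> \<le> M" by (rule B[OF cont(4)]) (simp add: G_def)
    show "\<bar>k (x, y)\<bar> \<le> M" by (rule B[OF cont(6)]) (simp add: G_def)
    show "\<bar>\<kappa> (x, y)\<bar> \<le> M" by (rule B[OF cont(7)]) (simp add: G_def)
  qed
  have low: "1 / M \<le> u" if "u > 0" "\<bar>1 / u\<bar> \<le> M" for u :: real
    using that M by (simp add: field_simps)
  have sub: "{-b<..<b} \<times> {-b<..<b} \<subseteq> B" using b by (auto simp: B_def)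
  note cb = continuous_on_subset[OF _ sub]
  interpret A: transport b M "1 / M" "\<lambda>z. D z * cos (t z)" "\<lambda>z. tan (t z)" c \<Phi> k
  proof
    show "0 < b" "0 < 1 / M" using b M by auto
    show "continuous_on ({-b<..<b} \<times> {-b<..<b}) (\<lambda>z. D z * cos (t z))" by (rule cb[OF cc(2)])
    show "continuous_on ({-b<..<b} \<times> {-b<..<b}) (\<lambda>z. tan (t z))" by (rule cb[OF cc(4)])
    show "continuous_on ({-b<..<b} \<times> {-b<..<b}) c" by (rule cb[OF cont(3)])
    show "continuous_on ({-b<..<b} \<times> {-b<..<b}) k" by (rule cb[OF cont(6)])
    fix x y assume xy: "\<bar>x\<bar> < b" "\<bar>y\<bar> < b"
    then have xa: "\<bar>x\<bar> < a" "\<bar>y\<bar> < a" using b by auto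
    have "D (x, y) * cos (t (x, y)) > 0" using cp[OF xa] tD[OF xa] by simp
    then show "1 / M \<le> D (x, y) * cos (t (x, y)) \<and> D (x, y) * cos (t (x, y)) \<le> M \<and> \<bar>tan (t (x, y))\<bar> \<le> M \<and> \<bar>c (x, y)\<bar> \<le> M \<and> \<bar>k (x, y)\<bar> \<le> M"
      using bM(2,4,7,9)[OF xy] low[OF _ bM(6)[OF xy]] by (simp add: abs_le_iff)
    show "((\<lambda>y. k (x, y)) has_real_derivative c (x, y)) (at y)" by (rule dk[OF xa])
    have eq: "D (x, y) * cos (t (x, y)) * tan (t (x, y)) = D (x, y) * sin (t (x, y))"
      using cp[OF xa] by (simp add: tan_def)
    show "(\<Phi> has_derivative (\<lambda>(p, r). (k (x, y) - D (x, y) * cos (t (x, y)) * tan (t (x, y))) * p + D (x, y) * cos (t (x, y)) * r)) (at (x, y))"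
      unfolding eq by (rule d\<Phi>[OF xa])
  qed
  \<comment> \<open>The curves of N are graphs x = X y with slope - tan t. With the coordinates
    exchanged, the form that vanishes along them is cos t dx + sin t dy, so the dual form becomes
    the transported one.\<close>
  interpret N: transport b M "1 / M" "\<lambda>(y, x). cos (t (x, y))" "\<lambda>(y, x). - tan (t (x, y))" "\<lambda>(y, x). H (x, y)"
    "\<lambda>(y, x). - f (x, y)" "\<lambda>(y, x). \<kappa> (x, y)"
  proof
    show "0 < b" "0 < 1 / M" using b M by auto
    show "continuous_on ({-b<..<b} \<times> {-b<..<b}) (\<lambda>(y, x). cos (t (x, y)))" by (rule continuous_on_swap[OF cb[OF cc(1)]])
    show "continuous_on ({-b<..<b} \<times> {-b<..<b}) (\<lambda>(y, x). - tan (t (x, y)))"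
      by (rule continuous_on_swap[of _ "\<lambda>z. - tan (t z)"]) (intro continuous_intros cb[OF cc(4)])
    show "continuous_on ({-b<..<b} \<times> {-b<..<b}) (\<lambda>(y, x). H (x, y))" by (rule continuous_on_swap[OF cb[OF cont(4)]])
    show "continuous_on ({-b<..<b} \<times> {-b<..<b}) (\<lambda>(y, x). \<kappa> (x, y))" by (rule continuous_on_swap[OF cb[OF cont(7)]])
    fix y x assume yx: "\<bar>y\<bar> < b" "\<bar>x\<bar> < b"
    then have xa: "\<bar>x\<bar> < a" "\<bar>y\<bar> < a" using b by auto
    show "1 / M \<le> (case (y, x) of (y, x) \<Rightarrow> cos (t (x, y))) \<and> (case (y, x) of (y, x) \<Rightarrow> cos (t (x, y))) \<le> M \<and>
      \<bar>case (y, x) of (y, x) \<Rightarrow> - tan (t (x, y))\<bar> \<le> M \<and> \<bar>case (y, x) of (y, x) \<Rightarrow> H (x, y)\<bar> \<le> M \<and> \<bar>case (y, x) of (y, x) \<Rightarrow> \<kappa> (x, y)\<bar> \<le> M"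
      using bM(1,4,8,10)[OF yx(2,1)] low[OF cp[OF xa] bM(5)[OF yx(2,1)]] by (simp add: abs_le_iff)
    show "((\<lambda>x. case (y, x) of (y, x) \<Rightarrow> \<kappa> (x, y)) has_real_derivative (case (y, x) of (y, x) \<Rightarrow> H (x, y))) (at x)"
      using \<kappa>x[OF xa] by simp
    have ct: "cos (t (x, y)) * tan (t (x, y)) = sin (t (x, y))" using cp[OF xa] by (simp add: tan_def)
    have "((\<lambda>(y, x). - f (x, y)) has_derivative (\<lambda>(p, r). (\<lambda>(y, x). sin (t (x, y)) + \<kappa> (x, y)) (y, x) * p + cos (t (x, y)) * r)) (at (y, x))"
    proof (rule has_derivative_from_partials[where S = "{-b<..<b} \<times> {-b<..<b}"])
      show "((\<lambda>y. case (y, x) of (y, x) \<Rightarrow> - f (x, y)) has_real_derivative (\<lambda>(y, x). sin (t (x, y)) + \<kappa> (x, y)) (y, x)) (at y)"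
        if "(y, x) \<in> {-b<..<b} \<times> {-b<..<b}" for y x
      proof -
        have "\<bar>x\<bar> < a" "\<bar>y\<bar> < a" using that b by auto
        then have "((\<lambda>y. f (x, y)) has_real_derivative - sin (t (x, y)) - \<kappa> (x, y)) (at y)" by (rule fy)
        from DERIV_minus[OF this] show ?thesis by (simp add: add.commute)
      qed
      show "continuous_on ({-b<..<b} \<times> {-b<..<b}) (\<lambda>(y, x). sin (t (x, y)) + \<kappa> (x, y))"
        by (rule continuous_on_swap[of _ "\<lambda>z. sin (t z) + \<kappa> z"]) (intro continuous_intros cb[OF cont(1)] cb[OF cont(7)])
      have "((\<lambda>x. f (x, y)) has_real_derivative - cos (t (x, y))) (at x)" by (rule fx[OF xa])
      from DERIV_minus[OF this]
      show "((\<lambda>x. case (y, x) of (y, x) \<Rightarrow> - f (x, y)) has_real_derivative cos (t (x, y))) (at x)" by simp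
    qed (use yx in \<open>auto simp: open_Times\<close>)
    then show "((\<lambda>(y, x). - f (x, y)) has_derivative (\<lambda>(p, r). ((case (y, x) of (y, x) \<Rightarrow> \<kappa> (x, y)) -
        (case (y, x) of (y, x) \<Rightarrow> cos (t (x, y))) * (case (y, x) of (y, x) \<Rightarrow> - tan (t (x, y)))) * p
        + (case (y, x) of (y, x) \<Rightarrow> cos (t (x, y))) * r)) (at (y, x))"
      by (simp add: ct add.commute)
  qed
  \<comment> \<open>Weighting this form by \<open>H\<close> yields the exterior derivative cos t
    (N(H) / cos t) + H H. This is the origin of \<open>K\<close>; the division by cos t appears
    because the derivative along the graph is taken in y.\<close>
  have "\<exists>\<rho> f \<kappa>. 0 < \<rho> \<and> \<rho> \<le> b \<and> continuous_on ({-\<rho><..<\<rho>} \<times> {-\<rho><..<\<rho>}) \<kappa> \<and>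
    (\<forall>y x. \<bar>y\<bar> < \<rho> \<longrightarrow> \<bar>x\<bar> < \<rho> \<longrightarrow>
      ((\<lambda>x. f (y, x)) has_real_derivative (\<lambda>(y, x). H (x, y)) (y, x) * (\<lambda>(y, x). cos (t (x, y))) (y, x)) (at x) \<and>
      ((\<lambda>y. f (y, x)) has_real_derivative \<kappa> (y, x) - (\<lambda>(y, x). H (x, y)) (y, x) * (\<lambda>(y, x). cos (t (x, y))) (y, x) * (\<lambda>(y, x). - tan (t (x, y))) (y, x)) (at y) \<and>
      ((\<lambda>x. \<kappa> (y, x)) has_real_derivative (\<lambda>(y, x). cos (t (x, y))) (y, x) * (\<lambda>(y, x). NH (x, y) / cos (t (x, y))) (y, x)
         + (\<lambda>(y, x). H (x, y)) (y, x) * (\<lambda>(y, x). H (x, y)) (y, x)) (at x))"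
  proof (rule N.weighted_form_potential)
    show "continuous_on ({-b<..<b} \<times> {-b<..<b}) (\<lambda>(y, x). H (x, y))" by (rule continuous_on_swap[OF cb[OF cont(4)]])
    show "continuous_on ({-b<..<b} \<times> {-b<..<b}) (\<lambda>(y, x). NH (x, y) / cos (t (x, y)))"
      by (rule continuous_on_swap[OF cb[OF cc(7)]])
    fix r X y assume X: "N.sol r X" "r \<le> b" "\<bar>y\<bar> < r"
    have "((\<lambda>y. H (X y, y)) has_real_derivative NH (X y, y) / cos (t (X y, y))) (at y)"
      by (rule dH[OF _ _ X(3)]) (use X b in \<open>auto simp: N.sol_def\<close>)
    then show "((\<lambda>y. case (y, X y) of (y, x) \<Rightarrow> H (x, y)) has_real_derivative (case (y, X y) of (y, x) \<Rightarrow> NH (x, y) / cos (t (x, y)))) (at y)"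
      by simp
  qed
  then obtain \<rho>1 f2 \<kappa>2 where \<rho>1: "0 < \<rho>1" "\<rho>1 \<le> b" and c\<kappa>2: "continuous_on ({-\<rho>1<..<\<rho>1} \<times> {-\<rho>1<..<\<rho>1}) \<kappa>2"
    and f2: "\<And>y x. \<bar>y\<bar> < \<rho>1 \<Longrightarrow> \<bar>x\<bar> < \<rho>1 \<Longrightarrow>
      ((\<lambda>x. f2 (y, x)) has_real_derivative H (x, y) * cos (t (x, y))) (at x) \<and>
      ((\<lambda>y. f2 (y, x)) has_real_derivative \<kappa>2 (y, x) + H (x, y) * cos (t (x, y)) * tan (t (x, y))) (at y) \<and>
      ((\<lambda>x. \<kappa>2 (y, x)) has_real_derivative cos (t (x, y)) * (NH (x, y) / cos (t (x, y))) + H (x, y) * H (x, y)) (at x)"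
    unfolding prod.case mult_minus_right diff_minus_eq_add by blast
  define \<rho>2 where "\<rho>2 = \<rho>1 / 2"
  have \<rho>2: "0 < \<rho>2" "\<rho>2 < \<rho>1" "\<rho>2 < a" "\<rho>2 \<le> b" using \<rho>1 b by (auto simp: \<rho>2_def)
  have sub1: "{-\<rho>1<..<\<rho>1} \<times> {-\<rho>1<..<\<rho>1} \<subseteq> B" using \<rho>1 b by (auto simp: B_def)
  have sub2: "{-\<rho>2<..<\<rho>2} \<times> {-\<rho>2<..<\<rho>2} \<subseteq> B" using \<rho>2 b by (auto simp: B_def)
  \<comment> \<open>Since the coordinates were exchanged, the correction sits in the dy part. It is
    moved to the dx part, the shape in which it can be differenced between neighbouring graphs over
    the x-axis.\<close>
  have "\<exists>\<Theta> l. continuous_on ({-\<rho>2<..<\<rho>2} \<times> {-\<rho>2<..<\<rho>2}) l \<and> (\<forall>x y. \<bar>x\<bar> < \<rho>2 \<longrightarrow> \<bar>y\<bar> < \<rho>2 \<longrightarrow>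
     (\<Theta> has_derivative (\<lambda>(p, r). (l (x, y) + - (H (x, y) * cos (t (x, y)))) * p + (- H (x, y) * sin (t (x, y))) * r)) (at (x, y)) \<and>
     ((\<lambda>y. l (x, y)) has_real_derivative K (x, y)) (at y))"
  proof (rule change_gauge[OF \<rho>2(1,2), where f = "\<lambda>(x, y). - f2 (y, x)" and \<kappa> = "\<lambda>(x, y). \<kappa>2 (y, x)"])
    fix x y assume xy: "\<bar>x\<bar> < \<rho>1" "\<bar>y\<bar> < \<rho>1"
    then have xa: "\<bar>x\<bar> < a" "\<bar>y\<bar> < a" using \<rho>1 b by auto
    note F = f2[OF xy(2,1)]
    show "((\<lambda>x. case (x, y) of (x, y) \<Rightarrow> - f2 (y, x)) has_real_derivative - (H (x, y) * cos (t (x, y)))) (at x)"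
      using DERIV_minus[OF F[THEN conjunct1]] by simp
    show "((\<lambda>y. case (x, y) of (x, y) \<Rightarrow> - f2 (y, x)) has_real_derivative - H (x, y) * sin (t (x, y)) - (case (x, y) of (x, y) \<Rightarrow> \<kappa>2 (y, x))) (at y)"
      unfolding prod.case
      by (rule DERIV_cong[OF DERIV_minus[OF F[THEN conjunct2, THEN conjunct1]]]) (use cp[OF xa] in \<open>simp add: tan_def\<close>)
    show "((\<lambda>x. case (x, y) of (x, y) \<Rightarrow> \<kappa>2 (y, x)) has_real_derivative K (x, y)) (at x)"
      using F[THEN conjunct2, THEN conjunct2] cp[OF xa] by (simp add: K_def power2_eq_square add.commute)
  next
    show "continuous_on ({-\<rho>1<..<\<rho>1} \<times> {-\<rho>1<..<\<rho>1}) (\<lambda>z. - (H z * cos (t z)))"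
      by (intro continuous_intros continuous_on_subset[OF cont(4) sub1] continuous_on_subset[OF cont(1) sub1])
    show "continuous_on ({-\<rho>1<..<\<rho>1} \<times> {-\<rho>1<..<\<rho>1}) K" by (rule continuous_on_subset[OF cc(3) sub1])
    show "continuous_on ({-\<rho>1<..<\<rho>1} \<times> {-\<rho>1<..<\<rho>1}) (\<lambda>(x, y). \<kappa>2 (y, x))" by (rule continuous_on_swap[OF c\<kappa>2])
  qed
  then obtain \<Theta> l where cl: "continuous_on ({-\<rho>2<..<\<rho>2} \<times> {-\<rho>2<..<\<rho>2}) l"
    and \<Theta>: "\<And>x y. \<bar>x\<bar> < \<rho>2 \<Longrightarrow> \<bar>y\<bar> < \<rho>2 \<Longrightarrow> (\<Theta> has_derivative
      (\<lambda>(p, r). (l (x, y) - H (x, y) * cos (t (x, y))) * p + (- H (x, y) * sin (t (x, y))) * r)) (at (x, y))"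
    and dl: "\<And>x y. \<bar>x\<bar> < \<rho>2 \<Longrightarrow> \<bar>y\<bar> < \<rho>2 \<Longrightarrow> ((\<lambda>y. l (x, y)) has_real_derivative K (x, y)) (at y)"
    unfolding add_uminus_conv_diff by blast
  \<comment> \<open>The same change for the unweighted dual form, to reach the shape that
    \<open>sin_angle_deriv\<close> expects.\<close>
  have "\<exists>\<Psi> l. continuous_on ({-\<rho>2<..<\<rho>2} \<times> {-\<rho>2<..<\<rho>2}) l \<and> (\<forall>x y. \<bar>x\<bar> < \<rho>2 \<longrightarrow> \<bar>y\<bar> < \<rho>2 \<longrightarrow>
     (\<Psi> has_derivative (\<lambda>(p, r). (l (x, y) + - cos (t (x, y))) * p + (- sin (t (x, y))) * r)) (at (x, y)) \<and>
     ((\<lambda>y. l (x, y)) has_real_derivative H (x, y)) (at y))"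
    by (rule change_gauge[OF \<rho>2(1,3) fx fy \<kappa>x])
       (use cont cc(1) in \<open>auto simp: B_def[symmetric] intro!: continuous_intros\<close>)
  then obtain \<Psi> l1 where \<Psi>: "\<And>x y. \<bar>x\<bar> < \<rho>2 \<Longrightarrow> \<bar>y\<bar> < \<rho>2 \<Longrightarrow> (\<Psi> has_derivative
      (\<lambda>(p, r). (l1 (x, y) - cos (t (x, y))) * p - sin (t (x, y)) * r)) (at (x, y))"
    and dl1: "\<And>x y. \<bar>x\<bar> < \<rho>2 \<Longrightarrow> \<bar>y\<bar> < \<rho>2 \<Longrightarrow> ((\<lambda>y. l1 (x, y)) has_real_derivative H (x, y)) (at y)"
    unfolding mult_minus_left add_uminus_conv_diff by blast
  interpret A2: transport \<rho>2 M "1 / M" "\<lambda>z. D z * cos (t z)" "\<lambda>z. tan (t z)" c \<Phi> k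
    by (rule A.restrict[OF \<rho>2(1,4)])
  interpret R: riccati \<rho>2 M "1 / M" D t c \<Phi> k H K \<Theta> l
  proof
    show "continuous_on ({-\<rho>2<..<\<rho>2} \<times> {-\<rho>2<..<\<rho>2}) t" by (rule continuous_on_subset[OF cont(1) sub2])
    show cH: "continuous_on ({-\<rho>2<..<\<rho>2} \<times> {-\<rho>2<..<\<rho>2}) H" by (rule continuous_on_subset[OF cont(4) sub2])
    show "continuous_on ({-\<rho>2<..<\<rho>2} \<times> {-\<rho>2<..<\<rho>2}) K" by (rule continuous_on_subset[OF cc(3) sub2])
    show "continuous_on ({-\<rho>2<..<\<rho>2} \<times> {-\<rho>2<..<\<rho>2}) l" by (rule cl)
    show "\<bar>t (x, y)\<bar> < pi / 2 \<and> \<bar>H (x, y)\<bar> \<le> M \<and> \<bar>K (x, y)\<bar> \<le> M" if "\<bar>x\<bar> < \<rho>2" "\<bar>y\<bar> < \<rho>2" for x y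
      using tD[of x y] bM[of x y] that \<rho>2 by auto
    show "((\<lambda>x. sin (t (x, Y x))) has_real_derivative - H (x, Y x)) (at x)" if "A2.sol r Y" "r \<le> \<rho>2" "\<bar>x\<bar> < r" for r Y x
    proof (rule sin_angle_deriv[where a = \<rho>2, OF _ cH _ \<Psi> dl1 _ that(2,3)])
      show "continuous_on ({-\<rho>2<..<\<rho>2} \<times> {-\<rho>2<..<\<rho>2}) t" by (rule continuous_on_subset[OF cont(1) sub2])
      show "cos (t (x, y)) > 0" if "\<bar>x\<bar> < \<rho>2" "\<bar>y\<bar> < \<rho>2" for x y using cp[of x y] that \<rho>2 by auto
      show "\<bar>Y x\<bar> < \<rho>2 \<and> (Y has_real_derivative tan (t (x, Y x))) (at x)" if "\<bar>x\<bar> < r" for x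
        using A2.solD[OF \<open>A2.sol r Y\<close> that] by simp
    qed
  qed (rule \<Theta> dl; assumption)+
  show thesis
  proof (rule R.riccati_local)
    fix \<rho> r w assume \<rho>: "0 < \<rho>" "\<rho> \<le> r" "r \<le> \<rho>2" and cw: "continuous_on ({-\<rho><..<\<rho>} \<times> {-\<rho><..<\<rho>}) w"
      and ex: "\<And>x y. \<bar>x\<bar> < \<rho> \<Longrightarrow> \<bar>y\<bar> < \<rho> \<Longrightarrow> \<exists>Y. A2.sol r Y \<and> Y x = y"
      and dw: "\<And>Y x. A2.sol r Y \<Longrightarrow> \<bar>x\<bar> < \<rho> \<Longrightarrow> \<bar>Y x\<bar> < \<rho> \<Longrightarrow>
      ((\<lambda>x. D (x, Y x)) has_real_derivative (c (x, Y x) - D (x, Y x) * w (x, Y x)) / cos (t (x, Y x))) (at x) \<and>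
      ((\<lambda>x. w (x, Y x)) has_real_derivative - (K (x, Y x) + (w (x, Y x))\<^sup>2) / cos (t (x, Y x))) (at x)"
    show thesis
    proof (rule that[OF \<rho>(1) _ cw])
      show "\<rho> \<le> a" using \<rho> \<rho>2 by linarith
      fix \<xi> \<eta> assume 0: "\<bar>\<xi> 0\<bar> < \<rho>" "\<bar>\<eta> 0\<bar> < \<rho>"
        and ev: "\<forall>\<^sub>F \<tau> in nhds 0. (\<xi> has_real_derivative cos (t (\<xi> \<tau>, \<eta> \<tau>))) (at \<tau>) \<and>
          (\<eta> has_real_derivative sin (t (\<xi> \<tau>, \<eta> \<tau>))) (at \<tau>)"
      obtain Y where Y: "A2.sol r Y" "Y (\<xi> 0) = \<eta> 0" using ex[OF 0] by blast
      have d0: "(\<xi> has_real_derivative cos (t (\<xi> 0, \<eta> 0))) (at 0)" "(\<eta> has_real_derivative sin (t (\<xi> 0, \<eta> 0))) (at 0)"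
        using eventually_nhds_x_imp_x[OF ev] by auto
      have near: "\<forall>\<^sub>F \<tau> in nhds 0. \<bar>g \<tau>\<bar> < \<rho>" if g: "isCont g 0" "\<bar>g 0\<bar> < \<rho>" for g :: "real \<Rightarrow> real"
      proof -
        have "(g \<longlongrightarrow> g 0) (nhds 0)" using g(1) unfolding isCont_def tendsto_at_iff_tendsto_nhds .
        from order_tendstoD(2)[OF tendsto_rabs[OF this] g(2)] show ?thesis .
      qed
      note n1 = near[OF DERIV_isCont[OF d0(1)] 0(1)] and n2 = near[OF DERIV_isCont[OF d0(2)] 0(2)]
      from eventually_conj[OF ev eventually_conj[OF n1 n2]] have "\<forall>\<^sub>F \<tau> in nhds 0. ((\<xi> has_real_derivative cos (t (\<xi> \<tau>, \<eta> \<tau>))) (at \<tau>) \<and>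
          (\<eta> has_real_derivative sin (t (\<xi> \<tau>, \<eta> \<tau>))) (at \<tau>)) \<and> \<bar>\<xi> \<tau>\<bar> < \<rho> \<and> \<bar>\<eta> \<tau>\<bar> < \<rho>"
        .
      then obtain \<epsilon> where \<epsilon>: "\<epsilon> > 0" and E: "\<And>\<tau>. \<bar>\<tau>\<bar> < \<epsilon> \<Longrightarrow> (\<xi> has_real_derivative cos (t (\<xi> \<tau>, \<eta> \<tau>))) (at \<tau>) \<and>
          (\<eta> has_real_derivative sin (t (\<xi> \<tau>, \<eta> \<tau>))) (at \<tau>) \<and> \<bar>\<xi> \<tau>\<bar> < \<rho> \<and> \<bar>\<eta> \<tau>\<bar> < \<rho>"
        unfolding eventually_nhds_metric dist_real_def by auto
      \<comment> \<open>Every integral curve stays on the graph of the one solution through its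
        starting point. Hence the derivatives obtained do not depend on the chosen integral
        curve.\<close>
      have eq: "\<eta> \<tau> = Y (\<xi> \<tau>)" if \<tau>: "\<bar>\<tau>\<bar> < \<epsilon>" for \<tau>
      proof (rule A2.curve_on_sol[OF Y(1) \<rho>(3) \<tau>, where \<xi>' = "\<lambda>\<tau>. cos (t (\<xi> \<tau>, \<eta> \<tau>))"])
        show "\<bar>\<xi> \<tau>\<bar> < r \<and> (\<xi> has_real_derivative cos (t (\<xi> \<tau>, \<eta> \<tau>))) (at \<tau>) \<and> \<bar>cos (t (\<xi> \<tau>, \<eta> \<tau>))\<bar> \<le> 1"
          if "\<bar>\<tau>\<bar> < \<epsilon>" for \<tau> using E[OF that] \<rho> by auto
        show "\<bar>\<eta> \<tau>\<bar> < \<rho>2 \<and> (\<eta> has_real_derivative tan (t (\<xi> \<tau>, \<eta> \<tau>)) * cos (t (\<xi> \<tau>, \<eta> \<tau>))) (at \<tau>)"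
          if "\<bar>\<tau>\<bar> < \<epsilon>" for \<tau>
        proof -
          have "cos (t (\<xi> \<tau>, \<eta> \<tau>)) > 0" by (rule cp) (use E[OF that] \<rho> \<rho>2 in auto)
          then show ?thesis using E[OF that] \<rho> by (simp add: tan_def)
        qed
      qed (use Y in auto)
      have c0: "cos (t (\<xi> 0, \<eta> 0)) > 0" by (rule cp) (use 0 \<rho> \<rho>2 in auto)
      have dY: "((\<lambda>x. D (x, Y x)) has_real_derivative (c (\<xi> 0, \<eta> 0) - D (\<xi> 0, \<eta> 0) * w (\<xi> 0, \<eta> 0)) / cos (t (\<xi> 0, \<eta> 0))) (at (\<xi> 0))"
        "((\<lambda>x. w (x, Y x)) has_real_derivative - (K (\<xi> 0, \<eta> 0) + (w (\<xi> 0, \<eta> 0))\<^sup>2) / cos (t (\<xi> 0, \<eta> 0))) (at (\<xi> 0))"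
        using dw[OF Y(1) 0(1)] 0(2) by (auto simp: Y(2))
      \<comment> \<open>The horizontal speed cos t cancels the factor 1 / cos t.\<close>
      have "((\<lambda>\<tau>. D (\<xi> \<tau>, Y (\<xi> \<tau>))) has_real_derivative c (\<xi> 0, \<eta> 0) - D (\<xi> 0, \<eta> 0) * w (\<xi> 0, \<eta> 0)) (at 0)"
        "((\<lambda>\<tau>. w (\<xi> \<tau>, Y (\<xi> \<tau>))) has_real_derivative - (K (\<xi> 0, \<eta> 0) + (w (\<xi> 0, \<eta> 0))\<^sup>2)) (at 0)"
        using DERIV_chain2[OF dY(1) d0(1)] DERIV_chain2[OF dY(2) d0(1)] c0 by simp_all
      then have "((\<lambda>\<tau>. D (\<xi> \<tau>, \<eta> \<tau>)) has_real_derivative c (\<xi> 0, \<eta> 0) - D (\<xi> 0, \<eta> 0) * w (\<xi> 0, \<eta> 0)) (at 0)"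
        "((\<lambda>\<tau>. w (\<xi> \<tau>, \<eta> \<tau>)) has_real_derivative - (K (\<xi> 0, \<eta> 0) + (w (\<xi> 0, \<eta> 0))\<^sup>2)) (at 0)"
        using eq \<epsilon> by (auto elim!: has_field_derivative_transform_within_open[where S = "{-\<epsilon><..<\<epsilon>}"])
      then show "((\<lambda>\<tau>. D (\<xi> \<tau>, \<eta> \<tau>)) has_real_derivative c (\<xi> 0, \<eta> 0) - D (\<xi> 0, \<eta> 0) * w (\<xi> 0, \<eta> 0)) (at 0) \<and>
        ((\<lambda>\<tau>. w (\<xi> \<tau>, \<eta> \<tau>)) has_real_derivative
          - ((H (\<xi> 0, \<eta> 0))\<^sup>2 + NH (\<xi> 0, \<eta> 0) + (w (\<xi> 0, \<eta> 0))\<^sup>2)) (at 0)"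
        by (simp add: K_def)
    qed
  qed
qed

section \<open>Test functions and weak derivatives\<close>

text \<open>Quantifying the derivative existentially lets closure properties exhibit a derivative
  instead of computing with a derivative operator. Smoothness is the property for all
  \<open>k\<close>.\<close>

primrec differentiable_times :: "nat \<Rightarrow> (real \<Rightarrow> real) \<Rightarrow> bool" where
  "differentiable_times 0 f \<longleftrightarrow> continuous_on UNIV f"
| "differentiable_times (Suc k) f \<longleftrightarrow>
     (\<exists>f'. (\<forall>x. (f has_real_derivative f' x) (at x)) \<and> differentiable_times k f')"

lemma differentiable_times_SucI:
  "(\<And>x. (f has_real_derivative f' x) (at x)) \<Longrightarrow> differentiable_times k f' \<Longrightarrow> differentiable_times (Suc k) f"
  by auto

lemma differentiable_times_continuous:
  assumes "differentiable_times k f"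
  shows "continuous_on UNIV f"
proof (cases k)
  case 0
  then show ?thesis using assms by simp
next
  case (Suc n)
  then obtain f' where "\<forall>x. (f has_real_derivative f' x) (at x)" using assms by auto
  then show ?thesis by (intro continuous_at_imp_continuous_on) (auto intro: DERIV_isCont)
qed

lemma differentiable_times_Suc: "differentiable_times (Suc k) f \<Longrightarrow> differentiable_times k f"
proof (induction k arbitrary: f)
  case 0
  show ?case using differentiable_times_continuous[OF 0] by simp
next
  case (Suc k)
  then obtain f' where f': "\<forall>x. (f has_real_derivative f' x) (at x)" "differentiable_times (Suc k) f'"
    by (metis differentiable_times.simps(2))
  show ?case by (rule differentiable_times_SucI[OF f'(1)[rule_format] Suc.IH[OF f'(2)]])
qed

text \<open>Stated for linear combinations so that sums, differences and multiples are all covered.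
  Coefficients such as 1, -1 or 0 in later terms only serve to match this form.\<close>

lemma differentiable_times_add:
  "differentiable_times k f \<Longrightarrow> differentiable_times k g \<Longrightarrow> differentiable_times k (\<lambda>x. \<alpha> * f x + \<beta> * g x)"
proof (induction k arbitrary: f g)
  case 0
  then show ?case by (auto intro!: continuous_intros)
next
  case (Suc k)
  then obtain f' g' where d: "\<forall>x. (f has_real_derivative f' x) (at x)" "differentiable_times k f'"
    "\<forall>x. (g has_real_derivative g' x) (at x)" "differentiable_times k g'" by auto
  have "((\<lambda>x. \<alpha> * f x + \<beta> * g x) has_real_derivative \<alpha> * f' x + \<beta> * g' x) (at x)" for x
    using d by (intro DERIV_add DERIV_cmult) auto
  then show ?case by (rule differentiable_times_SucI[OF _ Suc.IH[OF d(2,4)]])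
qed

lemma differentiable_times_mult:
  "differentiable_times k f \<Longrightarrow> differentiable_times k g \<Longrightarrow> differentiable_times k (\<lambda>x. f x * g x)"
proof (induction k arbitrary: f g)
  case 0
  then show ?case by (auto intro!: continuous_intros)
next
  case (Suc k)
  obtain f' g' where d: "\<forall>x. (f has_real_derivative f' x) (at x)" "differentiable_times k f'"
    "\<forall>x. (g has_real_derivative g' x) (at x)" "differentiable_times k g'" using Suc.prems by auto
  have "((\<lambda>x. f x * g x) has_real_derivative 1 * (f' x * g x) + 1 * (g' x * f x)) (at x)" for x
    using DERIV_mult[of f "f' x" x UNIV g "g' x"] d by simp
  moreover have "differentiable_times k (\<lambda>x. 1 * (f' x * g x) + 1 * (g' x * f x))"
    by (rule differentiable_times_add[OF Suc.IH[OF d(2) differentiable_times_Suc[OF Suc.prems(2)]]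
      Suc.IH[OF d(4) differentiable_times_Suc[OF Suc.prems(1)]]])
  ultimately show ?case by (rule differentiable_times_SucI)
qed

lemma differentiable_times_affine:
  "differentiable_times k f \<Longrightarrow> differentiable_times k (\<lambda>x. f (\<alpha> * x + \<beta>))"
proof (induction k arbitrary: f)
  case 0
  then show ?case by (auto intro!: continuous_on_compose2[of UNIV f] continuous_intros)
next
  case (Suc k)
  obtain f' where d: "\<forall>x. (f has_real_derivative f' x) (at x)" "differentiable_times k f'" using Suc.prems by auto
  have "((\<lambda>x. f (\<alpha> * x + \<beta>)) has_real_derivative \<alpha> * f' (\<alpha> * x + \<beta>) + 0 * f' (\<alpha> * x + \<beta>)) (at x)" for x
  proof -
    have "((\<lambda>x. \<alpha> * x + \<beta>) has_real_derivative \<alpha>) (at x)" by (auto intro!: derivative_eq_intros)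
    from DERIV_chain2[OF d(1)[rule_format] this] show ?thesis by (simp add: mult.commute)
  qed
  moreover have "differentiable_times k (\<lambda>x. \<alpha> * f' (\<alpha> * x + \<beta>) + 0 * f' (\<alpha> * x + \<beta>))"
    by (rule differentiable_times_add[OF Suc.IH[OF d(2)] Suc.IH[OF d(2)]])
  ultimately show ?case by (rule differentiable_times_SucI)
qed

text \<open>For \<open>n = 0\<close> the standard smooth function that is flat at \<open>0\<close>; the family is closed under
  differentiation up to linear combinations.\<close>

definition flat_exp :: "nat \<Rightarrow> real \<Rightarrow> real" where
  "flat_exp n x = (if x > 0 then (1 / x) ^ n * exp (- (1 / x)) else 0)"

lemma flat_exp_tendsto: "(flat_exp n \<longlongrightarrow> 0) (at 0)"
proof -
  have "((\<lambda>h::real. (\<lambda>y. y ^ n / exp y) (inverse h)) \<longlongrightarrow> 0) (at_right 0)"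
    by (rule filterlim_compose[OF tendsto_power_div_exp_0 filterlim_inverse_at_top_right])
  moreover have "\<forall>\<^sub>F h in at_right 0. (\<lambda>y. y ^ n / exp y) (inverse h) = flat_exp n h"
    unfolding eventually_at_right_field
    by (intro exI[of _ 1]) (auto simp: flat_exp_def exp_minus field_simps)
  ultimately have 1: "(flat_exp n \<longlongrightarrow> 0) (at_right 0)" by (rule Lim_transform_eventually)
  have "\<forall>\<^sub>F h in at_left 0. 0 = flat_exp n h"
    unfolding eventually_at_left_field by (intro exI[of _ "-1"]) (auto simp: flat_exp_def)
  then have "(flat_exp n \<longlongrightarrow> 0) (at_left 0)"
    by (rule Lim_transform_eventually[OF tendsto_const])
  with 1 show ?thesis by (simp add: filterlim_at_split)
qed

lemma flat_exp_deriv: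
  "(flat_exp n has_real_derivative 1 * flat_exp (n + 2) x + (- real n) * flat_exp (n + 1) x) (at x)"
proof -
  consider "x > 0" | "x < 0" | "x = 0" by linarith
  then show ?thesis
  proof cases
    case 1
    have "((\<lambda>x. (1 / x) ^ n * exp (- (1 / x))) has_real_derivative
      1 * flat_exp (n + 2) x + (- real n) * flat_exp (n + 1) x) (at x)"
    proof -
      have i: "((\<lambda>x. 1 / x) has_real_derivative (- ((1 / x) ^ 2))) (at x)"
        using 1 by (auto intro!: derivative_eq_intros simp: power2_eq_square)
      have "((\<lambda>x. (1 / x) ^ n * exp (- (1 / x))) has_real_derivative
        real n * (- ((1 / x) ^ 2) * (1 / x) ^ (n - Suc 0)) * exp (- (1 / x)) +
        exp (- (1 / x)) * (- (- ((1 / x) ^ 2))) * (1 / x) ^ n) (at x)"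
        by (intro DERIV_mult DERIV_power[OF i] DERIV_chain2[OF DERIV_exp] DERIV_minus i)
      moreover have "real n * (- (y ^ 2) * y ^ (n - Suc 0)) * E + E * (- (- (y ^ 2))) * y ^ n
          = 1 * (y ^ (n + 2) * E) + (- real n) * (y ^ (n + 1) * E)" for y E :: real
        by (cases n) (simp_all add: power2_eq_square algebra_simps)
      ultimately show ?thesis
        using 1 unfolding flat_exp_def by (simp only: if_True)
    qed
    then show ?thesis
      by (rule has_field_derivative_transform_within_open[where S = "{0<..}"]) (use 1 in \<open>auto simp: flat_exp_def\<close>)
  next
    case 2
    have "((\<lambda>x. 0) has_real_derivative 1 * flat_exp (n + 2) x + (- real n) * flat_exp (n + 1) x) (at x)"
      using 2 by (simp add: flat_exp_def)
    then show ?thesis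
      by (rule has_field_derivative_transform_within_open[where S = "{..<0}"]) (use 2 in \<open>auto simp: flat_exp_def\<close>)
  next
    case 3
    \<comment> \<open>The difference quotient at 0 is the next member of the family, so
      differentiability at 0 is the limit already established for n + 1.\<close>
    have eq: "flat_exp (n + 1) = (\<lambda>h. (flat_exp n h - flat_exp n 0) / (h - 0))"
      by (auto simp: flat_exp_def fun_eq_iff)
    have "(flat_exp n has_real_derivative 0) (at 0)"
      unfolding has_field_derivative_iff eq[symmetric] by (rule flat_exp_tendsto)
    then show ?thesis using 3 by (simp add: flat_exp_def)
  qed
qed

lemma differentiable_times_flat_exp: "differentiable_times k (flat_exp n)"
proof (induction k arbitrary: n)
  case 0
  show ?case unfolding differentiable_times.simps
    by (rule continuous_at_imp_continuous_on) (use DERIV_isCont[OF flat_exp_deriv] in blast)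
next
  case (Suc k)
  have "differentiable_times k (\<lambda>x. 1 * flat_exp (n + 2) x + (- real n) * flat_exp (n + 1) x)"
    by (intro differentiable_times_add Suc)
  then show ?case by (rule differentiable_times_SucI[OF flat_exp_deriv])
qed

text \<open>The second factor is the reflection of the first at 1 / 2, written as an affine argument
  to match \<open>differentiable_times_affine\<close>.\<close>

definition bump :: "real \<Rightarrow> real" where
  "bump x = flat_exp 0 x * flat_exp 0 ((-1) * x + 1)"

lemma bump_properties: "bump x \<ge> 0" "x \<le> 0 \<or> 1 \<le> x \<Longrightarrow> bump x = 0" "0 < x \<Longrightarrow> x < 1 \<Longrightarrow> bump x > 0"
  by (auto simp: bump_def flat_exp_def)

lemma differentiable_times_bump: "differentiable_times k bump"
  unfolding bump_def[abs_def]
  by (rule differentiable_times_mult[OF differentiable_times_flat_exp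
    differentiable_times_affine[OF differentiable_times_flat_exp]])

lemma smooth_step_exists:
  obtains S S' :: "real \<Rightarrow> real" where "\<And>k. differentiable_times k S" "\<And>x. (S has_real_derivative S' x) (at x)"
    "\<And>x. S' x \<ge> 0" "\<And>x. x \<le> 0 \<Longrightarrow> S x = 0" "\<And>x. x \<ge> 1 \<Longrightarrow> S x = 1" "\<And>x. x \<le> 0 \<or> 1 \<le> x \<Longrightarrow> S' x = 0"
    "continuous_on UNIV S'"
proof -
  have cb: "continuous_on A bump" for A
    using differentiable_times_continuous[OF differentiable_times_bump] continuous_on_subset by blast
  have int: "bump integrable_on {x..y}" for x y by (rule integrable_continuous_real[OF cb])
  define m where "m = integral {0..1} bump"
  have m: "m > 0"
  proof -
    have "m \<ge> 0" unfolding m_def by (rule integral_nonneg[OF int]) (auto simp: bump_properties)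
    moreover have "m \<noteq> 0"
    proof
      assume "m = 0"
      then have "(bump has_integral 0) {0..1}" using int unfolding m_def by (metis integrable_integral)
      then have "bump (1 / 2) = 0"
        by (intro has_integral_0_cbox_imp_0[of 0 1 bump "1 / 2"]) (auto intro: cb simp: bump_properties)
      then show False using bump_properties(3)[of "1 / 2"] by simp
    qed
    ultimately show ?thesis by simp
  qed
  define P where "P x = integral {0..x} bump" for x
  \<comment> \<open>For x < 0 the interval {0..x} is empty and \<open>P x\<close> is 0 by
    convention. The primitive based at - L agrees with \<open>P\<close> because \<open>bump\<close>
    vanishes left of 0, and it can be differentiated on both sides of 0.\<close>
  have Peq: "integral {-L..x} bump = P x" if "L \<ge> 0" "-L \<le> x" for L x
  proof (cases "x \<ge> 0")
    case True
    have "integral {-L..0} bump + integral {0..x} bump = integral {-L..x} bump"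
      by (rule Henstock_Kurzweil_Integration.integral_combine) (use that True int in auto)
    moreover have "integral {-L..0} bump = integral {-L..0} (\<lambda>_. 0)"
      by (rule integral_cong) (auto simp: bump_properties)
    ultimately show ?thesis by (simp add: P_def)
  next
    case False
    have "integral {-L..x} bump = integral {-L..x} (\<lambda>_. 0)"
      by (rule integral_cong) (use False in \<open>auto simp: bump_properties\<close>)
    then show ?thesis using False by (simp add: P_def)
  qed
  have dP: "(P has_real_derivative bump x) (at x)" for x
  proof -
    define L where "L = \<bar>x\<bar> + 1"
    have "((\<lambda>y. integral {-L..y} bump) has_real_derivative bump x) (at x)"
      by (rule integral_has_real_derivative_interior[where e = L, OF cb]) (auto simp: L_def)
    then show ?thesis
      by (rule has_field_derivative_transform_within_open[where S = "{-L<..<L}"])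
         (use Peq[of L] in \<open>auto simp: L_def\<close>)
  qed
  define S where "S x = (1 / m) * P x + 0 * P x" for x
  define S' where "S' x = (1 / m) * bump x + 0 * bump x" for x
  have dS: "(S has_real_derivative S' x) (at x)" for x
    unfolding S_def S'_def by (intro DERIV_add DERIV_cmult dP)
  show thesis
  proof (rule that)
    show "differentiable_times k S" for k
    proof (cases k)
      case 0
      show ?thesis unfolding 0 differentiable_times.simps
        by (rule continuous_at_imp_continuous_on) (use DERIV_isCont[OF dS] in blast)
    next
      case (Suc n)
      have "differentiable_times n S'"
        unfolding S'_def by (rule differentiable_times_add[OF differentiable_times_bump differentiable_times_bump])
      then show ?thesis unfolding Suc by (rule differentiable_times_SucI[OF dS])
    qed
    show "S' x \<ge> 0" for x using m bump_properties(1)[of x] by (simp add: S'_def)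
    show "S x = 0" if "x \<le> 0" for x
      using that by (cases "x = 0") (auto simp: S_def P_def)
    show "S x = 1" if "x \<ge> 1" for x
    proof -
      have "integral {0..1} bump + integral {1..x} bump = integral {0..x} bump"
        by (rule Henstock_Kurzweil_Integration.integral_combine) (use that int in auto)
      moreover have "integral {1..x} bump = integral {1..x} (\<lambda>_. 0)"
        by (rule integral_cong) (auto simp: bump_properties)
      ultimately show ?thesis using m by (simp add: S_def P_def m_def)
    qed
    show "S' x = 0" if "x \<le> 0 \<or> 1 \<le> x" for x using bump_properties(2)[OF that] by (simp add: S'_def)
    show "continuous_on UNIV S'" unfolding S'_def by (intro continuous_intros cb)
  qed (rule dS)
qed

text \<open>The test function is a difference of two steep smooth steps, so that its derivative is
  an approximate point mass at \<open>x1\<close> minus one at \<open>x2\<close>. After integration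
  by parts of the term with \<open>k\<close>, the averages of G = g - (primitive of k) near
  \<open>x1\<close> and near \<open>x2\<close> coincide, and continuity of \<open>G\<close> gives
  equality of its values.\<close>

lemma du_Bois_Reymond:
  fixes g k :: "real \<Rightarrow> real"
  assumes g: "continuous_on {a..b} g" and k: "continuous_on {a..b} k"
    and weak: "\<And>A A' a' b'. (\<And>n. differentiable_times n A) \<Longrightarrow> (\<And>x. (A has_real_derivative A' x) (at x)) \<Longrightarrow>
      continuous_on UNIV A' \<Longrightarrow> a < a' \<Longrightarrow> b' < b \<Longrightarrow> (\<And>x. x \<notin> {a'..b'} \<Longrightarrow> A x = 0) \<Longrightarrow>
      integral {a..b} (\<lambda>x. g x * A' x + k x * A x) = 0"
    and x: "a < x1" "x1 \<le> x2" "x2 < b"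
  shows "g x2 - g x1 = integral {x1..x2} k"
proof (cases "x1 = x2")
  case False
  then have x12: "x1 < x2" using x by simp
  show ?thesis
  proof (rule smooth_step_exists)
  fix S S' :: "real \<Rightarrow> real" assume S: "\<And>k. differentiable_times k S" "\<And>x. (S has_real_derivative S' x) (at x)"
    "\<And>x. S' x \<ge> 0" "\<And>x. x \<le> 0 \<Longrightarrow> S x = 0" "\<And>x. x \<ge> 1 \<Longrightarrow> S x = 1" "\<And>x. x \<le> 0 \<or> 1 \<le> x \<Longrightarrow> S' x = 0"
    "continuous_on UNIV S'"
  define G where "G x = g x - integral {a..x} k" for x
  have cG: "continuous_on {a..b} G"
    unfolding G_def by (intro continuous_intros g indefinite_integral_continuous_1[OF integrable_continuous_real[OF k]])
  define R where "R \<epsilon> y x = S' ((1 / \<epsilon>) * x + (- y / \<epsilon>)) / \<epsilon>" for \<epsilon> y x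
  define Z where "Z \<epsilon> y x = S ((1 / \<epsilon>) * x + (- y / \<epsilon>))" for \<epsilon> y x
  have arg: "(1 / \<epsilon>) * x + (- y / \<epsilon>) = (x - y) / \<epsilon>" for \<epsilon> x y :: real
    by (simp add: diff_divide_distrib)
  have dZ: "(Z \<epsilon> y has_real_derivative R \<epsilon> y x) (at x)" for \<epsilon> y x
  proof -
    have "((\<lambda>x. (1 / \<epsilon>) * x + (- y / \<epsilon>)) has_real_derivative 1 / \<epsilon>) (at x)"
      by (rule DERIV_cong[OF DERIV_add[OF DERIV_cmult[OF DERIV_ident] DERIV_const]]) simp
    from DERIV_chain2[OF S(2) this] show ?thesis by (simp add: Z_def[abs_def] R_def)
  qed
  have cR: "continuous_on A (R \<epsilon> y)" for A \<epsilon> y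
  proof -
    have "continuous_on A (\<lambda>x. (1 / \<epsilon>) * S' ((1 / \<epsilon>) * x + (- y / \<epsilon>)))"
      by (intro continuous_on_mult_left continuous_on_compose2[OF S(7)] continuous_intros) auto
    then show ?thesis by (simp add: R_def[abs_def])
  qed
  have approx: "\<bar>integral {a..b} (\<lambda>x. G x * R \<epsilon> y x) - G y\<bar> \<le> e"
    if y: "a < y" and \<epsilon>: "0 < \<epsilon>" "y + \<epsilon> < b" and osc: "\<And>x. x \<in> {y..y + \<epsilon>} \<Longrightarrow> \<bar>G x - G y\<bar> \<le> e" for y \<epsilon> e
  proof -
    have one: "(R \<epsilon> y has_integral 1) {a..b}"
    proof -
      have "(R \<epsilon> y has_integral Z \<epsilon> y b - Z \<epsilon> y a) {a..b}"
        by (rule fundamental_theorem_of_calculus)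
           (use dZ y \<epsilon> in \<open>auto simp flip: has_real_derivative_iff_has_vector_derivative intro: DERIV_subset\<close>)
      moreover have "Z \<epsilon> y b = 1" unfolding Z_def arg by (rule S(5)) (use \<epsilon> in \<open>simp add: pos_le_divide_eq\<close>)
      moreover have "Z \<epsilon> y a = 0" unfolding Z_def arg by (rule S(4)) (use \<epsilon> y in \<open>simp add: divide_le_0_iff\<close>)
      ultimately show ?thesis by simp
    qed
    have i1: "(\<lambda>x. G x * R \<epsilon> y x) integrable_on {a..b}" "(\<lambda>x. (G x - G y) * R \<epsilon> y x) integrable_on {a..b}"
      "(\<lambda>x. e * R \<epsilon> y x) integrable_on {a..b}"
      by (intro integrable_continuous_real continuous_intros cG cR)+
    have "integral {a..b} (\<lambda>x. (G x - G y) * R \<epsilon> y x) = integral {a..b} (\<lambda>x. G x * R \<epsilon> y x - G y * R \<epsilon> y x)"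
      by (simp add: left_diff_distrib)
    also have "\<dots> = integral {a..b} (\<lambda>x. G x * R \<epsilon> y x) - G y"
      using integral_diff[OF i1(1) integrable_on_cmult_left[OF has_integral_integrable[OF one], of "G y"]] one
      by (simp add: integral_unique)
    finally have eq: "integral {a..b} (\<lambda>x. G x * R \<epsilon> y x) - G y = integral {a..b} (\<lambda>x. (G x - G y) * R \<epsilon> y x)" by simp
    have "norm (integral {a..b} (\<lambda>x. (G x - G y) * R \<epsilon> y x)) \<le> integral {a..b} (\<lambda>x. e * R \<epsilon> y x)"
    proof (rule integral_norm_bound_integral[OF i1(2,3)])
      fix x assume "x \<in> {a..b}"
      have R0: "R \<epsilon> y x \<ge> 0" using S(3) \<epsilon> by (simp add: R_def)
      show "norm ((G x - G y) * R \<epsilon> y x) \<le> e * R \<epsilon> y x"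
      proof (cases "x \<in> {y..y + \<epsilon>}")
        case True
        then show ?thesis using osc[OF True] R0 by (simp add: abs_mult mult_right_mono)
      next
        case False
        then have "(x - y) / \<epsilon> \<le> 0 \<or> 1 \<le> (x - y) / \<epsilon>" using \<epsilon>
          by (auto simp: divide_le_0_iff pos_le_divide_eq)
        then have "R \<epsilon> y x = 0" unfolding R_def arg using S(6) by simp
        then show ?thesis by simp
      qed
    qed
    also have "\<dots> = e" using one by (simp add: integral_unique)
    finally show ?thesis unfolding eq by simp
  qed
  have le: "\<bar>G x1 - G x2\<bar> \<le> 2 * e" if e: "e > 0" for e
  proof -
    have ex: "\<exists>d>0. \<forall>x\<in>{a..b}. dist x y < d \<longrightarrow> dist (G x) (G y) < e" if "y \<in> {a..b}" for y
      using cG e that unfolding continuous_on_iff by blast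
    obtain d1 where d1: "d1 > 0" "\<forall>x\<in>{a..b}. dist x x1 < d1 \<longrightarrow> dist (G x) (G x1) < e"
      using ex[of x1] x by auto
    obtain d2 where d2: "d2 > 0" "\<forall>x\<in>{a..b}. dist x x2 < d2 \<longrightarrow> dist (G x) (G x2) < e"
      using ex[of x2] x by auto
    define \<mu> where "\<mu> = min (min d1 d2) (b - x2)"
    have \<mu>: "0 < \<mu>" "\<mu> \<le> d1" "\<mu> \<le> d2" "\<mu> \<le> b - x2" using d1 d2 x by (auto simp: \<mu>_def)
    define \<epsilon> where "\<epsilon> = \<mu> / 2"
    have \<epsilon>: "0 < \<epsilon>" "\<epsilon> < d1" "\<epsilon> < d2" "x2 + \<epsilon> < b"
      using \<mu> unfolding \<epsilon>_def by linarith+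
    have 1: "\<bar>integral {a..b} (\<lambda>x. G x * R \<epsilon> x1 x) - G x1\<bar> \<le> e"
    proof (rule approx)
      fix x assume "x \<in> {x1..x1 + \<epsilon>}"
      then have "x \<in> {a..b}" "dist x x1 < d1" using x \<epsilon> by (auto simp: dist_real_def)
      with d1(2) have "dist (G x) (G x1) < e" by blast
      then show "\<bar>G x - G x1\<bar> \<le> e" by (simp add: dist_real_def)
    qed (use x \<epsilon> in auto)
    have 2: "\<bar>integral {a..b} (\<lambda>x. G x * R \<epsilon> x2 x) - G x2\<bar> \<le> e"
    proof (rule approx)
      fix x assume "x \<in> {x2..x2 + \<epsilon>}"
      then have "x \<in> {a..b}" "dist x x2 < d2" using x \<epsilon> by (auto simp: dist_real_def)
      with d2(2) have "dist (G x) (G x2) < e" by blast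
      then show "\<bar>G x - G x2\<bar> \<le> e" by (simp add: dist_real_def)
    qed (use x \<epsilon> in auto)
    define A where "A x = 1 * Z \<epsilon> x1 x + (-1) * Z \<epsilon> x2 x" for x
    define A' where "A' x = 1 * R \<epsilon> x1 x + (-1) * R \<epsilon> x2 x" for x
    have dA: "(A has_real_derivative A' x) (at x)" for x
      unfolding A_def A'_def by (intro DERIV_add DERIV_cmult dZ)
    have Ax: "A x = 0" if "x \<notin> {x1..x2 + \<epsilon>}" for x
    proof -
      consider "x < x1" | "x > x2 + \<epsilon>" using \<open>x \<notin> {x1..x2 + \<epsilon>}\<close> by force
      then show ?thesis
      proof cases
        case 1
        then have "Z \<epsilon> x1 x = 0" "Z \<epsilon> x2 x = 0"
          unfolding Z_def arg using x \<epsilon> by (auto intro!: S(4) simp: divide_le_0_iff)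
        then show ?thesis by (simp add: A_def)
      next
        case 2
        then have "Z \<epsilon> x1 x = 1" "Z \<epsilon> x2 x = 1"
          unfolding Z_def arg using x \<epsilon> by (auto intro!: S(5) simp: pos_le_divide_eq)
        then show ?thesis by (simp add: A_def)
      qed
    qed
    have cA': "continuous_on B A'" for B unfolding A'_def by (intro continuous_intros cR)
    have cA: "continuous_on B A" for B
      by (rule continuous_at_imp_continuous_on) (use dA DERIV_isCont in blast)
    have w: "integral {a..b} (\<lambda>x. g x * A' x + k x * A x) = 0"
    proof (rule weak)
      show "differentiable_times n A" for n
        unfolding A_def Z_def
        by (rule differentiable_times_add[OF differentiable_times_affine[OF S(1)] differentiable_times_affine[OF S(1)]])
    qed (use dA cA' Ax x \<epsilon> in auto)
    \<comment> \<open>Integration by parts for the primitive of \<open>k\<close>; the boundary terms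
      vanish because \<open>A\<close> is supported in the interior.\<close>
    have parts: "((\<lambda>x. k x * A x + A' x * integral {a..x} k) has_integral integral {a..b} k * A b - integral {a..a} k * A a) {a..b}"
    proof (rule fundamental_theorem_of_calculus)
      fix x assume xx: "x \<in> {a..b}"
      have "((\<lambda>x. integral {a..x} k * A x) has_real_derivative k x * A x + A' x * integral {a..x} k) (at x within {a..b})"
        by (intro DERIV_mult integral_has_real_derivative[OF k xx] has_field_derivative_at_within[OF dA])
      then show "((\<lambda>x. integral {a..x} k * A x) has_vector_derivative k x * A x + A' x * integral {a..x} k) (at x within {a..b})"
        by (simp add: has_real_derivative_iff_has_vector_derivative)
    qed (use x in auto)
    have "A b = 0" "A a = 0" using Ax[of b] Ax[of a] x \<epsilon> by auto
    then have p0: "integral {a..b} (\<lambda>x. k x * A x + A' x * integral {a..x} k) = 0"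
      using integral_unique[OF parts] by simp
    have "integral {a..b} (\<lambda>x. G x * R \<epsilon> x1 x) - integral {a..b} (\<lambda>x. G x * R \<epsilon> x2 x)
      = integral {a..b} (\<lambda>x. G x * R \<epsilon> x1 x - G x * R \<epsilon> x2 x)"
      by (rule integral_diff[symmetric]) (intro integrable_continuous_real continuous_intros cG cR)+
    also have "\<dots> = integral {a..b} (\<lambda>x. (g x * A' x + k x * A x) - (k x * A x + A' x * integral {a..x} k))"
      by (rule integral_cong) (simp add: A'_def G_def algebra_simps)
    also have "\<dots> = 0"
      unfolding w p0[symmetric] using w p0 parts
      by (subst integral_diff) (auto intro!: integrable_continuous_real continuous_intros g k cA cA'
        indefinite_integral_continuous_1)
    finally show ?thesis using 1 2 by linarith
  qed
  have "\<bar>G x1 - G x2\<bar> \<le> 0"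
    by (rule field_le_epsilon) (use le[of "e / 2" for e] in force)
  then have "g x2 - g x1 = integral {a..x2} k - integral {a..x1} k" by (simp add: G_def)
  also have "\<dots> = integral {x1..x2} k"
  proof -
    have "k integrable_on {a..x2}"
      by (rule integrable_continuous_real[OF continuous_on_subset[OF k]]) (use x in auto)
    then have "integral {a..x1} k + integral {x1..x2} k = integral {a..x2} k"
      using x by (intro Henstock_Kurzweil_Integration.integral_combine) auto
    then show ?thesis by simp
  qed
  finally show ?thesis .
  qed
qed simp

section \<open>Orthonormal charts\<close>

lemma differentiable_times_deriv:
  assumes "\<And>n. differentiable_times n A" "\<And>x. (A has_real_derivative A' x) (at x)"
  shows "differentiable_times n A'"
proof -
  obtain f' where f': "\<forall>x. (A has_real_derivative f' x) (at x)" "differentiable_times n f'"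
    using assms(1)[of "Suc n"] by auto
  have "f' = A'" using f'(1) assms(2) DERIV_unique by blast
  then show ?thesis using f'(2) by simp
qed

lemma partial_deriv_eq:
  assumes "(f has_derivative f') (at x)"
  shows "partial_deriv i f x = f' (axis i 1)"
  unfolding partial_deriv_def using frechet_derivative_at[OF assms] by simp

lemma C_k_on_add:
  fixes \<phi> \<psi> :: "real^'n::finite \<Rightarrow> real"
  shows "C_k_on k UNIV \<phi> \<Longrightarrow> C_k_on k UNIV \<psi> \<Longrightarrow> C_k_on k UNIV (\<lambda>z. \<alpha> * \<phi> z + \<beta> * \<psi> z)"
proof (induction k arbitrary: \<phi> \<psi>)
  case 0
  then show ?case by (auto intro!: continuous_intros)
next
  case (Suc k)
  have d: "(\<phi> has_derivative frechet_derivative \<phi> (at z)) (at z)" "(\<psi> has_derivative frechet_derivative \<psi> (at z)) (at z)" for z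
    using Suc.prems by (auto simp: frechet_derivative_works)
  have s: "((\<lambda>z. \<alpha> * \<phi> z + \<beta> * \<psi> z) has_derivative
      (\<lambda>h. \<alpha> * frechet_derivative \<phi> (at z) h + \<beta> * frechet_derivative \<psi> (at z) h)) (at z)" for z
    by (intro has_derivative_add has_derivative_mult_right d)
  have p: "partial_deriv i (\<lambda>z. \<alpha> * \<phi> z + \<beta> * \<psi> z) = (\<lambda>z. \<alpha> * partial_deriv i \<phi> z + \<beta> * partial_deriv i \<psi> z)" for i
    using partial_deriv_eq[OF s] by (auto simp: partial_deriv_def fun_eq_iff)
  have "C_k_on k UNIV (\<lambda>z. \<alpha> * partial_deriv i \<phi> z + \<beta> * partial_deriv i \<psi> z)" for i
    by (rule Suc.IH) (use Suc.prems in auto)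
  then show ?case using s by (auto simp: p differentiable_def)
qed

lemma plane_product_derivative:
  fixes f e z p :: "real^'n::finite"
  assumes A: "\<And>x. (A has_real_derivative A' x) (at x)" and B: "\<And>x. (B has_real_derivative B' x) (at x)"
  shows "((\<lambda>z. A ((z - p) \<bullet> f) * B ((z - p) \<bullet> e)) has_derivative
    (\<lambda>h. (h \<bullet> f) * (A' ((z - p) \<bullet> f) * B ((z - p) \<bullet> e)) + (h \<bullet> e) * (A ((z - p) \<bullet> f) * B' ((z - p) \<bullet> e)))) (at z)"
proof -
  have l: "((\<lambda>z. (z - p) \<bullet> w) has_derivative (\<lambda>h. h \<bullet> w)) (at z)" for w :: "real^'n"
    by (auto intro!: derivative_eq_intros)
  have a: "((\<lambda>z. G ((z - p) \<bullet> w)) has_derivative (\<lambda>h. (h \<bullet> w) * G' ((z - p) \<bullet> w))) (at z)"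
    if "\<And>x. (G has_real_derivative G' x) (at x)" for G G' :: "real \<Rightarrow> real" and w
    by (rule has_derivative_eq_rhs[OF has_derivative_compose[OF l that[unfolded has_field_derivative_def]]])
       (simp add: mult.commute)
  show ?thesis
    by (rule has_derivative_eq_rhs[OF has_derivative_mult[OF a[OF A] a[OF B]]]) (simp add: algebra_simps fun_eq_iff)
qed

text \<open>Each partial derivative is a linear combination of two products of the same kind, so an
  induction over \<open>k\<close> for all \<open>A\<close> and \<open>B\<close> closes.\<close>

lemma C_k_on_plane_product:
  fixes f e p :: "real^'n::finite"
  shows "(\<And>n. differentiable_times n A) \<Longrightarrow> (\<And>n. differentiable_times n B) \<Longrightarrow>
    C_k_on k UNIV (\<lambda>z. A ((z - p) \<bullet> f) * B ((z - p) \<bullet> e))"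
proof (induction k arbitrary: A B)
  case 0
  have "continuous_on UNIV A" "continuous_on UNIV B" using 0[of 0] by simp_all
  then show ?case
    by (auto intro!: continuous_intros continuous_on_compose2[of UNIV A] continuous_on_compose2[of UNIV B])
next
  case (Suc k)
  obtain A' where A': "\<And>x. (A has_real_derivative A' x) (at x)" using Suc.prems(1)[of "Suc 0"] by auto
  obtain B' where B': "\<And>x. (B has_real_derivative B' x) (at x)" using Suc.prems(2)[of "Suc 0"] by auto
  note d = plane_product_derivative[OF A' B', of p f e]
  have p: "partial_deriv i (\<lambda>z. A ((z - p) \<bullet> f) * B ((z - p) \<bullet> e)) =
    (\<lambda>z. (f $ i) * (A' ((z - p) \<bullet> f) * B ((z - p) \<bullet> e)) + (e $ i) * (A ((z - p) \<bullet> f) * B' ((z - p) \<bullet> e)))" for i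
    using partial_deriv_eq[OF d] by (auto simp: fun_eq_iff inner_axis inner_commute)
  have "C_k_on k UNIV (\<lambda>z. (f $ i) * (A' ((z - p) \<bullet> f) * B ((z - p) \<bullet> e)) + (e $ i) * (A ((z - p) \<bullet> f) * B' ((z - p) \<bullet> e)))" for i
    by (rule C_k_on_add[OF Suc.IH[OF differentiable_times_deriv[OF Suc.prems(1) A'] Suc.prems(2)]
      Suc.IH[OF Suc.prems(1) differentiable_times_deriv[OF Suc.prems(2) B']]])
  then show ?case using d unfolding C_k_on.simps p differentiable_def by blast
qed

lemma gradient_plane_product:
  fixes f e z p :: "real^'n::finite"
  assumes "\<And>x. (A has_real_derivative A' x) (at x)" "\<And>x. (B has_real_derivative B' x) (at x)"
  shows "gradient (\<lambda>z. A ((z - p) \<bullet> f) * B ((z - p) \<bullet> e)) z =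
    (A' ((z - p) \<bullet> f) * B ((z - p) \<bullet> e)) *\<^sub>R f + (A ((z - p) \<bullet> f) * B' ((z - p) \<bullet> e)) *\<^sub>R e"
  using partial_deriv_eq[OF plane_product_derivative[OF assms, of p f e z]]
  by (simp add: gradient_def vec_eq_iff inner_axis inner_commute mult.commute)

lemma sum_2_vec:
  fixes z w :: "real^2"
  shows "z \<bullet> w = z $ 1 * w $ 1 + z $ 2 * w $ 2"
  by (simp add: inner_vec_def sum_2)

section \<open>Orthonormal frames and Lebesgue measure\<close>

definition frame :: "real^2 \<Rightarrow> real^2 \<Rightarrow> bool" where
  "frame f e \<longleftrightarrow> f \<bullet> f = 1 \<and> e \<bullet> e = 1 \<and> f \<bullet> e = 0"

lemma frameD:
  assumes "frame f e"
  shows "f \<bullet> f = 1" "e \<bullet> e = 1" "f \<bullet> e = 0" "e \<bullet> f = 0"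
  using assms by (auto simp: frame_def inner_commute[of e f])

definition chart :: "real^2 \<Rightarrow> real^2 \<Rightarrow> real^2 \<Rightarrow> real \<times> real \<Rightarrow> real^2" where
  "chart p f e = (\<lambda>(x, y). p + x *\<^sub>R f + y *\<^sub>R e)"

lemma continuous_chart: "continuous_on S (chart p f e)"
  unfolding chart_def case_prod_unfold by (intro continuous_intros)

lemma chart_coords:
  assumes "frame f e"
  shows "(chart p f e (x, y) - p) \<bullet> f = x" "(chart p f e (x, y) - p) \<bullet> e = y"
  using frameD[OF assms] by (simp_all add: chart_def inner_add_left)

lemma frame_orthogonal_transformation:
  assumes "frame f e"
  shows "orthogonal_transformation (\<lambda>z::real^2. z $ 1 *\<^sub>R f + z $ 2 *\<^sub>R e)"
  unfolding orthogonal_transformation_def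
proof (intro conjI allI)
  show "linear (\<lambda>z::real^2. z $ 1 *\<^sub>R f + z $ 2 *\<^sub>R e)"
    by (rule linearI) (simp_all add: algebra_simps)
  fix v w :: "real^2"
  show "(v $ 1 *\<^sub>R f + v $ 2 *\<^sub>R e) \<bullet> (w $ 1 *\<^sub>R f + w $ 2 *\<^sub>R e) = v \<bullet> w"
    using frameD[OF assms] by (simp add: inner_add_left inner_add_right sum_2_vec[of v w])
qed

lemma chart_inverse:
  assumes "frame f e"
  shows "chart p f e ((z - p) \<bullet> f, (z - p) \<bullet> e) = z"
proof -
  obtain v :: "real^2" where v: "v $ 1 *\<^sub>R f + v $ 2 *\<^sub>R e = z - p"
    using surjD[OF orthogonal_transformation_surj[OF frame_orthogonal_transformation[OF assms]], of "z - p"]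
    by (auto simp: eq_commute)
  have "chart p f e ((z - p) \<bullet> f, (z - p) \<bullet> e) = p + (v $ 1 *\<^sub>R f + v $ 2 *\<^sub>R e)"
    unfolding v[symmetric] chart_def using frameD[OF assms] by (simp add: inner_add_left)
  then show ?thesis unfolding v by simp
qed

text \<open>Lebesgue measure is determined by its values on boxes, and the preimage of a box is its
  image under the inverse isometry, which preserves measure.\<close>

lemma lborel_orthogonal:
  fixes T :: "real^2 \<Rightarrow> real^2"
  assumes T: "orthogonal_transformation T"
  shows "distr lborel borel T = lborel"
proof (rule lborel_eqI[symmetric])
  have T_meas: "T \<in> borel_measurable borel"
    using T by (intro borel_measurable_continuous_onI linear_continuous_on)
      (simp add: orthogonal_transformation_linear linear_conv_bounded_linear[symmetric])
  have bij: "bij T" by (rule orthogonal_transformation_bij[OF T])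
  fix l u :: "real^2" assume lu: "\<And>b. b \<in> Basis \<Longrightarrow> l \<bullet> b \<le> u \<bullet> b"
  have inv: "orthogonal_transformation (inv T)" by (rule orthogonal_transformation_inv[OF T])
  have eq: "T -` box l u = inv T ` box l u" by (rule bij_vimage_eq_inv_image[OF bij])
  have b: "box l u \<in> lmeasurable" by simp
  have "emeasure (distr lborel borel T) (box l u) = emeasure lborel (T -` box l u)"
    using T_meas by (simp add: emeasure_distr)
  also have "\<dots> = emeasure lebesgue (T -` box l u)"
  proof -
    have "T -` box l u \<in> sets borel"
      using measurable_sets[OF T_meas, of "box l u"] by simp
    then show ?thesis by simp
  qed
  also have "\<dots> = ennreal (measure lebesgue (inv T ` box l u))"
    unfolding eq using measurable_orthogonal_image[OF inv b] by (intro emeasure_eq_measure2)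
  also have "\<dots> = ennreal (measure lebesgue (box l u))" by (simp add: measure_orthogonal_image[OF inv b])
  also have "\<dots> = emeasure lebesgue (box l u)" using b by (intro emeasure_eq_measure2[symmetric])
  also have "\<dots> = (\<Prod>b\<in>Basis. (u - l) \<bullet> b)" using lu by simp
  finally show "emeasure (distr lborel borel T) (box l u) = (\<Prod>b\<in>Basis. (u - l) \<bullet> b)" .
qed simp

lemma Basis_real2: "(Basis :: (real^2) set) = {axis 1 1, axis 2 1}"
  by (auto simp: Basis_vec_def UNIV_2)

text \<open>The bridge between pairs, on which iterated integrals are taken, and vectors, on which
  the weak equation lives.\<close>

lemma lborel_pair_vec:
  "distr lborel borel (\<lambda>(x, y). x *\<^sub>R axis 1 1 + y *\<^sub>R axis 2 1 :: real^2) = lborel"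
proof (rule lborel_eqI[symmetric])
  let ?\<psi> = "\<lambda>(x, y). x *\<^sub>R axis 1 1 + y *\<^sub>R axis 2 1 :: real^2"
  have m: "?\<psi> \<in> borel_measurable borel"
    unfolding case_prod_unfold by (intro borel_measurable_continuous_onI continuous_intros)
  fix l u :: "real^2" assume le: "\<And>b. b \<in> Basis \<Longrightarrow> l \<bullet> b \<le> u \<bullet> b"
  have lu: "l $ 1 \<le> u $ 1" "l $ 2 \<le> u $ 2"
    using le[of "axis 1 1"] le[of "axis 2 1"] by (simp_all add: Basis_real2 inner_axis)
  have "emeasure (distr lborel borel ?\<psi>) (box l u) = emeasure lborel (?\<psi> -` box l u)"
    using m by (simp add: emeasure_distr)
  also have "?\<psi> -` box l u = box (l $ 1) (u $ 1) \<times> box (l $ 2) (u $ 2)"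
    by (auto simp: mem_box_cart forall_2 axis_def box_real)
  also have "\<dots> = box (l $ 1, l $ 2) (u $ 1, u $ 2)" by (auto simp: box_def Basis_prod_def)
  also have "emeasure lborel \<dots> = (\<Prod>b\<in>Basis. ((u $ 1, u $ 2) - (l $ 1, l $ 2)) \<bullet> b)"
    by (rule emeasure_lborel_box) (use lu in \<open>auto simp: Basis_prod_def\<close>)
  also have "(\<Prod>b\<in>Basis. ((u $ 1, u $ 2) - (l $ 1, l $ 2)) \<bullet> b) = (u $ 1 - l $ 1) * (u $ 2 - l $ 2)"
    by (simp add: Basis_prod_def)
  also have "\<dots> = (\<Prod>b\<in>Basis. (u - l) \<bullet> b)"
    by (simp add: Basis_real2 inner_axis axis_eq_axis)
  finally show "emeasure (distr lborel borel ?\<psi>) (box l u) = (\<Prod>b\<in>Basis. (u - l) \<bullet> b)" .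
qed simp

text \<open>The chart is composed of the identification of pairs with vectors, an orthogonal map and
  a translation, each of which preserves Lebesgue measure.\<close>

lemma lborel_chart:
  assumes "frame f e"
  shows "distr lborel borel (chart p f e) = lborel"
proof -
  let ?\<psi> = "\<lambda>(x, y). x *\<^sub>R axis 1 1 + y *\<^sub>R axis 2 1 :: real^2"
  let ?T = "\<lambda>z::real^2. z $ 1 *\<^sub>R f + z $ 2 *\<^sub>R e"
  have m: "?\<psi> \<in> borel_measurable borel" "?T \<in> borel_measurable borel" "(+) p \<in> borel_measurable borel"
    unfolding case_prod_unfold by (intro borel_measurable_continuous_onI continuous_intros)+
  have "chart p f e = (\<lambda>z. p + z) \<circ> (?T \<circ> ?\<psi>)"
    by (auto simp: chart_def fun_eq_iff axis_def)
  then have "distr lborel borel (chart p f e) = distr (distr (distr lborel borel ?\<psi>) borel ?T) borel ((+) p)"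
    using m by (simp add: distr_distr comp_assoc)
  also have "\<dots> = lborel"
    unfolding lborel_pair_vec lborel_orthogonal[OF frame_orthogonal_transformation[OF assms]] lborel_distr_plus ..
  finally show ?thesis .
qed

text \<open>The integrand vanishes off the square, so in coordinates the indicator of
  \<open>\<Omega>\<close> may be exchanged for that of a compact box. There continuity gives
  integrability and the iterated integral.\<close>

lemma set_integral_chart:
  fixes g :: "real^2 \<Rightarrow> real"
  assumes fe: "frame f e" and \<Omega>: "open \<Omega>" and g: "continuous_on \<Omega> g"
    and sub: "chart p f e ` ({-a..a} \<times> {-a..a}) \<subseteq> \<Omega>"
    and zero: "\<And>z. z \<in> \<Omega> \<Longrightarrow> z \<notin> chart p f e ` ({-a..a} \<times> {-a..a}) \<Longrightarrow> g z = 0"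
  shows "(LINT z : \<Omega> | lborel. g z) =
    integral {-a..a} (\<lambda>x. integral {-a..a} (\<lambda>y. g (chart p f e (x, y))))"
proof -
  have box: "cbox (-a, -a) (a, a) = {-a..a} \<times> {-a..a}" by (simp add: cbox_Pair_eq)
  have cg: "continuous_on (cbox (-a, -a) (a, a)) (\<lambda>q. g (chart p f e q))"
    unfolding box by (rule continuous_on_compose2[OF g continuous_chart sub])
  have ind: "indicator \<Omega> (chart p f e q) *\<^sub>R g (chart p f e q) = indicator (cbox (-a, -a) (a, a)) q *\<^sub>R g (chart p f e q)" for q
  proof (cases "q \<in> cbox (-a, -a) (a, a)")
    case True
    then have "chart p f e q \<in> \<Omega>" using sub unfolding box by blast
    then show ?thesis using True by simp
  next
    case False
    have inj: "inj (chart p f e)"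
      by (rule injI) (metis chart_coords[OF fe] prod.collapse)
    then have "chart p f e q \<notin> chart p f e ` ({-a..a} \<times> {-a..a})"
      using False unfolding box by (simp add: inj_image_mem_iff)
    then have "chart p f e q \<in> \<Omega> \<Longrightarrow> g (chart p f e q) = 0" by (rule zero[rotated])
    then show ?thesis using False by (cases "chart p f e q \<in> \<Omega>") auto
  qed
  have "(LINT z : \<Omega> | lborel. g z) = integral\<^sup>L (distr lborel borel (chart p f e)) (\<lambda>z. indicator \<Omega> z *\<^sub>R g z)"
    unfolding set_lebesgue_integral_def lborel_chart[OF fe] ..
  also have "\<dots> = integral\<^sup>L lborel (\<lambda>q. indicator \<Omega> (chart p f e q) *\<^sub>R g (chart p f e q))"
  proof (rule integral_distr)
    show "chart p f e \<in> measurable lborel borel"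
      using borel_measurable_continuous_onI[OF continuous_chart] by simp
    show "(\<lambda>z. indicator \<Omega> z *\<^sub>R g z) \<in> borel_measurable borel"
      by (rule borel_measurable_continuous_on_indicator) (use \<Omega> g in auto)
  qed
  also have "\<dots> = (LINT q : cbox (-a, -a) (a, a) | lborel. g (chart p f e q))"
    unfolding ind set_lebesgue_integral_def ..
  also have "\<dots> = integral (cbox (-a, -a) (a, a)) (\<lambda>q. g (chart p f e q))"
    by (rule set_borel_integral_eq_integral(2))
       (use borel_integrable_compact[OF compact_cbox cg] in \<open>simp add: set_integrable_def\<close>)
  also have "\<dots> = integral (cbox (-a) a) (\<lambda>x. integral (cbox (-a) a) (\<lambda>y. g (chart p f e (x, y))))"
    by (rule integral_prod_continuous[OF cg])
  finally show ?thesis by simp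
qed

section \<open>The weak equation in a chart\<close>

context
  fixes \<Omega> :: "(real^2) set" and F :: "real^2 \<Rightarrow> real^2" and H u :: "real^2 \<Rightarrow> real"
    and p f e :: "real^2" and a :: real
  assumes ws: "weak_solution \<Omega> F H u" and \<Omega>: "open \<Omega>" and ns: "singular_set \<Omega> F u = {}"
    and cH: "continuous_on \<Omega> H" and cN: "continuous_on \<Omega> (N_field F u)"
    and fe: "frame f e" and sub: "chart p f e ` ({-a..a} \<times> {-a..a}) \<subseteq> \<Omega>"
begin

abbreviation (input) n1 :: "real \<Rightarrow> real \<Rightarrow> real" where "n1 x y \<equiv> N_field F u (chart p f e (x, y)) \<bullet> f"
abbreviation (input) n2 :: "real \<Rightarrow> real \<Rightarrow> real" where "n2 x y \<equiv> N_field F u (chart p f e (x, y)) \<bullet> e"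
abbreviation (input) hh :: "real \<Rightarrow> real \<Rightarrow> real" where "hh x y \<equiv> H (chart p f e (x, y))"

lemma continuous_chart_fields:
  "continuous_on ({-a..a} \<times> {-a..a}) (\<lambda>(x, y). n1 x y)"
  "continuous_on ({-a..a} \<times> {-a..a}) (\<lambda>(x, y). n2 x y)"
  "continuous_on ({-a..a} \<times> {-a..a}) (\<lambda>(x, y). hh x y)"
  using continuous_on_compose2[OF cN continuous_chart sub] continuous_on_compose2[OF cH continuous_chart sub]
  by (auto simp: case_prod_unfold intro!: continuous_intros)

lemma continuous_chart_N: "S \<subseteq> {-a..a} \<times> {-a..a} \<Longrightarrow> continuous_on S (\<lambda>q. N_field F u (chart p f e q))"
  and continuous_chart_H: "S \<subseteq> {-a..a} \<times> {-a..a} \<Longrightarrow> continuous_on S (\<lambda>q. H (chart p f e q))"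
  using continuous_on_compose2[OF cN continuous_chart sub] continuous_on_compose2[OF cH continuous_chart sub]
  by (auto elim: continuous_on_subset)

text \<open>The test function is the product of \<open>A\<close> and \<open>B\<close> in the chart
  coordinates, whose gradient has the components A' B and A B' in the frame. As the singular set is
  empty, the integral of the norm of the gradient disappears.\<close>

lemma weak_form_nonneg:
  assumes A: "\<And>n. differentiable_times n A" "\<And>x. (A has_real_derivative A' x) (at x)"
    and B: "\<And>n. differentiable_times n B" "\<And>x. (B has_real_derivative B' x) (at x)"
    and cA': "continuous_on UNIV A'" and cB': "continuous_on UNIV B'"
    and supp: "-a < a'" "b' < a" "-a < c'" "d' < a"
    and A0: "\<And>x. x \<notin> {a'..b'} \<Longrightarrow> A x = 0" and B0: "\<And>x. x \<notin> {c'..d'} \<Longrightarrow> B x = 0"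
  shows "0 \<le> integral {-a..a} (\<lambda>x. integral {-a..a} (\<lambda>y.
    n1 x y * (A' x * B y) + n2 x y * (A x * B' y) + hh x y * (A x * B y)))"
proof -
  define \<phi> where "\<phi> z = A ((z - p) \<bullet> f) * B ((z - p) \<bullet> e)" for z
  have grad: "gradient \<phi> z = (A' ((z - p) \<bullet> f) * B ((z - p) \<bullet> e)) *\<^sub>R f + (A ((z - p) \<bullet> f) * B' ((z - p) \<bullet> e)) *\<^sub>R e" for z
    unfolding \<phi>_def[abs_def] by (rule gradient_plane_product[OF A(2) B(2)])
  have zero_deriv: "G' x = 0" if "\<And>x. (G has_real_derivative G' x) (at x)" "\<And>x. x \<notin> {l..m} \<Longrightarrow> G x = 0" "x \<notin> {l..m}"
    for G G' :: "real \<Rightarrow> real" and l m x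
  proof -
    have "((\<lambda>_. 0) has_real_derivative 0) (at x)" by simp
    then have "(G has_real_derivative 0) (at x)"
      by (rule has_field_derivative_transform_within_open[where S = "- {l..m}"]) (use that in auto)
    then show ?thesis using that(1) DERIV_unique by blast
  qed
  have A'0: "A' x = 0" if "x \<notin> {a'..b'}" for x using zero_deriv[OF A(2) A0 that] .
  have B'0: "B' x = 0" if "x \<notin> {c'..d'}" for x using zero_deriv[OF B(2) B0 that] .
  define K where "K = chart p f e ` ({a'..b'} \<times> {c'..d'})"
  have K: "compact K" unfolding K_def
    by (intro compact_continuous_image continuous_chart compact_Times compact_Icc)
  have KS: "K \<subseteq> chart p f e ` ({-a..a} \<times> {-a..a})" unfolding K_def using supp by (intro image_mono) auto
  have inK: "z \<in> K" if "(z - p) \<bullet> f \<in> {a'..b'}" "(z - p) \<bullet> e \<in> {c'..d'}" for z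
  proof -
    have "((z - p) \<bullet> f, (z - p) \<bullet> e) \<in> {a'..b'} \<times> {c'..d'}" using that by (rule SigmaI)
    then have "chart p f e ((z - p) \<bullet> f, (z - p) \<bullet> e) \<in> K" unfolding K_def by (rule imageI)
    then show ?thesis unfolding chart_inverse[OF fe] .
  qed
  have off: "A ((z - p) \<bullet> f) * B ((z - p) \<bullet> e) = 0 \<and> gradient \<phi> z = 0" if zK: "z \<notin> K" for z
  proof -
    have "(z - p) \<bullet> f \<notin> {a'..b'} \<or> (z - p) \<bullet> e \<notin> {c'..d'}" using inK[of z] zK by blast
    then consider "(z - p) \<bullet> f \<notin> {a'..b'}" | "(z - p) \<bullet> e \<notin> {c'..d'}" by blast
    then show ?thesis
    proof cases
      case 1
      show ?thesis unfolding grad by (simp add: A0[OF 1] A'0[OF 1])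
    next
      case 2
      show ?thesis unfolding grad by (simp add: B0[OF 2] B'0[OF 2])
    qed
  qed
  have supp\<phi>: "{z. \<phi> z \<noteq> 0} \<subseteq> K" using off unfolding \<phi>_def by blast
  then have cl: "closure {z. \<phi> z \<noteq> 0} \<subseteq> K" by (rule closure_minimal[OF _ compact_imp_closed[OF K]])
  have test: "test_function \<Omega> \<phi>"
    unfolding test_function_def
  proof (intro conjI allI)
    show "C_k_on k UNIV \<phi>" for k unfolding \<phi>_def[abs_def] by (rule C_k_on_plane_product[OF A(1) B(1)])
    show "compact (closure {z. \<phi> z \<noteq> 0})"
      using compact_closure bounded_subset[OF compact_imp_bounded[OF K] supp\<phi>] by blast
    show "closure {z. \<phi> z \<noteq> 0} \<subseteq> \<Omega>" using cl KS sub by blast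
  qed
  have cA: "continuous_on UNIV A" and cB: "continuous_on UNIV B"
    using A(1)[of 0] B(1)[of 0] by simp_all
  have comp: "continuous_on S (\<lambda>z. G ((z - p) \<bullet> v))" if "continuous_on UNIV G" for G :: "real \<Rightarrow> real" and S v
    by (rule continuous_on_compose2[OF that]) (auto intro!: continuous_intros)
  have cgrad: "continuous_on \<Omega> (\<lambda>z. N_field F u z \<bullet> gradient \<phi> z)"
    unfolding grad by (intro continuous_intros cN comp cA cB cA' cB')
  have c\<phi>: "continuous_on \<Omega> (\<lambda>z. H z * \<phi> z)"
    unfolding \<phi>_def by (intro continuous_intros cH comp cA cB)
  have offS: "\<phi> z = 0" "gradient \<phi> z = 0" if "z \<notin> chart p f e ` ({-a..a} \<times> {-a..a})" for z
  proof -
    have "z \<notin> K" using that KS by blast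
    from off[OF this] show "\<phi> z = 0" "gradient \<phi> z = 0" by (simp_all add: \<phi>_def)
  qed
  have i1: "(LINT z : \<Omega> | lborel. N_field F u z \<bullet> gradient \<phi> z) =
      integral {-a..a} (\<lambda>x. integral {-a..a} (\<lambda>y. n1 x y * (A' x * B y) + n2 x y * (A x * B' y)))"
  proof -
    have "(LINT z : \<Omega> | lborel. N_field F u z \<bullet> gradient \<phi> z) =
      integral {-a..a} (\<lambda>x. integral {-a..a} (\<lambda>y. N_field F u (chart p f e (x, y)) \<bullet> gradient \<phi> (chart p f e (x, y))))"
      by (rule set_integral_chart[OF fe \<Omega> cgrad sub]) (simp add: offS)
    then show ?thesis unfolding grad chart_coords[OF fe] by (simp add: inner_add_right mult.commute)
  qed
  have i2: "(LINT z : \<Omega> | lborel. H z * \<phi> z) =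
      integral {-a..a} (\<lambda>x. integral {-a..a} (\<lambda>y. hh x y * (A x * B y)))"
  proof -
    have "(LINT z : \<Omega> | lborel. H z * \<phi> z) =
      integral {-a..a} (\<lambda>x. integral {-a..a} (\<lambda>y. hh x y * \<phi> (chart p f e (x, y))))"
      by (rule set_integral_chart[OF fe \<Omega> c\<phi> sub]) (simp add: offS)
    then show ?thesis unfolding \<phi>_def chart_coords[OF fe] .
  qed
  have c0: "continuous_on ({-a..a} \<times> {-a..a}) (\<lambda>(x, y). n1 x y * (A' x * B y) + n2 x y * (A x * B' y))"
    "continuous_on ({-a..a} \<times> {-a..a}) (\<lambda>(x, y). hh x y * (A x * B y))"
  proof -
    have G: "continuous_on S (\<lambda>q. G (fst q))" "continuous_on S (\<lambda>q. G (snd q))" if "continuous_on UNIV G"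
      for G :: "real \<Rightarrow> real" and S :: "(real \<times> real) set"
      by (rule continuous_on_compose2[OF that], auto intro!: continuous_intros)+
    show "continuous_on ({-a..a} \<times> {-a..a}) (\<lambda>(x, y). n1 x y * (A' x * B y) + n2 x y * (A x * B' y))"
      "continuous_on ({-a..a} \<times> {-a..a}) (\<lambda>(x, y). hh x y * (A x * B y))"
      unfolding case_prod_unfold prod.collapse
      by (intro continuous_intros continuous_chart_N continuous_chart_H subset_refl G[OF cA] G[OF cB] G[OF cA'] G[OF cB'])+
  qed
  have box: "cbox (-a, -a) (a, a) = {-a..a} \<times> {-a..a}" by (simp add: cbox_Pair_eq)
  have c: "continuous_on (cbox (-a, -a) (a, a)) (\<lambda>(x, y). n1 x y * (A' x * B y) + n2 x y * (A x * B' y))"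
    "continuous_on (cbox (-a, -a) (a, a)) (\<lambda>(x, y). hh x y * (A x * B y))"
    unfolding box by (rule c0)+
  have "0 \<le> (LINT z : singular_set \<Omega> F u | lborel. norm (gradient \<phi> z))
      + (LINT z : \<Omega> - singular_set \<Omega> F u | lborel. N_field F u z \<bullet> gradient \<phi> z)
      + (LINT z : \<Omega> | lborel. H z * \<phi> z)"
    using ws test unfolding weak_solution_def by blast
  also have "\<dots> = (LINT z : \<Omega> | lborel. N_field F u z \<bullet> gradient \<phi> z) + (LINT z : \<Omega> | lborel. H z * \<phi> z)"
    unfolding ns by (simp add: set_lebesgue_integral_def)
  also have "\<dots> = integral (cbox (-a, -a) (a, a)) (\<lambda>(x, y). n1 x y * (A' x * B y) + n2 x y * (A x * B' y))
      + integral (cbox (-a, -a) (a, a)) (\<lambda>(x, y). hh x y * (A x * B y))"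
    unfolding i1 i2 integral_prod_continuous[OF c(1)] integral_prod_continuous[OF c(2)] by simp
  also have "\<dots> = integral (cbox (-a, -a) (a, a)) (\<lambda>(x, y). n1 x y * (A' x * B y) + n2 x y * (A x * B' y) + hh x y * (A x * B y))"
    using integral_add[OF integrable_continuous[OF c(1)] integrable_continuous[OF c(2)]] by (simp add: case_prod_unfold)
  also have "\<dots> = integral {-a..a} (\<lambda>x. integral {-a..a} (\<lambda>y.
    n1 x y * (A' x * B y) + n2 x y * (A x * B' y) + hh x y * (A x * B y)))"
    using integral_prod_continuous[of "-a" "-a" a a "\<lambda>(x, y). n1 x y * (A' x * B y) + n2 x y * (A x * B' y) + hh x y * (A x * B y)"]
      continuous_on_add[OF c] by (simp add: case_prod_unfold)
  finally show ?thesis .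
qed

text \<open>Without singular points the weak inequality is linear in the test function, so replacing
  \<open>A\<close> by its negative gives the reverse inequality.\<close>

lemma weak_form_zero:
  assumes A: "\<And>n. differentiable_times n A" "\<And>x. (A has_real_derivative A' x) (at x)"
    and B: "\<And>n. differentiable_times n B" "\<And>x. (B has_real_derivative B' x) (at x)"
    and cA': "continuous_on UNIV A'" and cB': "continuous_on UNIV B'"
    and supp: "-a < a'" "b' < a" "-a < c'" "d' < a"
    and A0: "\<And>x. x \<notin> {a'..b'} \<Longrightarrow> A x = 0" and B0: "\<And>x. x \<notin> {c'..d'} \<Longrightarrow> B x = 0"
  shows "integral {-a..a} (\<lambda>x. integral {-a..a} (\<lambda>y.
    n1 x y * (A' x * B y) + n2 x y * (A x * B' y) + hh x y * (A x * B y))) = 0"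
proof -
  let ?I = "\<lambda>A A'. integral {-a..a} (\<lambda>x. integral {-a..a} (\<lambda>y.
    n1 x y * (A' x * B y) + n2 x y * (A x * B' y) + hh x y * (A x * B y)))"
  have "0 \<le> ?I A A'" by (rule weak_form_nonneg[OF A B cA' cB' supp A0 B0])
  moreover have "0 \<le> ?I (\<lambda>x. (-1) * A x + 0 * A x) (\<lambda>x. - A' x)"
  proof (rule weak_form_nonneg[OF _ _ B _ cB' supp _ B0])
    show "differentiable_times n (\<lambda>x. (-1) * A x + 0 * A x)" for n by (rule differentiable_times_add[OF A(1) A(1)])
    show "((\<lambda>x. (-1) * A x + 0 * A x) has_real_derivative - A' x) (at x)" for x
      using DERIV_minus[OF A(2)[of x]] by simp
    show "continuous_on UNIV (\<lambda>x. - A' x)" by (intro continuous_intros cA')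
    show "(-1) * A x + 0 * A x = 0" if "x \<notin> {a'..b'}" for x using A0[OF that] by simp
  qed
  moreover have "?I (\<lambda>x. (-1) * A x + 0 * A x) (\<lambda>x. - A' x) = - ?I A A'"
  proof -
    have "?I (\<lambda>x. (-1) * A x + 0 * A x) (\<lambda>x. - A' x) = integral {-a..a} (\<lambda>x. integral {-a..a} (\<lambda>y.
      - (n1 x y * (A' x * B y) + n2 x y * (A x * B' y) + hh x y * (A x * B y))))"
      by (intro integral_cong) (simp add: algebra_simps)
    then show ?thesis by (simp only: integral_neg)
  qed
  ultimately show ?thesis by linarith
qed

text \<open>The divergence theorem on rectangles for a continuous field. The factors of the product
  test functions are removed one at a time: for fixed \<open>B\<close> the weak form is a
  one-dimensional weak equation in x, and its integrated version is a one-dimensional weak equation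
  in y.\<close>

lemma weak_flux:
  assumes x: "-a < x1" "x1 \<le> x2" "x2 < a" and y: "-a < y1" "y1 \<le> y2" "y2 < a"
  shows "integral {x1..x2} (\<lambda>x. n2 x y2) - integral {x1..x2} (\<lambda>x. n2 x y1) =
    integral {y1..y2} (\<lambda>y. integral {x1..x2} (\<lambda>x. hh x y) - n1 x2 y + n1 x1 y)"
proof -
  note cf = continuous_chart_fields[unfolded case_prod_unfold]
  have slice: "continuous_on S (\<lambda>y. G x y)" if "continuous_on ({-a..a} \<times> {-a..a}) (\<lambda>q. G (fst q) (snd q))" "x \<in> {-a..a}" "S \<subseteq> {-a..a}"
    for G :: "real \<Rightarrow> real \<Rightarrow> real" and x S
  proof -
    have "continuous_on S (\<lambda>z. (\<lambda>q. G (fst q) (snd q)) (x, z))"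
      by (rule continuous_on_compose2[OF that(1)]) (use that in \<open>auto intro!: continuous_intros\<close>)
    then show ?thesis by simp
  qed
  have swp: "continuous_on ({-a..a} \<times> {-a..a}) (\<lambda>q. G (snd q) (fst q))" if "continuous_on ({-a..a} \<times> {-a..a}) (\<lambda>q. G (fst q) (snd q))"
    for G :: "real \<Rightarrow> real \<Rightarrow> real"
  proof -
    have "continuous_on ({-a..a} \<times> {-a..a}) (\<lambda>z. (\<lambda>q. G (fst q) (snd q)) (snd z, fst z))"
      by (rule continuous_on_compose2[OF that(1)]) (auto intro!: continuous_intros)
    then show ?thesis by simp
  qed
  have param: "continuous_on {-a..a} (\<lambda>x. integral {l..r} (\<lambda>y. G x y))"
    if "continuous_on ({-a..a} \<times> {-a..a}) (\<lambda>q. G (fst q) (snd q))" "{l..r} \<subseteq> {-a..a}" for G :: "real \<Rightarrow> real \<Rightarrow> real" and l r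
  proof -
    have "continuous_on ({-a..a} \<times> cbox l r) (\<lambda>(x, y). G x y)"
      unfolding case_prod_unfold by (rule continuous_on_subset[OF that(1)]) (use that(2) in auto)
    from integral_continuous_on_param[OF this] show ?thesis by simp
  qed
  have subx: "{x1..x2} \<subseteq> {-a..a}" using x by auto
  show ?thesis
  proof (rule du_Bois_Reymond[where a = "-a" and b = a, OF _ _ _ y])
    show "continuous_on {-a..a} (\<lambda>y. integral {x1..x2} (\<lambda>x. n2 x y))"
      by (rule param[OF swp[OF cf(2)] subx])
    show "continuous_on {-a..a} (\<lambda>y. integral {x1..x2} (\<lambda>x. hh x y) - n1 x2 y + n1 x1 y)"
      by (intro continuous_intros param[OF swp[OF cf(3)] subx] slice[OF cf(1)]) (use x in auto)
    fix B B' c' d'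
    assume B: "\<And>n. differentiable_times n B" "\<And>x. (B has_real_derivative B' x) (at x)"
      and cB': "continuous_on UNIV B'" and suppB: "-a < c'" "d' < a" and B0: "\<And>x. x \<notin> {c'..d'} \<Longrightarrow> B x = 0"
    have cB: "continuous_on S B" for S using B(1)[of 0] continuous_on_subset by auto
    have cB'': "continuous_on S B'" for S using cB' continuous_on_subset by blast
    have cBs: "continuous_on S (\<lambda>q. B (snd q))" "continuous_on S (\<lambda>q. B' (snd q))" for S :: "(real \<times> real) set"
      by (auto intro!: continuous_on_compose2[OF cB[of UNIV]] continuous_on_compose2[OF cB'] continuous_intros)
    define g where "g x = integral {-a..a} (\<lambda>y. n1 x y * B y)" for x
    define k where "k x = integral {-a..a} (\<lambda>y. n2 x y * B' y + hh x y * B y)" for x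
    have cg: "continuous_on {-a..a} g" unfolding g_def
      by (rule param) (auto intro!: continuous_intros continuous_chart_N continuous_chart_H cBs)
    have ck: "continuous_on {-a..a} k" unfolding k_def
      by (rule param) (auto intro!: continuous_intros continuous_chart_N continuous_chart_H cBs)
    have gk: "g x2 - g x1 = integral {x1..x2} k"
    proof (rule du_Bois_Reymond[OF cg ck _ x])
      fix A A' a' b'
      assume A: "\<And>n. differentiable_times n A" "\<And>x. (A has_real_derivative A' x) (at x)"
        and cA': "continuous_on UNIV A'" and suppA: "-a < a'" "b' < a" and A0: "\<And>x. x \<notin> {a'..b'} \<Longrightarrow> A x = 0"
      have "integral {-a..a} (\<lambda>x. g x * A' x + k x * A x) = integral {-a..a} (\<lambda>x. integral {-a..a} (\<lambda>y.
        n1 x y * (A' x * B y) + n2 x y * (A x * B' y) + hh x y * (A x * B y)))"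
      proof (rule integral_cong)
        fix x assume xx: "x \<in> {-a..a}"
        have i: "(\<lambda>y. n1 x y * B y * A' x) integrable_on {-a..a}" "(\<lambda>y. (n2 x y * B' y + hh x y * B y) * A x) integrable_on {-a..a}"
          by (intro integrable_continuous_real continuous_intros slice[OF cf(1) xx] slice[OF cf(2) xx] slice[OF cf(3) xx] cB cB''; simp)+
        have "g x * A' x + k x * A x = integral {-a..a} (\<lambda>y. n1 x y * B y * A' x) + integral {-a..a} (\<lambda>y. (n2 x y * B' y + hh x y * B y) * A x)"
          unfolding g_def k_def by simp
        also have "\<dots> = integral {-a..a} (\<lambda>y. n1 x y * B y * A' x + (n2 x y * B' y + hh x y * B y) * A x)"
          by (rule integral_add[symmetric, OF i])
        also have "\<dots> = integral {-a..a} (\<lambda>y. n1 x y * (A' x * B y) + n2 x y * (A x * B' y) + hh x y * (A x * B y))"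
          by (rule integral_cong) (simp add: algebra_simps)
        finally show "g x * A' x + k x * A x = integral {-a..a} (\<lambda>y. n1 x y * (A' x * B y) + n2 x y * (A x * B' y) + hh x y * (A x * B y))" .
      qed
      also have "\<dots> = 0" by (rule weak_form_zero[OF A B cA' cB' suppA suppB A0 B0])
      finally show "integral {-a..a} (\<lambda>x. g x * A' x + k x * A x) = 0" .
    qed
    have iy: "(\<lambda>y. integral {x1..x2} (\<lambda>x. n2 x y * B' y + hh x y * B y)) integrable_on {-a..a}"
      by (intro integrable_continuous_real param[where G = "\<lambda>y x. n2 x y * B' y + hh x y * B y"] subx)
         (auto intro!: continuous_intros swp[OF cf(2)] swp[OF cf(3)] continuous_on_compose2[OF cB[of UNIV]] continuous_on_compose2[OF cB'])
    have ig: "(\<lambda>y. n1 x y * B y) integrable_on {-a..a}" if "x \<in> {-a..a}" for x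
      by (intro integrable_continuous_real continuous_intros slice[OF cf(1) that] cB) simp
    have "integral {-a..a} (\<lambda>y. integral {x1..x2} (\<lambda>x. n2 x y) * B' y
        + (integral {x1..x2} (\<lambda>x. hh x y) - n1 x2 y + n1 x1 y) * B y)
      = integral {-a..a} (\<lambda>y. integral {x1..x2} (\<lambda>x. n2 x y * B' y + hh x y * B y) - (n1 x2 y * B y - n1 x1 y * B y))"
    proof (rule integral_cong)
      fix y assume yy: "y \<in> {-a..a}"
      have i: "(\<lambda>x. n2 x y * B' y) integrable_on {x1..x2}" "(\<lambda>x. hh x y * B y) integrable_on {x1..x2}"
        by (intro integrable_continuous_real continuous_on_mult_right slice[OF swp[OF cf(2)] yy subx] slice[OF swp[OF cf(3)] yy subx])+
      have "integral {x1..x2} (\<lambda>x. n2 x y * B' y + hh x y * B y) =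
          integral {x1..x2} (\<lambda>x. n2 x y * B' y) + integral {x1..x2} (\<lambda>x. hh x y * B y)"
        by (rule integral_add[OF i])
      then show "integral {x1..x2} (\<lambda>x. n2 x y) * B' y + (integral {x1..x2} (\<lambda>x. hh x y) - n1 x2 y + n1 x1 y) * B y
        = integral {x1..x2} (\<lambda>x. n2 x y * B' y + hh x y * B y) - (n1 x2 y * B y - n1 x1 y * B y)"
        by (simp add: algebra_simps)
    qed
    also have "\<dots> = integral {-a..a} (\<lambda>y. integral {x1..x2} (\<lambda>x. n2 x y * B' y + hh x y * B y)) - (g x2 - g x1)"
      unfolding g_def using x by (simp add: integral_diff iy ig integrable_diff)
    \<comment> \<open>The equation in x has the y-integration inside, the equation in y has it
      outside; exchanging the integrals identifies the two.\<close>
    also have "integral {-a..a} (\<lambda>y. integral {x1..x2} (\<lambda>x. n2 x y * B' y + hh x y * B y)) = integral {x1..x2} k"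
    proof -
      have "continuous_on (cbox (x1, -a) (x2, a)) (\<lambda>(x, y). n2 x y * B' y + hh x y * B y)"
        unfolding case_prod_unfold cbox_Pair_eq
        using subx x by (auto intro!: continuous_intros cBs continuous_chart_N continuous_chart_H)
      from integral_swap_continuous[OF this] show ?thesis unfolding k_def by simp
    qed
    also have "integral {x1..x2} k - (g x2 - g x1) = 0" using gk by simp
    finally show "integral {-a..a} (\<lambda>y. integral {x1..x2} (\<lambda>x. n2 x y) * B' y
        + (integral {x1..x2} (\<lambda>x. hh x y) - n1 x2 y + n1 x1 y) * B y) = 0" .
  qed
qed

text \<open>\<open>f0\<close> is minus the flux through a horizontal segment, and the flux identity
  is what makes it differentiable in y. \<open>\<kappa>\<close> collects the rest of that identity:
  the x-primitive of \<open>H\<close> and the flux through the left edge.\<close>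

lemma weak_potential:
  assumes b: "0 < b" "b < a"
  obtains f0 \<kappa> where "continuous_on ({-b<..<b} \<times> {-b<..<b}) \<kappa>"
    "\<And>x y. \<bar>x\<bar> < b \<Longrightarrow> \<bar>y\<bar> < b \<Longrightarrow> ((\<lambda>x. f0 (x, y)) has_real_derivative - n2 x y) (at x)"
    "\<And>x y. \<bar>x\<bar> < b \<Longrightarrow> \<bar>y\<bar> < b \<Longrightarrow> ((\<lambda>y. f0 (x, y)) has_real_derivative n1 x y - \<kappa> (x, y)) (at y)"
    "\<And>x y. \<bar>x\<bar> < b \<Longrightarrow> \<bar>y\<bar> < b \<Longrightarrow> ((\<lambda>x. \<kappa> (x, y)) has_real_derivative hh x y) (at x)"
proof -
  note cf = continuous_chart_fields[unfolded case_prod_unfold]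
  define f0 where "f0 = (\<lambda>(x, y). - integral {-b..x} (\<lambda>\<xi>. n2 \<xi> y))"
  define \<kappa> where "\<kappa> = (\<lambda>(x, y). integral {-b..x} (\<lambda>\<xi>. hh \<xi> y) + n1 (-b) y)"
  have sb: "{-b..b} \<times> {-b..b} \<subseteq> {-a..a} \<times> {-a..a}" using b by auto
  have cx: "continuous_on {-b..b} (\<lambda>x. G x y)" if "continuous_on ({-a..a} \<times> {-a..a}) (\<lambda>q. G (fst q) (snd q))" "y \<in> {-b..b}"
    for G :: "real \<Rightarrow> real \<Rightarrow> real" and y
  proof -
    have "continuous_on {-b..b} (\<lambda>z. (\<lambda>q. G (fst q) (snd q)) (z, y))"
      by (rule continuous_on_compose2[OF that(1)]) (use that b in \<open>auto intro!: continuous_intros\<close>)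
    then show ?thesis by simp
  qed
  have cy: "continuous_on {-b..b} (\<lambda>y. G x y)" if "continuous_on ({-a..a} \<times> {-a..a}) (\<lambda>q. G (fst q) (snd q))" "x \<in> {-b..b}"
    for G :: "real \<Rightarrow> real \<Rightarrow> real" and x
  proof -
    have "continuous_on {-b..b} (\<lambda>z. (\<lambda>q. G (fst q) (snd q)) (x, z))"
      by (rule continuous_on_compose2[OF that(1)]) (use that b in \<open>auto intro!: continuous_intros\<close>)
    then show ?thesis by simp
  qed
  have prim: "((\<lambda>x. integral {-b..x} (\<lambda>\<xi>. G \<xi> y)) has_real_derivative G x y) (at x)"
    if "continuous_on ({-a..a} \<times> {-a..a}) (\<lambda>q. G (fst q) (snd q))" "\<bar>x\<bar> < b" "\<bar>y\<bar> < b" for G :: "real \<Rightarrow> real \<Rightarrow> real" and x y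
    by (rule integral_has_real_derivative_interior[OF cx[OF that(1)]]) (use that in auto)
  have cI: "continuous_on ({-b..b} \<times> {-b..b}) (\<lambda>(x, y). integral {-b..x} (\<lambda>\<xi>. hh \<xi> y))"
    using continuous_on_primitive_param[OF continuous_on_subset[OF cf(3) sb]] by simp
  have c\<kappa>: "continuous_on ({-b..b} \<times> {-b..b}) \<kappa>"
  proof -
    have "continuous_on ({-b..b} \<times> {-b..b}) (\<lambda>z. (\<lambda>q. n1 (fst q) (snd q)) (-b, snd z))"
      by (rule continuous_on_compose2[OF cf(1)]) (use b in \<open>auto intro!: continuous_intros\<close>)
    then have "continuous_on ({-b..b} \<times> {-b..b}) (\<lambda>q. n1 (-b) (snd q))" by simp
    then show ?thesis using cI unfolding \<kappa>_def case_prod_unfold by (intro continuous_on_add)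
  qed
  show thesis
  proof (rule that[of \<kappa> f0])
    show "continuous_on ({-b<..<b} \<times> {-b<..<b}) \<kappa>" by (rule continuous_on_subset[OF c\<kappa>]) auto
    fix x y assume xy: "\<bar>x\<bar> < b" "\<bar>y\<bar> < b"
    show "((\<lambda>x. f0 (x, y)) has_real_derivative - n2 x y) (at x)"
      unfolding f0_def using DERIV_minus[OF prim[OF cf(2) xy]] by simp
    show "((\<lambda>x. \<kappa> (x, y)) has_real_derivative hh x y) (at x)"
      unfolding \<kappa>_def using DERIV_add[OF prim[OF cf(3) xy] DERIV_const] by simp
    define R where "R y = integral {-b..x} (\<lambda>\<xi>. hh \<xi> y) - n1 x y + n1 (-b) y" for y
    have cR: "continuous_on {-b..b} R"
    proof -
      have "continuous_on {-b..b} (\<lambda>y. (\<lambda>(x, y). integral {-b..x} (\<lambda>\<xi>. hh \<xi> y)) (x, y))"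
        by (rule continuous_on_compose2[OF cI]) (use xy in \<open>auto intro!: continuous_intros\<close>)
      then have "continuous_on {-b..b} (\<lambda>y. integral {-b..x} (\<lambda>\<xi>. hh \<xi> y))" by simp
      then show ?thesis unfolding R_def
        by (intro continuous_intros cy[OF cf(1)]) (use xy b in auto)
    qed
    \<comment> \<open>The flux identity on the rectangle with corners (- b, - b) and (x, y) exhibits
      \<open>f0\<close>, up to a constant, as a y-primitive of a continuous function.\<close>
    have eq: "f0 (x, y) = f0 (x, -b) - integral {-b..y} R" if "y \<in> {-b<..<b}" for y
    proof -
      have "integral {-b..x} (\<lambda>x. n2 x y) - integral {-b..x} (\<lambda>x. n2 x (-b)) = integral {-b..y} R"
        unfolding R_def by (rule weak_flux) (use that xy b in auto)
      then show ?thesis by (simp add: f0_def)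
    qed
    have "((\<lambda>y. f0 (x, -b) - integral {-b..y} R) has_real_derivative 0 - R y) (at y)"
      by (intro DERIV_diff DERIV_const integral_has_real_derivative_interior[OF cR]) (use xy in auto)
    then have "((\<lambda>y. f0 (x, y)) has_real_derivative 0 - R y) (at y)"
      by (rule has_field_derivative_transform_within_open[where S = "{-b<..<b}"]) (use eq xy in auto)
    then show "((\<lambda>y. f0 (x, y)) has_real_derivative n1 x y - \<kappa> (x, y)) (at y)"
      by (rule DERIV_cong) (simp add: R_def \<kappa>_def)
  qed
qed

end

section \<open>The equation for D\<close>

lemma has_derivative_gradient:
  fixes g :: "real^2 \<Rightarrow> real"
  assumes "g differentiable (at z)"
  shows "(g has_derivative (\<lambda>h. gradient g z \<bullet> h)) (at z)"
proof -
  have d: "(g has_derivative frechet_derivative g (at z)) (at z)"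
    using assms by (simp add: frechet_derivative_works)
  then have lin: "linear (frechet_derivative g (at z))" by (rule has_derivative_linear)
  have "frechet_derivative g (at z) = (\<lambda>h. gradient g z \<bullet> h)"
  proof
    fix h :: "real^2"
    have "h = h $ 1 *\<^sub>R axis 1 1 + h $ 2 *\<^sub>R axis 2 1"
      by (simp add: vec_eq_iff forall_2 axis_def)
    then have "frechet_derivative g (at z) h = frechet_derivative g (at z) (h $ 1 *\<^sub>R axis 1 1 + h $ 2 *\<^sub>R axis 2 1)"
      by simp
    also have "\<dots> = h $ 1 * partial_deriv 1 g z + h $ 2 * partial_deriv 2 g z"
      using lin by (simp add: linear_add linear_scale partial_deriv_def)
    finally show "frechet_derivative g (at z) h = gradient g z \<bullet> h"
      by (simp add: sum_2_vec gradient_def mult.commute)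
  qed
  then show ?thesis using d by simp
qed

lemma chart_partials:
  fixes g :: "real^2 \<Rightarrow> real"
  assumes "g differentiable (at (chart p f e (x, y)))"
  shows "((\<lambda>x. g (chart p f e (x, y))) has_real_derivative gradient g (chart p f e (x, y)) \<bullet> f) (at x)"
    "((\<lambda>y. g (chart p f e (x, y))) has_real_derivative gradient g (chart p f e (x, y)) \<bullet> e) (at y)"
proof -
  have c: "((\<lambda>x. chart p f e (x, y)) has_derivative (\<lambda>h. h *\<^sub>R f)) (at x)"
    "((\<lambda>y. chart p f e (x, y)) has_derivative (\<lambda>h. h *\<^sub>R e)) (at y)"
    unfolding chart_def by (auto intro!: derivative_eq_intros)
  note g = has_derivative_gradient[OF assms]
  show "((\<lambda>x. g (chart p f e (x, y))) has_real_derivative gradient g (chart p f e (x, y)) \<bullet> f) (at x)"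
    unfolding has_field_derivative_def
    by (rule has_derivative_eq_rhs[OF has_derivative_compose[OF c(1) g]]) (simp add: fun_eq_iff mult.commute)
  show "((\<lambda>y. g (chart p f e (x, y))) has_real_derivative gradient g (chart p f e (x, y)) \<bullet> e) (at y)"
    unfolding has_field_derivative_def
    by (rule has_derivative_eq_rhs[OF has_derivative_compose[OF c(2) g]]) (simp add: fun_eq_iff mult.commute)
qed

lemma C_1_on_gradient:
  assumes "C_k_on 1 \<Omega> g"
  shows "\<And>z. z \<in> \<Omega> \<Longrightarrow> g differentiable (at z)" "continuous_on \<Omega> (gradient g)"
proof -
  show "\<And>z. z \<in> \<Omega> \<Longrightarrow> g differentiable (at z)" using assms by (simp add: One_nat_def)
  have "continuous_on \<Omega> (partial_deriv i g)" for i using assms by (simp add: One_nat_def)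
  then show "continuous_on \<Omega> (gradient g)"
    unfolding gradient_def[abs_def] by (intro continuous_on_vec_lambda) (simp add: eta_contract_eq)
qed

lemma eventually_in_open_curve:
  assumes "integral_curve_at V z \<gamma>" "open U" "z \<in> U"
  shows "\<forall>\<^sub>F \<tau> in nhds 0. \<gamma> \<tau> \<in> U \<and> (\<gamma> has_vector_derivative V (\<gamma> \<tau>)) (at \<tau>)"
proof -
  have ev: "\<forall>\<^sub>F \<tau> in nhds 0. (\<gamma> has_vector_derivative V (\<gamma> \<tau>)) (at \<tau>)" and 0: "\<gamma> 0 = z"
    using assms(1) by (auto simp: integral_curve_at_def)
  have "isCont \<gamma> 0"
    using eventually_nhds_x_imp_x[OF ev] by (rule has_vector_derivative_continuous)
  then have "(\<gamma> \<longlongrightarrow> \<gamma> 0) (nhds 0)" unfolding isCont_def tendsto_at_iff_tendsto_nhds .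
  then have "\<forall>\<^sub>F \<tau> in nhds 0. \<gamma> \<tau> \<in> U" using assms(2,3) 0 by (auto dest: topological_tendstoD)
  then show ?thesis using ev by (rule eventually_conj)
qed

text \<open>A graph curve is reparametrized by the inverse of \<open>\<integral> d\<eta> / \<rho>(\<eta>)\<close>.\<close>

lemma graph_time_change:
  fixes \<rho> :: "real \<Rightarrow> real"
  assumes c: "continuous_on {-r<..<r} \<rho>" and pos: "\<And>y. \<bar>y\<bar> < r \<Longrightarrow> \<rho> y > 0" and y0: "\<bar>y0\<bar> < r"
  obtains T g :: "real \<Rightarrow> real" and s where "s > 0" "T y0 = 0" "(T has_real_derivative 1 / \<rho> y0) (at y0)"
    "\<And>y. \<bar>y - y0\<bar> < s \<Longrightarrow> \<bar>y\<bar> < r \<and> g (T y) = y"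
    "\<forall>\<^sub>F \<tau> in nhds 0. \<bar>g \<tau>\<bar> < r \<and> (g has_real_derivative \<rho> (g \<tau>)) (at \<tau>)"
proof -
  define s where "s = (r - \<bar>y0\<bar>) / 2"
  have s: "s > 0" using y0 by (simp add: s_def)
  have sr: "\<bar>y\<bar> < r" if "y \<in> {y0 - s..y0 + s}" for y
  proof -
    have "\<bar>y - y0\<bar> \<le> s" using that by (simp add: abs_le_iff)
    moreover have "2 * s = r - \<bar>y0\<bar>" by (simp add: s_def)
    ultimately show ?thesis using s by linarith
  qed
  have ci: "continuous_on {y0 - s..y0 + s} (\<lambda>y. 1 / \<rho> y)"
  proof (intro continuous_on_divide continuous_on_const continuous_on_subset[OF c] ballI)
    show "{y0 - s..y0 + s} \<subseteq> {-r<..<r}"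
    proof
      fix y assume "y \<in> {y0 - s..y0 + s}"
      from sr[OF this] show "y \<in> {-r<..<r}" by auto
    qed
    show "\<rho> y \<noteq> 0" if "y \<in> {y0 - s..y0 + s}" for y using pos[OF sr[OF that]] by simp
  qed
  define T0 where "T0 y = integral {y0 - s..y} (\<lambda>y. 1 / \<rho> y)" for y
  define T where "T y = T0 y - T0 y0" for y
  have dT: "(T has_real_derivative 1 / \<rho> y) (at y)" if "y0 - s < y" "y < y0 + s" for y
  proof -
    have "(T has_real_derivative 1 / \<rho> y - 0) (at y)"
      unfolding T_def T0_def
      by (intro DERIV_diff DERIV_const integral_has_real_derivative_interior[OF ci that])
    then show ?thesis by simp
  qed
  \<comment> \<open>The inverse is taken on a closed interval that is strictly smaller, so that
    \<open>T\<close> is differentiable at its end points too.\<close>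
  define l where "l = y0 - s / 2"
  define m where "m = y0 + s / 2"
  have lm: "l < y0" "y0 < m" "y0 - s < l" "m < y0 + s" "\<And>y. l \<le> y \<Longrightarrow> y \<le> m \<Longrightarrow> y0 - s < y \<and> y < y0 + s \<and> \<bar>y\<bar> < r"
    using s sr by (auto simp: l_def m_def)
  have mono: "T x < T y" if "l \<le> x" "x < y" "y \<le> m" for x y
  proof (rule DERIV_pos_imp_increasing[OF that(2)])
    fix z assume "x \<le> z" "z \<le> y"
    then have z: "y0 - s < z" "z < y0 + s" "\<bar>z\<bar> < r" using lm(5)[of z] that by auto
    then show "\<exists>d. (T has_real_derivative d) (at z) \<and> d > 0" using dT[OF z(1,2)] pos[OF z(3)] by auto
  qed
  have inj: "inj_on T {l..m}"
    by (rule inj_onI) (metis atLeastAtMost_iff less_irrefl linorder_neqE_linordered_idom mono)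
  define g where "g = the_inv_into {l..m} T"
  have gT: "g (T y) = y" if "l \<le> y" "y \<le> m" for y
    unfolding g_def by (rule the_inv_into_f_f[OF inj]) (use that in auto)
  have contT: "isCont T y" if "l \<le> y" "y \<le> m" for y
    by (rule DERIV_isCont[OF dT]) (use lm(5)[OF that] in auto)
  have T0: "T y0 = 0" by (simp add: T_def)
  have Tlm: "T l < 0" "0 < T m" using mono[of l y0] mono[of y0 m] lm T0 by auto
  have surj: "\<exists>y. l < y \<and> y < m \<and> T y = \<tau>" if "T l < \<tau>" "\<tau> < T m" for \<tau>
  proof -
    have "\<exists>y\<ge>l. y \<le> m \<and> T y = \<tau>"
      by (rule IVT) (use that contT lm in auto)
    then obtain y where y: "l \<le> y" "y \<le> m" "T y = \<tau>" by blast
    then have "y \<noteq> l" "y \<noteq> m" using that by auto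
    then show ?thesis using y by (intro exI[of _ y]) auto
  qed
  have dg: "\<bar>g \<tau>\<bar> < r \<and> (g has_real_derivative \<rho> (g \<tau>)) (at \<tau>)" if \<tau>: "T l < \<tau>" "\<tau> < T m" for \<tau>
  proof -
    obtain y where y: "l < y" "y < m" "T y = \<tau>" using surj[OF \<tau>] by blast
    have g\<tau>: "g \<tau> = y" using gT[of y] y by auto
    have yr: "y0 - s < y" "y < y0 + s" "\<bar>y\<bar> < r" using lm(5)[of y] y by auto
    have cont: "isCont g \<tau>"
      unfolding y(3)[symmetric] by (rule isCont_inverse_function2[OF y(1,2)]) (use gT contT in auto)
    have "(g has_real_derivative inverse (1 / \<rho> y)) (at \<tau>)"
    proof (rule DERIV_inverse_function[OF _ _ \<tau>])
      show "(T has_real_derivative 1 / \<rho> y) (at (g \<tau>))" unfolding g\<tau> by (rule dT[OF yr(1,2)])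
      show "1 / \<rho> y \<noteq> 0" using pos[OF yr(3)] by simp
      show "T (g \<sigma>) = \<sigma>" if "T l < \<sigma>" "\<sigma> < T m" for \<sigma>
      proof -
        obtain z where "l < z" "z < m" "T z = \<sigma>" using surj[OF \<open>T l < \<sigma>\<close> \<open>\<sigma> < T m\<close>] by blast
        then show ?thesis using gT[of z] by auto
      qed
    qed (rule cont)
    then show ?thesis using yr(3) by (simp add: g\<tau>)
  qed
  show thesis
  proof (rule that[of "s / 2" T g])
    show "(T has_real_derivative 1 / \<rho> y0) (at y0)" by (rule dT) (use s in auto)
    show "\<bar>y\<bar> < r \<and> g (T y) = y" if "\<bar>y - y0\<bar> < s / 2" for y
    proof -
      have "l \<le> y" "y \<le> m" using that unfolding l_def m_def abs_less_iff by linarith+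
      then show ?thesis using gT lm(5) by auto
    qed
    have "\<forall>\<^sub>F \<tau> in nhds 0. \<tau> \<in> {T l<..<T m}"
      by (rule eventually_nhds_in_open) (use Tlm in auto)
    then show "\<forall>\<^sub>F \<tau> in nhds 0. \<bar>g \<tau>\<bar> < r \<and> (g has_real_derivative \<rho> (g \<tau>)) (at \<tau>)"
      by eventually_elim (use dg in auto)
  qed (use s T0 in auto)
qed

section \<open>From the plane to coordinates around a point\<close>

lemma continuous_on_curl2:
  assumes "\<forall>i. C_k_on 1 \<Omega> (\<lambda>x. F x $ i)"
  shows "continuous_on \<Omega> (curl2 F)"
proof -
  have "continuous_on \<Omega> (partial_deriv i (\<lambda>x. F x $ j))" for i j
    using assms by (simp add: One_nat_def)
  then show ?thesis unfolding curl2_def[abs_def] by (intro continuous_intros)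
qed

text \<open>The planar theorem carried back to the plane. Existence of integral curves is left open
  here: the derivatives hold along every integral curve that there is, which is the universal half
  of \<open>has_deriv_along\<close>.\<close>

lemma local_structure:
  fixes \<Omega> :: "(real^2) set" and F :: "real^2 \<Rightarrow> real^2" and H u :: "real^2 \<Rightarrow> real"
  defines "N \<equiv> N_field F u" and "Np \<equiv> Nperp_field F u" and "D \<equiv> D_fun F u"
  assumes \<Omega>: "open \<Omega>" and hF: "\<forall>i. C_k_on 1 \<Omega> (\<lambda>x. F x $ i)" and cH: "continuous_on \<Omega> H"
    and ws: "weak_solution \<Omega> F H u" and ns: "singular_set \<Omega> F u = {}"
    and NH: "C1_along N H \<Omega>" and p: "p \<in> \<Omega>"
  shows "\<exists>U w. open U \<and> p \<in> U \<and> U \<subseteq> \<Omega> \<and> continuous_on U D \<and> continuous_on U w \<and>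
    (\<forall>z\<in>U. \<forall>\<gamma>. integral_curve_at Np z \<gamma> \<longrightarrow>
      ((\<lambda>\<tau>. D (\<gamma> \<tau>)) has_real_derivative curl2 F z - D z * w z) (at 0) \<and>
      ((\<lambda>\<tau>. w (\<gamma> \<tau>)) has_real_derivative - ((H z)\<^sup>2 + deriv_along N H z + (w z)\<^sup>2)) (at 0))"
proof -
  have hu: "C_k_on 1 \<Omega> u" using ws by (simp add: weak_solution_def)
  note gu = C_1_on_gradient[OF hu]
  note gF = C_1_on_gradient[OF hF[rule_format]]
  have cF: "continuous_on \<Omega> F"
  proof -
    have "continuous_on \<Omega> (\<lambda>x. F x $ i)" for i
      by (rule continuous_at_imp_continuous_on) (use gF(1) differentiable_imp_continuous_within in blast)
    then have "continuous_on \<Omega> (\<lambda>x. \<chi> i. F x $ i)" by (intro continuous_on_vec_lambda)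
    then show ?thesis by simp
  qed
  have G0: "gradient u z + F z \<noteq> 0" if "z \<in> \<Omega>" for z using ns that by (auto simp: singular_set_def)
  have D0: "D z > 0" if "z \<in> \<Omega>" for z using G0[OF that] by (simp add: D_def D_fun_def)
  have DN: "D z *\<^sub>R N z = gradient u z + F z" if "z \<in> \<Omega>" for z
    using D0[OF that] by (simp add: N_def N_field_def D_def)
  have N1: "N z \<bullet> N z = 1" if "z \<in> \<Omega>" for z
  proof -
    have "norm (N z) = 1" using D0[OF that] by (simp add: N_def N_field_def D_def D_fun_def)
    then show ?thesis by (simp add: dot_square_norm)
  qed
  have cD: "continuous_on \<Omega> D"
    unfolding D_def D_fun_def[abs_def] by (intro continuous_intros gu cF)
  have cN: "continuous_on \<Omega> N"
  proof -
    have "continuous_on \<Omega> (\<lambda>z. (1 / D z) *\<^sub>R (gradient u z + F z))"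
      using D0 by (intro continuous_intros gu cF cD) (auto simp: less_imp_neq[symmetric])
    then show ?thesis by (simp add: N_def N_field_def[abs_def] D_def divide_inverse)
  qed
  \<comment> \<open>With the frame (N-perp, N) at \<open>p\<close> the angle t is 0 there. Near
    \<open>p\<close> the component N . e stays positive, so both families of curves are
    graphs.\<close>
  define e where "e = N p"
  define f where "f = Np p"
  have ee: "e $ 1 * e $ 1 + e $ 2 * e $ 2 = 1" using N1[OF p] by (simp add: e_def sum_2_vec)
  have f12: "f $ 1 = e $ 2" "f $ 2 = - (e $ 1)" by (simp_all add: f_def Np_def Nperp_field_def e_def N_def)
  have fe: "frame f e" using ee by (simp add: frame_def sum_2_vec f12)
  have Npf: "Np z \<bullet> f = N z \<bullet> e" "Np z \<bullet> e = - (N z \<bullet> f)" for z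
    by (simp_all add: sum_2_vec f12 Np_def Nperp_field_def N_def)
  have Nsq: "(N z \<bullet> f)\<^sup>2 + (N z \<bullet> e)\<^sup>2 = 1" if "z \<in> \<Omega>" for z
  proof -
    have "(N z \<bullet> f)\<^sup>2 + (N z \<bullet> e)\<^sup>2 = (N z $ 1 * N z $ 1 + N z $ 2 * N z $ 2) * (e $ 1 * e $ 1 + e $ 2 * e $ 2)"
      by (simp add: sum_2_vec f12 power2_eq_square algebra_simps)
    also have "\<dots> = 1" using N1[OF that] ee by (simp add: sum_2_vec)
    finally show ?thesis .
  qed
  have exp_frame: "v = (v \<bullet> f) *\<^sub>R f + (v \<bullet> e) *\<^sub>R e" for v :: "real^2"
    using chart_inverse[OF fe, of 0 v] by (simp add: chart_def)
  define \<Omega>0 where "\<Omega>0 = {z \<in> \<Omega>. N z \<bullet> e > 0}"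
  have "open \<Omega>0"
  proof -
    have "open ((\<lambda>z. N z \<bullet> e) -` {0<..} \<inter> \<Omega>)"
      using continuous_on_open_vimage[OF \<Omega>, of "\<lambda>z. N z \<bullet> e"] cN by (auto intro!: continuous_intros)
    then show ?thesis by (simp add: \<Omega>0_def vimage_def Int_def conj_commute)
  qed
  moreover have "p \<in> \<Omega>0" using p N1[OF p] by (simp add: \<Omega>0_def e_def)
  ultimately obtain R where R: "R > 0" "ball p R \<subseteq> \<Omega>0" using openE by blast
  \<comment> \<open>Points of the square have distance at most 2 a < R from
    \<open>p\<close>.\<close>
  define a where "a = R / 3"
  have a: "a > 0" using R by (simp add: a_def)
  let ?\<chi> = "chart p f e"
  have nf: "norm f = 1" "norm e = 1" using frameD[OF fe] by (simp_all add: norm_eq_1)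
  have sub0: "?\<chi> ` ({-a..a} \<times> {-a..a}) \<subseteq> \<Omega>0"
  proof (clarify)
    fix x y assume "x \<in> {-a..a}" "y \<in> {-a..a}"
    then have "\<bar>x\<bar> \<le> a" "\<bar>y\<bar> \<le> a" by auto
    moreover have "norm (x *\<^sub>R f + y *\<^sub>R e) \<le> \<bar>x\<bar> + \<bar>y\<bar>"
      using norm_triangle_ineq[of "x *\<^sub>R f" "y *\<^sub>R e"] nf by simp
    moreover have "dist p (?\<chi> (x, y)) = norm (x *\<^sub>R f + y *\<^sub>R e)"
    proof -
      have "p - ?\<chi> (x, y) = - (x *\<^sub>R f + y *\<^sub>R e)" by (simp add: chart_def)
      then show ?thesis unfolding dist_norm by (metis norm_minus_cancel)
    qed
    ultimately have "dist p (?\<chi> (x, y)) \<le> 2 * a" by linarith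
    then have "?\<chi> (x, y) \<in> ball p R" using R(1) by (simp add: a_def)
    then show "?\<chi> (x, y) \<in> \<Omega>0" using R(2) by blast
  qed
  then have sub: "?\<chi> ` ({-a..a} \<times> {-a..a}) \<subseteq> \<Omega>" by (auto simp: \<Omega>0_def)
  have in\<Omega>: "?\<chi> (x, y) \<in> \<Omega>" and Ne: "N (?\<chi> (x, y)) \<bullet> e > 0" if "\<bar>x\<bar> \<le> a" "\<bar>y\<bar> \<le> a" for x y
  proof -
    have "(x, y) \<in> {-a..a} \<times> {-a..a}" using that by auto
    then have "?\<chi> (x, y) \<in> \<Omega>0" using sub0 by blast
    then show "?\<chi> (x, y) \<in> \<Omega>" "N (?\<chi> (x, y)) \<bullet> e > 0" by (auto simp: \<Omega>0_def)
  qed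
  \<comment> \<open>With this sign N has the frame components (- sin t, cos t), and N-perp has (cos
    t, sin t).\<close>
  define t where "t q = - arcsin (N (?\<chi> q) \<bullet> f)" for q
  have t: "sin (t (x, y)) = - (N (?\<chi> (x, y)) \<bullet> f)" "cos (t (x, y)) = N (?\<chi> (x, y)) \<bullet> e" "\<bar>t (x, y)\<bar> < pi / 2"
    if "\<bar>x\<bar> \<le> a" "\<bar>y\<bar> \<le> a" for x y
  proof -
    let ?n1 = "N (?\<chi> (x, y)) \<bullet> f" and ?n2 = "N (?\<chi> (x, y)) \<bullet> e"
    have sq: "?n1\<^sup>2 + ?n2\<^sup>2 = 1" and pos: "?n2 > 0" using Nsq[OF in\<Omega>[OF that]] Ne[OF that] by auto
    have "?n1\<^sup>2 < 1" using sq pos by (smt (verit) zero_less_power)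
    then have b: "- 1 < ?n1" "?n1 < 1" by (auto simp: abs_square_less_1 abs_less_iff)
    show "sin (t (x, y)) = - ?n1" unfolding t_def using b by (simp add: sin_arcsin)
    have "cos (t (x, y)) = sqrt (1 - ?n1\<^sup>2)" unfolding t_def using b by (simp add: cos_arcsin)
    also have "1 - ?n1\<^sup>2 = ?n2\<^sup>2" using sq by simp
    finally show "cos (t (x, y)) = ?n2" using pos by simp
    show "\<bar>t (x, y)\<bar> < pi / 2" unfolding t_def using arcsin_lt_bounded[OF b] by auto
  qed
  define B where "B d = {-d<..<d} \<times> {-d<..<d}" for d :: real
  have cchart: "continuous_on (B d) (\<lambda>q. g (?\<chi> q))" if "continuous_on \<Omega> g" "d \<le> a" for g :: "real^2 \<Rightarrow> 'b::topological_space" and d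
  proof (rule continuous_on_compose2[OF that(1) continuous_chart])
    show "?\<chi> ` B d \<subseteq> \<Omega>"
      using sub image_mono[of "B d" "{-a..a} \<times> {-a..a}" ?\<chi>] that(2) by (fastforce simp: B_def)
  qed
  \<comment> \<open>Two halvings, because \<open>weak_potential\<close> and
    \<open>change_gauge\<close> each give their results on a strictly smaller square only.\<close>
  define b0 where "b0 = a / 2"
  define b where "b = b0 / 2"
  have b0: "0 < b0" "b0 < a" and b: "0 < b" "b < b0" "b < a" "b \<le> a" "b0 \<le> a" using a by (auto simp: b0_def b_def)
  show ?thesis
  proof (rule weak_potential[OF ws \<Omega> ns cH cN[unfolded N_def] fe sub b0])
    fix f0 \<kappa>
    assume c\<kappa>: "continuous_on ({-b0<..<b0} \<times> {-b0<..<b0}) \<kappa>"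
      and f0x: "\<And>x y. \<bar>x\<bar> < b0 \<Longrightarrow> \<bar>y\<bar> < b0 \<Longrightarrow> ((\<lambda>x. f0 (x, y)) has_real_derivative - (N_field F u (?\<chi> (x, y)) \<bullet> e)) (at x)"
      and f0y: "\<And>x y. \<bar>x\<bar> < b0 \<Longrightarrow> \<bar>y\<bar> < b0 \<Longrightarrow> ((\<lambda>y. f0 (x, y)) has_real_derivative N_field F u (?\<chi> (x, y)) \<bullet> f - \<kappa> (x, y)) (at y)"
      and \<kappa>x: "\<And>x y. \<bar>x\<bar> < b0 \<Longrightarrow> \<bar>y\<bar> < b0 \<Longrightarrow> ((\<lambda>x. \<kappa> (x, y)) has_real_derivative H (?\<chi> (x, y))) (at x)"
    define dF where "dF v w z = (gradient (\<lambda>x. F x $ 1) z \<bullet> v) * w $ 1 + (gradient (\<lambda>x. F x $ 2) z \<bullet> v) * w $ 2" for v w z :: "real^2"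
    have cdF: "continuous_on \<Omega> (dF v w)" for v w :: "real^2"
      unfolding dF_def by (intro continuous_intros gF(2))
    have Fx: "((\<lambda>x. F (?\<chi> (x, y)) \<bullet> w) has_real_derivative dF f w (?\<chi> (x, y))) (at x)"
      and Fy: "((\<lambda>y. F (?\<chi> (x, y)) \<bullet> w) has_real_derivative dF e w (?\<chi> (x, y))) (at y)" if "\<bar>x\<bar> \<le> a" "\<bar>y\<bar> \<le> a" for x y and w :: "real^2"
      unfolding sum_2_vec[of "F _" w] dF_def
      by (intro DERIV_add DERIV_cmult_right chart_partials gF(1) in\<Omega>[OF that])+
    \<comment> \<open>The frame (f, e) is positively oriented and orthonormal, so the curl computed
      in it is the standard one.\<close>
    have curl: "dF f e z - dF e f z = curl2 F z" for z
    proof -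
      have "dF f e z - dF e f z = (partial_deriv 1 (\<lambda>y. F y $ 2) z - partial_deriv 2 (\<lambda>y. F y $ 1) z) * (e $ 1 * e $ 1 + e $ 2 * e $ 2)"
        by (simp add: dF_def sum_2_vec f12 gradient_def algebra_simps)
      then show ?thesis unfolding ee curl2_def by simp
    qed
    \<comment> \<open>The gradient part of D N . dr has the potential \<open>u\<close>, and the
      component F . e is the correction to be moved from the dy part to the dx part. The component F
      . f is subtracted from \<open>k0\<close> afterwards; the y-derivative of the difference is
      then the curl.\<close>
    have "\<exists>\<Phi> k. continuous_on ({-b<..<b} \<times> {-b<..<b}) k \<and> (\<forall>x y. \<bar>x\<bar> < b \<longrightarrow> \<bar>y\<bar> < b \<longrightarrow>
       (\<Phi> has_derivative (\<lambda>(q, r). (k (x, y) + gradient u (?\<chi> (x, y)) \<bullet> f) * q + (D (?\<chi> (x, y)) * cos (t (x, y))) * r)) (at (x, y)) \<and>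
       ((\<lambda>y. k (x, y)) has_real_derivative dF f e (?\<chi> (x, y))) (at y))"
    proof (rule change_gauge[OF b(1,2), where f = "\<lambda>q. u (?\<chi> q)" and \<kappa> = "\<lambda>q. F (?\<chi> q) \<bullet> e"])
      fix x y assume "\<bar>x\<bar> < b0" "\<bar>y\<bar> < b0"
      then have xy: "\<bar>x\<bar> \<le> a" "\<bar>y\<bar> \<le> a" using b0 by auto
      show "((\<lambda>x. u (?\<chi> (x, y))) has_real_derivative gradient u (?\<chi> (x, y)) \<bullet> f) (at x)"
        by (rule chart_partials(1)[OF gu(1)[OF in\<Omega>[OF xy]]])
      have "D (?\<chi> (x, y)) * cos (t (x, y)) = (D (?\<chi> (x, y)) *\<^sub>R N (?\<chi> (x, y))) \<bullet> e" using t(2)[OF xy] by simp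
      also have "\<dots> = gradient u (?\<chi> (x, y)) \<bullet> e + F (?\<chi> (x, y)) \<bullet> e"
        unfolding DN[OF in\<Omega>[OF xy]] by (rule inner_add_left)
      finally show "((\<lambda>y. u (?\<chi> (x, y))) has_real_derivative D (?\<chi> (x, y)) * cos (t (x, y)) - F (?\<chi> (x, y)) \<bullet> e) (at y)"
        using chart_partials(2)[OF gu(1)[OF in\<Omega>[OF xy]]] by simp
      show "((\<lambda>x. F (?\<chi> (x, y)) \<bullet> e) has_real_derivative dF f e (?\<chi> (x, y))) (at x)" by (rule Fx[OF xy])
    next
      show "continuous_on ({-b0<..<b0} \<times> {-b0<..<b0}) (\<lambda>q. gradient u (?\<chi> q) \<bullet> f)"
        "continuous_on ({-b0<..<b0} \<times> {-b0<..<b0}) (\<lambda>q. dF f e (?\<chi> q))"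
        "continuous_on ({-b0<..<b0} \<times> {-b0<..<b0}) (\<lambda>q. F (?\<chi> q) \<bullet> e)"
        unfolding B_def[symmetric] by (intro continuous_intros cchart gu cF cdF b)+
    qed
    then obtain \<Phi> k0 where ck0: "continuous_on (B b) k0"
      and \<Phi>: "\<And>x y. \<bar>x\<bar> < b \<Longrightarrow> \<bar>y\<bar> < b \<Longrightarrow> (\<Phi> has_derivative (\<lambda>(q, r). (k0 (x, y) + gradient u (?\<chi> (x, y)) \<bullet> f) * q + (D (?\<chi> (x, y)) * cos (t (x, y))) * r)) (at (x, y))"
      and dk0: "\<And>x y. \<bar>x\<bar> < b \<Longrightarrow> \<bar>y\<bar> < b \<Longrightarrow> ((\<lambda>y. k0 (x, y)) has_real_derivative dF f e (?\<chi> (x, y))) (at y)"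
      unfolding B_def by blast
    have bx: "\<bar>x\<bar> \<le> a" "\<bar>y\<bar> \<le> a" if "\<bar>x\<bar> < b" "\<bar>y\<bar> < b" for x y using that b by auto
    have ct: "continuous_on (B b) t"
      unfolding t_def
    proof (intro continuous_on_minus continuous_on_arcsin continuous_on_inner cchart cN b continuous_on_const ballI)
      fix q assume "q \<in> B b"
      then have q: "\<bar>fst q\<bar> \<le> a" "\<bar>snd q\<bar> \<le> a" using b by (auto simp: B_def)
      have "?\<chi> q \<in> \<Omega>" using in\<Omega>[OF q] by simp
      from Nsq[OF this] have "(N (?\<chi> q) \<bullet> f)\<^sup>2 \<le> 1" by (smt (verit) zero_le_power2)
      then have "\<bar>N (?\<chi> q) \<bullet> f\<bar> \<le> 1" by (simp add: abs_square_le_1)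
      then show "- 1 \<le> N (?\<chi> q) \<bullet> f \<and> N (?\<chi> q) \<bullet> f \<le> 1" by (simp add: abs_le_iff)
    qed
    have c\<kappa>': "continuous_on (B b) \<kappa>" by (rule continuous_on_subset[OF c\<kappa>]) (use b in \<open>auto simp: B_def\<close>)
    have cNH: "continuous_on \<Omega> (deriv_along N H)" using NH by (simp add: C1_along_def)
    \<comment> \<open>The hypothesis on N(H) concerns integral curves of N, whereas the planar
      theorem asks for graphs x = X y. The time change y = g \<open>\<tau>\<close> with g' = cos t
      turns such a graph into an integral curve.\<close>
    have dH: "((\<lambda>y. H (?\<chi> (X y, y))) has_real_derivative deriv_along N H (?\<chi> (X y0, y0)) / cos (t (X y0, y0))) (at y0)"
      if X: "\<And>y. \<bar>y\<bar> < r \<Longrightarrow> \<bar>X y\<bar> < b \<and> (X has_real_derivative - tan (t (X y, y))) (at y)" and r: "r \<le> b" and y0: "\<bar>y0\<bar> < r"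
      for r X y0
    proof -
      have Xa: "\<bar>X y\<bar> \<le> a" "\<bar>y\<bar> \<le> a" if "\<bar>y\<bar> < r" for y using X[OF that] that r b by auto
      have cpos: "cos (t (X y, y)) > 0" if "\<bar>y\<bar> < r" for y using t(2)[OF Xa[OF that]] Ne[OF Xa[OF that]] by simp
      have cX: "continuous_on {-r<..<r} X"
      proof (rule continuous_at_imp_continuous_on, rule)
        fix y assume "y \<in> {-r<..<r}"
        then have "\<bar>y\<bar> < r" by auto
        from DERIV_isCont[OF X[OF this, THEN conjunct2]] show "isCont X y" .
      qed
      have c: "continuous_on {-r<..<r} (\<lambda>y. cos (t (X y, y)))"
      proof (rule continuous_on_cos, rule continuous_on_compose2[OF ct])
        show "continuous_on {-r<..<r} (\<lambda>y. (X y, y))" by (intro continuous_intros cX)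
        show "(\<lambda>y. (X y, y)) ` {-r<..<r} \<subseteq> B b"
        proof (rule image_subsetI)
          fix y assume "y \<in> {-r<..<r}"
          then have y: "\<bar>y\<bar> < r" by auto
          then show "(X y, y) \<in> B b" using X[OF y] r by (auto simp: B_def abs_less_iff)
        qed
      qed
      show ?thesis
      proof (rule graph_time_change[OF c cpos y0])
        fix T g s assume s: "s > 0" and T0: "T y0 = 0" and dT: "(T has_real_derivative 1 / cos (t (X y0, y0))) (at y0)"
          and gT: "\<And>y. \<bar>y - y0\<bar> < s \<Longrightarrow> \<bar>y\<bar> < r \<and> g (T y) = y"
          and dg: "\<forall>\<^sub>F \<tau> in nhds 0. \<bar>g \<tau>\<bar> < r \<and> (g has_real_derivative cos (t (X (g \<tau>), g \<tau>))) (at \<tau>)"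
        define \<gamma> where "\<gamma> \<tau> = ?\<chi> (X (g \<tau>), g \<tau>)" for \<tau>
        have g0: "g 0 = y0" using gT[of y0] s T0 by simp
        have "integral_curve_at N (?\<chi> (X y0, y0)) \<gamma>"
          unfolding integral_curve_at_def
        proof
          show "\<gamma> 0 = ?\<chi> (X y0, y0)" by (simp add: \<gamma>_def g0)
          show "\<forall>\<^sub>F \<tau> in nhds 0. (\<gamma> has_vector_derivative N (\<gamma> \<tau>)) (at \<tau>)"
            using dg
          proof eventually_elim
            case (elim \<tau>)
            then have gr: "\<bar>g \<tau>\<bar> < r" and dg': "(g has_real_derivative cos (t (X (g \<tau>), g \<tau>))) (at \<tau>)" by auto
            have dX: "((\<lambda>\<tau>. X (g \<tau>)) has_real_derivative - tan (t (X (g \<tau>), g \<tau>)) * cos (t (X (g \<tau>), g \<tau>))) (at \<tau>)"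
              by (rule DERIV_chain2[OF X[OF gr, THEN conjunct2] dg'])
            have "- tan (t (X (g \<tau>), g \<tau>)) * cos (t (X (g \<tau>), g \<tau>)) = N (\<gamma> \<tau>) \<bullet> f"
              using cpos[OF gr] t(1)[OF Xa[OF gr]] by (simp add: tan_def \<gamma>_def)
            then have d1: "((\<lambda>\<tau>. X (g \<tau>)) has_vector_derivative N (\<gamma> \<tau>) \<bullet> f) (at \<tau>)"
              using dX by (simp add: has_real_derivative_iff_has_vector_derivative)
            have d2: "(g has_vector_derivative N (\<gamma> \<tau>) \<bullet> e) (at \<tau>)"
              using dg' t(2)[OF Xa[OF gr]] by (simp add: has_real_derivative_iff_has_vector_derivative \<gamma>_def)
            have "(\<gamma> has_vector_derivative 0 + (N (\<gamma> \<tau>) \<bullet> f) *\<^sub>R f + (N (\<gamma> \<tau>) \<bullet> e) *\<^sub>R e) (at \<tau>)"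
              unfolding \<gamma>_def[abs_def] chart_def prod.case
              using d1 d2 unfolding \<gamma>_def chart_def prod.case
              by (auto intro!: derivative_eq_intros simp: has_real_derivative_iff_has_vector_derivative)
            then show ?case using exp_frame[of "N (\<gamma> \<tau>)"] by simp
          qed
        qed
        moreover have "has_deriv_along N H (?\<chi> (X y0, y0)) (deriv_along N H (?\<chi> (X y0, y0)))"
          using NH in\<Omega>[OF Xa[OF y0]] deriv_along_eq unfolding C1_along_def by metis
        ultimately have "((\<lambda>\<tau>. H (\<gamma> \<tau>)) has_real_derivative deriv_along N H (?\<chi> (X y0, y0))) (at (T y0))"
          unfolding has_deriv_along_def T0 by blast
        from DERIV_chain2[OF this dT]
        have "((\<lambda>y. H (\<gamma> (T y))) has_real_derivative deriv_along N H (?\<chi> (X y0, y0)) / cos (t (X y0, y0))) (at y0)" by simp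
        then show ?thesis
          by (rule has_field_derivative_transform_within_open[where S = "{y0 - s<..<y0 + s}"])
             (use s gT in \<open>auto simp: \<gamma>_def abs_less_iff\<close>)
      qed
    qed
    show ?thesis
    proof (rule planar_riccati[of b t "\<lambda>q. D (?\<chi> q)" "\<lambda>q. curl2 F (?\<chi> q)" "\<lambda>q. H (?\<chi> q)" "\<lambda>q. deriv_along N H (?\<chi> q)"
        "\<lambda>q. k0 q - F (?\<chi> q) \<bullet> f" \<kappa> \<Phi> f0, OF b(1), folded B_def])
      show "continuous_on (B b) t" "continuous_on (B b) \<kappa>" by (rule ct c\<kappa>')+
      show "continuous_on (B b) (\<lambda>q. D (?\<chi> q))" "continuous_on (B b) (\<lambda>q. curl2 F (?\<chi> q))" "continuous_on (B b) (\<lambda>q. H (?\<chi> q))"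
        "continuous_on (B b) (\<lambda>q. deriv_along N H (?\<chi> q))"
        by (rule cchart[OF cD b(4)] cchart[OF continuous_on_curl2[OF hF] b(4)] cchart[OF cH b(4)] cchart[OF cNH b(4)])+
      show "continuous_on (B b) (\<lambda>q. k0 q - F (?\<chi> q) \<bullet> f)" by (intro continuous_intros ck0 cchart cF b)
      show "((\<lambda>y. H (?\<chi> (X y, y))) has_real_derivative deriv_along N H (?\<chi> (X y, y)) / cos (t (X y, y))) (at y)"
        if "\<And>y. \<bar>y\<bar> < r \<Longrightarrow> \<bar>X y\<bar> < b \<and> (X has_real_derivative - tan (t (X y, y))) (at y)" "r \<le> b" "\<bar>y\<bar> < r" for r X y
        by (rule dH[OF that])
    next
      fix x y assume xy: "\<bar>x\<bar> < b" "\<bar>y\<bar> < b"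
      note xa = bx[OF xy]
      have xb0: "\<bar>x\<bar> < b0" "\<bar>y\<bar> < b0" using xy b by auto
      show "\<bar>t (x, y)\<bar> < pi / 2 \<and> D (?\<chi> (x, y)) > 0" using t(3)[OF xa] D0[OF in\<Omega>[OF xa]] by simp
      have "D (?\<chi> (x, y)) * sin (t (x, y)) = - ((D (?\<chi> (x, y)) *\<^sub>R N (?\<chi> (x, y))) \<bullet> f)" using t(1)[OF xa] by simp
      also have "\<dots> = - (gradient u (?\<chi> (x, y)) \<bullet> f + F (?\<chi> (x, y)) \<bullet> f)"
        unfolding DN[OF in\<Omega>[OF xa]] by (simp add: inner_add_left)
      finally have k0: "k0 (x, y) - F (?\<chi> (x, y)) \<bullet> f - D (?\<chi> (x, y)) * sin (t (x, y)) = k0 (x, y) + gradient u (?\<chi> (x, y)) \<bullet> f"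
        by simp
      show "(\<Phi> has_derivative (\<lambda>(q, r). (k0 (x, y) - F (?\<chi> (x, y)) \<bullet> f - D (?\<chi> (x, y)) * sin (t (x, y))) * q
          + D (?\<chi> (x, y)) * cos (t (x, y)) * r)) (at (x, y))"
        unfolding k0 by (rule \<Phi>[OF xy])
      show "((\<lambda>y. k0 (x, y) - F (?\<chi> (x, y)) \<bullet> f) has_real_derivative curl2 F (?\<chi> (x, y))) (at y)"
        unfolding curl[symmetric] by (rule DERIV_diff[OF dk0[OF xy] Fy[OF xa]])
      show "((\<lambda>x. f0 (x, y)) has_real_derivative - cos (t (x, y))) (at x)"
        using f0x[OF xb0] t(2)[OF xa] by (simp add: N_def)
      show "((\<lambda>y. f0 (x, y)) has_real_derivative - sin (t (x, y)) - \<kappa> (x, y)) (at y)"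
        using f0y[OF xb0] t(1)[OF xa] by (simp add: N_def)
      show "((\<lambda>x. \<kappa> (x, y)) has_real_derivative H (?\<chi> (x, y))) (at x)" by (rule \<kappa>x[OF xb0])
    next
      fix \<rho> w0 assume \<rho>: "0 < \<rho>" "\<rho> \<le> b" and cw: "continuous_on (B \<rho>) w0"
        and main: "\<And>\<xi> \<eta>. \<bar>\<xi> 0\<bar> < \<rho> \<Longrightarrow> \<bar>\<eta> 0\<bar> < \<rho> \<Longrightarrow>
          (\<forall>\<^sub>F \<tau> in nhds 0. (\<xi> has_real_derivative cos (t (\<xi> \<tau>, \<eta> \<tau>))) (at \<tau>) \<and>
            (\<eta> has_real_derivative sin (t (\<xi> \<tau>, \<eta> \<tau>))) (at \<tau>)) \<Longrightarrow>
          ((\<lambda>\<tau>. D (?\<chi> (\<xi> \<tau>, \<eta> \<tau>))) has_real_derivative curl2 F (?\<chi> (\<xi> 0, \<eta> 0)) - D (?\<chi> (\<xi> 0, \<eta> 0)) * w0 (\<xi> 0, \<eta> 0)) (at 0) \<and>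
          ((\<lambda>\<tau>. w0 (\<xi> \<tau>, \<eta> \<tau>)) has_real_derivative
            - ((H (?\<chi> (\<xi> 0, \<eta> 0)))\<^sup>2 + deriv_along N H (?\<chi> (\<xi> 0, \<eta> 0)) + (w0 (\<xi> 0, \<eta> 0))\<^sup>2)) (at 0)"
      define co where "co z = ((z - p) \<bullet> f, (z - p) \<bullet> e)" for z
      have \<chi>co: "?\<chi> (co z) = z" for z unfolding co_def by (rule chart_inverse[OF fe])
      have cco: "continuous_on S co" for S unfolding co_def[abs_def] by (intro continuous_intros)
      define U where "U = co -` B \<rho>"
      define w where "w z = w0 (co z)" for z
      have opU: "open U" unfolding U_def
        by (rule open_vimage) (auto simp: B_def open_Times cco)
      have pU: "p \<in> U" using \<rho> by (simp add: U_def co_def B_def)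
      have Uin: "\<bar>(z - p) \<bullet> f\<bar> < \<rho>" "\<bar>(z - p) \<bullet> e\<bar> < \<rho>" "z \<in> \<Omega>" if "z \<in> U" for z
      proof -
        show *: "\<bar>(z - p) \<bullet> f\<bar> < \<rho>" "\<bar>(z - p) \<bullet> e\<bar> < \<rho>" using that by (auto simp: U_def co_def B_def)
        have "?\<chi> (co z) \<in> \<Omega>" unfolding co_def by (rule in\<Omega>) (use * \<rho> b in auto)
        then show "z \<in> \<Omega>" by (simp add: \<chi>co)
      qed
      have U\<Omega>: "U \<subseteq> \<Omega>" using Uin(3) by blast
      have cwU: "continuous_on U w" unfolding w_def[abs_def]
        by (rule continuous_on_compose2[OF cw cco]) (auto simp: U_def)
      have "((\<lambda>\<tau>. D (\<gamma> \<tau>)) has_real_derivative curl2 F z - D z * w z) (at 0) \<and>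
          ((\<lambda>\<tau>. w (\<gamma> \<tau>)) has_real_derivative - ((H z)\<^sup>2 + deriv_along N H z + (w z)\<^sup>2)) (at 0)"
        if z: "z \<in> U" and \<gamma>: "integral_curve_at Np z \<gamma>" for z \<gamma>
      proof -
        define \<xi> where "\<xi> \<tau> = (\<gamma> \<tau> - p) \<bullet> f" for \<tau>
        define \<eta> where "\<eta> \<tau> = (\<gamma> \<tau> - p) \<bullet> e" for \<tau>
        have \<gamma>0: "\<gamma> 0 = z" using \<gamma> by (simp add: integral_curve_at_def)
        have pair: "(\<xi> \<tau>, \<eta> \<tau>) = co (\<gamma> \<tau>)" for \<tau> by (simp add: co_def \<xi>_def \<eta>_def)
        have "\<forall>\<^sub>F \<tau> in nhds 0. (\<xi> has_real_derivative cos (t (\<xi> \<tau>, \<eta> \<tau>))) (at \<tau>) \<and>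
            (\<eta> has_real_derivative sin (t (\<xi> \<tau>, \<eta> \<tau>))) (at \<tau>)"
          using eventually_in_open_curve[OF \<gamma> opU z]
        proof eventually_elim
          case (elim \<tau>)
          then have \<gamma>U: "\<gamma> \<tau> \<in> U" and d: "(\<gamma> has_vector_derivative Np (\<gamma> \<tau>)) (at \<tau>)" by auto
          have xa: "\<bar>\<xi> \<tau>\<bar> \<le> a" "\<bar>\<eta> \<tau>\<bar> \<le> a" using Uin[OF \<gamma>U] \<rho> b by (auto simp: \<xi>_def \<eta>_def)
          have dv: "((\<lambda>\<tau>. (\<gamma> \<tau> - p) \<bullet> v) has_real_derivative Np (\<gamma> \<tau>) \<bullet> v) (at \<tau>)" for v
            using d unfolding has_real_derivative_iff_has_vector_derivative has_vector_derivative_def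
            by (auto intro!: derivative_eq_intros)
          have "N (?\<chi> (\<xi> \<tau>, \<eta> \<tau>)) = N (\<gamma> \<tau>)" unfolding pair \<chi>co ..
          then show ?case using dv[of f] dv[of e] t(1,2)[OF xa] by (simp add: \<xi>_def[abs_def] \<eta>_def[abs_def] Npf)
        qed
        moreover have "\<bar>\<xi> 0\<bar> < \<rho>" "\<bar>\<eta> 0\<bar> < \<rho>" using Uin[OF z] by (auto simp: \<xi>_def \<eta>_def \<gamma>0)
        ultimately show ?thesis using main[of \<xi> \<eta>] unfolding pair \<chi>co w_def \<gamma>0 by blast
      qed
      then show ?thesis using opU pU U\<Omega> cwU continuous_on_subset[OF cD U\<Omega>] by blast
    qed
  qed
qed

section \<open>Elimination of w and passage to the whole domain\<close>

lemma continuous_on_locally_eq: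
  fixes g :: "'a::t2_space \<Rightarrow> 'b::topological_space"
  assumes "\<And>p. p \<in> S \<Longrightarrow> \<exists>U h. open U \<and> p \<in> U \<and> continuous_on U h \<and> (\<forall>z\<in>U. g z = h z)"
  shows "continuous_on S g"
proof (rule continuous_at_imp_continuous_on, rule)
  fix p assume "p \<in> S"
  then obtain U h where U: "open U" "p \<in> U" "continuous_on U h" "\<forall>z\<in>U. g z = h z"
    using assms by blast
  then have "continuous_on U g" by (metis continuous_on_cong)
  then show "isCont g p" using U(1,2) continuous_on_eq_continuous_at by blast
qed

lemma has_deriv_along_deriv:
  assumes "C1_along V f S" "p \<in> S"
  shows "has_deriv_along V f p (deriv_along V f p)"
  using assms deriv_along_eq unfolding C1_along_def by metis

theorem theoremA:
  fixes \<Omega> :: "(real^2) set" and F :: "real^2 \<Rightarrow> real^2" and H u :: "real^2 \<Rightarrow> real"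
  defines "N \<equiv> N_field F u"
    and "Np \<equiv> Nperp_field F u"
    and "D \<equiv> D_fun F u"
  defines "D' \<equiv> deriv_along Np D"
  defines "D'' \<equiv> deriv_along Np D'"
  assumes "open \<Omega>" and "connected \<Omega>"
    and "\<forall>i. C_k_on 1 \<Omega> (\<lambda>x. F x $ i)"
    and "continuous_on \<Omega> H"
    and "weak_solution \<Omega> F H u"
    and "singular_set \<Omega> F u = {}"
    and "C1_along Np (curl2 F) \<Omega>"
    and "C1_along N H \<Omega>"
  shows "C1_along Np D \<Omega> \<and> C1_along Np D' \<Omega> \<and>
    (\<forall>p\<in>\<Omega>. D p * D'' p =
        2 * (D' p - curl2 F p / 2) * (D' p - curl2 F p)
        + deriv_along Np (curl2 F) p * D p
        + ((H p)\<^sup>2 + deriv_along N H p) * (D p)\<^sup>2)"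
proof -
  let ?c = "curl2 F" and ?c' = "deriv_along Np (curl2 F)" and ?K = "\<lambda>z. (H z)\<^sup>2 + deriv_along N H z"
  have cont: "continuous_on \<Omega> ?c" "continuous_on \<Omega> ?c'" "continuous_on \<Omega> ?K"
    using assms by (auto simp: C1_along_def intro!: continuous_intros continuous_on_curl2)
  \<comment> \<open>The functions \<open>w\<close> of different points are not compared on overlaps.
    Each is used on its own neighbourhood only, because continuity and the final identity are
    local.\<close>
  have loc: "\<exists>U w. open U \<and> p \<in> U \<and> U \<subseteq> \<Omega> \<and> continuous_on U D \<and> continuous_on U w \<and>
      (\<forall>z\<in>U. has_deriv_along Np D z (?c z - D z * w z) \<and>
        has_deriv_along Np D' z (?c' z - D' z * w z + D z * (?K z + (w z)\<^sup>2)))" if p: "p \<in> \<Omega>" for p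
  proof -
    from local_structure[OF assms(6,8-11) assms(13)[unfolded N_def] p] obtain U w
      where U: "open U" "p \<in> U" "U \<subseteq> \<Omega>" and cD: "continuous_on U D" and cw: "continuous_on U w"
        and dD: "\<And>z \<gamma>. z \<in> U \<Longrightarrow> integral_curve_at Np z \<gamma> \<Longrightarrow>
          ((\<lambda>\<tau>. D (\<gamma> \<tau>)) has_real_derivative ?c z - D z * w z) (at 0)"
        and dw: "\<And>z \<gamma>. z \<in> U \<Longrightarrow> integral_curve_at Np z \<gamma> \<Longrightarrow>
          ((\<lambda>\<tau>. w (\<gamma> \<tau>)) has_real_derivative - (?K z + (w z)\<^sup>2)) (at 0)"
      unfolding N_def Np_def D_def by blast
    \<comment> \<open>Besides the derivative of the curl, this supplies the existence of integral
      curves of \<open>Np\<close> that \<open>has_deriv_along\<close> demands for \<open>D\<close>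
      and \<open>D'\<close>.\<close>
    have c': "has_deriv_along Np ?c z (?c' z)" if "z \<in> U" for z
      using has_deriv_along_deriv[OF assms(12)] that U(3) by blast
    have D1: "has_deriv_along Np D z (?c z - D z * w z)" if "z \<in> U" for z
      using c'[OF that] dD[OF that] by (simp add: has_deriv_along_def)
    have D': "D' z = ?c z - D z * w z" if "z \<in> U" for z
      unfolding D'_def by (rule deriv_along_eq[OF D1[OF that]])
    have D2: "has_deriv_along Np D' z (?c' z - D' z * w z + D z * (?K z + (w z)\<^sup>2))" if z: "z \<in> U" for z
      unfolding has_deriv_along_def
    proof (intro conjI allI impI)
      show "\<exists>\<gamma>. integral_curve_at Np z \<gamma>" using c'[OF z] by (simp add: has_deriv_along_def)
      fix \<gamma> assume \<gamma>: "integral_curve_at Np z \<gamma>"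
      have \<gamma>0: "\<gamma> 0 = z" using \<gamma> by (simp add: integral_curve_at_def)
      have dc: "((\<lambda>\<tau>. ?c (\<gamma> \<tau>)) has_real_derivative ?c' z) (at 0)"
        using c'[OF z] \<gamma> by (simp add: has_deriv_along_def)
      have "((\<lambda>\<tau>. ?c (\<gamma> \<tau>) - D (\<gamma> \<tau>) * w (\<gamma> \<tau>)) has_real_derivative
          ?c' z - D' z * w z + D z * (?K z + (w z)\<^sup>2)) (at 0)"
        using DERIV_diff[OF dc DERIV_mult[OF dD[OF z \<gamma>] dw[OF z \<gamma>]]]
        by (simp add: \<gamma>0 D'[OF z] algebra_simps)
      \<comment> \<open>The formula for \<open>D'\<close> holds on \<open>U\<close> only; this is
        enough since the curve stays in \<open>U\<close> for small times.\<close>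
      moreover have "\<forall>\<^sub>F \<tau> in nhds 0. D' (\<gamma> \<tau>) = ?c (\<gamma> \<tau>) - D (\<gamma> \<tau>) * w (\<gamma> \<tau>)"
        using eventually_in_open_curve[OF \<gamma> U(1) z] by eventually_elim (simp add: D')
      ultimately show "((\<lambda>\<tau>. D' (\<gamma> \<tau>)) has_real_derivative ?c' z - D' z * w z + D z * (?K z + (w z)\<^sup>2)) (at 0)"
        by (subst DERIV_cong_ev[OF refl _ refl])
    qed
    show ?thesis using U cD cw D1 D2 by blast
  qed
  have L1: "C1_along Np D \<Omega>"
    unfolding C1_along_def
  proof
    show "\<forall>p\<in>\<Omega>. \<exists>L. has_deriv_along Np D p L" using loc by blast
    show "continuous_on \<Omega> (deriv_along Np D)"
    proof (rule continuous_on_locally_eq)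
      fix p assume "p \<in> \<Omega>"
      from loc[OF this] obtain U w where U: "open U" "p \<in> U" "U \<subseteq> \<Omega>" "continuous_on U D" "continuous_on U w"
        and d: "\<forall>z\<in>U. has_deriv_along Np D z (?c z - D z * w z)" by blast
      have "continuous_on U (\<lambda>z. ?c z - D z * w z)"
        by (intro continuous_intros U continuous_on_subset[OF cont(1) U(3)])
      then show "\<exists>U h. open U \<and> p \<in> U \<and> continuous_on U h \<and> (\<forall>z\<in>U. deriv_along Np D z = h z)"
        using U(1,2) d deriv_along_eq by blast
    qed
  qed
  then have cD': "continuous_on \<Omega> D'" by (simp add: C1_along_def D'_def)
  have L2: "C1_along Np D' \<Omega>"
    unfolding C1_along_def
  proof
    show "\<forall>p\<in>\<Omega>. \<exists>L. has_deriv_along Np D' p L" using loc by blast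
    show "continuous_on \<Omega> (deriv_along Np D')"
    proof (rule continuous_on_locally_eq)
      fix p assume "p \<in> \<Omega>"
      from loc[OF this] obtain U w where U: "open U" "p \<in> U" "U \<subseteq> \<Omega>" "continuous_on U D" "continuous_on U w"
        and d: "\<forall>z\<in>U. has_deriv_along Np D' z (?c' z - D' z * w z + D z * (?K z + (w z)\<^sup>2))" by blast
      have "continuous_on U (\<lambda>z. ?c' z - D' z * w z + D z * (?K z + (w z)\<^sup>2))"
        by (intro continuous_on_add continuous_on_diff continuous_on_mult continuous_on_power U
            continuous_on_subset[OF cont(2) U(3)] continuous_on_subset[OF cont(3) U(3)] continuous_on_subset[OF cD' U(3)])
      then show "\<exists>U h. open U \<and> p \<in> U \<and> continuous_on U h \<and> (\<forall>z\<in>U. deriv_along Np D' z = h z)"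
        using U(1,2) d deriv_along_eq by blast
    qed
  qed
  have "D p * D'' p = 2 * (D' p - ?c p / 2) * (D' p - ?c p) + ?c' p * D p + ?K p * (D p)\<^sup>2" if p: "p \<in> \<Omega>" for p
  proof -
    from loc[OF p] obtain w where "has_deriv_along Np D p (?c p - D p * w p)"
      "has_deriv_along Np D' p (?c' p - D' p * w p + D p * (?K p + (w p)\<^sup>2))" by blast
    then have 1: "D' p = ?c p - D p * w p" and 2: "D'' p = ?c' p - D' p * w p + D p * (?K p + (w p)\<^sup>2)"
      unfolding D''_def D'_def by (metis deriv_along_eq)+
    \<comment> \<open>With c for the curl, both sides become 2 (D w)^2 - c D w plus the terms with
      the derivative of c and with H^2 + N(H).\<close>
    show ?thesis unfolding 2 1 by (simp add: field_simps power2_eq_square)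
  qed
  then show ?thesis using L1 L2 by blast
qed

end
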